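(* Let $X$ be an open subset of $\mathbb{C}^n$. Then $$V_X=E_{\mathcal{N}_X}\nu=E_{\mathcal{N}_X^-}\nu$$ on $\mathbb{C}^n$; that is, for every $z\in\mathbb{C}^n$, $$V_X(z)=\inf\{\nu(f): f\in\mathcal{N}_X,\ f(0)=z\}=\inf\{\nu(f): f\in\mathcal{N}_X^-,\ f(0)=z\}.$$
   Context: Notation: $\mathbb{D}$ is the open unit disc in $\mathbb{C}$, and $\mathbb{T}$ is the unit circle with normalized arc length measure $\sigma$; a subset of $\mathbb{T}$ is conull if its complement is $\sigma$-null. $\inf\varnothing=\infty$. The Siciak-Zahariuta extremal function: the Lelong class $\mathcal{L}$ is the set of plurisubharmonic functions $u$ on $\mathbb{C}^n$ such that $u-\log^+\|\cdot\|$ is bounded above on $\mathbb{C}^n$ ($\|\cdot\|$ is the Euclidean norm). For $X\subset\mathbb{C}^n$, $V_X(z)=\sup\{u(z): u\in\mathcal{L},\ u|_X\leq 0\}$ for $z\in\mathbb{C}^n$. Nevanlinna discs: a holomorphic map $f=(f_1,\dots,f_n):\mathbb{D}\to\mathbb{C}^n$ is a Nevanlinna disc if each component lies in the Nevanlinna class $N$ (equivalently, $\log\|f\|$ has a positive harmonic majorant on $\mathbb{D}$). Nevanlinna functions have nontangential boundary values a.e. on $\mathbb{T}$. A singular function is a function of the form $s(z)=\exp\int_{\mathbb{T}}\frac{z+\zeta}{z-\zeta}\,d\mu(\zeta)$, where $\mu$ is a finite positive Borel measure on $\mathbb{T}$, singular with respect to $\sigma$ and uniquely determined by $s$ ($\mu=0$,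 $s=1$ allowed). A (not identically zero) Nevanlinna function can be factored, essentially uniquely, as $Bhs/t$, where $B$ is a Blaschke product, $h$ is an outer function, and $s,t$ are singular functions given by mutually singular measures. $N^-$ denotes the class of Nevanlinna functions with $s=1$. Convention: the zero function is considered to belong to $N^-$, with $s=t=1$. Negative mass: for a Nevanlinna disc $f=(f_1,\dots,f_n)$, let the singular denominator $t_j$ of $f_j=B_jh_js_j/t_j$ be given by the measure $\nu_j$, and let $\nu$ be the smallest Borel measure on $\mathbb{T}$ with $\nu\geq\nu_j$ for $j=1,\dots,n$. The negative mass of $f$ is $\nu(f)=\nu(\mathbb{T})\in[0,\infty)$. For $X\subset\mathbb{C}^n$ open, $\mathcal{N}_X$ is the set of Nevanlinna discs in $\mathbb{C}^n$ whose boundary map takes a conull subset of $\mathbb{T}$ into $X$, and $\mathcal{N}_X^-$ is the subset of those discs whose components all lie in $N^-$. *)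

theory Defs
  imports "HOL-Analysis.Analysis"
begin

section \<open>The unit circle\<close>

text \<open>
  Normalized arc length measure \<open>\<sigma>\<close>. Its underlying space is the unit circle
  itself, not the whole plane.
\<close>

definition circle_measure :: "complex measure" where
  "circle_measure =
     distr (uniform_measure lborel {0..2 * pi}) (restrict_space borel (sphere 0 1)) cis"

definition circle_borel_measure :: "complex measure \<Rightarrow> bool" where
  "circle_borel_measure \<mu> \<longleftrightarrow>
     sets \<mu> = sets (restrict_space borel (sphere 0 1)) \<and> finite_measure \<mu>"

definition mutually_singular :: "'a measure \<Rightarrow> 'a measure \<Rightarrow> bool" where
  "mutually_singular \<mu> \<nu> \<longleftrightarrow> (\<exists>A\<in>sets \<mu>. emeasure \<mu> A = 0 \<and> emeasure \<nu> (space \<nu> - A) = 0)"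

definition singular_circle_measure :: "complex measure \<Rightarrow> bool" where
  "singular_circle_measure \<mu> \<longleftrightarrow>
     circle_borel_measure \<mu> \<and> mutually_singular \<mu> circle_measure"

definition log_plus :: "real \<Rightarrow> real" where
  "log_plus x = max 0 (ln x)"


section \<open>Plurisubharmonic functions and the Siciak-Zahariuta extremal function\<close>

definition usc :: "('a::topological_space \<Rightarrow> ereal) \<Rightarrow> bool" where
  "usc u \<longleftrightarrow> (\<forall>c. open {x. u x < c})"

text \<open>
  The integral of an extended real function over the circle, as the integral of its
  positive part minus that of its negative part (\<^const>\<open>e2ennreal\<close> sends negative
  numbers to \<open>0\<close>). It is only applied to functions that are bounded above, so the
  first term is finite and the difference is meaningful, with value possibly \<open>-\<infinity>\<close>.
\<close>

definition circle_mean :: "(complex \<Rightarrow> ereal) \<Rightarrow> ereal" where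
  "circle_mean g =
     enn2ereal (\<integral>\<^sup>+ \<zeta>. e2ennreal (g \<zeta>) \<partial>circle_measure)
     - enn2ereal (\<integral>\<^sup>+ \<zeta>. e2ennreal (- g \<zeta>) \<partial>circle_measure)"

text \<open>
  The constant \<open>-\<infinity>\<close> is admitted as a subharmonic function, so that the restriction of a
  plurisubharmonic function to a complex line is always subharmonic. Admitting it does not
  affect the supremum defining the extremal function, since the zero function always competes.
\<close>

definition subharmonic :: "(complex \<Rightarrow> ereal) \<Rightarrow> bool" where
  "subharmonic u \<longleftrightarrow>
     usc u \<and> (\<forall>c. u c < \<infinity>) \<and>
     (\<forall>c. \<forall>r>0. u c \<le> circle_mean (\<lambda>\<zeta>. u (c + of_real r * \<zeta>)))"

definition plurisubharmonic :: "(complex ^ 'n \<Rightarrow> ereal) \<Rightarrow> bool" where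
  "plurisubharmonic u \<longleftrightarrow>
     usc u \<and> (\<forall>z. u z < \<infinity>) \<and> (\<forall>a b. subharmonic (\<lambda>\<zeta>. u (a + \<zeta> *s b)))"

definition lelong_class :: "(complex ^ 'n \<Rightarrow> ereal) set" where
  "lelong_class =
     {u. plurisubharmonic u \<and> (\<exists>C::real. \<forall>z. u z \<le> ereal (log_plus (norm z) + C))}"

definition extremal_function :: "(complex ^ 'n) set \<Rightarrow> complex ^ 'n \<Rightarrow> ereal" where
  "extremal_function X z = (SUP u\<in>{u \<in> lelong_class. \<forall>x\<in>X. u x \<le> 0}. u z)"


section \<open>Nevanlinna functions and their factorization\<close>

text \<open>
  Functions on the unit disc are represented by total functions of which only the values on
  \<open>ball 0 1\<close> matter.
\<close>

definition nevanlinna :: "(complex \<Rightarrow> complex) \<Rightarrow> bool" where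
  "nevanlinna f \<longleftrightarrow>
     f holomorphic_on ball 0 1 \<and>
     bdd_above ((\<lambda>r. LINT \<zeta>|circle_measure. log_plus (cmod (f (of_real r * \<zeta>)))) ` {0..<1})"

definition singular_function :: "complex measure \<Rightarrow> complex \<Rightarrow> complex" where
  "singular_function \<mu> z = exp (LINT \<zeta>|\<mu>. (z + \<zeta>) / (z - \<zeta>))"

text \<open>
  \<open>B\<close> is the Blaschke product with a zero of order \<open>m\<close> at the origin and further zeros
  \<open>a k\<close>, repeated according to multiplicity, with \<open>k\<close> in the finite or infinite set
  \<open>K\<close>.
\<close>

definition blaschke_product :: "(complex \<Rightarrow> complex) \<Rightarrow> bool" where
  "blaschke_product B \<longleftrightarrow>
     (\<exists>(m::nat) (K::nat set) (a::nat \<Rightarrow> complex).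
        (\<forall>k\<in>K. 0 < cmod (a k) \<and> cmod (a k) < 1) \<and>
        (\<lambda>k. 1 - cmod (a k)) summable_on K \<and>
        (\<forall>z\<in>ball 0 1.
           B z = z ^ m *
             (\<Prod>k. if k \<in> K
                  then of_real (cmod (a k)) / a k * ((a k - z) / (1 - cnj (a k) * z))
                  else 1)))"

text \<open>Here \<open>\<phi>\<close> is the boundary modulus of \<open>h\<close>; it is determined up to null sets, so it may
  be taken to be positive everywhere.\<close>

definition outer_function :: "(complex \<Rightarrow> complex) \<Rightarrow> bool" where
  "outer_function h \<longleftrightarrow>
     (\<exists>(c::complex) (\<phi>::complex \<Rightarrow> real).
        cmod c = 1 \<and> (\<forall>\<zeta>\<in>sphere 0 1. 0 < \<phi> \<zeta>) \<and>
        integrable circle_measure (\<lambda>\<zeta>. ln (\<phi> \<zeta>)) \<and>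
        (\<forall>z\<in>ball 0 1.
           h z = c * exp (LINT \<zeta>|circle_measure. (\<zeta> + z) / (\<zeta> - z) * of_real (ln (\<phi> \<zeta>)))))"

text \<open>
  \<open>f = B h s / t\<close>, where \<open>\<mu>\<close> and \<open>\<nu>\<close> are the measures of the singular functions
  \<open>s\<close> and \<open>t\<close>.
\<close>

definition nevanlinna_factorization ::
    "(complex \<Rightarrow> complex) \<Rightarrow> complex measure \<Rightarrow> complex measure \<Rightarrow> bool" where
  "nevanlinna_factorization f \<mu> \<nu> \<longleftrightarrow>
     singular_circle_measure \<mu> \<and> singular_circle_measure \<nu> \<and> mutually_singular \<mu> \<nu> \<and>
     (\<exists>B h. blaschke_product B \<and> outer_function h \<and>
        (\<forall>z\<in>ball 0 1. f z = B z * h z * singular_function \<mu> z / singular_function \<nu> z))"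

definition denominator_measure :: "(complex \<Rightarrow> complex) \<Rightarrow> complex measure" where
  "denominator_measure f =
     (if \<forall>z\<in>ball 0 1. f z = 0 then null_measure circle_measure
      else (THE \<nu>. \<exists>\<mu>. nevanlinna_factorization f \<mu> \<nu>))"

definition nevanlinna_minus :: "(complex \<Rightarrow> complex) \<Rightarrow> bool" where
  "nevanlinna_minus f \<longleftrightarrow>
     nevanlinna f \<and>
     ((\<forall>z\<in>ball 0 1. f z = 0) \<or>
      (\<exists>\<nu>. nevanlinna_factorization f (null_measure circle_measure) \<nu>))"


section \<open>Nevanlinna discs and the negative mass\<close>

text \<open>Approach regions \<open>{z. \<bar>z - \<zeta>\<bar> < \<alpha> (1 - \<bar>z\<bar>)}\<close> are contained in the unit disc;
  for \<open>\<alpha> > 1\<close> they have \<open>\<zeta>\<close> as a limit point, so the limit is unique.\<close>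

definition has_nontangential_limit ::
    "(complex \<Rightarrow> 'a::topological_space) \<Rightarrow> complex \<Rightarrow> 'a \<Rightarrow> bool" where
  "has_nontangential_limit f \<zeta> w \<longleftrightarrow>
     (\<forall>\<alpha>>1. (f \<longlongrightarrow> w) (at \<zeta> within {z. cmod (z - \<zeta>) < \<alpha> * (1 - cmod z)}))"

definition nevanlinna_disc :: "(complex \<Rightarrow> complex ^ 'n) \<Rightarrow> bool" where
  "nevanlinna_disc f \<longleftrightarrow> (\<forall>j. nevanlinna (\<lambda>z. f z $ j))"

definition nevanlinna_discs :: "(complex ^ 'n) set \<Rightarrow> (complex \<Rightarrow> complex ^ 'n) set" where
  "nevanlinna_discs X =
     {f. nevanlinna_disc f \<and>
         (AE \<zeta> in circle_measure. \<exists>w\<in>X. has_nontangential_limit f \<zeta> w)}"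

definition nevanlinna_minus_discs :: "(complex ^ 'n) set \<Rightarrow> (complex \<Rightarrow> complex ^ 'n) set" where
  "nevanlinna_minus_discs X = {f \<in> nevanlinna_discs X. \<forall>j. nevanlinna_minus (\<lambda>z. f z $ j)}"

text \<open>
  On measures with the same measurable sets, the order of the complete lattice of measures
  is the setwise one, so the supremum below is the smallest Borel measure on the circle
  dominating all the denominator measures.
\<close>

definition negative_mass :: "(complex \<Rightarrow> complex ^ 'n) \<Rightarrow> ereal" where
  "negative_mass f =
     enn2ereal (emeasure (SUP j. denominator_measure (\<lambda>z. f z $ j)) (sphere 0 1))"

definition disc_envelope ::
    "(complex \<Rightarrow> complex ^ 'n) set \<Rightarrow> ((complex \<Rightarrow> complex ^ 'n) \<Rightarrow> ereal) \<Rightarrow> complex ^ 'n \<Rightarrow> ereal" where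
  "disc_envelope F H z = (INF f\<in>{f \<in> F. f 0 = z}. H f)"

end

theory Submission
  imports Defs "HOL-Complex_Analysis.Complex_Analysis" "HOL-Probability.Probability"
begin

text \<open>
  Let \<open>u\<close> compete in the definition of \<open>V\<^sub>X(z)\<close> and let \<open>f\<close> be a disc in \<open>\<N>\<^sub>X\<close> centred at \<open>z\<close>. On the circle
  of radius \<open>r\<close> the function \<open>u \<circ> f\<close> is bounded by \<open>log\<^sup>+ \<bar>f\<bar> + C\<close>, hence by the Poisson integral of an
  integrable function plus that of the smallest measure dominating the denominators; as \<open>r \<rightarrow> 1\<close> the
  boundary values lie in \<open>X\<close>, where \<open>u \<le> 0\<close>, so that only the mass \<open>\<nu>(f)\<close> survives in the submean
  value inequality for \<open>u \<circ> f\<close> at \<open>0\<close>.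

  Conversely, fix a ball \<open>B(p, r)\<close> in \<open>X\<close> and let \<open>L(w) = log\<^sup>+ (\<bar>w - p\<bar> / r)\<close>. The infimum, over polynomial
  discs \<open>P\<close> centred at \<open>z\<close>, of the mean of (continuous majorants of) \<open>L\<close> cut off to the complement of \<open>X\<close>
  is plurisubharmonic in \<open>z\<close> by Poletsky's gluing of discs, so it is at most \<open>V\<^sub>X(z)\<close>. Given \<open>P\<close>, choose a step
  function \<open>c \<ge> L \<circ> P\<close> on finitely many arcs that cover the part of the circle sent outside \<open>X\<close>, with
  integral close to the mean. Let \<open>\<nu>\<close> be obtained from \<open>c \<sigma>\<close> by moving its mass to atoms in the arcs, over
  distances that shrink quadratically towards the ends, and let \<open>G\<close> be the Herglotz transform of
  \<open>c \<sigma> - \<nu>\<close>. Then \<open>G(0) = 0\<close>, \<open>Re G = c\<close> almost everywhere on the arcs and \<open>G\<close> is small off them, so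
  \<open>p + (P - p) exp (- G)\<close> is a disc centred at \<open>z\<close> with boundary values in \<open>B(p, r)\<close> on the arcs and near \<open>P\<close>
  elsewhere, and its negative mass is at most \<open>\<integral> c d\<sigma>\<close>. Its components have no singular numerator, since
  they stay away from \<open>0\<close> near every boundary point outside a countable set and radially at the points
  of that set.
\<close>

section \<open>Integration over the unit circle\<close>

text \<open>The obstacle in building a disc is that \<open>P - p\<close> must shrink by
  \<open>exp (- c)\<close> on the arcs while the centre stays fixed. With the Herglotz transform of
  \<open>c \<sigma>\<close> alone, \<open>G(0)\<close> would be the integral of \<open>c\<close>;
  subtracting a singular measure of the same mass restores \<open>G(0) = 0\<close>, leaves
  \<open>Re G\<close> unchanged almost everywhere, and is what becomes the negative mass. Off the
  arcs the imaginary part of \<open>G\<close> must be small as well, since the values of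
  \<open>P\<close> have to stay in \<open>X\<close>. The kernels at \<open>x\<close> and at its new
  place \<open>x'\<close> differ by a fraction with denominator \<open>(x - z) (x' - z)\<close>,
  which is why the displacement must be quadratically small towards the ends. The weight
  \<open>L\<close> is the exact price: multiplying \<open>w - p\<close> by
  \<open>exp (- L(w))\<close> brings \<open>w\<close> into the closed ball. The ball is taken off
  the coordinate hyperplanes, so that boundary values there have no vanishing component; the test
  for a trivial singular numerator lives on this. As \<open>denominator_measure\<close> is a
  definite description, existence and uniqueness of the factorization come first. Uniqueness and all
  mass estimates rest on one comparison, \<open>denominator_le\<close>.\<close>

lemma space_circle_measure [simp]: "space circle_measure = sphere 0 1"
  by (simp add: circle_measure_def space_restrict_space)

lemma sets_circle_measure [simp, measurable_cong]:
  "sets circle_measure = sets (restrict_space borel (sphere 0 1))"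
  by (simp add: circle_measure_def)

lemma measurable_cis_circle [measurable]: "cis \<in> measurable borel (restrict_space borel (sphere 0 1))"
  by (intro measurable_restrict_space2 borel_measurable_continuous_onI continuous_intros) auto

lemma prob_space_circle_measure: "prob_space circle_measure"
proof -
  have "prob_space (uniform_measure lborel {0..2 * pi})"
    by (rule prob_space_uniform_measure) auto
  then show ?thesis
    unfolding circle_measure_def by (rule prob_space.prob_space_distr) simp
qed

interpretation circle: prob_space circle_measure
  by (rule prob_space_circle_measure)

lemma circle_borel_circle_measure: "circle_borel_measure circle_measure"
  by (simp add: circle_borel_measure_def circle.finite_measure_axioms)

lemma circle_borelD:
  assumes "circle_borel_measure m"
  shows "sets m = sets (restrict_space borel (sphere 0 1))" "finite_measure m" "space m = sphere 0 1"
  using assms sets_eq_imp_space_eq[of m "restrict_space borel (sphere 0 1)"]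
  by (auto simp: circle_borel_measure_def space_restrict_space)

lemma circle_borel_measurable_cong:
  assumes "circle_borel_measure m"
  shows "measurable m N = measurable circle_measure N"
  by (intro measurable_cong_sets) (simp_all add: circle_borelD(1)[OF assms])

lemma circle_continuous_measurable:
  fixes g :: "complex \<Rightarrow> 'a::topological_space"
  assumes "circle_borel_measure m" "continuous_on (sphere 0 1) g"
  shows "g \<in> borel_measurable m"
  using borel_measurable_continuous_on_restrict[OF assms(2)]
    measurable_cong_sets[OF circle_borelD(1)[OF assms(1)] refl] by blast

lemma circle_bounded_integrable:
  fixes g :: "complex \<Rightarrow> 'a::{banach,second_countable_topology}"
  assumes m: "circle_borel_measure m" and "g \<in> borel_measurable m"
    and "\<And>x. x \<in> sphere 0 1 \<Longrightarrow> norm (g x) \<le> B"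
  shows "integrable m g"
  using assms circle_borelD[OF m]
  by (intro finite_measure.integrable_const_bound[where B = B]) (auto intro!: AE_I2)

lemma circle_continuous_integrable:
  fixes g :: "complex \<Rightarrow> 'a::{banach,second_countable_topology}"
  assumes m: "circle_borel_measure m" and g: "continuous_on (sphere 0 1) g"
  shows "integrable m g"
proof -
  obtain B where "\<forall>x\<in>sphere 0 1. norm (g x) \<le> B"
    using compact_imp_bounded[OF compact_continuous_image[OF g]]
    by (auto simp: bounded_iff)
  then show ?thesis
    using circle_bounded_integrable[OF m circle_continuous_measurable[OF m g]] by blast
qed

lemma circle_integral_eq:
  fixes g :: "complex \<Rightarrow> 'a::euclidean_space"
  assumes g: "continuous_on (sphere 0 1) g"
  shows "(LINT \<zeta>|circle_measure. g \<zeta>) = (1 / (2 * pi)) *\<^sub>R integral {0..2 * pi} (\<lambda>t. g (cis t))"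
proof -
  let ?U = "uniform_measure lborel {0..2 * pi}"
  have c: "continuous_on UNIV (\<lambda>t. g (cis t))"
    by (intro continuous_on_compose2[OF g] continuous_intros) auto
  have gm: "g \<in> borel_measurable (restrict_space borel (sphere 0 1))"
    by (rule borel_measurable_continuous_on_restrict[OF g])
  have cm [measurable]: "(\<lambda>t. g (cis t)) \<in> borel_measurable borel"
    by (rule borel_measurable_continuous_onI[OF c])
  have "(LINT \<zeta>|circle_measure. g \<zeta>) = (LINT t|?U. g (cis t))"
    unfolding circle_measure_def by (rule integral_distr[OF _ gm]) simp
  also have "?U = density lborel (\<lambda>t. ennreal (indicator {0..2*pi} t / (2 * pi)))"
    unfolding uniform_measure_def
    by (intro density_cong) (auto simp: indicator_def divide_ennreal simp flip: ennreal_1)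
  also have "(LINT t|\<dots>. g (cis t)) = (LINT t|lborel. (indicator {0..2*pi} t / (2 * pi)) *\<^sub>R g (cis t))"
    by (rule integral_density) auto
  also have "\<dots> = (1 / (2 * pi)) *\<^sub>R (LINT t:{0..2*pi}|lborel. g (cis t))"
    unfolding set_lebesgue_integral_def
    by (subst integral_scaleR_right[symmetric]) (simp add: field_simps)
  also have "(LINT t:{0..2*pi}|lborel. g (cis t)) = integral {0..2 * pi} (\<lambda>t. g (cis t))"
    by (intro set_borel_integral_eq_integral(2) borel_integrable_atLeastAtMost' continuous_on_subset[OF c]) auto
  finally show ?thesis .
qed

section \<open>Cauchy, Schwarz and Poisson formulas on the circle\<close>

lemma circle_Cauchy:
  assumes f: "continuous_on (cball 0 1) f" "f holomorphic_on ball 0 1" and w: "cmod w < 1"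
  shows "(LINT \<zeta>|circle_measure. f \<zeta> * \<zeta> / (\<zeta> - w)) = f w"
proof -
  have "((\<lambda>u. f u/(u-w)) has_contour_integral (2 * of_real pi * \<i> * f w)) (part_circlepath 0 1 0 (2*pi))"
    using Cauchy_integral_circlepath[OF f] w by (simp add: circlepath_def)
  \<comment> \<open>The factor \<open>\<i> * cis t\<close> is the derivative of the parametrisation;
    it is the source of the extra \<open>\<zeta>\<close> in the integrand of the lemma.\<close>
  then have "((\<lambda>t. f (cis t) / (cis t - w) * \<i> * cis t) has_integral (2 * of_real pi * \<i> * f w)) {0..2*pi}"
    by (subst (asm) has_contour_integral_part_circlepath_iff) auto
  then have "((\<lambda>t. (1/\<i>) * (f (cis t) / (cis t - w) * \<i> * cis t)) has_integral (1/\<i>) * (2 * of_real pi * \<i> * f w)) {0..2*pi}"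
    by (rule has_integral_mult_right)
  then have "((\<lambda>t. f (cis t) * cis t / (cis t - w)) has_integral (2 * of_real pi * f w)) {0..2*pi}"
    by (rule has_integral_eq_rhs[OF has_integral_eq, rotated]) (auto simp: field_simps)
  moreover have "continuous_on (sphere 0 1) (\<lambda>\<zeta>. f \<zeta> * \<zeta> / (\<zeta> - w))"
    using w by (intro continuous_intros continuous_on_subset[OF f(1)]) auto
  ultimately show ?thesis
    by (simp add: circle_integral_eq integral_unique scaleR_conv_of_real)
qed

lemma circle_mean_value:
  assumes f: "continuous_on (cball 0 1) f" "f holomorphic_on ball 0 1"
  shows "(LINT \<zeta>|circle_measure. f \<zeta>) = f 0"
proof -
  have "(LINT \<zeta>|circle_measure. f \<zeta>) = (LINT \<zeta>|circle_measure. f \<zeta> * \<zeta> / (\<zeta> - 0))"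
    by (intro Bochner_Integration.integral_cong) auto
  then show ?thesis
    using circle_Cauchy[OF f, of 0] by simp
qed

lemma circle_mean_value_Re:
  assumes f: "continuous_on (cball 0 1) f" "f holomorphic_on ball 0 1"
  shows "(LINT \<zeta>|circle_measure. Re (f \<zeta>)) = Re (f 0)"
proof -
  have "integrable circle_measure f"
    by (rule circle_continuous_integrable[OF circle_borel_circle_measure])
      (auto intro: continuous_on_subset[OF f(1)])
  then show ?thesis
    using circle_mean_value[OF f] by (simp add: integral_Re)
qed

text \<open>The Herglotz kernel on the circle splits as \<open>2\<zeta>/(\<zeta> - z) - 1\<close>, and its conjugate is
  holomorphic in \<open>\<zeta>\<close>, which is all that is needed for the Schwarz formula.\<close>

definition herglotz_kernel :: "complex \<Rightarrow> complex \<Rightarrow> complex" where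
  "herglotz_kernel z \<zeta> = (\<zeta> + z) / (\<zeta> - z)"

definition poisson_kernel :: "complex \<Rightarrow> complex \<Rightarrow> real" where
  "poisson_kernel z \<zeta> = Re (herglotz_kernel z \<zeta>)"

lemma poisson_kernel_eq:
  assumes "cmod \<zeta> = 1"
  shows "poisson_kernel z \<zeta> = (1 - (cmod z)\<^sup>2) / (cmod (\<zeta> - z))\<^sup>2"
proof -
  have "(Re \<zeta>)\<^sup>2 + (Im \<zeta>)\<^sup>2 = 1"
    using assms by (simp add: cmod_def)
  then show ?thesis
    unfolding poisson_kernel_def herglotz_kernel_def Re_divide cmod_power2
    by (simp add: power2_eq_square algebra_simps)
qed

lemma poisson_kernel_pos: "cmod \<zeta> = 1 \<Longrightarrow> cmod z < 1 \<Longrightarrow> 0 < poisson_kernel z \<zeta>"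
  by (subst poisson_kernel_eq) (auto intro!: divide_pos_pos simp: power_less_one_iff abs_square_less_1)

lemma herglotz_kernel_bound:
  assumes "cmod \<zeta> = 1" "cmod z < 1"
  shows "cmod (herglotz_kernel z \<zeta>) \<le> 2 / (1 - cmod z)"
proof -
  have "cmod (\<zeta> + z) \<le> 2"
    using assms norm_triangle_ineq[of \<zeta> z] by simp
  moreover have "1 - cmod z \<le> cmod (\<zeta> - z)"
    using assms norm_triangle_ineq2[of \<zeta> z] by simp
  ultimately show ?thesis
    unfolding herglotz_kernel_def norm_divide using assms by (intro frac_le) auto
qed

lemma poisson_kernel_bounds:
  assumes "cmod \<zeta> = 1" "cmod z < 1"
  shows "poisson_kernel z \<zeta> \<le> 2 / (1 - cmod z)" "\<bar>poisson_kernel z \<zeta>\<bar> \<le> 2 / (1 - cmod z)"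
  using herglotz_kernel_bound[OF assms] abs_Re_le_cmod[of "herglotz_kernel z \<zeta>"]
  unfolding poisson_kernel_def by linarith+

lemma continuous_herglotz_kernel:
  "cmod z < 1 \<Longrightarrow> continuous_on (sphere 0 1) (herglotz_kernel z)"
  unfolding herglotz_kernel_def by (intro continuous_intros) auto

lemma continuous_poisson_kernel:
  "cmod z < 1 \<Longrightarrow> continuous_on (sphere 0 1) (poisson_kernel z)"
  unfolding poisson_kernel_def by (intro continuous_intros continuous_herglotz_kernel)

text \<open>Multiplying \<open>cnj (y - r * x)\<close> by the unimodular number \<open>x * y\<close>
  gives \<open>x - r * y\<close>, so the two distances agree. The symmetry lets Fubini turn the
  Poisson integral of a measure into that of a test function.\<close>

lemma poisson_kernel_sym:
  assumes "cmod x = 1" "cmod y = 1"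
  shows "poisson_kernel (of_real r * x) y = poisson_kernel (of_real r * y) x"
proof -
  have "cmod (y - of_real r * x) = cmod (cnj (y - of_real r * x) * (x * y))"
    by (simp only: norm_mult complex_mod_cnj assms mult_1_right)
  also have "cnj (y - of_real r * x) * (x * y) = x - of_real r * y"
    using assms complex_norm_square[of x] complex_norm_square[of y]
    by (simp add: algebra_simps)
  finally show ?thesis
    using assms by (simp add: poisson_kernel_eq norm_mult)
qed

lemma schwarz_formula:
  assumes f: "continuous_on (cball 0 1) f" "f holomorphic_on ball 0 1" and z: "cmod z < 1"
  shows "(LINT \<zeta>|circle_measure. herglotz_kernel z \<zeta> * of_real (Re (f \<zeta>))) = f z - \<i> * of_real (Im (f 0))"
proof -
  note I = circle_continuous_integrable[OF circle_borel_circle_measure]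
  have cf: "continuous_on (sphere 0 1) f"
    by (auto intro: continuous_on_subset[OF f(1)])
  have zz: "1 - cnj z * \<zeta> \<noteq> 0" if "cmod \<zeta> \<le> 1" for \<zeta>
  proof -
    have "cmod (cnj z * \<zeta>) < 1"
      using that z mult_mono[of "cmod z" "cmod z" "cmod \<zeta>" 1] by (simp add: norm_mult)
    then show ?thesis
      by auto
  qed
  have 1: "(LINT \<zeta>|circle_measure. herglotz_kernel z \<zeta> * f \<zeta>) = 2 * f z - f 0"
  proof -
    have "(LINT \<zeta>|circle_measure. herglotz_kernel z \<zeta> * f \<zeta>)
        = (LINT \<zeta>|circle_measure. 2 * (f \<zeta> * \<zeta> / (\<zeta> - z)) - f \<zeta>)"
    proof (intro Bochner_Integration.integral_cong refl)
      fix \<zeta> assume "\<zeta> \<in> space circle_measure"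
      then have "\<zeta> - z \<noteq> 0"
        using z by auto
      then show "herglotz_kernel z \<zeta> * f \<zeta> = 2 * (f \<zeta> * \<zeta> / (\<zeta> - z)) - f \<zeta>"
        unfolding herglotz_kernel_def by (simp add: field_simps)
    qed
    also have "\<dots> = (LINT \<zeta>|circle_measure. 2 * (f \<zeta> * \<zeta> / (\<zeta> - z))) - (LINT \<zeta>|circle_measure. f \<zeta>)"
      using z by (intro Bochner_Integration.integral_diff I continuous_intros cf) auto
    finally show ?thesis
      by (simp only: integral_mult_right_zero circle_Cauchy[OF f z] circle_mean_value[OF f])
  qed
  have 2: "(LINT \<zeta>|circle_measure. herglotz_kernel z \<zeta> * cnj (f \<zeta>)) = cnj (f 0)"
  proof -
    \<comment> \<open>On the circle \<open>cnj \<zeta> = 1 / \<zeta>\<close>, so the conjugate of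
      the integrand agrees there with \<open>?g\<close>, which is holomorphic in the disc and has a
      mean value at 0.\<close>
    let ?g = "\<lambda>\<zeta>. (1 + cnj z * \<zeta>) / (1 - cnj z * \<zeta>) * f \<zeta>"
    have "(LINT \<zeta>|circle_measure. ?g \<zeta>) = ?g 0"
      using zz by (intro circle_mean_value continuous_intros holomorphic_intros f) auto
    moreover have "?g \<zeta> = cnj (herglotz_kernel z \<zeta> * cnj (f \<zeta>))" if "cmod \<zeta> = 1" for \<zeta>
    proof -
      have u: "\<zeta> * cnj \<zeta> = 1"
        using that complex_norm_square[of \<zeta>] by simp
      then have "cnj \<zeta> \<noteq> cnj z" "cnj \<zeta> \<noteq> 0"
        using that z by (metis complex_cnj_cancel_iff less_irrefl, force)
      moreover have "(1 + cnj z * \<zeta>) * (cnj \<zeta> - cnj z) = (cnj \<zeta> + cnj z) * (1 - cnj z * \<zeta>)"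
        using u by (simp add: algebra_simps)
      ultimately show ?thesis
        using zz[of \<zeta>] that unfolding herglotz_kernel_def by (simp add: frac_eq_eq)
    qed
    ultimately have "(LINT \<zeta>|circle_measure. cnj (herglotz_kernel z \<zeta> * cnj (f \<zeta>))) = f 0"
      by (subst Bochner_Integration.integral_cong[OF refl, where g = ?g]) auto
    then have "cnj (LINT \<zeta>|circle_measure. herglotz_kernel z \<zeta> * cnj (f \<zeta>)) = f 0"
      by (simp only: Bochner_Integration.integral_cnj)
    then show ?thesis
      by (metis complex_cnj_cnj)
  qed
  have "(LINT \<zeta>|circle_measure. herglotz_kernel z \<zeta> * of_real (Re (f \<zeta>)))
      = (LINT \<zeta>|circle_measure. (herglotz_kernel z \<zeta> * f \<zeta> + herglotz_kernel z \<zeta> * cnj (f \<zeta>)) / 2)"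
    by (intro Bochner_Integration.integral_cong) (auto simp: complex_add_cnj simp flip: distrib_left)
  also have "\<dots> = ((LINT \<zeta>|circle_measure. herglotz_kernel z \<zeta> * f \<zeta>) + (LINT \<zeta>|circle_measure. herglotz_kernel z \<zeta> * cnj (f \<zeta>))) / 2"
    using z by (subst Bochner_Integration.integral_divide_zero, subst Bochner_Integration.integral_add)
      (auto intro!: I continuous_intros cf continuous_herglotz_kernel)
  also have "\<dots> = f z - \<i> * of_real (Im (f 0))"
    unfolding 1 2 by (simp add: complex_eq_iff)
  finally show ?thesis .
qed

lemma poisson_formula:
  assumes f: "continuous_on (cball 0 1) f" "f holomorphic_on ball 0 1" and z: "cmod z < 1"
  shows "(LINT \<zeta>|circle_measure. poisson_kernel z \<zeta> * Re (f \<zeta>)) = Re (f z)"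
proof -
  have cf: "continuous_on (sphere 0 1) f"
    by (auto intro: continuous_on_subset[OF f(1)])
  have "integrable circle_measure (\<lambda>\<zeta>. herglotz_kernel z \<zeta> * of_real (Re (f \<zeta>)))"
    using z by (intro circle_continuous_integrable[OF circle_borel_circle_measure] continuous_intros cf
      continuous_herglotz_kernel)
  from integral_Re[OF this] show ?thesis
    using schwarz_formula[OF f z] by (simp add: poisson_kernel_def)
qed

lemma poisson_kernel_integral: "cmod z < 1 \<Longrightarrow> (LINT \<zeta>|circle_measure. poisson_kernel z \<zeta>) = 1"
  using poisson_formula[of "\<lambda>_. 1" z] by simp

section \<open>Trigonometric approximation\<close>

text \<open>On the circle \<open>cnj \<zeta> = 1 / \<zeta>\<close>, so a polynomial in the real and
  imaginary parts is a Laurent polynomial in \<open>\<zeta>\<close>; the power \<open>N\<close>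
  clears its pole.\<close>

lemma trigonometric_polynomial:
  assumes "real_polynomial_function (g :: complex \<Rightarrow> real)"
  shows "\<exists>N q. \<forall>\<zeta>\<in>sphere 0 1. complex_of_real (g \<zeta>) * \<zeta> ^ N = poly q \<zeta>"
  using assms
proof (induction g rule: real_polynomial_function.induct)
  case (linear f)
  have "complex_of_real (f \<zeta>) * \<zeta> ^ 1
      = poly [:(of_real (f 1) + \<i> * of_real (f \<i>)) / 2, 0, (of_real (f 1) - \<i> * of_real (f \<i>)) / 2:] \<zeta>"
    if "\<zeta> \<in> sphere 0 1" for \<zeta>
  proof -
    have "f \<zeta> = f (Re \<zeta> *\<^sub>R 1 + Im \<zeta> *\<^sub>R \<i>)"
      by (rule arg_cong[where f = f]) (simp add: complex_eq_iff)
    also have "\<dots> = Re \<zeta> * f 1 + Im \<zeta> * f \<i>"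
      using linear by (simp add: linear_simps)
    finally have "f \<zeta> = Re \<zeta> * f 1 + Im \<zeta> * f \<i>" .
    moreover have "\<zeta> * cnj \<zeta> = 1"
      using that complex_norm_square[of \<zeta>] by simp
    moreover have "complex_of_real (Re \<zeta>) = (\<zeta> + cnj \<zeta>) / 2" "complex_of_real (Im \<zeta>) = - \<i> * (\<zeta> - cnj \<zeta>) / 2"
      by (simp_all add: complex_eq_iff)
    ultimately have "complex_of_real (f \<zeta>)
        = (\<zeta> + cnj \<zeta>) / 2 * of_real (f 1) + (- \<i> * (\<zeta> - cnj \<zeta>) / 2) * of_real (f \<i>)"
      by (simp only: of_real_add of_real_mult)
    then have "complex_of_real (f \<zeta>) * \<zeta> = (of_real (f 1) + \<i> * of_real (f \<i>)) / 2 * (\<zeta> * cnj \<zeta>)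
        + (of_real (f 1) - \<i> * of_real (f \<i>)) / 2 * \<zeta> * \<zeta>"
      by (simp only:) (simp add: field_simps)
    then show ?thesis
      using \<open>\<zeta> * cnj \<zeta> = 1\<close> by (simp add: algebra_simps)
  qed
  then show ?case by blast
next
  case (const c)
  have "\<forall>\<zeta>\<in>sphere 0 1. complex_of_real c * \<zeta> ^ 0 = poly [:of_real c:] \<zeta>" by simp
  then show ?case by blast
next
  case (add f g)
  then obtain N q N' q' where "\<forall>\<zeta>\<in>sphere 0 1. complex_of_real (f \<zeta>) * \<zeta> ^ N = poly q \<zeta>"
    "\<forall>\<zeta>\<in>sphere 0 1. complex_of_real (g \<zeta>) * \<zeta> ^ N' = poly q' \<zeta>" by blast
  then have "\<forall>\<zeta>\<in>sphere 0 1. complex_of_real (f \<zeta> + g \<zeta>) * \<zeta> ^ (N + N')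
      = poly (q * monom 1 N' + q' * monom 1 N) \<zeta>"
    by (auto simp: poly_monom power_add algebra_simps)
  then show ?case by blast
next
  case (mult f g)
  then obtain N q N' q' where "\<forall>\<zeta>\<in>sphere 0 1. complex_of_real (f \<zeta>) * \<zeta> ^ N = poly q \<zeta>"
    "\<forall>\<zeta>\<in>sphere 0 1. complex_of_real (g \<zeta>) * \<zeta> ^ N' = poly q' \<zeta>" by blast
  then have "\<forall>\<zeta>\<in>sphere 0 1. (complex_of_real (f \<zeta>) * \<zeta> ^ N) * (complex_of_real (g \<zeta>) * \<zeta> ^ N') = poly (q * q') \<zeta>"
    by simp
  then have "\<forall>\<zeta>\<in>sphere 0 1. complex_of_real (f \<zeta> * g \<zeta>) * \<zeta> ^ (N + N') = poly (q * q') \<zeta>"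
    by (simp add: power_add mult_ac)
  then show ?case by blast
qed

lemma trigonometric_approx:
  fixes \<psi> :: "complex \<Rightarrow> real"
  assumes "continuous_on (sphere 0 1) \<psi>" "e > 0"
  shows "\<exists>N q. \<forall>\<zeta>\<in>sphere 0 1. cmod (of_real (\<psi> \<zeta>) - poly q \<zeta> / \<zeta> ^ N) < e"
proof -
  obtain g where g: "real_polynomial_function g" "\<And>x. x \<in> sphere 0 1 \<Longrightarrow> \<bar>\<psi> x - g x\<bar> < e"
    using Stone_Weierstrass_real_polynomial_function[OF _ assms] by auto
  obtain N q where q: "\<forall>\<zeta>\<in>sphere 0 1. complex_of_real (g \<zeta>) * \<zeta> ^ N = poly q \<zeta>"
    using trigonometric_polynomial[OF g(1)] by blast
  have "cmod (of_real (\<psi> \<zeta>) - poly q \<zeta> / \<zeta> ^ N) < e" if "\<zeta> \<in> sphere 0 1" for \<zeta>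
  proof -
    have "\<zeta> ^ N \<noteq> 0"
      using that by auto
    then have "poly q \<zeta> / \<zeta> ^ N = of_real (g \<zeta>)"
      using q that by (metis nonzero_mult_div_cancel_right)
    then show ?thesis
      using g(2)[OF that] by (simp flip: of_real_diff)
  qed
  then show ?thesis by blast
qed

lemma Re_poly_approx:
  fixes \<psi> :: "complex \<Rightarrow> real"
  assumes "continuous_on (sphere 0 1) \<psi>" "e > 0"
  shows "\<exists>p. \<forall>\<zeta>\<in>sphere 0 1. \<bar>\<psi> \<zeta> - Re (poly p \<zeta>)\<bar> < e"
proof -
  obtain N q where q: "\<forall>\<zeta>\<in>sphere 0 1. cmod (of_real (\<psi> \<zeta>) - poly q \<zeta> / \<zeta> ^ N) < e"
    using trigonometric_approx[OF assms] by blast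
  \<comment> \<open>Only the real part matters: a negative power is the conjugate of a positive one,
    so its coefficient is conjugated and its exponent reversed.\<close>
  define p where "p = (\<Sum>i\<le>degree q. if N \<le> i then monom (coeff q i) (i - N) else monom (cnj (coeff q i)) (N - i))"
  have "Re (poly p \<zeta>) = Re (poly q \<zeta> / \<zeta> ^ N)" if "\<zeta> \<in> sphere 0 1" for \<zeta>
  proof -
    have nz: "\<zeta> \<noteq> 0" and inv: "\<zeta> * cnj \<zeta> = 1"
      using that complex_norm_square[of \<zeta>] by auto
    have "Re (poly (if N \<le> i then monom (coeff q i) (i - N) else monom (cnj (coeff q i)) (N - i)) \<zeta>)
        = Re (coeff q i * \<zeta> ^ i / \<zeta> ^ N)" for i
    proof (cases "N \<le> i")
      case True
      then show ?thesis
        using nz by (simp add: poly_monom power_diff)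
    next
      case False
      have "coeff q i * \<zeta> ^ i / \<zeta> ^ N = coeff q i / \<zeta> ^ (N - i)"
        using False nz by (simp add: power_diff)
      also have "1 / \<zeta> ^ (N - i) = cnj \<zeta> ^ (N - i)"
        using inv nz by (simp add: field_simps flip: power_mult_distrib)
      then have "coeff q i / \<zeta> ^ (N - i) = cnj (cnj (coeff q i) * \<zeta> ^ (N - i))"
        by (metis complex_cnj_cnj complex_cnj_mult complex_cnj_power mult.right_neutral times_divide_eq_right)
      finally show ?thesis
        using False by (simp only: if_False poly_monom cnj.simps)
    qed
    then show ?thesis
      unfolding p_def poly_sum Re_sum
      by (simp add: poly_altdef[of q] sum_divide_distrib)
  qed
  moreover have "\<bar>\<psi> \<zeta> - Re (poly q \<zeta> / \<zeta> ^ N)\<bar> < e" if "\<zeta> \<in> sphere 0 1" for \<zeta>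
    using q that abs_Re_le_cmod[of "of_real (\<psi> \<zeta>) - poly q \<zeta> / \<zeta> ^ N"] by fastforce
  ultimately show ?thesis
    by (intro exI[of _ p]) auto
qed

text \<open>Approximate \<open>\<psi> + e / 2\<close> up to \<open>e / 2\<close>. The real part of a
  polynomial is harmonic in the disc, so such majorants reduce integral inequalities to the maximum
  principle.\<close>

lemma Re_poly_majorant:
  fixes \<psi> :: "complex \<Rightarrow> real"
  assumes "continuous_on (sphere 0 1) \<psi>" "e > 0"
  shows "\<exists>p. \<forall>\<zeta>\<in>sphere 0 1. \<psi> \<zeta> < Re (poly p \<zeta>) \<and> Re (poly p \<zeta>) < \<psi> \<zeta> + e"
proof -
  have "continuous_on (sphere 0 1) (\<lambda>\<zeta>. \<psi> \<zeta> + e / 2)"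
    by (intro continuous_intros assms)
  from Re_poly_approx[OF this half_gt_zero[OF assms(2)]] obtain p
    where p: "\<And>\<zeta>. \<zeta> \<in> sphere 0 1 \<Longrightarrow> \<bar>\<psi> \<zeta> + e / 2 - Re (poly p \<zeta>)\<bar> < e / 2"
    by blast
  have "\<psi> \<zeta> < Re (poly p \<zeta>) \<and> Re (poly p \<zeta>) < \<psi> \<zeta> + e" if "\<zeta> \<in> sphere 0 1" for \<zeta>
    using p[OF that] by linarith
  then show ?thesis by blast
qed

lemma poly_mean_value_Re:
  "(LINT \<zeta>|circle_measure. Re (poly p (of_real r * \<zeta>))) = Re (poly p 0)"
  using circle_mean_value_Re[of "\<lambda>\<zeta>. poly p (of_real r * \<zeta>)"] by (simp add: continuous_intros holomorphic_intros)

section \<open>Poisson integrals of measures on the circle\<close>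

lemma continuous_on_compact_bound:
  fixes f :: "'a::topological_space \<Rightarrow> 'b::real_normed_vector"
  assumes "compact S" "continuous_on S f"
  obtains B where "0 \<le> B" "\<And>x. x \<in> S \<Longrightarrow> norm (f x) \<le> B"
proof -
  obtain b where b: "\<forall>x\<in>S. norm (f x) \<le> b"
    using compact_imp_bounded[OF compact_continuous_image[OF assms(2,1)]] by (auto simp: bounded_iff)
  then show thesis
    by (intro that[of "max 0 b"]) force+
qed

definition herglotz :: "complex measure \<Rightarrow> complex \<Rightarrow> complex" where
  "herglotz m z = (LINT \<zeta>|m. herglotz_kernel z \<zeta>)"

definition poisson :: "complex measure \<Rightarrow> complex \<Rightarrow> real" where
  "poisson m z = (LINT \<zeta>|m. poisson_kernel z \<zeta>)"

lemma integrable_herglotz_kernel: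
  "circle_borel_measure m \<Longrightarrow> cmod z < 1 \<Longrightarrow> integrable m (herglotz_kernel z)"
  by (rule circle_continuous_integrable[OF _ continuous_herglotz_kernel])

lemma integrable_poisson_kernel:
  "circle_borel_measure m \<Longrightarrow> cmod z < 1 \<Longrightarrow> integrable m (poisson_kernel z)"
  by (rule circle_continuous_integrable[OF _ continuous_poisson_kernel])

lemma Re_herglotz:
  "circle_borel_measure m \<Longrightarrow> cmod z < 1 \<Longrightarrow> Re (herglotz m z) = poisson m z"
  unfolding herglotz_def poisson_def poisson_kernel_def
  by (intro integral_Re[symmetric] integrable_herglotz_kernel)

lemma poisson_nonneg:
  assumes "circle_borel_measure m" "cmod z < 1"
  shows "0 \<le> poisson m z"
  unfolding poisson_def using assms
  by (intro integral_nonneg_AE AE_I2) (auto intro!: less_imp_le poisson_kernel_pos dest: circle_borelD(3))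

lemma singular_function_eq: "singular_function m z = exp (- herglotz m z)"
proof -
  have "(z + \<zeta>) / (z - \<zeta>) = - herglotz_kernel z \<zeta>" for \<zeta>
    unfolding herglotz_kernel_def
    by (metis add.commute minus_diff_eq minus_divide_right)
  then show ?thesis
    unfolding singular_function_def herglotz_def by simp
qed

lemma cmod_singular_function:
  "circle_borel_measure m \<Longrightarrow> cmod z < 1 \<Longrightarrow> cmod (singular_function m z) = exp (- poisson m z)"
  by (simp add: singular_function_eq Re_herglotz)

lemma herglotz_at_0: "circle_borel_measure m \<Longrightarrow> herglotz m 0 = of_real (measure m (sphere 0 1))"
proof -
  assume m: "circle_borel_measure m"
  have "herglotz m 0 = (LINT \<zeta>|m. 1)"
    unfolding herglotz_def
    by (intro Bochner_Integration.integral_cong) (auto simp: herglotz_kernel_def circle_borelD(3)[OF m])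
  then show ?thesis
    by (simp add: circle_borelD(3)[OF m] scaleR_conv_of_real)
qed

text \<open>The kernel is \<open>2 / (1 - w / \<zeta>) - 1\<close>; its geometric series is
  integrated term by term. Hence the coefficient 1 for \<open>k = 0\<close> and 2 for the
  others.\<close>

lemma herglotz_holomorphic:
  assumes m: "circle_borel_measure m"
  shows "herglotz m holomorphic_on ball 0 1"
proof -
  define c where "c k = (if k = 0 then 1 else 2) * (LINT \<zeta>|m. 1 / \<zeta> ^ k)" for k :: nat
  interpret finite_measure m by (rule circle_borelD(2)[OF m])
  have I: "integrable m (\<lambda>\<zeta>. 1 / \<zeta> ^ k)" for k
    by (rule circle_continuous_integrable[OF m]) (auto intro!: continuous_intros)
  have "(\<lambda>k. c k * (w - 0) ^ k) sums herglotz m w" if "w \<in> ball 0 1" for w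
  proof -
    have w: "cmod w < 1" using that by simp
    define f where "f k \<zeta> = (if k = 0 then 1 else 2) * w ^ k * (1 / \<zeta> ^ k)" for k and \<zeta> :: complex
    have int: "integrable m (f k)" for k
      unfolding f_def by (rule integrable_mult_right[OF I])
    have norm_le: "norm (f k \<zeta>) \<le> 2 * cmod w ^ k" if "\<zeta> \<in> sphere 0 1" for k \<zeta>
      using that by (simp add: f_def norm_mult norm_divide norm_power)
    have sg: "summable (\<lambda>k. 2 * cmod w ^ k)"
      using w by (intro summable_mult summable_geometric) simp
    have s1: "summable (\<lambda>k. norm (f k \<zeta>))" if "\<zeta> \<in> sphere 0 1" for \<zeta>
      by (rule summable_comparison_test[OF _ sg]) (auto intro!: exI[of _ 0] norm_le that)
    have s2: "summable (\<lambda>k. LINT \<zeta>|m. norm (f k \<zeta>))"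
    proof (rule summable_comparison_test)
      show "summable (\<lambda>k. 2 * cmod w ^ k * measure m (space m))"
        by (rule summable_mult2[OF sg])
      have "(LINT \<zeta>|m. norm (f k \<zeta>)) \<le> (LINT \<zeta>|m. 2 * cmod w ^ k)" for k
        by (intro integral_mono integrable_norm int) (use norm_le circle_borelD(3)[OF m] in auto)
      then show "\<exists>N. \<forall>k\<ge>N. norm (LINT \<zeta>|m. norm (f k \<zeta>)) \<le> 2 * cmod w ^ k * measure m (space m)"
        by (simp add: mult_ac)
    qed
    have val: "(\<Sum>k. f k \<zeta>) = herglotz_kernel w \<zeta>" if "\<zeta> \<in> sphere 0 1" for \<zeta>
    proof -
      have q: "norm (w / \<zeta>) < 1" "\<zeta> \<noteq> 0" "\<zeta> \<noteq> w"
        using that w by (auto simp: norm_divide)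
      have "(\<lambda>k. 2 * (w / \<zeta>) ^ k - (if k = 0 then 1 else 0)) sums (2 * (1 / (1 - w / \<zeta>)) - 1)"
        by (intro sums_diff sums_mult geometric_sums q sums_single)
      also have "(\<lambda>k. 2 * (w / \<zeta>) ^ k - (if k = 0 then 1 else 0)) = (\<lambda>k. f k \<zeta>)"
        by (auto simp: f_def fun_eq_iff power_divide)
      also have "2 * (1 / (1 - w / \<zeta>)) - 1 = herglotz_kernel w \<zeta>"
        using q by (simp add: herglotz_kernel_def field_simps)
      finally show ?thesis by (rule sums_unique[symmetric])
    qed
    have "(\<lambda>k. LINT \<zeta>|m. f k \<zeta>) sums (LINT \<zeta>|m. (\<Sum>k. f k \<zeta>))"
      by (intro sums_integral int s2 AE_I2) (use s1 circle_borelD(3)[OF m] in auto)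
    also have "(LINT \<zeta>|m. (\<Sum>k. f k \<zeta>)) = herglotz m w"
      unfolding herglotz_def
      by (intro Bochner_Integration.integral_cong refl val) (simp add: circle_borelD(3)[OF m])
    also have "(\<lambda>k. LINT \<zeta>|m. f k \<zeta>) = (\<lambda>k. c k * (w - 0) ^ k)"
      unfolding f_def c_def by (simp add: mult_ac fun_eq_iff flip: integral_mult_right_zero)
    finally show ?thesis .
  qed
  then show ?thesis
    by (rule power_series_holomorphic)
qed

lemma circle_ident_measurable:
  assumes "circle_borel_measure m"
  shows "(\<lambda>x. x) \<in> m \<rightarrow>\<^sub>M borel"
  using circle_continuous_measurable[OF assms, of "\<lambda>x. x"] by simp

lemma continuous_on_poisson: "circle_borel_measure m \<Longrightarrow> continuous_on (ball 0 1) (poisson m)"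
proof -
  assume m: "circle_borel_measure m"
  have "continuous_on (ball 0 1) (\<lambda>z. Re (herglotz m z))"
    by (intro continuous_intros holomorphic_on_imp_continuous_on herglotz_holomorphic m)
  then show ?thesis
    by (rule continuous_on_eq) (simp add: Re_herglotz m)
qed

lemma continuous_on_poisson_circle:
  assumes "circle_borel_measure m" "0 \<le> r" "r < 1"
  shows "continuous_on (sphere 0 1) (\<lambda>\<zeta>. poisson m (of_real r * \<zeta>))"
  by (intro continuous_on_compose2[OF continuous_on_poisson[OF assms(1)]] continuous_intros)
    (use assms in \<open>auto simp: norm_mult\<close>)

text \<open>Fubini and \<open>poisson_kernel_sym\<close>: testing the smoothed measure against
  \<open>\<psi>\<close> is testing the measure against the smoothed \<open>\<psi>\<close>.\<close>

lemma poisson_integral_swap: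
  assumes m: "circle_borel_measure m" and r: "0 \<le> r" "r < 1" and \<psi>: "continuous_on (sphere 0 1) \<psi>"
  shows "(LINT \<zeta>|circle_measure. \<psi> \<zeta> * poisson m (of_real r * \<zeta>))
       = (LINT x|m. (LINT \<zeta>|circle_measure. poisson_kernel (of_real r * x) \<zeta> * \<psi> \<zeta>))"
proof -
  interpret m: finite_measure m by (rule circle_borelD(2)[OF m])
  interpret pair_sigma_finite m circle_measure ..
  have [measurable]: "(\<lambda>x. x) \<in> m \<rightarrow>\<^sub>M borel" "(\<lambda>x. x) \<in> circle_measure \<rightarrow>\<^sub>M borel"
    by (rule circle_ident_measurable m circle_borel_circle_measure)+
  have [measurable]: "\<psi> \<in> borel_measurable circle_measure"
    by (rule circle_continuous_measurable[OF circle_borel_circle_measure \<psi>])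
  obtain B where B0: "0 \<le> B" and B: "\<And>x. x \<in> sphere 0 1 \<Longrightarrow> norm (\<psi> x) \<le> B"
    using continuous_on_compact_bound[OF compact_sphere \<psi>] by blast
  interpret P: finite_measure "m \<Otimes>\<^sub>M circle_measure"
    by (rule finite_measure_pair_measure) (simp_all add: m.finite_measure_axioms circle.finite_measure_axioms)
  have "integrable (m \<Otimes>\<^sub>M circle_measure) (case_prod (\<lambda>x \<zeta>. \<psi> \<zeta> * poisson_kernel (of_real r * \<zeta>) x))"
  proof (rule P.integrable_const_bound[where B = "B * (2 / (1 - r))"])
    show "case_prod (\<lambda>x \<zeta>. \<psi> \<zeta> * poisson_kernel (of_real r * \<zeta>) x) \<in> borel_measurable (m \<Otimes>\<^sub>M circle_measure)"
      unfolding poisson_kernel_def herglotz_kernel_def by measurable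
    show "AE p in m \<Otimes>\<^sub>M circle_measure. norm (case p of (x, \<zeta>) \<Rightarrow> \<psi> \<zeta> * poisson_kernel (of_real r * \<zeta>) x) \<le> B * (2 / (1 - r))"
    proof (rule AE_I2, clarsimp simp: space_pair_measure circle_borelD(3)[OF m] abs_mult)
      fix x \<zeta> :: complex assume a: "cmod x = 1" "cmod \<zeta> = 1"
      have "\<bar>poisson_kernel (of_real r * \<zeta>) x\<bar> \<le> 2 / (1 - r)"
        using poisson_kernel_bounds(2)[of x "of_real r * \<zeta>"] a r by (simp add: norm_mult)
      then have "\<bar>\<psi> \<zeta>\<bar> * \<bar>poisson_kernel (of_real r * \<zeta>) x\<bar> \<le> B * (2 / (1 - r))"
        using B[of \<zeta>] a B0 r by (intro mult_mono) auto
      then show "\<bar>\<psi> \<zeta>\<bar> * \<bar>poisson_kernel (of_real r * \<zeta>) x\<bar> \<le> B * 2 / (1 - r)" by simp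
    qed
  qed
  from Fubini_integral[OF this]
  have "(LINT \<zeta>|circle_measure. (LINT x|m. \<psi> \<zeta> * poisson_kernel (of_real r * \<zeta>) x))
      = (LINT x|m. (LINT \<zeta>|circle_measure. \<psi> \<zeta> * poisson_kernel (of_real r * \<zeta>) x))" .
  also have "\<dots> = (LINT x|m. (LINT \<zeta>|circle_measure. poisson_kernel (of_real r * x) \<zeta> * \<psi> \<zeta>))"
    by (intro Bochner_Integration.integral_cong refl, subst poisson_kernel_sym)
      (auto simp: circle_borelD(3)[OF m])
  finally show ?thesis
    unfolding poisson_def by simp
qed

lemma poisson_mean:
  assumes m: "circle_borel_measure m" and r: "0 \<le> r" "r < 1"
  shows "(LINT \<zeta>|circle_measure. poisson m (of_real r * \<zeta>)) = measure m (sphere 0 1)"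
proof -
  have "(LINT \<zeta>|circle_measure. 1 * poisson m (of_real r * \<zeta>))
      = (LINT x|m. (LINT \<zeta>|circle_measure. poisson_kernel (of_real r * x) \<zeta> * 1))"
    by (rule poisson_integral_swap[OF m r]) simp
  also have "\<dots> = (LINT x|m. 1)"
    by (intro Bochner_Integration.integral_cong refl)
      (use r in \<open>auto simp: circle_borelD(3)[OF m] norm_mult intro!: poisson_kernel_integral\<close>)
  finally show ?thesis
    by (simp add: circle_borelD(3)[OF m])
qed

lemma poisson_integral_Re_poly:
  assumes m: "circle_borel_measure m" and r: "0 \<le> r" "r < 1"
  shows "(LINT \<zeta>|circle_measure. Re (poly p \<zeta>) * poisson m (of_real r * \<zeta>)) = (LINT x|m. Re (poly p (of_real r * x)))"
proof -
  have "(LINT \<zeta>|circle_measure. Re (poly p \<zeta>) * poisson m (of_real r * \<zeta>))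
      = (LINT x|m. (LINT \<zeta>|circle_measure. poisson_kernel (of_real r * x) \<zeta> * Re (poly p \<zeta>)))"
    by (rule poisson_integral_swap[OF m r]) (intro continuous_intros)
  also have "\<dots> = (LINT x|m. Re (poly p (of_real r * x)))"
    using r by (intro Bochner_Integration.integral_cong refl poisson_formula)
      (auto simp: circle_borelD(3)[OF m] norm_mult intro!: continuous_intros holomorphic_intros)
  finally show ?thesis .
qed

text \<open>For \<open>Re (poly p)\<close> the integral is that of
  \<open>Re (poly p (r n * x))\<close> against \<open>m\<close>, which converges by domination.
  Every circle mean of the Poisson integral is the mass of \<open>m\<close>, so replacing
  \<open>\<psi>\<close> by such a function costs at most \<open>d * K\<close> on either
  side.\<close>

lemma poisson_weak_limit:
  assumes m: "circle_borel_measure m" and r: "\<And>n. 0 \<le> r n" "\<And>n. r n < 1" "r \<longlonglongrightarrow> 1"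
    and \<psi>: "continuous_on (sphere 0 1) \<psi>"
  shows "(\<lambda>n. LINT \<zeta>|circle_measure. \<psi> \<zeta> * poisson m (of_real (r n) * \<zeta>)) \<longlonglongrightarrow> (LINT x|m. \<psi> x)"
proof (rule LIMSEQ_I)
  fix e :: real assume e: "e > 0"
  interpret m: finite_measure m by (rule circle_borelD(2)[OF m])
  define K where "K = measure m (sphere 0 1)"
  have K: "0 \<le> K" by (simp add: K_def)
  define d where "d = e / (3 * (K + 1))"
  have d: "0 < d" using e K by (simp add: d_def)
  obtain p where p: "\<And>\<zeta>. \<zeta> \<in> sphere 0 1 \<Longrightarrow> \<bar>\<psi> \<zeta> - Re (poly p \<zeta>)\<bar> < d"
    using Re_poly_approx[OF \<psi> d] by blast
  have lim: "(\<lambda>n. LINT x|m. Re (poly p (of_real (r n) * x))) \<longlonglongrightarrow> (LINT x|m. Re (poly p x))"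
  proof -
    have "continuous_on (cball 0 1) (poly p)"
      by (intro continuous_intros)
    then obtain B where B: "\<And>x. x \<in> cball 0 1 \<Longrightarrow> norm (poly p x) \<le> B"
      using continuous_on_compact_bound[OF compact_cball] by blast
    show ?thesis
    proof (rule integral_dominated_convergence[where w = "\<lambda>_. B"])
      show "AE x in m. (\<lambda>n. Re (poly p (of_real (r n) * x))) \<longlonglongrightarrow> Re (poly p x)"
      proof (rule AE_I2)
        fix x
        have "(\<lambda>n. Re (poly p (of_real (r n) * x))) \<longlonglongrightarrow> Re (poly p (of_real 1 * x))"
          by (intro tendsto_intros r)
        then show "(\<lambda>n. Re (poly p (of_real (r n) * x))) \<longlonglongrightarrow> Re (poly p x)" by simp
      qed
      show "AE x in m. norm (Re (poly p (of_real (r n) * x))) \<le> B" for n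
        by (rule AE_I2) (use r B circle_borelD(3)[OF m] in
          \<open>auto simp: norm_mult less_imp_le intro!: order_trans[OF abs_Re_le_cmod]\<close>)
    qed (auto intro!: circle_continuous_measurable[OF m] continuous_intros)
  qed
  then obtain N where N: "\<And>n. n \<ge> N \<Longrightarrow> \<bar>(LINT x|m. Re (poly p (of_real (r n) * x))) - (LINT x|m. Re (poly p x))\<bar> < e / 3"
    using LIMSEQ_D[OF lim, of "e / 3"] e by auto
  have "\<bar>(LINT \<zeta>|circle_measure. \<psi> \<zeta> * poisson m (of_real (r n) * \<zeta>)) - (LINT x|m. \<psi> x)\<bar> < e" if "n \<ge> N" for n
  proof -
    note I = circle_continuous_integrable[OF circle_borel_circle_measure]
    have cp: "continuous_on (sphere 0 1) (\<lambda>\<zeta>. poisson m (of_real (r n) * \<zeta>))"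
      by (rule continuous_on_poisson_circle[OF m r(1,2)])
    have "\<bar>(LINT \<zeta>|circle_measure. \<psi> \<zeta> * poisson m (of_real (r n) * \<zeta>)) - (LINT \<zeta>|circle_measure. Re (poly p \<zeta>) * poisson m (of_real (r n) * \<zeta>))\<bar>
        = \<bar>LINT \<zeta>|circle_measure. (\<psi> \<zeta> - Re (poly p \<zeta>)) * poisson m (of_real (r n) * \<zeta>)\<bar>"
      unfolding left_diff_distrib
      by (subst Bochner_Integration.integral_diff) (auto intro!: I continuous_intros cp \<psi>)
    also have "\<dots> \<le> (LINT \<zeta>|circle_measure. \<bar>(\<psi> \<zeta> - Re (poly p \<zeta>)) * poisson m (of_real (r n) * \<zeta>)\<bar>)"
      by (rule integral_abs_bound)
    also have "\<dots> \<le> (LINT \<zeta>|circle_measure. d * poisson m (of_real (r n) * \<zeta>))"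
    proof (rule integral_mono)
      fix \<zeta> assume z: "\<zeta> \<in> space circle_measure"
      have "0 \<le> poisson m (of_real (r n) * \<zeta>)"
        using z r by (intro poisson_nonneg m) (auto simp: norm_mult)
      then show "\<bar>(\<psi> \<zeta> - Re (poly p \<zeta>)) * poisson m (of_real (r n) * \<zeta>)\<bar> \<le> d * poisson m (of_real (r n) * \<zeta>)"
        using p[of \<zeta>] z by (auto simp: abs_mult intro!: mult_right_mono)
    qed (auto intro!: I continuous_intros cp \<psi>)
    also have "\<dots> = d * K"
      by (simp add: poisson_mean[OF m r(1,2)] K_def)
    finally have 1: "\<bar>(LINT \<zeta>|circle_measure. \<psi> \<zeta> * poisson m (of_real (r n) * \<zeta>)) - (LINT x|m. Re (poly p (of_real (r n) * x)))\<bar> \<le> d * K"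
      by (simp add: poisson_integral_Re_poly[OF m r(1,2)])
    have "\<bar>(LINT x|m. Re (poly p x)) - (LINT x|m. \<psi> x)\<bar> = \<bar>LINT x|m. Re (poly p x) - \<psi> x\<bar>"
      by (subst Bochner_Integration.integral_diff) (auto intro!: circle_continuous_integrable[OF m] continuous_intros \<psi>)
    also have "\<dots> \<le> (LINT x|m. \<bar>Re (poly p x) - \<psi> x\<bar>)"
      by (rule integral_abs_bound)
    also have "\<dots> \<le> (LINT x|m. d)"
    proof (rule integral_mono)
      fix x assume "x \<in> space m"
      then show "\<bar>Re (poly p x) - \<psi> x\<bar> \<le> d"
        using p[of x] circle_borelD(3)[OF m] by (auto simp: abs_minus_commute)
    qed (auto intro!: circle_continuous_integrable[OF m] continuous_intros \<psi>)
    also have "\<dots> = d * K"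
      by (simp add: K_def circle_borelD(3)[OF m])
    finally have 2: "\<bar>(LINT x|m. Re (poly p x)) - (LINT x|m. \<psi> x)\<bar> \<le> d * K" .
    have "d * K \<le> e / 3"
      using e K by (simp add: d_def field_simps)
    then show ?thesis
      using 1 2 N[OF that] by linarith
  qed
  then show "\<exists>N. \<forall>n\<ge>N. norm ((LINT \<zeta>|circle_measure. \<psi> \<zeta> * poisson m (of_real (r n) * \<zeta>)) - (LINT x|m. \<psi> x)) < e"
    by auto
qed

text \<open>Localised to an open set \<open>J\<close>, so that pointwise bounds near a single boundary point can be used.\<close>

lemma measure_le_sum_if_integral_le:
  assumes m: "circle_borel_measure m" and I: "finite I" "\<And>i. i \<in> I \<Longrightarrow> circle_borel_measure (m' i)"
    and J: "open J"
    and le: "\<And>\<psi> :: complex \<Rightarrow> real. continuous_on UNIV \<psi> \<Longrightarrow> (\<And>x. 0 \<le> \<psi> x) \<Longrightarrow> (\<And>x. x \<notin> J \<Longrightarrow> \<psi> x = 0) \<Longrightarrow>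
        (LINT x|m. \<psi> x) \<le> (\<Sum>i\<in>I. LINT x|m' i. \<psi> x)"
    and A: "A \<in> sets m" "A \<subseteq> J"
  shows "measure m A \<le> (\<Sum>i\<in>I. measure (m' i) A)"
proof -
  interpret m: finite_measure m by (rule circle_borelD(2)[OF m])
  have sets_borel: "K \<in> sets M" if "compact K" "K \<subseteq> A" "circle_borel_measure M" for K M
    using that A sets.sets_into_space[OF A(1)] circle_borelD[OF m]
    by (auto simp: circle_borelD(1)[OF that(3)] sets_restrict_space compact_imp_closed intro!: image_eqI[of _ _ K])
  have compact: "measure m K \<le> (\<Sum>i\<in>I. measure (m' i) A)" if K: "compact K" "K \<subseteq> A" "K \<noteq> {}" for K
  proof -
    \<comment> \<open>Continuous tents that decrease to the indicator of the compact set
      \<open>K\<close>.\<close>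
    define \<psi> where "\<psi> n x = max 0 (1 - real n * infdist x K)" for n :: nat and x
    have c: "continuous_on S (\<psi> n)" for S n
      unfolding \<psi>_def by (intro continuous_intros)
    have lim: "(\<lambda>n. LINT x|M. \<psi> n x) \<longlonglongrightarrow> measure M K" if M: "circle_borel_measure M" for M
    proof -
      interpret finite_measure M by (rule circle_borelD(2)[OF M])
      have "(\<lambda>n. LINT x|M. \<psi> n x) \<longlonglongrightarrow> (LINT x|M. indicator K x)"
      proof (rule integral_dominated_convergence[where w = "\<lambda>_. 1"])
        show "AE x in M. (\<lambda>n. \<psi> n x) \<longlonglongrightarrow> indicator K x"
        proof (rule AE_I2)
          fix x
          show "(\<lambda>n. \<psi> n x) \<longlonglongrightarrow> indicator K x"
          proof (cases "x \<in> K")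
            case False
            then have "infdist x K > 0"
              using infdist_pos_not_in_closed[OF compact_imp_closed[OF K(1)] K(3)] by blast
            then obtain N :: nat where N: "1 < real N * infdist x K"
              using reals_Archimedean3 by blast
            have "\<psi> n x = 0" if "n \<ge> N" for n
            proof -
              have "real N * infdist x K \<le> real n * infdist x K"
                using that by (intro mult_right_mono) (auto simp: infdist_nonneg)
              then show ?thesis using N by (simp add: \<psi>_def)
            qed
            then show ?thesis
              using False by (intro tendsto_eventually) (auto simp: eventually_sequentially)
          qed (simp add: \<psi>_def)
        qed
        show "AE x in M. norm (\<psi> n x) \<le> 1" for n
          by (rule AE_I2) (auto simp: \<psi>_def infdist_nonneg)
        show "indicator K \<in> borel_measurable M"
          using sets_borel[OF K(1,2) M] by simp
      qed (auto intro!: circle_continuous_measurable[OF M] c)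
      then show ?thesis
        using sets_borel[OF K(1,2) M] sets.sets_into_space[of K M] by (simp add: Int_absorb2)
    qed
    \<comment> \<open>\<open>K\<close> has positive distance from the complement of
      \<open>J\<close>, so the tents are eventually supported in \<open>J\<close>, as
      \<open>le\<close> demands.\<close>
    obtain d where d: "0 < d" "\<And>x y. x \<in> K \<Longrightarrow> y \<in> - J \<Longrightarrow> d \<le> dist x y"
    proof -
      have "K \<inter> - J = {}" "closed (- J)"
        using J K A by auto
      from separate_compact_closed[OF K(1) this(2,1)] show ?thesis
        using that by blast
    qed
    obtain N :: nat where N: "1 < real N * d"
      using reals_Archimedean3[OF d(1)] by blast
    have "(LINT x|m. \<psi> n x) \<le> (\<Sum>i\<in>I. LINT x|m' i. \<psi> n x)" if "n \<ge> N" for n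
    proof (rule le[of "\<psi> n"])
      fix x assume "x \<notin> J"
      then have "d \<le> infdist x K"
        using d(2) K(3) by (auto simp: infdist_def dist_commute intro!: cINF_greatest)
      then have "real N * d \<le> real n * infdist x K"
        using that d by (intro mult_mono) auto
      then show "\<psi> n x = 0" using N by (simp add: \<psi>_def)
    qed (auto simp: c, simp add: \<psi>_def)
    then have "measure m K \<le> (\<Sum>i\<in>I. measure (m' i) K)"
      by (intro LIMSEQ_le[OF lim[OF m] tendsto_sum[OF lim[OF I(2)]]]) auto
    also have "\<dots> \<le> (\<Sum>i\<in>I. measure (m' i) A)"
      using A I(2) K by (intro sum_mono finite_measure.finite_measure_mono circle_borelD(2))
        (auto simp: circle_borelD(1)[OF m] circle_borelD(1))
    finally show ?thesis .
  qed
  \<comment> \<open>Borel sets are exhausted by compact ones in measure;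
    \<open>inner_regular\<close> is applied to the image of \<open>m\<close> in the whole
    plane.\<close>
  define M where "M = distr m borel (\<lambda>x. x)"
  have AB: "A \<in> sets borel"
    using A(1) circle_borelD(1)[OF m] by (auto simp: sets_restrict_space)
  have M: "emeasure M B = emeasure m B" if "B \<in> sets borel" "B \<subseteq> A" for B
    unfolding M_def using that sets.sets_into_space[OF A(1)]
    by (subst emeasure_distr[OF circle_ident_measurable[OF m]]) (auto intro!: arg_cong[where f = "emeasure m"])
  have "emeasure M A = (SUP K \<in> {K. K \<subseteq> A \<and> compact K}. emeasure M K)"
  proof (rule inner_regular)
    show "emeasure M (space M) \<noteq> \<infinity>"
      using m.emeasure_finite[of "space m"]
      by (simp add: M_def emeasure_distr[OF circle_ident_measurable[OF m]])
  qed (auto simp: AB M_def)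
  also have "\<dots> \<le> ennreal (\<Sum>i\<in>I. measure (m' i) A)"
  proof (rule SUP_least)
    fix K assume K: "K \<in> {K. K \<subseteq> A \<and> compact K}"
    show "emeasure M K \<le> ennreal (\<Sum>i\<in>I. measure (m' i) A)"
    proof (cases "K = {}")
      case False
      then show ?thesis
        using K compact[of K] M[of K]
        by (auto simp: m.emeasure_eq_measure compact_imp_closed borel_closed intro!: ennreal_leI)
    qed simp
  qed
  finally have "ennreal (measure m A) \<le> ennreal (\<Sum>i\<in>I. measure (m' i) A)"
    using M[of A] AB by (simp add: m.emeasure_eq_measure)
  then show ?thesis
    by (subst (asm) ennreal_le_iff) (auto intro!: sum_nonneg)
qed

text \<open>Integrate the bound against a test function on the circles of radius \<open>r n\<close>:
  the Poisson integrals tend weakly to their measures. The errors \<open>e n\<close> are controlled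
  in mean only, which is all that is known of the logarithm of a Blaschke product.\<close>

lemma measure_le_sum_if_poisson_le:
  assumes m: "circle_borel_measure m" and I: "finite I" "\<And>i. i \<in> I \<Longrightarrow> circle_borel_measure (m' i)"
    and J: "open J"
    and r: "\<And>n. 0 \<le> r n" "\<And>n. r n < 1" "r \<longlonglongrightarrow> 1"
    and e: "\<And>n. integrable circle_measure (e n)" "(\<lambda>n. LINT \<zeta>|circle_measure. \<bar>e n \<zeta>\<bar>) \<longlonglongrightarrow> 0"
    and le: "\<And>n \<zeta>. \<zeta> \<in> sphere 0 1 \<Longrightarrow> \<zeta> \<in> J \<Longrightarrow>
        poisson m (of_real (r n) * \<zeta>) \<le> (\<Sum>i\<in>I. poisson (m' i) (of_real (r n) * \<zeta>)) + e n \<zeta>"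
    and A: "A \<in> sets m" "A \<subseteq> J"
  shows "measure m A \<le> (\<Sum>i\<in>I. measure (m' i) A)"
proof (rule measure_le_sum_if_integral_le[OF m I J _ A])
  fix \<psi> :: "complex \<Rightarrow> real"
  assume \<psi>: "continuous_on UNIV \<psi>" "\<And>x. 0 \<le> \<psi> x" "\<And>x. x \<notin> J \<Longrightarrow> \<psi> x = 0"
  have c: "continuous_on (sphere 0 1) \<psi>"
    by (rule continuous_on_subset[OF \<psi>(1)]) simp
  obtain B where B: "0 \<le> B" "\<And>x. x \<in> sphere 0 1 \<Longrightarrow> norm (\<psi> x) \<le> B"
    using continuous_on_compact_bound[OF compact_sphere c] by blast
  note K = circle_continuous_integrable[OF circle_borel_circle_measure]
  have cp: "continuous_on (sphere 0 1) (\<lambda>\<zeta>. poisson M (of_real (r n) * \<zeta>))" if "circle_borel_measure M" for M n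
    by (rule continuous_on_poisson_circle[OF that r(1,2)])
  have "(\<lambda>n. (\<Sum>i\<in>I. LINT \<zeta>|circle_measure. \<psi> \<zeta> * poisson (m' i) (of_real (r n) * \<zeta>))
      + B * (LINT \<zeta>|circle_measure. \<bar>e n \<zeta>\<bar>)) \<longlonglongrightarrow> (\<Sum>i\<in>I. LINT x|m' i. \<psi> x) + B * 0"
    by (intro tendsto_intros poisson_weak_limit r c I e)
  moreover have "(LINT \<zeta>|circle_measure. \<psi> \<zeta> * poisson m (of_real (r n) * \<zeta>))
    \<le> (\<Sum>i\<in>I. LINT \<zeta>|circle_measure. \<psi> \<zeta> * poisson (m' i) (of_real (r n) * \<zeta>)) + B * (LINT \<zeta>|circle_measure. \<bar>e n \<zeta>\<bar>)" for n
  proof -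
    have i: "integrable circle_measure (\<lambda>\<zeta>. \<psi> \<zeta> * poisson (m' i) (of_real (r n) * \<zeta>))" if "i \<in> I" for i
      by (intro K continuous_intros c cp I that)
    have "(LINT \<zeta>|circle_measure. \<psi> \<zeta> * poisson m (of_real (r n) * \<zeta>))
        \<le> (LINT \<zeta>|circle_measure. (\<Sum>i\<in>I. \<psi> \<zeta> * poisson (m' i) (of_real (r n) * \<zeta>)) + B * \<bar>e n \<zeta>\<bar>)"
    proof (rule integral_mono)
      show "integrable circle_measure (\<lambda>\<zeta>. \<psi> \<zeta> * poisson m (of_real (r n) * \<zeta>))"
        by (intro K continuous_intros c cp m)
      show "integrable circle_measure (\<lambda>\<zeta>. (\<Sum>i\<in>I. \<psi> \<zeta> * poisson (m' i) (of_real (r n) * \<zeta>)) + B * \<bar>e n \<zeta>\<bar>)"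
        by (intro Bochner_Integration.integrable_add Bochner_Integration.integrable_sum i
          integrable_mult_right integrable_abs e)
      fix \<zeta> assume "\<zeta> \<in> space circle_measure"
      then have z: "\<zeta> \<in> sphere 0 1" by simp
      show "\<psi> \<zeta> * poisson m (of_real (r n) * \<zeta>)
          \<le> (\<Sum>i\<in>I. \<psi> \<zeta> * poisson (m' i) (of_real (r n) * \<zeta>)) + B * \<bar>e n \<zeta>\<bar>"
      proof (cases "\<zeta> \<in> J")
        case True
        have "\<psi> \<zeta> * poisson m (of_real (r n) * \<zeta>)
            \<le> \<psi> \<zeta> * ((\<Sum>i\<in>I. poisson (m' i) (of_real (r n) * \<zeta>)) + e n \<zeta>)"
          by (intro mult_left_mono le z True \<psi>)
        also have "\<dots> = (\<Sum>i\<in>I. \<psi> \<zeta> * poisson (m' i) (of_real (r n) * \<zeta>)) + \<psi> \<zeta> * e n \<zeta>"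
          by (simp add: distrib_left sum_distrib_left)
        also have "\<psi> \<zeta> * e n \<zeta> \<le> B * \<bar>e n \<zeta>\<bar>"
          by (rule order_trans[OF mult_left_mono[OF abs_ge_self] mult_right_mono]) (use B(2)[OF z] \<psi>(2) in auto)
        finally show ?thesis by simp
      next
        case False
        then show ?thesis
          using B by (simp add: \<psi>(3))
      qed
    qed
    also have "\<dots> = (\<Sum>i\<in>I. LINT \<zeta>|circle_measure. \<psi> \<zeta> * poisson (m' i) (of_real (r n) * \<zeta>)) + B * (LINT \<zeta>|circle_measure. \<bar>e n \<zeta>\<bar>)"
      by (subst Bochner_Integration.integral_add)
        (auto intro!: Bochner_Integration.integrable_sum i integrable_mult_right integrable_abs e
          simp: Bochner_Integration.integral_sum[OF i])
    finally show ?thesis .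
  qed
  ultimately show "(LINT x|m. \<psi> x) \<le> (\<Sum>i\<in>I. LINT x|m' i. \<psi> x)"
    by (intro LIMSEQ_le[OF poisson_weak_limit[OF m r c]]) auto
qed

lemma measure_circle_sphere [simp]: "measure circle_measure (sphere 0 1) = 1"
  using circle.prob_space by simp

section \<open>Means of logarithms\<close>

lemma ln_le_iff_le_exp: "0 < x \<Longrightarrow> ln x \<le> c \<longleftrightarrow> x \<le> exp c" for x :: real
  by (metis exp_le_cancel_iff exp_ln)

text \<open>Removes the dependence on \<open>ln 0\<close>; the right-hand side is visibly
  continuous, also at 0.\<close>

lemma log_plus_eq:
  assumes "0 \<le> x"
  shows "log_plus x = ln (max 1 x)"
proof (cases "x = 0")
  case False
  then show ?thesis
    using assms by (cases "x \<le> 1") (simp_all add: log_plus_def max_def)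
qed (simp add: log_plus_def)

lemma log_plus_nonneg [simp]: "0 \<le> log_plus x"
  by (simp add: log_plus_def)

lemma le_exp_log_plus: "0 \<le> x \<Longrightarrow> x \<le> exp (log_plus x)"
  by (simp add: log_plus_eq)

lemma log_plus_le_iff: "0 \<le> x \<Longrightarrow> log_plus x \<le> c \<longleftrightarrow> 0 \<le> c \<and> x \<le> exp c"
proof -
  assume "0 \<le> x"
  then have "log_plus x \<le> c \<longleftrightarrow> max 1 x \<le> exp c"
    by (simp add: log_plus_eq ln_le_iff_le_exp less_max_iff_disj)
  then show ?thesis by simp
qed

lemma continuous_on_log_plus:
  fixes f :: "'a::topological_space \<Rightarrow> real"
  assumes "continuous_on S f" "\<And>x. x \<in> S \<Longrightarrow> 0 \<le> f x"
  shows "continuous_on S (\<lambda>x. log_plus (f x))"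
proof -
  have "continuous_on S (\<lambda>x. ln (max 1 (f x)))"
    by (intro continuous_intros assms) (auto simp: max_def)
  then show ?thesis
    by (rule continuous_on_eq) (simp add: log_plus_eq assms)
qed

lemma continuous_on_log_plus_norm:
  fixes f :: "'a::topological_space \<Rightarrow> 'b::real_normed_vector"
  shows "continuous_on S f \<Longrightarrow> continuous_on S (\<lambda>x. log_plus (norm (f x)))"
  by (intro continuous_on_log_plus continuous_intros) auto

lemma cmod_of_real_mult_less_1:
  assumes "0 \<le> r" "r \<le> 1" "cmod z < 1"
  shows "cmod (of_real r * z) < 1"
  using mult_left_le_one_le[of "cmod z" r] assms by (simp add: norm_mult)

text \<open>Maximum modulus for \<open>g z * exp (- p z)\<close>; in this form the zeros of
  \<open>g\<close> do no harm.\<close>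

lemma maximum_principle_Re:
  assumes g: "continuous_on (cball 0 1) g" "g holomorphic_on ball 0 1"
    and p: "continuous_on (cball 0 1) p" "p holomorphic_on ball 0 1"
    and le: "\<And>\<zeta>. \<zeta> \<in> sphere 0 1 \<Longrightarrow> cmod (g \<zeta>) \<le> exp (Re (p \<zeta>))"
    and z: "cmod z \<le> 1"
  shows "cmod (g z) \<le> exp (Re (p z))"
proof -
  have "cmod (g z * exp (- p z)) \<le> 1"
  proof (rule maximum_modulus_frontier[of "\<lambda>z. g z * exp (- p z)" "cball 0 1"])
    show "(\<lambda>z. g z * exp (- p z)) holomorphic_on interior (cball 0 1)"
      using g p by (auto intro!: holomorphic_intros)
    show "continuous_on (closure (cball 0 1)) (\<lambda>z. g z * exp (- p z))"
      using g p by (auto intro!: continuous_intros)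
    fix \<zeta> :: complex assume "\<zeta> \<in> frontier (cball 0 1)"
    then have "cmod (g \<zeta>) \<le> exp (Re (p \<zeta>))"
      by (intro le) (simp add: frontier_cball)
    then show "cmod (g \<zeta> * exp (- p \<zeta>)) \<le> 1"
      by (simp add: norm_mult norm_divide norm_exp_eq_Re exp_minus field_simps)
  qed (use z in auto)
  then show ?thesis
    by (simp add: norm_mult norm_divide norm_exp_eq_Re exp_minus field_simps)
qed

text \<open>For a majorant \<open>Re (poly p)\<close> of \<open>\<psi>\<close> the maximum principle
  applies and the Poisson formula is exact; then let the gap to \<open>\<psi>\<close>
  shrink.\<close>

lemma cmod_le_exp_poisson:
  assumes g: "continuous_on (cball 0 1) g" "g holomorphic_on ball 0 1"
    and \<psi>: "continuous_on (sphere 0 1) \<psi>"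
    and le: "\<And>\<zeta>. \<zeta> \<in> sphere 0 1 \<Longrightarrow> cmod (g \<zeta>) \<le> exp (\<psi> \<zeta>)"
    and z: "cmod z < 1"
  shows "cmod (g z) \<le> exp (LINT \<zeta>|circle_measure. poisson_kernel z \<zeta> * \<psi> \<zeta>)"
proof (cases "g z = 0")
  case False
  let ?I = "LINT \<zeta>|circle_measure. poisson_kernel z \<zeta> * \<psi> \<zeta>"
  note K = circle_continuous_integrable[OF circle_borel_circle_measure]
  have "ln (cmod (g z)) \<le> ?I + e" if e: "e > 0" for e
  proof -
    obtain p where p: "\<And>\<zeta>. \<zeta> \<in> sphere 0 1 \<Longrightarrow> \<psi> \<zeta> < Re (poly p \<zeta>) \<and> Re (poly p \<zeta>) < \<psi> \<zeta> + e"
      using Re_poly_majorant[OF \<psi> e] by blast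
    have "cmod (g z) \<le> exp (Re (poly p z))"
    proof (rule maximum_principle_Re[OF g])
      fix \<zeta> :: complex assume "\<zeta> \<in> sphere 0 1"
      then show "cmod (g \<zeta>) \<le> exp (Re (poly p \<zeta>))"
        using le[of \<zeta>] p[of \<zeta>] by (meson exp_le_cancel_iff less_imp_le order_trans)
    qed (use z in \<open>auto intro!: continuous_intros holomorphic_intros\<close>)
    then have "ln (cmod (g z)) \<le> Re (poly p z)"
      using False by (simp add: ln_le_iff_le_exp)
    also have "\<dots> = (LINT \<zeta>|circle_measure. poisson_kernel z \<zeta> * Re (poly p \<zeta>))"
      by (rule poisson_formula[symmetric]) (auto intro!: continuous_intros holomorphic_intros z)
    also have "\<dots> \<le> (LINT \<zeta>|circle_measure. poisson_kernel z \<zeta> * \<psi> \<zeta> + e * poisson_kernel z \<zeta>)"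
    proof (rule integral_mono)
      fix \<zeta> assume "\<zeta> \<in> space circle_measure"
      then have "poisson_kernel z \<zeta> * Re (poly p \<zeta>) \<le> poisson_kernel z \<zeta> * (\<psi> \<zeta> + e)"
        using p[of \<zeta>] z by (intro mult_left_mono) (auto intro!: less_imp_le poisson_kernel_pos)
      then show "poisson_kernel z \<zeta> * Re (poly p \<zeta>) \<le> poisson_kernel z \<zeta> * \<psi> \<zeta> + e * poisson_kernel z \<zeta>"
        by (simp add: algebra_simps)
    qed (auto intro!: K continuous_intros continuous_poisson_kernel z \<psi>)
    also have "\<dots> = ?I + e"
      using z by (subst Bochner_Integration.integral_add)
        (auto intro!: K continuous_intros continuous_poisson_kernel \<psi> simp: poisson_kernel_integral)
    finally show ?thesis .
  qed
  then have "ln (cmod (g z)) \<le> ?I"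
    by (rule field_le_epsilon)
  then show ?thesis
    using False by (simp add: ln_le_iff_le_exp)
qed simp

lemma cmod_le_exp_mean:
  assumes g: "continuous_on (cball 0 1) g" "g holomorphic_on ball 0 1"
    and \<psi>: "continuous_on (sphere 0 1) \<psi>"
    and le: "\<And>\<zeta>. \<zeta> \<in> sphere 0 1 \<Longrightarrow> cmod (g \<zeta>) \<le> exp (\<psi> \<zeta>)"
  shows "cmod (g 0) \<le> exp (LINT \<zeta>|circle_measure. \<psi> \<zeta>)"
proof -
  have "cmod (g 0) \<le> exp (LINT \<zeta>|circle_measure. poisson_kernel 0 \<zeta> * \<psi> \<zeta>)"
    by (rule cmod_le_exp_poisson[OF assms]) auto
  also have "(LINT \<zeta>|circle_measure. poisson_kernel 0 \<zeta> * \<psi> \<zeta>) = (LINT \<zeta>|circle_measure. \<psi> \<zeta>)"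
    by (intro Bochner_Integration.integral_cong) (auto simp: poisson_kernel_def herglotz_kernel_def)
  finally show ?thesis .
qed

lemma log_plus_le_poisson:
  assumes g: "continuous_on (cball 0 1) g" "g holomorphic_on ball 0 1" and z: "cmod z < 1"
  shows "log_plus (cmod (g z)) \<le> (LINT \<zeta>|circle_measure. poisson_kernel z \<zeta> * log_plus (cmod (g \<zeta>)))"
proof -
  have c: "continuous_on (sphere 0 1) (\<lambda>\<zeta>. log_plus (cmod (g \<zeta>)))"
    by (intro continuous_on_log_plus_norm continuous_on_subset[OF g(1)]) auto
  have "cmod (g z) \<le> exp (LINT \<zeta>|circle_measure. poisson_kernel z \<zeta> * log_plus (cmod (g \<zeta>)))"
    by (rule cmod_le_exp_poisson[OF g c _ z]) (simp add: le_exp_log_plus)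
  moreover have "0 \<le> (LINT \<zeta>|circle_measure. poisson_kernel z \<zeta> * log_plus (cmod (g \<zeta>)))"
    using z by (intro integral_nonneg_AE AE_I2 mult_nonneg_nonneg) (auto intro!: less_imp_le poisson_kernel_pos)
  ultimately show ?thesis
    by (simp add: log_plus_le_iff)
qed

lemma poisson_circle_measure: "cmod z < 1 \<Longrightarrow> poisson circle_measure z = 1"
  by (simp add: poisson_def poisson_kernel_integral)

text \<open>Inside the disc \<open>log_plus |g|\<close> lies below the Poisson integral of its
  boundary values, that is, of the measure \<open>D\<close>; the mean of that integral over every
  circle is the mass of \<open>D\<close>.\<close>

lemma log_plus_mean_le:
  assumes g: "continuous_on (cball 0 1) g" "g holomorphic_on ball 0 1" and s: "0 \<le> s" "s < 1"
  shows "(LINT \<zeta>|circle_measure. log_plus (cmod (g (of_real s * \<zeta>)))) \<le> (LINT \<zeta>|circle_measure. log_plus (cmod (g \<zeta>)))"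
proof -
  have c: "continuous_on (sphere 0 1) (\<lambda>\<zeta>. log_plus (cmod (g \<zeta>)))"
    by (intro continuous_on_log_plus_norm continuous_on_subset[OF g(1)]) auto
  note K = circle_continuous_integrable[OF circle_borel_circle_measure]
  define D where "D = density circle_measure (\<lambda>\<zeta>. ennreal (log_plus (cmod (g \<zeta>))))"
  note [measurable] = circle_continuous_measurable[OF circle_borel_circle_measure c]
  have D: "circle_borel_measure D"
  proof -
    have "emeasure D (sphere 0 1) = (\<integral>\<^sup>+\<zeta>. ennreal (log_plus (cmod (g \<zeta>))) * indicator (sphere 0 1) \<zeta> \<partial>circle_measure)"
      unfolding D_def by (rule emeasure_density) (use sets.top[of circle_measure] in auto)
    also have "\<dots> = (\<integral>\<^sup>+\<zeta>. ennreal (log_plus (cmod (g \<zeta>))) \<partial>circle_measure)"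
      by (intro nn_integral_cong) auto
    also have "\<dots> = ennreal (LINT \<zeta>|circle_measure. log_plus (cmod (g \<zeta>)))"
      by (rule nn_integral_eq_integral[OF K[OF c]]) simp
    finally have "emeasure D (space D) \<noteq> \<infinity>"
      by (simp add: D_def)
    then show ?thesis
      unfolding circle_borel_measure_def by (auto simp: D_def intro!: finite_measureI)
  qed
  have P: "poisson D z = (LINT \<zeta>|circle_measure. poisson_kernel z \<zeta> * log_plus (cmod (g \<zeta>)))" if "cmod z < 1" for z
    unfolding poisson_def D_def
    by (subst integral_density) (auto simp: mult.commute intro!: circle_continuous_measurable[OF circle_borel_circle_measure]
        continuous_poisson_kernel that)
  have "(LINT \<zeta>|circle_measure. log_plus (cmod (g (of_real s * \<zeta>)))) \<le> (LINT \<zeta>|circle_measure. poisson D (of_real s * \<zeta>))"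
  proof (rule integral_mono)
    show "integrable circle_measure (\<lambda>\<zeta>. log_plus (cmod (g (of_real s * \<zeta>))))"
      using s by (intro K continuous_on_log_plus_norm continuous_on_compose2[OF g(1)] continuous_intros)
        (auto simp: norm_mult)
    show "integrable circle_measure (\<lambda>\<zeta>. poisson D (of_real s * \<zeta>))"
      by (intro K continuous_on_poisson_circle D s)
    fix \<zeta> assume "\<zeta> \<in> space circle_measure"
    then have "cmod (of_real s * \<zeta>) < 1"
      using s by (simp add: norm_mult)
    then show "log_plus (cmod (g (of_real s * \<zeta>))) \<le> poisson D (of_real s * \<zeta>)"
      using log_plus_le_poisson[OF g] by (simp add: P)
  qed
  also have "\<dots> = measure D (sphere 0 1)"
    by (rule poisson_mean[OF D s])
  also have "\<dots> = (LINT \<zeta>|D. 1)"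
    by (simp add: circle_borelD(3)[OF D])
  also have "\<dots> = (LINT \<zeta>|circle_measure. log_plus (cmod (g \<zeta>)))"
    unfolding D_def by (subst integral_density) auto
  finally show ?thesis .
qed

section \<open>Blaschke products\<close>

definition blaschke_factor :: "complex \<Rightarrow> complex \<Rightarrow> complex" where
  "blaschke_factor a z = of_real (cmod a) / a * ((a - z) / (1 - cnj a * z))"

lemma blaschke_denominator_nonzero:
  assumes "cmod a < 1" "cmod z \<le> 1"
  shows "1 - cnj a * z \<noteq> 0"
proof -
  have "cmod (cnj a * z) < 1"
    using assms mult_mono[of "cmod a" "cmod a" "cmod z" 1] by (simp add: norm_mult)
  then show ?thesis by auto
qed

lemma blaschke_denominator_ne_1: "cmod a < 1 \<Longrightarrow> cmod z \<le> 1 \<Longrightarrow> cnj a * z \<noteq> 1"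
  using blaschke_denominator_nonzero[of a z] by auto

lemma continuous_on_blaschke_factor:
  "0 < cmod a \<Longrightarrow> cmod a < 1 \<Longrightarrow> continuous_on (cball 0 1) (blaschke_factor a)"
  unfolding blaschke_factor_def
  by (intro continuous_intros) (auto simp: blaschke_denominator_ne_1)

lemma holomorphic_on_blaschke_factor:
  "0 < cmod a \<Longrightarrow> cmod a < 1 \<Longrightarrow> blaschke_factor a holomorphic_on ball 0 1"
  unfolding blaschke_factor_def
  by (intro holomorphic_intros) (auto simp: blaschke_denominator_ne_1)

lemma cmod_blaschke_factor_circle:
  assumes "0 < cmod a" "cmod a < 1" "cmod \<zeta> = 1"
  shows "cmod (blaschke_factor a \<zeta>) = 1"
proof -
  have "1 - cnj a * \<zeta> = \<zeta> * cnj (\<zeta> - a)"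
    using complex_norm_square[of \<zeta>] assms by (simp add: algebra_simps)
  then have "cmod (1 - cnj a * \<zeta>) = cmod (a - \<zeta>)"
    using assms by (simp only: norm_mult complex_mod_cnj mult_1 norm_minus_commute)
  moreover have "a \<noteq> \<zeta>" using assms by auto
  ultimately show ?thesis
    using assms by (simp add: blaschke_factor_def norm_mult norm_divide)
qed

lemma cmod_blaschke_factor_le:
  assumes "0 < cmod a" "cmod a < 1" "cmod z \<le> 1"
  shows "cmod (blaschke_factor a z) \<le> 1"
  using maximum_principle_Re[of "blaschke_factor a" "\<lambda>_. 0" z] assms
  by (auto simp: continuous_on_blaschke_factor holomorphic_on_blaschke_factor cmod_blaschke_factor_circle)

lemma blaschke_factor_0: "cmod (blaschke_factor a 0) = (if a = 0 then 0 else cmod a)"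
  by (simp add: blaschke_factor_def norm_mult norm_divide)

lemma blaschke_factor_eq_0_iff:
  assumes "0 < cmod a" "cmod a < 1" "cmod z \<le> 1"
  shows "blaschke_factor a z = 0 \<longleftrightarrow> z = a"
  using assms blaschke_denominator_nonzero[of a z] by (auto simp: blaschke_factor_def)

text \<open>There is an exact identity: 1 minus the factor equals
  \<open>(1 - |a|) (a + |a| z) / (a (1 - cnj a z))\<close>. The leading term \<open>1 - |a|\<close>
  makes the product converge under the Blaschke condition.\<close>

lemma blaschke_factor_minus_1:
  assumes "0 < cmod a" "cmod a < 1" "cmod z < 1"
  shows "cmod (blaschke_factor a z - 1) \<le> 2 / (1 - cmod z) * (1 - cmod a)"
proof -
  have nz: "a \<noteq> 0" "1 - cnj a * z \<noteq> 0"
    using assms blaschke_denominator_nonzero[of a z] by auto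
  have "a * cnj a = of_real (cmod a) * of_real (cmod a)"
    by (metis complex_norm_square of_real_mult power2_eq_square)
  then have "a * (1 - cnj a * z) - of_real (cmod a) * (a - z) = of_real (1 - cmod a) * (a + of_real (cmod a) * z)"
    by (simp add: algebra_simps)
  then have "1 - blaschke_factor a z = of_real (1 - cmod a) * (a + of_real (cmod a) * z) / (a * (1 - cnj a * z))"
    using nz by (simp add: blaschke_factor_def field_simps)
  then have "cmod (1 - blaschke_factor a z) = (1 - cmod a) * cmod (a + of_real (cmod a) * z) / (cmod a * cmod (1 - cnj a * z))"
    using assms by (simp only: norm_mult norm_divide norm_of_real)
  also have "\<dots> \<le> (1 - cmod a) * (2 * cmod a) / (cmod a * (1 - cmod z))"
  proof (intro frac_le mult_mono)
    have "cmod (a + of_real (cmod a) * z) \<le> cmod a + cmod a * cmod z"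
      by (rule order_trans[OF norm_triangle_ineq]) (simp add: norm_mult)
    also have "\<dots> \<le> 2 * cmod a"
      using assms mult_left_mono[of "cmod z" 1 "cmod a"] by simp
    finally show "cmod (a + of_real (cmod a) * z) \<le> 2 * cmod a" .
    have "cmod (cnj a * z) \<le> cmod z"
      using assms mult_right_mono[of "cmod a" 1 "cmod z"] by (simp add: norm_mult)
    then show "1 - cmod z \<le> cmod (1 - cnj a * z)"
      using norm_triangle_ineq2[of 1 "cnj a * z"] by simp
  qed (use assms in auto)
  also have "\<dots> = 2 / (1 - cmod z) * (1 - cmod a)"
    using assms by (simp add: field_simps)
  finally show ?thesis by (simp add: norm_minus_commute)
qed

text \<open>\<open>K\<close> collects the indices that carry a factor, matching the encoding of
  \<^const>\<open>blaschke_product\<close>.\<close>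

locale blaschke_zeros =
  fixes K :: "nat set" and a :: "nat \<Rightarrow> complex"
  assumes zeros: "\<And>k. k \<in> K \<Longrightarrow> 0 < cmod (a k) \<and> cmod (a k) < 1"
    and summable_zeros: "summable (\<lambda>k. if k \<in> K then 1 - cmod (a k) else 0)"
begin

definition factor :: "nat \<Rightarrow> complex \<Rightarrow> complex" where
  "factor k z = (if k \<in> K then blaschke_factor (a k) z else 1)"

lemma continuous_on_factor: "continuous_on (cball 0 1) (factor k)"
  using continuous_on_blaschke_factor[of "a k"] zeros[of k]
  by (cases "k \<in> K") (auto simp: factor_def[abs_def])

lemma holomorphic_on_factor: "factor k holomorphic_on ball 0 1"
  using holomorphic_on_blaschke_factor[of "a k"] zeros[of k]
  by (cases "k \<in> K") (auto simp: factor_def[abs_def])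

lemma cmod_factor_circle: "cmod \<zeta> = 1 \<Longrightarrow> cmod (factor k \<zeta>) = 1"
  using zeros[of k] by (auto simp: factor_def cmod_blaschke_factor_circle)

lemma cmod_factor_le: "cmod z \<le> 1 \<Longrightarrow> cmod (factor k z) \<le> 1"
  using zeros[of k] by (auto simp: factor_def cmod_blaschke_factor_le)

lemma factor_eq_0_iff: "cmod z \<le> 1 \<Longrightarrow> factor k z = 0 \<longleftrightarrow> k \<in> K \<and> z = a k"
  using zeros[of k] by (auto simp: factor_def blaschke_factor_eq_0_iff)

lemma convergent_factors:
  assumes z: "cmod z < 1"
  shows "convergent_prod (\<lambda>k. factor k z)"
proof -
  have "summable (\<lambda>k. norm (factor k z - 1))"
  proof (rule summable_comparison_test)
    show "summable (\<lambda>k. 2 / (1 - cmod z) * (if k \<in> K then 1 - cmod (a k) else 0))"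
      by (rule summable_mult[OF summable_zeros])
    show "\<exists>N. \<forall>k\<ge>N. norm (norm (factor k z - 1)) \<le> 2 / (1 - cmod z) * (if k \<in> K then 1 - cmod (a k) else 0)"
      using blaschke_factor_minus_1[OF _ _ z] zeros by (auto simp: factor_def)
  qed
  then show ?thesis
    by (intro abs_convergent_prod_imp_convergent_prod) (simp add: abs_convergent_prod_conv_summable)
qed

lemma factors_LIMSEQ:
  assumes z: "cmod z < 1"
  shows "(\<lambda>n. \<Prod>k<n. factor k z) \<longlonglongrightarrow> (\<Prod>k. factor k z)"
proof -
  have "(\<lambda>n. \<Prod>k<Suc n. factor k z) \<longlonglongrightarrow> (\<Prod>k. factor k z)"
    using convergent_prod_LIMSEQ[OF convergent_factors[OF z]] by (simp only: lessThan_Suc_atMost)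
  then show ?thesis
    by (rule LIMSEQ_imp_Suc)
qed

lemma cmod_prodinf_factor_le:
  assumes z: "cmod z < 1"
  shows "cmod (\<Prod>k. factor k z) \<le> 1"
proof (rule LIMSEQ_le_const2[OF tendsto_norm[OF factors_LIMSEQ[OF z]]])
  show "\<exists>N. \<forall>n\<ge>N. cmod (\<Prod>k<n. factor k z) \<le> 1"
    using z by (auto simp: prod_norm[symmetric] intro!: prod_le_1 cmod_factor_le)
qed

lemma ln_factors_sums:
  assumes z: "cmod z < 1" and nz: "\<And>k. k \<in> K \<Longrightarrow> z \<noteq> a k"
  shows "(\<Prod>k. factor k z) \<noteq> 0" "(\<lambda>k. ln (cmod (factor k z))) sums ln (cmod (\<Prod>k. factor k z))"
proof -
  have nz': "factor k z \<noteq> 0" for k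
    using z nz by (simp add: factor_eq_0_iff)
  show *: "(\<Prod>k. factor k z) \<noteq> 0"
    by (rule prodinf_nonzero[OF convergent_factors[OF z] nz'])
  have "(\<lambda>n. ln (cmod (\<Prod>k<n. factor k z))) \<longlonglongrightarrow> ln (cmod (\<Prod>k. factor k z))"
    using * by (intro tendsto_intros factors_LIMSEQ[OF z]) auto
  also have "(\<lambda>n. ln (cmod (\<Prod>k<n. factor k z))) = (\<lambda>n. \<Sum>k<n. ln (cmod (factor k z)))"
    using nz' by (simp add: prod_norm[symmetric] ln_prod fun_eq_iff)
  finally show "(\<lambda>k. ln (cmod (factor k z))) sums ln (cmod (\<Prod>k. factor k z))"
    by (simp add: sums_def)
qed

text \<open>Eventually \<open>|a k| > 1 / 2\<close>, where \<open>- ln x \<le> 2 * (1 - x)\<close>.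
  The sequence dominates the means of the single factors in
  \<open>blaschke_product_means\<close>.\<close>

lemma summable_ln_zeros: "summable (\<lambda>k. if k \<in> K then - ln (cmod (a k)) else 0)"
proof (rule summable_comparison_test_ev)
  show "summable (\<lambda>k. 2 * (if k \<in> K then 1 - cmod (a k) else 0))"
    by (rule summable_mult[OF summable_zeros])
  have "\<forall>\<^sub>F k in sequentially. (if k \<in> K then 1 - cmod (a k) else 0) < 1 / 2"
    by (rule order_tendstoD(2)[OF summable_LIMSEQ_zero[OF summable_zeros]]) simp
  then show "\<forall>\<^sub>F k in sequentially. norm (if k \<in> K then - ln (cmod (a k)) else 0)
      \<le> 2 * (if k \<in> K then 1 - cmod (a k) else 0)"
  proof eventually_elim
    case (elim k)
    show ?case
    proof (cases "k \<in> K")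
      case True
      let ?x = "cmod (a k)"
      have x: "1 / 2 < ?x" "0 < ?x" "?x < 1"
        using elim zeros[OF True] True by auto
      have "- ln ?x = ln (1 / ?x)"
        using x by (simp add: ln_div)
      also have "\<dots> \<le> 1 / ?x - 1"
        using x by (intro ln_le_minus_one) simp
      also have "\<dots> = (1 - ?x) / ?x"
        using x by (simp add: field_simps)
      also have "\<dots> \<le> (1 - ?x) / (1 / 2)"
        using x by (intro divide_left_mono) auto
      finally show ?thesis
        using True x by simp
    qed simp
  qed
qed

end

lemma unimodular_boundary_limit:
  assumes b: "continuous_on (cball 0 1) b" "\<And>\<zeta>. cmod \<zeta> = 1 \<Longrightarrow> cmod (b \<zeta>) = 1" and e: "e > 0"
  shows "\<exists>r<1. \<forall>s\<ge>r. \<forall>\<zeta>. s \<le> 1 \<longrightarrow> cmod \<zeta> = 1 \<longrightarrow> 1 - e < cmod (b (of_real s * \<zeta>))"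
proof -
  have "uniformly_continuous_on (cball 0 1) b"
    by (rule compact_uniformly_continuous[OF b(1)]) simp
  then obtain d where d: "0 < d" "\<And>x y. x \<in> cball 0 1 \<Longrightarrow> y \<in> cball 0 1 \<Longrightarrow> dist y x < d \<Longrightarrow> dist (b y) (b x) < e"
    using e unfolding uniformly_continuous_on_def by metis
  show ?thesis
  proof (intro exI[of _ "max 0 (1 - d / 2)"] conjI allI impI)
    fix s :: real and \<zeta> :: complex assume s: "max 0 (1 - d / 2) \<le> s" "s \<le> 1" and \<zeta>: "cmod \<zeta> = 1"
    have "dist (of_real s * \<zeta>) \<zeta> = cmod (of_real (s - 1) * \<zeta>)"
      by (simp add: dist_norm algebra_simps)
    also have "\<dots> = 1 - s"
      using s \<zeta> by (simp only: norm_mult norm_of_real) simp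
    finally have "dist (of_real s * \<zeta>) \<zeta> < d"
      using s d by linarith
    then have "dist (b (of_real s * \<zeta>)) (b \<zeta>) < e"
      using s \<zeta> by (intro d) (auto simp: norm_mult)
    then show "1 - e < cmod (b (of_real s * \<zeta>))"
      using norm_triangle_ineq3[of "b (of_real s * \<zeta>)" "b \<zeta>"] b(2)[OF \<zeta>] by (simp add: dist_norm)
  qed (use d in auto)
qed

lemma blaschke_productD:
  assumes "blaschke_product B"
  obtains m K a where "blaschke_zeros K a"
    "\<And>z. cmod z < 1 \<Longrightarrow> B z = z ^ m * (\<Prod>k. blaschke_zeros.factor K a k z)"
proof -
  obtain m :: nat and K :: "nat set" and a :: "nat \<Rightarrow> complex" where
    a: "\<forall>k\<in>K. 0 < cmod (a k) \<and> cmod (a k) < 1"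
    and s: "(\<lambda>k. 1 - cmod (a k)) summable_on K"
    and B: "\<forall>z\<in>ball 0 1. B z = z ^ m *
             (\<Prod>k. if k \<in> K then of_real (cmod (a k)) / a k * ((a k - z) / (1 - cnj (a k) * z)) else 1)"
    using assms unfolding blaschke_product_def by blast
  have "(\<lambda>k. if k \<in> K then 1 - cmod (a k) else 0) summable_on UNIV"
    using s by (subst summable_on_cong_neutral[of K UNIV "\<lambda>k. 1 - cmod (a k)"]) auto
  then interpret blaschke_zeros K a
    using a by unfold_locales (auto simp: summable_on_UNIV_nonneg_real_iff less_imp_le)
  show thesis
    by (rule that[OF blaschke_zeros_axioms, of m])
      (use B in \<open>simp add: factor_def[abs_def] blaschke_factor_def cong: if_cong\<close>)
qed

lemma blaschke_product_le_1:
  assumes "blaschke_product B" "cmod z < 1"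
  shows "cmod (B z) \<le> 1"
proof -
  obtain m K a where "blaschke_zeros K a"
    and B: "\<And>z. cmod z < 1 \<Longrightarrow> B z = z ^ m * (\<Prod>k. blaschke_zeros.factor K a k z)"
    by (rule blaschke_productD[OF assms(1)]) blast
  interpret blaschke_zeros K a by fact
  show ?thesis
    using B[OF assms(2)] cmod_prodinf_factor_le[OF assms(2)] assms(2)
    by (simp add: norm_mult norm_power mult_le_one power_le_one)
qed

text \<open>By Jensen's inequality the mean of \<open>- ln\<close> of the modulus of the
  \<open>k\<close>-th factor is at most \<open>- ln |a k|\<close>, a summable bound; for fixed
  \<open>k\<close> it tends to 0, because the factor is unimodular on the unit circle. Tannery's
  theorem sums these limits. The radii avoid the countably many moduli \<open>|a k|\<close>, so
  \<open>B\<close> has no zero on the circles.\<close>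

lemma blaschke_product_means:
  assumes "blaschke_product B"
  obtains r :: "nat \<Rightarrow> real" where "\<And>n. 0 < r n" "\<And>n. r n < 1" "r \<longlonglongrightarrow> 1"
    "\<And>n \<zeta>. cmod \<zeta> = 1 \<Longrightarrow> B (of_real (r n) * \<zeta>) \<noteq> 0"
    "\<And>n. integrable circle_measure (\<lambda>\<zeta>. ln (cmod (B (of_real (r n) * \<zeta>))))"
    "(\<lambda>n. LINT \<zeta>|circle_measure. \<bar>ln (cmod (B (of_real (r n) * \<zeta>)))\<bar>) \<longlonglongrightarrow> 0"
proof -
  obtain m K a where "blaschke_zeros K a"
    and B: "\<And>z. cmod z < 1 \<Longrightarrow> B z = z ^ m * (\<Prod>k. blaschke_zeros.factor K a k z)"
    by (rule blaschke_productD[OF assms(1)]) blast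
  interpret blaschke_zeros K a by fact
  note I = circle_continuous_integrable[OF circle_borel_circle_measure]
  have "\<exists>r. 1 - 1 / real (n + 2) < r \<and> r < 1 \<and> (\<forall>k\<in>K. r \<noteq> cmod (a k))" for n
  proof -
    have "uncountable {1 - 1 / real (n + 2)<..<1}"
      by (rule uncountable_open_interval[THEN iffD2]) simp
    moreover have "countable ((\<lambda>k. cmod (a k)) ` K)" by simp
    ultimately have "\<not> {1 - 1 / real (n + 2)<..<1} \<subseteq> (\<lambda>k. cmod (a k)) ` K"
      using countable_subset by blast
    then show ?thesis by fastforce
  qed
  then obtain r where r: "\<And>n. 1 - 1 / real (n + 2) < r n" "\<And>n. r n < 1" "\<And>n k. k \<in> K \<Longrightarrow> r n \<noteq> cmod (a k)"
    by metis
  have r0: "0 < r n" for n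
  proof -
    have "1 / real (n + 2) \<le> 1" by simp
    then show ?thesis using r(1)[of n] by linarith
  qed
  have rlim: "r \<longlonglongrightarrow> 1"
  proof (rule tendsto_sandwich[of "\<lambda>n. 1 - 1 / real (n + 2)" _ _ "\<lambda>_. 1", OF always_eventually always_eventually])
    show "(\<lambda>n. 1 - 1 / real (n + 2)) \<longlonglongrightarrow> 1"
      by real_asymp
  qed (use r in \<open>auto intro: less_imp_le\<close>)
  have nrm: "cmod (of_real (r n) * \<zeta>) = r n" if "cmod \<zeta> = 1" for n \<zeta>
    using that r0[of n] by (simp add: norm_mult)
  have nz: "of_real (r n) * \<zeta> \<noteq> a k" if "cmod \<zeta> = 1" "k \<in> K" for n k \<zeta>
    using nrm[OF that(1), of n] r(3)[OF that(2), of n] by metis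
  define l where "l n k \<zeta> = - ln (cmod (factor k (of_real (r n) * \<zeta>)))" for n k \<zeta>
  have fnz: "factor k (of_real (r n) * \<zeta>) \<noteq> 0" if "cmod \<zeta> = 1" for n k \<zeta>
    using nz[OF that] nrm[OF that, of n] r(2)[of n] by (auto simp: factor_eq_0_iff)
  have cl: "continuous_on (sphere 0 1) (l n k)" for n k
    unfolding l_def
    by (intro continuous_intros continuous_on_compose2[OF continuous_on_factor])
      (auto simp: fnz nrm less_imp_le[OF r(2)])
  have l0: "0 \<le> l n k \<zeta>" if "cmod \<zeta> = 1" for n k \<zeta>
    using cmod_factor_le[of "of_real (r n) * \<zeta>" k] nrm[OF that, of n] r(2)[of n] fnz[OF that]
    by (simp add: l_def ln_le_zero_iff)
  define F where "F k n = (LINT \<zeta>|circle_measure. l n k \<zeta>)" for k n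
  define c where "c k = (if k \<in> K then - ln (cmod (a k)) else 0)" for k
  have F0: "0 \<le> F k n" for k n
    unfolding F_def by (intro integral_nonneg_AE AE_I2) (auto intro!: l0)
  \<comment> \<open>The value at the centre is controlled by the mean over the circle:
    \<open>cmod_le_exp_mean\<close> with exponent \<open>- l n k\<close>.\<close>
  have Fc: "F k n \<le> c k" for k n
  proof (cases "k \<in> K")
    case True
    have "cmod (factor k (of_real (r n) * 0)) \<le> exp (LINT \<zeta>|circle_measure. - l n k \<zeta>)"
    proof (rule cmod_le_exp_mean)
      show "continuous_on (cball 0 1) (\<lambda>z. factor k (of_real (r n) * z))"
        using r0[of n] less_imp_le[OF r(2)[of n]]
        by (intro continuous_on_compose2[OF continuous_on_factor] continuous_intros)
          (auto simp: norm_mult intro!: mult_le_one)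
      show "(\<lambda>z. factor k (of_real (r n) * z)) holomorphic_on ball 0 1"
        by (intro holomorphic_on_compose_gen[OF _ holomorphic_on_factor, unfolded o_def] holomorphic_intros)
          (use cmod_of_real_mult_less_1[of "r n"] r0[of n] r(2)[of n] in auto)
      show "continuous_on (sphere 0 1) (\<lambda>\<zeta>. - l n k \<zeta>)"
        by (intro continuous_intros cl)
      fix \<zeta> :: complex assume "\<zeta> \<in> sphere 0 1"
      then show "cmod (factor k (of_real (r n) * \<zeta>)) \<le> exp (- l n k \<zeta>)"
        by (simp add: l_def fnz)
    qed
    then have "cmod (a k) \<le> exp (- F k n)"
      using True zeros[OF True] by (auto simp: factor_def blaschke_factor_0 F_def split: if_splits)
    then have "ln (cmod (a k)) \<le> - F k n"
      using zeros[OF True] by (simp add: ln_le_iff_le_exp)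
    then show ?thesis using True by (simp add: c_def)
  qed (simp add: F_def l_def c_def factor_def)
  have Flim: "(\<lambda>n. F k n) \<longlonglongrightarrow> 0" for k
  proof (rule LIMSEQ_I)
    fix e :: real assume e: "e > 0"
    obtain s where s: "s < 1" "\<And>t \<zeta>. s \<le> t \<Longrightarrow> t \<le> 1 \<Longrightarrow> cmod \<zeta> = 1 \<Longrightarrow> 1 - (1 - exp (- (e / 2))) < cmod (factor k (of_real t * \<zeta>))"
      using unimodular_boundary_limit[OF continuous_on_factor cmod_factor_circle, of "1 - exp (- (e / 2))" k] e by auto
    obtain N where N: "\<And>n. n \<ge> N \<Longrightarrow> s < r n"
      using order_tendstoD(1)[OF rlim s(1)] by (auto simp: eventually_sequentially)
    have Fe: "F k n \<le> e / 2" if "n \<ge> N" for n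
    proof -
      have "F k n \<le> (LINT \<zeta>|circle_measure. e / 2)"
        unfolding F_def
      proof (rule integral_mono[OF I[OF cl]])
        fix \<zeta> assume "\<zeta> \<in> space circle_measure"
        then have \<zeta>: "cmod \<zeta> = 1" by simp
        have "exp (- (e / 2)) < cmod (factor k (of_real (r n) * \<zeta>))"
          using s(2)[of "r n" \<zeta>] N[OF that] r(2)[of n] \<zeta> by simp
        then show "l n k \<zeta> \<le> e / 2"
          using fnz[OF \<zeta>, of k n] unfolding l_def by (smt (verit) ln_exp ln_less_cancel_iff exp_gt_zero)
      qed simp
      then show ?thesis by (simp add: circle.prob_space)
    qed
    have "norm (F k n - 0) < e" if "n \<ge> N" for n
      using Fe[OF that] F0[of k n] e by simp
    then show "\<exists>N. \<forall>n\<ge>N. norm (F k n - 0) < e"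
      by blast
  qed
  have csum: "summable c"
    unfolding c_def by (rule summable_ln_zeros)
  have sF: "summable (\<lambda>k. F k n)" for n
    by (rule summable_comparison_test[OF _ csum]) (auto simp: F0 Fc)
  have Flim': "(\<lambda>n. \<Sum>k. F k n) \<longlonglongrightarrow> (\<Sum>k. 0)"
  proof -
    have "eventually (\<lambda>(k, n). norm (F k n) \<le> c k) (sequentially \<times>\<^sub>F sequentially)"
      by (intro always_eventually) (auto simp: F0 Fc)
    from tannerys_theorem[OF Flim this csum] show ?thesis by simp
  qed
  have lsums: "(\<lambda>k. l n k \<zeta>) sums (- ln (cmod (\<Prod>k. factor k (of_real (r n) * \<zeta>))))" if "cmod \<zeta> = 1" for n \<zeta>
    unfolding l_def using that nz nrm[OF that, of n] r(2)[of n] by (intro sums_minus ln_factors_sums) auto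
  have Pnz: "(\<Prod>k. factor k (of_real (r n) * \<zeta>)) \<noteq> 0" if "cmod \<zeta> = 1" for n \<zeta>
    using that nz nrm[OF that, of n] r(2)[of n] by (intro ln_factors_sums) auto
  have lnB: "\<bar>ln (cmod (B (of_real (r n) * \<zeta>)))\<bar> = - real m * ln (r n) + (\<Sum>k. l n k \<zeta>)"
    "ln (cmod (B (of_real (r n) * \<zeta>))) = real m * ln (r n) - (\<Sum>k. l n k \<zeta>)" if "cmod \<zeta> = 1" for n \<zeta>
  proof -
    have lt: "cmod (of_real (r n) * \<zeta>) < 1"
      using nrm[OF that, of n] r(2)[of n] by simp
    show *: "ln (cmod (B (of_real (r n) * \<zeta>))) = real m * ln (r n) - (\<Sum>k. l n k \<zeta>)"
      using Pnz[OF that, of n] r0[of n] sums_unique[OF lsums[OF that, of n]]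
      by (simp add: B[OF lt] norm_mult norm_power that ln_mult ln_realpow)
    have "0 \<le> (\<Sum>k. l n k \<zeta>)"
      by (intro suminf_nonneg sums_summable[OF lsums[OF that]] l0 that)
    moreover have "real m * ln (r n) \<le> 0"
      using r0[of n] r(2)[of n] by (intro mult_nonneg_nonpos) auto
    ultimately show "\<bar>ln (cmod (B (of_real (r n) * \<zeta>)))\<bar> = - real m * ln (r n) + (\<Sum>k. l n k \<zeta>)"
      unfolding * by simp
  qed
  have swap: "integrable circle_measure (\<lambda>\<zeta>. \<Sum>k. l n k \<zeta>)" "(LINT \<zeta>|circle_measure. (\<Sum>k. l n k \<zeta>)) = (\<Sum>k. F k n)" for n
  proof -
    have 1: "AE \<zeta> in circle_measure. summable (\<lambda>k. norm (l n k \<zeta>))"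
    proof (rule AE_I2)
      fix \<zeta> assume "\<zeta> \<in> space circle_measure"
      then have \<zeta>: "cmod \<zeta> = 1" by simp
      show "summable (\<lambda>k. norm (l n k \<zeta>))"
        using sums_summable[OF lsums[OF \<zeta>, of n]] l0[OF \<zeta>] by simp
    qed
    have "(LINT \<zeta>|circle_measure. norm (l n k \<zeta>)) = F k n" for k
      unfolding F_def by (intro Bochner_Integration.integral_cong) (auto simp: l0)
    then have 2: "summable (\<lambda>k. LINT \<zeta>|circle_measure. norm (l n k \<zeta>))"
      using sF by simp
    show "integrable circle_measure (\<lambda>\<zeta>. \<Sum>k. l n k \<zeta>)"
      by (rule integrable_suminf[OF I[OF cl] 1 2])
    show "(LINT \<zeta>|circle_measure. (\<Sum>k. l n k \<zeta>)) = (\<Sum>k. F k n)"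
      unfolding F_def by (rule integral_suminf[OF I[OF cl] 1 2])
  qed
  show thesis
  proof (rule that[OF r0 r(2) rlim])
    show "B (of_real (r n) * \<zeta>) \<noteq> 0" if "cmod \<zeta> = 1" for n \<zeta>
      using Pnz[OF that, of n] r0[of n] r(2)[of n] nrm[OF that, of n] that by (auto simp: B)
    show "integrable circle_measure (\<lambda>\<zeta>. ln (cmod (B (of_real (r n) * \<zeta>))))" for n
      by (subst Bochner_Integration.integrable_cong[OF refl lnB(2)]) (auto intro!: swap)
    have "(LINT \<zeta>|circle_measure. \<bar>ln (cmod (B (of_real (r n) * \<zeta>)))\<bar>) = - real m * ln (r n) + (\<Sum>k. F k n)" for n
    proof -
      have "(LINT \<zeta>|circle_measure. \<bar>ln (cmod (B (of_real (r n) * \<zeta>)))\<bar>) = (LINT \<zeta>|circle_measure. - real m * ln (r n) + (\<Sum>k. l n k \<zeta>))"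
        by (intro Bochner_Integration.integral_cong refl lnB(1)) simp
      also have "\<dots> = - real m * ln (r n) + (\<Sum>k. F k n)"
        by (subst Bochner_Integration.integral_add) (auto simp: swap circle.prob_space)
      finally show ?thesis .
    qed
    moreover have "(\<lambda>n. - real m * ln (r n) + (\<Sum>k. F k n)) \<longlonglongrightarrow> - real m * ln 1 + (\<Sum>k. 0)"
      by (intro tendsto_intros Flim' rlim) simp
    ultimately show "(\<lambda>n. LINT \<zeta>|circle_measure. \<bar>ln (cmod (B (of_real (r n) * \<zeta>)))\<bar>) \<longlonglongrightarrow> 0"
      by simp
  qed
qed

section \<open>Comparison of singular parts\<close>

lemma circle_borel_null_measure: "circle_borel_measure (null_measure circle_measure)"
  by (auto simp: circle_borel_measure_def intro!: finite_measureI)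

lemma circle_borel_density:
  assumes "integrable circle_measure a" "\<And>\<zeta>. \<zeta> \<in> sphere 0 1 \<Longrightarrow> 0 \<le> a \<zeta>"
  shows "circle_borel_measure (density circle_measure (\<lambda>\<zeta>. ennreal (a \<zeta>)))"
proof -
  have [measurable]: "a \<in> borel_measurable circle_measure"
    using assms(1) by (rule borel_measurable_integrable)
  have "emeasure (density circle_measure (\<lambda>\<zeta>. ennreal (a \<zeta>))) (sphere 0 1)
      = (\<integral>\<^sup>+\<zeta>. ennreal (a \<zeta>) * indicator (sphere 0 1) \<zeta> \<partial>circle_measure)"
    by (rule emeasure_density) (use sets.top[of circle_measure] in auto)
  also have "\<dots> = (\<integral>\<^sup>+\<zeta>. ennreal (a \<zeta>) \<partial>circle_measure)"
    by (intro nn_integral_cong) auto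
  also have "\<dots> = ennreal (LINT \<zeta>|circle_measure. a \<zeta>)"
    by (rule nn_integral_eq_integral[OF assms(1)]) (use assms(2) in auto)
  finally show ?thesis
    unfolding circle_borel_measure_def by (auto intro!: finite_measureI)
qed

lemma integral_circle_density:
  fixes g :: "complex \<Rightarrow> 'a::{banach,second_countable_topology}"
  assumes "integrable circle_measure a" "\<And>\<zeta>. \<zeta> \<in> sphere 0 1 \<Longrightarrow> 0 \<le> a \<zeta>"
    and "g \<in> borel_measurable circle_measure"
  shows "(LINT \<zeta>|density circle_measure (\<lambda>\<zeta>. ennreal (a \<zeta>)). g \<zeta>) = (LINT \<zeta>|circle_measure. a \<zeta> *\<^sub>R g \<zeta>)"
  using assms by (intro integral_density AE_I2) (auto intro: borel_measurable_integrable)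

lemma measure_density_null:
  assumes "integrable circle_measure a" "A \<in> sets circle_measure" "emeasure circle_measure A = 0"
  shows "measure (density circle_measure (\<lambda>\<zeta>. ennreal (a \<zeta>))) A = 0"
proof -
  have [measurable]: "a \<in> borel_measurable circle_measure"
    using assms(1) by (rule borel_measurable_integrable)
  have "A \<in> null_sets circle_measure"
    using assms by auto
  then have "A \<in> null_sets (density circle_measure (\<lambda>\<zeta>. ennreal (a \<zeta>)))"
    using absolutely_continuousI_density[of "\<lambda>\<zeta>. ennreal (a \<zeta>)" circle_measure]
    by (auto simp: absolutely_continuous_def)
  then have "emeasure (density circle_measure (\<lambda>\<zeta>. ennreal (a \<zeta>))) A = 0"
    by (rule null_setsD1)
  then show ?thesis
    by (simp add: measure_def)
qed

lemma integrable_kernel_mult: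
  assumes "integrable circle_measure a" "cmod z < 1"
  shows "integrable circle_measure (\<lambda>\<zeta>. herglotz_kernel z \<zeta> * of_real (a \<zeta>))"
    "integrable circle_measure (\<lambda>\<zeta>. poisson_kernel z \<zeta> * a \<zeta>)"
proof -
  have [measurable]: "a \<in> borel_measurable circle_measure"
    using assms(1) by (rule borel_measurable_integrable)
  have [measurable]: "herglotz_kernel z \<in> borel_measurable circle_measure"
    by (intro circle_continuous_measurable[OF circle_borel_circle_measure] continuous_herglotz_kernel assms)
  show 1: "integrable circle_measure (\<lambda>\<zeta>. herglotz_kernel z \<zeta> * of_real (a \<zeta>))"
  proof (rule Bochner_Integration.integrable_bound)
    show "integrable circle_measure (\<lambda>\<zeta>. 2 / (1 - cmod z) * a \<zeta>)"
      by (rule integrable_mult_right[OF assms(1)])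
    show "AE \<zeta> in circle_measure. norm (herglotz_kernel z \<zeta> * of_real (a \<zeta>)) \<le> norm (2 / (1 - cmod z) * a \<zeta>)"
    proof (rule AE_I2)
      fix \<zeta> assume "\<zeta> \<in> space circle_measure"
      then have "cmod (herglotz_kernel z \<zeta>) * \<bar>a \<zeta>\<bar> \<le> 2 / (1 - cmod z) * \<bar>a \<zeta>\<bar>"
        using assms by (intro mult_right_mono herglotz_kernel_bound) auto
      then show "norm (herglotz_kernel z \<zeta> * of_real (a \<zeta>)) \<le> norm (2 / (1 - cmod z) * a \<zeta>)"
        using assms by (simp add: norm_mult abs_mult)
    qed
  qed measurable
  have "integrable circle_measure (\<lambda>\<zeta>. Re (herglotz_kernel z \<zeta> * of_real (a \<zeta>)))"
    by (rule integrable_Re[OF 1])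
  then show "integrable circle_measure (\<lambda>\<zeta>. poisson_kernel z \<zeta> * a \<zeta>)"
    by (simp add: poisson_kernel_def)
qed

text \<open>The logarithm of the boundary modulus of the outer factor contributes the two measures
  \<open>p\<close> and \<open>q\<close>, which are absolutely continuous with respect to arc length.\<close>

lemma nevanlinna_factorization_cmod:
  assumes "nevanlinna_factorization f \<mu> \<nu>"
  obtains B p q where "blaschke_product B" "circle_borel_measure p" "circle_borel_measure q"
    "\<And>A. A \<in> sets circle_measure \<Longrightarrow> emeasure circle_measure A = 0 \<Longrightarrow> measure p A = 0"
    "\<And>A. A \<in> sets circle_measure \<Longrightarrow> emeasure circle_measure A = 0 \<Longrightarrow> measure q A = 0"
    "\<And>z. cmod z < 1 \<Longrightarrow> cmod (f z) = cmod (B z) * exp (poisson p z - poisson q z + poisson \<nu> z - poisson \<mu> z)"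
proof -
  have circ: "circle_borel_measure \<mu>" "circle_borel_measure \<nu>"
    using assms by (auto simp: nevanlinna_factorization_def singular_circle_measure_def)
  obtain B h where Bh: "blaschke_product B" "outer_function h"
    and f: "\<And>z. cmod z < 1 \<Longrightarrow> f z = B z * h z * singular_function \<mu> z / singular_function \<nu> z"
    using assms unfolding nevanlinna_factorization_def by auto
  obtain c \<phi> where c: "cmod c = 1" and i: "integrable circle_measure (\<lambda>\<zeta>. ln (\<phi> \<zeta>))"
    and h: "\<And>z. cmod z < 1 \<Longrightarrow> h z = c * exp (LINT \<zeta>|circle_measure. (\<zeta> + z) / (\<zeta> - z) * of_real (ln (\<phi> \<zeta>)))"
    using Bh(2) unfolding outer_function_def by auto
  define a b where "a \<zeta> = max 0 (ln (\<phi> \<zeta>))" and "b \<zeta> = max 0 (- ln (\<phi> \<zeta>))" for \<zeta>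
  have ab: "integrable circle_measure a" "integrable circle_measure b" "ln (\<phi> \<zeta>) = a \<zeta> - b \<zeta>"
    "0 \<le> a \<zeta>" "0 \<le> b \<zeta>" for \<zeta>
    unfolding a_def b_def using i by (auto intro!: integrable_max)
  have [measurable]: "a \<in> borel_measurable circle_measure" "b \<in> borel_measurable circle_measure"
    using ab by (auto intro: borel_measurable_integrable)
  define p q where "p = density circle_measure (\<lambda>\<zeta>. ennreal (a \<zeta>))" and "q = density circle_measure (\<lambda>\<zeta>. ennreal (b \<zeta>))"
  show thesis
  proof (rule that[OF Bh(1), of p q])
    show "circle_borel_measure p" "circle_borel_measure q"
      unfolding p_def q_def by (intro circle_borel_density ab)+
    fix A assume *: "A \<in> sets circle_measure" "emeasure circle_measure A = 0"
    show "measure p A = 0" "measure q A = 0"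
      unfolding p_def q_def by (intro measure_density_null ab *)+
  next
    fix z :: complex assume z: "cmod z < 1"
    have m: "poisson_kernel z \<in> borel_measurable circle_measure"
      by (intro circle_continuous_measurable[OF circle_borel_circle_measure] continuous_poisson_kernel z)
    have "cmod (h z) = exp (Re (LINT \<zeta>|circle_measure. herglotz_kernel z \<zeta> * of_real (ln (\<phi> \<zeta>))))"
      by (simp add: h[OF z] norm_mult c herglotz_kernel_def)
    also have "Re (LINT \<zeta>|circle_measure. herglotz_kernel z \<zeta> * of_real (ln (\<phi> \<zeta>)))
        = (LINT \<zeta>|circle_measure. Re (herglotz_kernel z \<zeta> * of_real (ln (\<phi> \<zeta>))))"
      by (rule integral_Re[symmetric, OF integrable_kernel_mult(1)[OF i z]])
    also have "\<dots> = (LINT \<zeta>|circle_measure. poisson_kernel z \<zeta> * a \<zeta> - poisson_kernel z \<zeta> * b \<zeta>)"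
      by (intro Bochner_Integration.integral_cong refl) (simp add: poisson_kernel_def ab(3) right_diff_distrib)
    also have "\<dots> = (LINT \<zeta>|circle_measure. poisson_kernel z \<zeta> * a \<zeta>) - (LINT \<zeta>|circle_measure. poisson_kernel z \<zeta> * b \<zeta>)"
      by (intro Bochner_Integration.integral_diff integrable_kernel_mult ab z)
    also have "(LINT \<zeta>|circle_measure. poisson_kernel z \<zeta> * a \<zeta>) = poisson p z"
      unfolding poisson_def p_def by (subst integral_circle_density[OF ab(1) ab(4) m]) (simp add: mult.commute)
    also have "(LINT \<zeta>|circle_measure. poisson_kernel z \<zeta> * b \<zeta>) = poisson q z"
      unfolding poisson_def q_def by (subst integral_circle_density[OF ab(2) ab(5) m]) (simp add: mult.commute)
    finally have "cmod (h z) = exp (poisson p z - poisson q z)" .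
    then show "cmod (f z) = cmod (B z) * exp (poisson p z - poisson q z + poisson \<nu> z - poisson \<mu> z)"
      using f[OF z] by (simp add: norm_mult norm_divide cmod_singular_function[OF _ z] circ exp_diff exp_add exp_minus field_simps)
  qed
qed

lemma mutually_singularE:
  assumes "mutually_singular \<mu> \<nu>" "circle_borel_measure \<mu>" "circle_borel_measure \<nu>"
  obtains A where "A \<in> sets circle_measure" "measure \<mu> A = 0" "measure \<nu> (sphere 0 1 - A) = 0"
proof -
  obtain A where "A \<in> sets \<mu>" "emeasure \<mu> A = 0" "emeasure \<nu> (space \<nu> - A) = 0"
    using assms(1) unfolding mutually_singular_def by blast
  then show thesis
    using that[of A] circle_borelD[OF assms(2)] circle_borelD[OF assms(3)] by (simp add: measure_def)
qed

lemma measure_Int_eq_if_null: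
  assumes m: "circle_borel_measure m" and X: "X \<in> sets circle_measure" and A: "A \<in> sets circle_measure"
    and "measure m (sphere 0 1 - A) = 0"
  shows "measure m X = measure m (X \<inter> A)"
proof -
  interpret finite_measure m by (rule circle_borelD(2)[OF m])
  have s: "sets m = sets circle_measure" "space m = sphere 0 1"
    using circle_borelD[OF m] by auto
  have "measure m (X - X \<inter> A) \<le> measure m (sphere 0 1 - A)"
    using X A sets.sets_into_space[of X m] sets.compl_sets[of A m] by (intro finite_measure_mono) (auto simp: s)
  then have "measure m (X - X \<inter> A) = 0"
    using assms(4) by (simp add: measure_le_0_iff)
  then show ?thesis
    using finite_measure_Diff[of X "X \<inter> A"] X A by (simp add: s)
qed

lemma measure_circle_null: "emeasure circle_measure A = 0 \<longleftrightarrow> measure circle_measure A = 0"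
  by (simp add: circle.emeasure_eq_measure)

text \<open>The radial means of \<open>ln \<bar>B\<bar>\<close> tend to \<open>0\<close>, so the pointwise bound passes to the boundary
  measures, and there only the singular parts matter.\<close>

lemma denominator_le:
  assumes fac: "nevanlinna_factorization f \<mu> \<nu>"
    and m: "circle_borel_measure m" and d: "circle_borel_measure d"
    and d0: "\<And>A. A \<in> sets circle_measure \<Longrightarrow> emeasure circle_measure A = 0 \<Longrightarrow> measure d A = 0"
    and le: "\<And>z. cmod z < 1 \<Longrightarrow> cmod (f z) \<le> exp (poisson m z + poisson d z)"
    and X: "X \<in> sets circle_measure"
  shows "measure \<nu> X \<le> measure m X"
proof -
  have circ: "circle_borel_measure \<mu>" "circle_borel_measure \<nu>"
    and sing: "mutually_singular \<nu> circle_measure" "mutually_singular \<mu> \<nu>"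
    using fac by (auto simp: nevanlinna_factorization_def singular_circle_measure_def)
  obtain B p q where B: "blaschke_product B" and p: "circle_borel_measure p" and q: "circle_borel_measure q"
    and q0: "\<And>A. A \<in> sets circle_measure \<Longrightarrow> emeasure circle_measure A = 0 \<Longrightarrow> measure q A = 0"
    and f: "\<And>z. cmod z < 1 \<Longrightarrow> cmod (f z) = cmod (B z) * exp (poisson p z - poisson q z + poisson \<nu> z - poisson \<mu> z)"
    by (rule nevanlinna_factorization_cmod[OF fac]) blast
  obtain r :: "nat \<Rightarrow> real" where r: "\<And>n. 0 < r n" "\<And>n. r n < 1" "r \<longlonglongrightarrow> 1"
    and Bnz: "\<And>n \<zeta>. cmod \<zeta> = 1 \<Longrightarrow> B (of_real (r n) * \<zeta>) \<noteq> 0"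
    and Bi: "\<And>n. integrable circle_measure (\<lambda>\<zeta>. ln (cmod (B (of_real (r n) * \<zeta>))))"
    "(\<lambda>n. LINT \<zeta>|circle_measure. \<bar>ln (cmod (B (of_real (r n) * \<zeta>)))\<bar>) \<longlonglongrightarrow> 0"
    by (rule blaschke_product_means[OF B]) blast
  define m' where "m' i = (if i = 0 then m else if i = 1 then d else if i = 2 then q else \<mu>)" for i :: nat
  have m': "circle_borel_measure (m' i)" for i
    by (simp add: m'_def m d q circ)
  have sum4: "(\<Sum>i<4. g (m' i)) = g m + g d + g q + g \<mu>" for g :: "complex measure \<Rightarrow> real"
    by (simp add: m'_def eval_nat_numeral)
  have main: "measure \<nu> A \<le> measure m A + measure d A + measure q A + measure \<mu> A" if A: "A \<in> sets circle_measure" for A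
  proof -
    have "measure \<nu> A \<le> (\<Sum>i<4. measure (m' i) A)"
    proof (rule measure_le_sum_if_poisson_le[where J = UNIV and r = r and e = "\<lambda>n \<zeta>. - ln (cmod (B (of_real (r n) * \<zeta>)))"])
      fix n and \<zeta> :: complex assume "\<zeta> \<in> sphere 0 1"
      then have \<zeta>: "cmod \<zeta> = 1" by simp
      let ?z = "of_real (r n) * \<zeta>"
      have z: "cmod ?z < 1"
        using \<zeta> r(1)[of n] r(2)[of n] by (simp add: norm_mult)
      have "cmod (B ?z) * exp (poisson p ?z - poisson q ?z + poisson \<nu> ?z - poisson \<mu> ?z) \<le> exp (poisson m ?z + poisson d ?z)"
        using le[OF z] f[OF z] by simp
      then have "ln (cmod (B ?z) * exp (poisson p ?z - poisson q ?z + poisson \<nu> ?z - poisson \<mu> ?z)) \<le> poisson m ?z + poisson d ?z"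
        using Bnz[OF \<zeta>, of n] by (subst ln_le_iff_le_exp) auto
      then have "ln (cmod (B ?z)) + (poisson p ?z - poisson q ?z + poisson \<nu> ?z - poisson \<mu> ?z) \<le> poisson m ?z + poisson d ?z"
        using Bnz[OF \<zeta>, of n] by (subst (asm) ln_mult) auto
      then show "poisson \<nu> ?z \<le> (\<Sum>i<4. poisson (m' i) ?z) + - ln (cmod (B ?z))"
        using poisson_nonneg[OF p z] unfolding sum4[of "\<lambda>M. poisson M ?z"] by linarith
    qed (use A circ circle_borelD[OF circ(2)] r Bi m' in \<open>auto simp: less_imp_le\<close>)
    then show ?thesis by (simp only: sum4[of "\<lambda>M. measure M A"])
  qed
  obtain A1 where A1: "A1 \<in> sets circle_measure" "measure \<nu> A1 = 0" "measure circle_measure (sphere 0 1 - A1) = 0"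
    by (rule mutually_singularE[OF sing(1) circ(2) circle_borel_circle_measure])
  obtain A2 where A2: "A2 \<in> sets circle_measure" "measure \<mu> A2 = 0" "measure \<nu> (sphere 0 1 - A2) = 0"
    by (rule mutually_singularE[OF sing(2) circ])
  have C1: "sphere 0 1 - A1 \<in> sets circle_measure"
    using sets.compl_sets[OF A1(1)] by simp
  have sub: "A1 \<subseteq> sphere 0 1"
    using sets.sets_into_space[OF A1(1)] by simp
  \<comment> \<open>\<open>\<nu>\<close> lives on the part of \<open>A2\<close> outside
    \<open>A1\<close>. There \<open>\<mu>\<close> vanishes, and so does arc length, hence also
    \<open>d\<close> and \<open>q\<close>; only \<open>m\<close> is left.\<close>
  define Y where "Y = X \<inter> A2 \<inter> (sphere 0 1 - A1)"
  have Y: "Y \<in> sets circle_measure"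
    unfolding Y_def by (intro sets.Int X A2 C1)
  have "measure \<nu> X = measure \<nu> (X \<inter> A2)"
    by (rule measure_Int_eq_if_null[OF circ(2) X A2(1,3)])
  also have "\<dots> = measure \<nu> Y"
    unfolding Y_def using A1(2) sub
    by (intro measure_Int_eq_if_null[OF circ(2) _ C1] sets.Int X A2) (simp add: double_diff)
  also have "\<dots> \<le> measure m Y + measure d Y + measure q Y + measure \<mu> Y"
    by (rule main[OF Y])
  also have "measure \<mu> Y = 0"
  proof -
    have "measure \<mu> Y \<le> measure \<mu> A2"
      using A2 circle_borelD(1)[OF circ(1)] by (intro finite_measure.finite_measure_mono circle_borelD(2) circ) (auto simp: Y_def)
    then show ?thesis
      using A2 by (simp add: measure_le_0_iff)
  qed
  also have "measure circle_measure Y \<le> measure circle_measure (sphere 0 1 - A1)"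
    using C1 by (intro circle.finite_measure_mono) (auto simp: Y_def)
  then have Y0: "emeasure circle_measure Y = 0"
    using A1 by (simp add: measure_circle_null measure_le_0_iff)
  have "measure d Y = 0"
    by (rule d0[OF Y Y0])
  also have "measure q Y = 0"
    by (rule q0[OF Y Y0])
  finally have "measure \<nu> X \<le> measure m Y" by simp
  also have "\<dots> \<le> measure m X"
    using X circle_borelD(1)[OF m] by (intro finite_measure.finite_measure_mono circle_borelD(2) m) (auto simp: Y_def)
  finally show ?thesis .
qed

text \<open>\<open>B\<close> has no zero on the circles of \<open>blaschke_product_means\<close>.
  This selects the second branch of \<open>denominator_measure\<close>.\<close>

lemma nevanlinna_factorization_nonzero:
  assumes "nevanlinna_factorization f \<mu> \<nu>"
  shows "\<exists>z\<in>ball 0 1. f z \<noteq> 0"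
proof -
  obtain B p q where B: "blaschke_product B"
    and f: "\<And>z. cmod z < 1 \<Longrightarrow> cmod (f z) = cmod (B z) * exp (poisson p z - poisson q z + poisson \<nu> z - poisson \<mu> z)"
    by (rule nevanlinna_factorization_cmod[OF assms]) blast
  obtain r :: "nat \<Rightarrow> real" where r: "\<And>n. 0 < r n" "\<And>n. r n < (1::real)"
    and Bnz: "\<And>n \<zeta>. cmod \<zeta> = 1 \<Longrightarrow> B (of_real (r n) * \<zeta>) \<noteq> 0"
    by (rule blaschke_product_means[OF B]) blast
  have z: "cmod (of_real (r 0)) < 1"
    using r(1)[of 0] r(2)[of 0] by simp
  then have "cmod (f (of_real (r 0))) \<noteq> 0"
    using Bnz[of 1 0] by (simp add: f[OF z])
  then show ?thesis
    using z by (intro bexI[of _ "of_real (r 0)"]) auto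
qed

lemma circle_measure_eqI:
  assumes "circle_borel_measure \<mu>" "circle_borel_measure \<nu>"
    and "\<And>A. A \<in> sets circle_measure \<Longrightarrow> measure \<mu> A = measure \<nu> A"
  shows "\<mu> = \<nu>"
  using assms by (intro measure_eqI) (auto simp: circle_borelD finite_measure.emeasure_eq_measure)

text \<open>The second factorization bounds \<open>|f|\<close> by
  \<open>exp (poisson \<nu>' z + poisson p z)\<close>, and \<open>denominator_le\<close> applies to
  the first. Used in both directions it gives the uniqueness behind
  \<open>denominator_measure\<close>.\<close>

lemma denominator_le_of_factorizations:
  assumes "nevanlinna_factorization f \<mu> \<nu>" "nevanlinna_factorization f \<mu>' \<nu>'" "X \<in> sets circle_measure"
  shows "measure \<nu> X \<le> measure \<nu>' X"
proof -
  have circ: "circle_borel_measure \<mu>'" "circle_borel_measure \<nu>'"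
    using assms(2) by (auto simp: nevanlinna_factorization_def singular_circle_measure_def)
  obtain B p q where B: "blaschke_product B" and p: "circle_borel_measure p" and q: "circle_borel_measure q"
    and p0: "\<And>A. A \<in> sets circle_measure \<Longrightarrow> emeasure circle_measure A = 0 \<Longrightarrow> measure p A = 0"
    and f: "\<And>z. cmod z < 1 \<Longrightarrow> cmod (f z) = cmod (B z) * exp (poisson p z - poisson q z + poisson \<nu>' z - poisson \<mu>' z)"
    by (rule nevanlinna_factorization_cmod[OF assms(2)]) blast
  show ?thesis
  proof (rule denominator_le[OF assms(1) circ(2) p p0 _ assms(3)])
    fix z :: complex assume z: "cmod z < 1"
    have "cmod (f z) \<le> 1 * exp (poisson p z - poisson q z + poisson \<nu>' z - poisson \<mu>' z)"
      unfolding f[OF z] by (intro mult_right_mono blaschke_product_le_1 B z) auto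
    also have "\<dots> \<le> exp (poisson \<nu>' z + poisson p z)"
      using poisson_nonneg[OF q z] poisson_nonneg[OF circ(1) z] by simp
    finally show "cmod (f z) \<le> exp (poisson \<nu>' z + poisson p z)" .
  qed
qed

lemma denominator_measure_eq:
  assumes "nevanlinna_factorization f \<mu> \<nu>"
  shows "denominator_measure f = \<nu>"
proof -
  have "\<nu>' = \<nu>" if "nevanlinna_factorization f \<mu>' \<nu>'" for \<mu>' \<nu>'
  proof (rule circle_measure_eqI)
    show "circle_borel_measure \<nu>'" "circle_borel_measure \<nu>"
      using assms that by (auto simp: nevanlinna_factorization_def singular_circle_measure_def)
    show "measure \<nu>' A = measure \<nu> A" if "A \<in> sets circle_measure" for A
      using that \<open>nevanlinna_factorization f \<mu>' \<nu>'\<close> assms denominator_le_of_factorizations by (meson antisym)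
  qed
  then have "(THE \<nu>. \<exists>\<mu>. nevanlinna_factorization f \<mu> \<nu>) = \<nu>"
    using assms by (intro the_equality) blast+
  then show ?thesis
    using nevanlinna_factorization_nonzero[OF assms] unfolding denominator_measure_def by auto
qed

section \<open>A criterion for a trivial singular numerator\<close>

text \<open>The scaled kernel is bounded by 2 and tends to 2 at \<open>\<eta>\<close> and to 0 at
  every other point of the circle.\<close>

lemma poisson_atom_limit:
  assumes m: "circle_borel_measure m" and \<eta>: "cmod \<eta> = 1"
    and r: "\<And>n. 0 \<le> r n" "\<And>n. r n < 1" "r \<longlonglongrightarrow> 1"
  shows "(\<lambda>n. (1 - r n) * poisson m (of_real (r n) * \<eta>)) \<longlonglongrightarrow> 2 * measure m {\<eta>}"
proof -
  interpret finite_measure m by (rule circle_borelD(2)[OF m])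
  have s: "{\<eta>} \<in> sets m"
    using \<eta> by (auto simp: circle_borelD(1)[OF m] sets_restrict_space intro!: image_eqI[of _ _ "{\<eta>}"])
  have z: "cmod (of_real (r n) * \<eta>) = r n" for n
    using r \<eta> by (simp add: norm_mult)
  have "(\<lambda>n. LINT \<zeta>|m. (1 - r n) * poisson_kernel (of_real (r n) * \<eta>) \<zeta>) \<longlonglongrightarrow> (LINT \<zeta>|m. 2 * indicator {\<eta>} \<zeta>)"
  proof (rule integral_dominated_convergence[where w = "\<lambda>_. 2"])
    show "AE \<zeta> in m. (\<lambda>n. (1 - r n) * poisson_kernel (of_real (r n) * \<eta>) \<zeta>) \<longlonglongrightarrow> 2 * indicator {\<eta>} \<zeta>"
    proof (rule AE_I2)
      fix \<zeta> assume "\<zeta> \<in> space m"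
      then have \<zeta>: "cmod \<zeta> = 1" by (simp add: circle_borelD(3)[OF m])
      show "(\<lambda>n. (1 - r n) * poisson_kernel (of_real (r n) * \<eta>) \<zeta>) \<longlonglongrightarrow> 2 * indicator {\<eta>} \<zeta>"
      proof (cases "\<zeta> = \<eta>")
        case True
        have "(1 - r n) * poisson_kernel (of_real (r n) * \<eta>) \<zeta> = 1 + r n" for n
        proof -
          have "cmod (\<eta> - of_real (r n) * \<eta>) = cmod (of_real (1 - r n) * \<eta>)"
            by (simp add: algebra_simps)
          also have "\<dots> = 1 - r n"
            using r(2)[of n] \<eta> by (simp only: norm_mult norm_of_real) simp
          finally show ?thesis
            using True \<eta> r(2)[of n] z[of n]
            by (simp add: poisson_kernel_eq power2_eq_square divide_simps) (simp add: algebra_simps)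
        qed
        moreover have "(\<lambda>n. 1 + r n) \<longlonglongrightarrow> 1 + 1"
          by (intro tendsto_intros r)
        ultimately show ?thesis using True by simp
      next
        case False
        have "(\<lambda>n. (1 - r n) * ((1 - (r n)\<^sup>2) / (cmod (\<zeta> - of_real (r n) * \<eta>))\<^sup>2))
            \<longlonglongrightarrow> (1 - 1) * ((1 - 1\<^sup>2) / (cmod (\<zeta> - of_real 1 * \<eta>))\<^sup>2)"
          using False by (intro tendsto_intros r) auto
        then show ?thesis
          using False \<zeta> z by (simp add: poisson_kernel_eq)
      qed
    qed
    show "AE \<zeta> in m. norm ((1 - r n) * poisson_kernel (of_real (r n) * \<eta>) \<zeta>) \<le> 2" for n
    proof (rule AE_I2)
      fix \<zeta> assume "\<zeta> \<in> space m"
      then have "\<bar>poisson_kernel (of_real (r n) * \<eta>) \<zeta>\<bar> \<le> 2 / (1 - r n)"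
        using poisson_kernel_bounds(2)[of \<zeta> "of_real (r n) * \<eta>"] z[of n] r(2)[of n] by (simp add: circle_borelD(3)[OF m])
      moreover have "0 < 1 - r n"
        using r(2)[of n] by simp
      ultimately have "\<bar>poisson_kernel (of_real (r n) * \<eta>) \<zeta>\<bar> * (1 - r n) \<le> 2"
        by (simp only: pos_le_divide_eq)
      then show "norm ((1 - r n) * poisson_kernel (of_real (r n) * \<eta>) \<zeta>) \<le> 2"
        using r(2)[of n] by (simp add: abs_mult mult.commute)
    qed
    show "(\<lambda>\<zeta>. (1 - r n) * poisson_kernel (of_real (r n) * \<eta>) \<zeta>) \<in> borel_measurable m" for n
      using z[of n] r(2)[of n] by (intro circle_continuous_measurable[OF m] continuous_intros continuous_poisson_kernel) simp
  qed (use s in auto)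
  then show ?thesis
    using s by (simp add: poisson_def)
qed

text \<open>Read off from \<open>poisson_atom_limit\<close>, as the Poisson integral of arc length
  is constantly 1.\<close>

lemma measure_circle_singleton: "cmod \<eta> = 1 \<Longrightarrow> measure circle_measure {\<eta>} = 0"
proof -
  assume \<eta>: "cmod \<eta> = 1"
  define r where "r n = 1 - 1 / real (n + 1)" for n :: nat
  have r: "0 \<le> r n" "r n < 1" for n
    by (auto simp: r_def)
  have lim: "r \<longlonglongrightarrow> 1"
    unfolding r_def by real_asymp
  have "(\<lambda>n. (1 - r n) * poisson circle_measure (of_real (r n) * \<eta>)) \<longlonglongrightarrow> 2 * measure circle_measure {\<eta>}"
    by (rule poisson_atom_limit[OF circle_borel_circle_measure \<eta> r lim])
  moreover have "(\<lambda>n. (1 - r n) * 1) \<longlonglongrightarrow> (1 - 1) * 1"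
    by (intro tendsto_intros lim)
  moreover have "(1 - r n) * poisson circle_measure (of_real (r n) * \<eta>) = (1 - r n) * 1" for n
    using r[of n] \<eta> by (subst poisson_circle_measure) (auto simp: norm_mult)
  ultimately show ?thesis
    using LIMSEQ_unique by fastforce
qed

text \<open>Where \<open>\<delta> \<le> |f|\<close>, the Poisson integral of \<open>\<mu>\<close> is
  at most that of \<open>p\<close> plus that of \<open>\<nu>\<close> minus
  \<open>ln \<delta>\<close>. Near a point outside \<open>Z\<close> this passes to the measures, and
  \<open>\<mu>\<close>, singular to \<open>\<nu>\<close> and to arc length, vanishes there; Lindelof
  reduces to countably many neighbourhoods. The countable set \<open>Z\<close> could only carry
  atoms of \<open>\<mu>\<close>, and the radial bound makes each of them at most an atom of
  \<open>\<nu>\<close>.\<close>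

lemma nevanlinna_numerator_trivial:
  assumes fac: "nevanlinna_factorization f \<mu> \<nu>" and Z: "countable Z" "Z \<subseteq> sphere 0 1"
    and loc: "\<And>\<eta>. \<eta> \<in> sphere 0 1 - Z \<Longrightarrow> \<exists>d>0. \<exists>\<delta>>0. \<forall>z. cmod z < 1 \<longrightarrow> cmod (z - \<eta>) < d \<longrightarrow> \<delta> \<le> cmod (f z)"
    and rad: "\<And>\<eta>. \<eta> \<in> Z \<Longrightarrow> \<exists>\<delta>>0. \<forall>\<^sub>F r in at_left 1. \<delta> \<le> cmod (f (of_real r * \<eta>))"
  shows "\<mu> = null_measure circle_measure"
proof -
  have circ: "circle_borel_measure \<mu>" "circle_borel_measure \<nu>"
    and sing: "mutually_singular \<mu> circle_measure" "mutually_singular \<mu> \<nu>"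
    using fac by (auto simp: nevanlinna_factorization_def singular_circle_measure_def)
  interpret \<mu>: finite_measure \<mu> by (rule circle_borelD(2)[OF circ(1)])
  have s\<mu>: "sets \<mu> = sets circle_measure" "space \<mu> = sphere 0 1"
    using circle_borelD[OF circ(1)] by auto
  obtain B p q where B: "blaschke_product B" and p: "circle_borel_measure p" and q: "circle_borel_measure q"
    and p0: "\<And>A. A \<in> sets circle_measure \<Longrightarrow> emeasure circle_measure A = 0 \<Longrightarrow> measure p A = 0"
    and f: "\<And>z. cmod z < 1 \<Longrightarrow> cmod (f z) = cmod (B z) * exp (poisson p z - poisson q z + poisson \<nu> z - poisson \<mu> z)"
    by (rule nevanlinna_factorization_cmod[OF fac]) blast
  have bound: "poisson \<mu> z \<le> poisson p z + poisson \<nu> z - ln \<delta>" if "0 < \<delta>" "\<delta> \<le> cmod (f z)" "cmod z < 1" for \<delta> z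
  proof -
    have "\<delta> \<le> 1 * exp (poisson p z - poisson q z + poisson \<nu> z - poisson \<mu> z)"
      using that(2) unfolding f[OF that(3)]
      by (rule order_trans) (intro mult_right_mono blaschke_product_le_1 B that(3), simp)
    then have "ln \<delta> \<le> poisson p z - poisson q z + poisson \<nu> z - poisson \<mu> z"
      using that(1) by (simp add: ln_le_iff_le_exp)
    then show ?thesis
      using poisson_nonneg[OF q that(3)] by linarith
  qed
  obtain A1 where A1: "A1 \<in> sets circle_measure" "measure \<mu> A1 = 0" "measure circle_measure (sphere 0 1 - A1) = 0"
    by (rule mutually_singularE[OF sing(1) circ(1) circle_borel_circle_measure])
  obtain A2 where A2: "A2 \<in> sets circle_measure" "measure \<mu> A2 = 0" "measure \<nu> (sphere 0 1 - A2) = 0"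
    by (rule mutually_singularE[OF sing(2) circ])
  have C: "sphere 0 1 - A1 \<in> sets circle_measure" "sphere 0 1 - A2 \<in> sets circle_measure"
    using sets.compl_sets[OF A1(1)] sets.compl_sets[OF A2(1)] by auto
  have sub: "A1 \<subseteq> sphere 0 1" "A2 \<subseteq> sphere 0 1"
    using sets.sets_into_space[OF A1(1)] sets.sets_into_space[OF A2(1)] by auto
  define r where "r n = 1 - 1 / real (n + 1)" for n :: nat
  have r: "0 \<le> r n" "r n < 1" for n
    by (auto simp: r_def)
  have rlim: "r \<longlonglongrightarrow> 1"
    unfolding r_def by real_asymp
  have local: "\<exists>J. open J \<and> \<eta> \<in> J \<and> measure \<mu> (J \<inter> sphere 0 1) = 0" if \<eta>: "\<eta> \<in> sphere 0 1 - Z" for \<eta>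
  proof -
    obtain d \<delta> where d: "d > 0" "\<delta> > 0" and ge: "\<And>z. cmod z < 1 \<Longrightarrow> cmod (z - \<eta>) < d \<Longrightarrow> \<delta> \<le> cmod (f z)"
      using loc[OF \<eta>] by blast
    \<comment> \<open>The other half of \<open>d\<close> is left for the distance between
      \<open>\<zeta>\<close> and \<open>r n * \<zeta>\<close>, which is below \<open>d / 2\<close>
      from \<open>N\<close> on.\<close>
    define J where "J = ball \<eta> (d / 2)"
    obtain N where N: "\<And>n. n \<ge> N \<Longrightarrow> 1 - d / 2 < r n"
      using order_tendstoD(1)[OF rlim, of "1 - d / 2"] d by (auto simp: eventually_sequentially)
    \<comment> \<open>The constant \<open>|ln \<delta>|\<close> enters as the Poisson integral of a
      multiple of arc length.\<close>
    define m' where "m' i = (if i = 0 then p else if i = 1 then \<nu> else density circle_measure (\<lambda>_. ennreal \<bar>ln \<delta>\<bar>))" for i :: nat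
    have Di: "integrable circle_measure (\<lambda>_. \<bar>ln \<delta>\<bar>)"
      by simp
    have m': "circle_borel_measure (m' i)" for i
      using circle_borel_density[OF Di] by (simp add: m'_def p circ)
    have sum3: "(\<Sum>i<3. g (m' i)) = g p + g \<nu> + g (m' 2)" for g :: "complex measure \<Rightarrow> real"
      by (simp add: m'_def eval_nat_numeral)
    have m'2: "poisson (m' 2) z = \<bar>ln \<delta>\<bar>" if "cmod z < 1" for z
      using that integral_circle_density[OF Di, of "poisson_kernel z"]
      by (simp add: m'_def poisson_def poisson_kernel_integral circle_continuous_measurable[OF circle_borel_circle_measure]
          continuous_poisson_kernel)
    have main: "measure \<mu> A \<le> measure p A + measure \<nu> A + measure (m' 2) A"
      if A: "A \<in> sets circle_measure" "A \<subseteq> J" for A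
    proof -
      have "measure \<mu> A \<le> (\<Sum>i<3. measure (m' i) A)"
      proof (rule measure_le_sum_if_poisson_le[where J = J and r = "\<lambda>n. r (n + N)" and e = "\<lambda>n \<zeta>. 0"])
        fix n and \<zeta> :: complex assume "\<zeta> \<in> sphere 0 1" and J: "\<zeta> \<in> J"
        then have \<zeta>: "cmod \<zeta> = 1" by simp
        let ?z = "of_real (r (n + N)) * \<zeta>"
        have z: "cmod ?z < 1"
          using \<zeta> r[of "n + N"] by (simp add: norm_mult)
        have "cmod (?z - \<eta>) \<le> cmod (?z - \<zeta>) + cmod (\<zeta> - \<eta>)"
          using norm_triangle_ineq[of "?z - \<zeta>" "\<zeta> - \<eta>"] by simp
        also have "cmod (?z - \<zeta>) = cmod (of_real (r (n + N) - 1) * \<zeta>)"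
          by (simp add: algebra_simps)
        also have "\<dots> = 1 - r (n + N)"
          using r(2)[of "n + N"] \<zeta> by (simp only: norm_mult norm_of_real) simp
        also have "\<dots> < d / 2"
          using N[of "n + N"] by simp
        also have "cmod (\<zeta> - \<eta>) < d / 2"
          using J by (simp add: J_def dist_norm norm_minus_commute)
        finally have "cmod (?z - \<eta>) < d" by simp
        then have "poisson \<mu> ?z \<le> poisson p ?z + poisson \<nu> ?z - ln \<delta>"
          by (intro bound d ge z)
        then show "poisson \<mu> ?z \<le> (\<Sum>i<3. poisson (m' i) ?z) + 0"
          unfolding sum3[of "\<lambda>M. poisson M ?z"] m'2[OF z] by linarith
      qed (use A s\<mu> circ r m' LIMSEQ_ignore_initial_segment[OF rlim, of N] in \<open>auto simp: J_def\<close>)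
      then show ?thesis by (simp only: sum3[of "\<lambda>M. measure M A"])
    qed
    define Y where "Y = J \<inter> sphere 0 1 \<inter> (sphere 0 1 - A1) \<inter> (sphere 0 1 - A2)"
    have J: "J \<inter> sphere 0 1 \<in> sets circle_measure"
      by (auto simp: sets_restrict_space J_def intro!: image_eqI[of _ _ "ball \<eta> (d / 2)"])
    have Y: "Y \<in> sets circle_measure"
      unfolding Y_def by (intro sets.Int J C)
    have "measure \<mu> (J \<inter> sphere 0 1) = measure \<mu> (J \<inter> sphere 0 1 \<inter> (sphere 0 1 - A1))"
      using A1 sub by (intro measure_Int_eq_if_null[OF circ(1) J C(1)]) (simp add: double_diff)
    also have "\<dots> = measure \<mu> Y"
      unfolding Y_def using A2 sub
      by (intro measure_Int_eq_if_null[OF circ(1) _ C(2)] sets.Int J C) (simp add: double_diff)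
    also have "\<dots> \<le> measure p Y + measure \<nu> Y + measure (m' 2) Y"
      by (rule main[OF Y]) (auto simp: Y_def)
    also have "measure \<nu> Y = 0"
    proof -
      have "measure \<nu> Y \<le> measure \<nu> (sphere 0 1 - A2)"
        using C circle_borelD(1)[OF circ(2)] by (intro finite_measure.finite_measure_mono circle_borelD(2) circ) (auto simp: Y_def)
      then show ?thesis
        using A2 by (simp add: measure_le_0_iff)
    qed
    also have Y0: "emeasure circle_measure Y = 0"
    proof -
      have "measure circle_measure Y \<le> measure circle_measure (sphere 0 1 - A1)"
        using C by (intro circle.finite_measure_mono) (auto simp: Y_def)
      then show ?thesis
        using A1 by (simp add: measure_circle_null measure_le_0_iff)
    qed
    have "measure p Y = 0"
      by (rule p0[OF Y Y0])
    also have "measure (m' 2) Y = 0"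
      using measure_density_null[OF Di Y Y0] by (simp add: m'_def)
    finally have "measure \<mu> (J \<inter> sphere 0 1) = 0"
      by (simp add: measure_le_0_iff)
    then show ?thesis
      using d by (intro exI[of _ J]) (auto simp: J_def)
  qed
  then obtain J where J: "\<And>\<eta>. \<eta> \<in> sphere 0 1 - Z \<Longrightarrow> open (J \<eta>) \<and> \<eta> \<in> J \<eta> \<and> measure \<mu> (J \<eta> \<inter> sphere 0 1) = 0"
    by metis
  obtain \<F> where \<F>: "\<F> \<subseteq> J ` (sphere 0 1 - Z)" "countable \<F>" "\<Union>\<F> = \<Union>(J ` (sphere 0 1 - Z))"
    by (rule Lindelof[of "J ` (sphere 0 1 - Z)"]) (use J in auto)
  have atom: "measure \<mu> {\<eta>} = 0" if \<eta>: "\<eta> \<in> Z" for \<eta>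
  proof -
    obtain \<delta> where \<delta>: "\<delta> > 0" "\<forall>\<^sub>F r in at_left 1. \<delta> \<le> cmod (f (of_real r * \<eta>))"
      using rad[OF \<eta>] by blast
    have n1: "cmod \<eta> = 1" using \<eta> Z by auto
    have "filterlim r (at_left 1) sequentially"
      using rlim r by (intro filterlim_atI tendsto_imp_filterlim_at_left) (auto simp: eventually_sequentially)
    then have "\<forall>\<^sub>F n in sequentially. \<delta> \<le> cmod (f (of_real (r n) * \<eta>))"
      using \<delta>(2) by (rule eventually_compose_filterlim[rotated])
    then have ev: "\<forall>\<^sub>F n in sequentially. (1 - r n) * poisson \<mu> (of_real (r n) * \<eta>)
        \<le> (1 - r n) * poisson p (of_real (r n) * \<eta>) + (1 - r n) * poisson \<nu> (of_real (r n) * \<eta>) - (1 - r n) * ln \<delta>"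
    proof eventually_elim
      case (elim n)
      have "poisson \<mu> (of_real (r n) * \<eta>) \<le> poisson p (of_real (r n) * \<eta>) + poisson \<nu> (of_real (r n) * \<eta>) - ln \<delta>"
        using elim \<delta> n1 r[of n] by (intro bound) (auto simp: norm_mult)
      from mult_left_mono[OF this, of "1 - r n"] show ?case
        using r(2)[of n] by (simp add: algebra_simps)
    qed
    have "2 * measure \<mu> {\<eta>} \<le> 2 * measure p {\<eta>} + 2 * measure \<nu> {\<eta>} - (1 - 1) * ln \<delta>"
      by (rule tendsto_le[OF sequentially_bot _ poisson_atom_limit[OF circ(1) n1 r rlim] ev])
        (intro tendsto_intros poisson_atom_limit p circ n1 r rlim)
    moreover have sing1: "{\<eta>} \<in> sets circle_measure"
      using n1 by (auto simp: sets_restrict_space intro!: image_eqI[of _ _ "{\<eta>}"])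
    then have "measure p {\<eta>} = 0"
      by (rule p0) (simp add: measure_circle_null measure_circle_singleton n1)
    ultimately have le: "measure \<mu> {\<eta>} \<le> measure \<nu> {\<eta>}"
      by simp
    \<comment> \<open>Mutual singularity: on one side of \<open>A2\<close> the point is null for
      \<open>\<mu>\<close>, on the other for \<open>\<nu>\<close>.\<close>
    show ?thesis
    proof (cases "\<eta> \<in> A2")
      case True
      then have "measure \<mu> {\<eta>} \<le> measure \<mu> A2"
        using A2 by (intro \<mu>.finite_measure_mono) (auto simp: s\<mu>)
      then show ?thesis using A2 by (simp add: measure_le_0_iff)
    next
      case False
      then have "measure \<nu> {\<eta>} \<le> measure \<nu> (sphere 0 1 - A2)"
        using C n1 circle_borelD(1)[OF circ(2)] by (intro finite_measure.finite_measure_mono circle_borelD(2) circ) auto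
      then show ?thesis using A2 le by (simp add: measure_le_0_iff)
    qed
  qed
  have null1: "(\<Union>U\<in>\<F>. U \<inter> sphere 0 1) \<in> null_sets \<mu>"
  proof (rule null_sets_UN'[OF \<F>(2)])
    fix U assume "U \<in> \<F>"
    then obtain \<eta> where \<eta>: "\<eta> \<in> sphere 0 1 - Z" "U = J \<eta>"
      using \<F>(1) by blast
    then show "U \<inter> sphere 0 1 \<in> null_sets \<mu>"
      using J[OF \<eta>(1)] by (auto simp: null_sets_def \<mu>.emeasure_eq_measure s\<mu> sets_restrict_space intro!: image_eqI[of _ _ U])
  qed
  have null2: "(\<Union>\<eta>\<in>Z. {\<eta>}) \<in> null_sets \<mu>"
  proof (rule null_sets_UN'[OF Z(1)])
    fix \<eta> assume \<eta>: "\<eta> \<in> Z"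
    then show "{\<eta>} \<in> null_sets \<mu>"
      using atom[OF \<eta>] Z by (auto simp: null_sets_def \<mu>.emeasure_eq_measure s\<mu> sets_restrict_space intro!: image_eqI[of _ _ "{\<eta>}"])
  qed
  have "sphere 0 1 \<subseteq> (\<Union>U\<in>\<F>. U \<inter> sphere 0 1) \<union> (\<Union>\<eta>\<in>Z. {\<eta>})"
  proof
    fix x :: complex assume x: "x \<in> sphere 0 1"
    show "x \<in> (\<Union>U\<in>\<F>. U \<inter> sphere 0 1) \<union> (\<Union>\<eta>\<in>Z. {\<eta>})"
    proof (cases "x \<in> Z")
      case False
      then have "x \<in> \<Union>(J ` (sphere 0 1 - Z))"
        using J[of x] x by blast
      then show ?thesis using x \<F>(3) by blast
    qed auto
  qed
  then have "sphere 0 1 \<in> null_sets \<mu>"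
    by (rule null_sets_subset[OF null_sets.Un[OF null1 null2], rotated]) (metis s\<mu>(2) sets.top)
  then have "emeasure \<mu> A = 0" if "A \<in> sets \<mu>" for A
    using that emeasure_mono[of A "sphere 0 1" \<mu>] sets.sets_into_space[OF that] s\<mu> by (auto simp: null_sets_def)
  then show ?thesis
    by (intro measure_eqI) (auto simp: s\<mu>)
qed

section \<open>Removing the zeros of a Nevanlinna function\<close>

text \<open>\<open>nevanlinna\<close> with an explicit bound: \<open>remove_zeros\<close> needs one
  \<open>M\<close> for all successive quotients.\<close>

definition log_means_le :: "(complex \<Rightarrow> complex) \<Rightarrow> real \<Rightarrow> bool" where
  "log_means_le f M \<longleftrightarrow> f holomorphic_on ball 0 1 \<and>
     (\<forall>r. 0 \<le> r \<longrightarrow> r < 1 \<longrightarrow> (LINT \<zeta>|circle_measure. log_plus (cmod (f (of_real r * \<zeta>)))) \<le> M)"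

lemma log_means_leD:
  assumes "log_means_le f M"
  shows "f holomorphic_on ball 0 1"
    "\<And>r. 0 \<le> r \<Longrightarrow> r < 1 \<Longrightarrow> (LINT \<zeta>|circle_measure. log_plus (cmod (f (of_real r * \<zeta>)))) \<le> M"
  using assms by (auto simp: log_means_le_def)

lemma nevanlinna_iff_log_means_le: "nevanlinna f \<longleftrightarrow> (\<exists>M. log_means_le f M)"
  unfolding nevanlinna_def log_means_le_def bdd_above_def by (simp add: image_iff Ball_def Bex_def) blast

lemma dilation_holomorphic:
  assumes "f holomorphic_on ball 0 1" "0 \<le> r" "r < 1"
  shows "continuous_on (cball 0 1) (\<lambda>z. f (of_real r * z))" "(\<lambda>z. f (of_real r * z)) holomorphic_on ball 0 1"
proof -
  have *: "of_real r * z \<in> ball 0 1" if "cmod z \<le> 1" for z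
  proof -
    have "r * cmod z \<le> r * 1"
      using assms that by (intro mult_left_mono)
    then show ?thesis using assms by (simp add: norm_mult)
  qed
  show "continuous_on (cball 0 1) (\<lambda>z. f (of_real r * z))"
    by (intro continuous_on_compose2[OF holomorphic_on_imp_continuous_on[OF assms(1)]] continuous_intros)
      (use * in auto)
  show "(\<lambda>z. f (of_real r * z)) holomorphic_on ball 0 1"
    by (intro holomorphic_on_compose_gen[OF _ assms(1), unfolded o_def] holomorphic_intros)
      (use * in auto)
qed

lemma integrable_log_plus_dilation:
  assumes "f holomorphic_on ball 0 1" "0 \<le> r" "r < 1"
  shows "integrable circle_measure (\<lambda>\<zeta>. log_plus (cmod (f (of_real r * \<zeta>))))"
  by (intro circle_continuous_integrable[OF circle_borel_circle_measure] continuous_on_log_plus_norm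
      continuous_on_subset[OF dilation_holomorphic(1)[OF assms]]) auto

text \<open>Near the circle \<open>|b|\<close> is close to 1, so there \<open>log_plus |g|\<close>
  exceeds \<open>log_plus |f|\<close> by at most \<open>e\<close>. As the means of \<open>g\<close>
  increase with the radius, the bound carries over to smaller circles without loss.\<close>

lemma log_means_le_divide:
  assumes f: "log_means_le f M" and g: "g holomorphic_on ball 0 1"
    and b: "continuous_on (cball 0 1) b" "\<And>\<zeta>. cmod \<zeta> = 1 \<Longrightarrow> cmod (b \<zeta>) = 1"
    and eq: "\<And>z. cmod z < 1 \<Longrightarrow> f z = b z * g z"
  shows "log_means_le g M"
  unfolding log_means_le_def
proof (intro conjI g allI impI)
  fix s :: real assume s: "0 \<le> s" "s < 1"
  show "(LINT \<zeta>|circle_measure. log_plus (cmod (g (of_real s * \<zeta>)))) \<le> M"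
  proof (rule field_le_epsilon)
    fix e :: real assume e: "e > 0"
    obtain r0 where r0: "r0 < 1" "\<And>t \<zeta>. r0 \<le> t \<Longrightarrow> t \<le> 1 \<Longrightarrow> cmod \<zeta> = 1 \<Longrightarrow> 1 - (1 - exp (- e)) < cmod (b (of_real t * \<zeta>))"
      using unimodular_boundary_limit[OF b, of "1 - exp (- e)"] e by auto
    define r where "r = max r0 ((1 + s) / 2)"
    have r: "r0 \<le> r" "s < r" "0 < r" "r < 1"
      using r0 s by (auto simp: r_def less_max_iff_disj)
    have "(LINT \<zeta>|circle_measure. log_plus (cmod (g (of_real r * (of_real (s / r) * \<zeta>)))))
        \<le> (LINT \<zeta>|circle_measure. log_plus (cmod (g (of_real r * \<zeta>))))"
      using r s by (intro log_plus_mean_le dilation_holomorphic[OF g]) auto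
    also have "\<dots> \<le> (LINT \<zeta>|circle_measure. log_plus (cmod (f (of_real r * \<zeta>))) + e)"
    proof (rule integral_mono)
      show "integrable circle_measure (\<lambda>\<zeta>. log_plus (cmod (g (of_real r * \<zeta>))))"
        using r by (intro integrable_log_plus_dilation g) auto
      show "integrable circle_measure (\<lambda>\<zeta>. log_plus (cmod (f (of_real r * \<zeta>))) + e)"
        using r by (intro Bochner_Integration.integrable_add integrable_log_plus_dilation log_means_leD[OF f]) auto
      fix \<zeta> assume "\<zeta> \<in> space circle_measure"
      then have \<zeta>: "cmod \<zeta> = 1" by simp
      let ?z = "of_real r * \<zeta>"
      have z: "cmod ?z < 1"
        using r \<zeta> by (simp add: norm_mult)
      have "exp (- e) * cmod (g ?z) \<le> cmod (f ?z)"
        unfolding eq[OF z] norm_mult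
        using r0(2)[OF r(1) less_imp_le[OF r(4)] \<zeta>] by (intro mult_right_mono) auto
      then have "cmod (g ?z) \<le> exp e * cmod (f ?z)"
        by (simp add: exp_minus field_simps)
      also have "\<dots> \<le> exp e * exp (log_plus (cmod (f ?z)))"
        by (intro mult_left_mono le_exp_log_plus) auto
      finally show "log_plus (cmod (g ?z)) \<le> log_plus (cmod (f ?z)) + e"
        using e by (simp add: log_plus_le_iff exp_add mult.commute)
    qed
    also have "\<dots> \<le> M + e"
      using r log_means_leD(2)[OF f, of r] by (simp add: integrable_log_plus_dilation[OF log_means_leD(1)[OF f]])
    finally show "(LINT \<zeta>|circle_measure. log_plus (cmod (g (of_real s * \<zeta>)))) \<le> M + e"
      using r by (simp add: mult.assoc[symmetric])
  qed
qed

text \<open>The Poisson inequality on the circle of radius \<open>(1 + \<rho>) / 2\<close>. A bound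
  in terms of \<open>\<rho>\<close> and \<open>M\<close> alone is what Montel's theorem needs in
  \<open>remove_zeros\<close>.\<close>

lemma log_means_le_bound:
  assumes g: "log_means_le g M" and z: "cmod z \<le> \<rho>" and \<rho>: "0 \<le> \<rho>" "\<rho> < 1"
  shows "cmod (g z) \<le> exp (2 / (1 - \<rho> / ((1 + \<rho>) / 2)) * M)"
proof -
  define r where "r = (1 + \<rho>) / 2"
  have r: "\<rho> < r" "0 < r" "r < 1"
    using \<rho> by (auto simp: r_def)
  define w where "w = z / of_real r"
  have w: "cmod w \<le> \<rho> / r" "cmod w < 1"
    using z r \<rho> by (auto simp: w_def norm_divide divide_right_mono field_simps)
  note hol = log_means_leD(1)[OF g]
  have c: "continuous_on (sphere 0 1) (\<lambda>\<zeta>. log_plus (cmod (g (of_real r * \<zeta>))))"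
    by (intro continuous_on_log_plus_norm continuous_on_subset[OF dilation_holomorphic(1)[OF hol]]) (use r in auto)
  have "log_plus (cmod (g (of_real r * w))) \<le> (LINT \<zeta>|circle_measure. poisson_kernel w \<zeta> * log_plus (cmod (g (of_real r * \<zeta>))))"
    using r w by (intro log_plus_le_poisson dilation_holomorphic hol) auto
  also have "\<dots> \<le> (LINT \<zeta>|circle_measure. 2 / (1 - \<rho> / r) * log_plus (cmod (g (of_real r * \<zeta>))))"
  proof (rule integral_mono)
    fix \<zeta> assume "\<zeta> \<in> space circle_measure"
    then have "poisson_kernel w \<zeta> \<le> 2 / (1 - cmod w)"
      using w by (intro poisson_kernel_bounds) auto
    also have "\<dots> \<le> 2 / (1 - \<rho> / r)"
    proof -
      have "0 < 1 - \<rho> / r" using r by (simp only: diff_gt_0_iff_gt divide_less_eq_1_pos)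
      then show ?thesis
        using w by (intro divide_left_mono mult_pos_pos) auto
    qed
    finally show "poisson_kernel w \<zeta> * log_plus (cmod (g (of_real r * \<zeta>))) \<le> 2 / (1 - \<rho> / r) * log_plus (cmod (g (of_real r * \<zeta>)))"
      by (intro mult_right_mono) auto
  qed (use w c r in \<open>auto intro!: circle_continuous_integrable[OF circle_borel_circle_measure] continuous_intros continuous_poisson_kernel\<close>)
  also have "\<dots> = 2 / (1 - \<rho> / r) * (LINT \<zeta>|circle_measure. log_plus (cmod (g (of_real r * \<zeta>))))"
    by simp
  also have "\<dots> \<le> 2 / (1 - \<rho> / r) * M"
    using r \<rho> by (intro mult_left_mono log_means_leD(2)[OF g]) (auto simp: field_simps)
  finally have "log_plus (cmod (g z)) \<le> 2 / (1 - \<rho> / r) * M"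
    using r by (simp add: w_def)
  then show ?thesis
    by (simp add: log_plus_le_iff r_def)
qed

lemma blaschke_factor_divides:
  assumes g: "g holomorphic_on ball 0 1" and a: "0 < cmod a" "cmod a < 1" "g a = 0"
  obtains h where "h holomorphic_on ball 0 1" "\<And>z. cmod z < 1 \<Longrightarrow> g z = blaschke_factor a z * h z"
proof -
  define q where "q z = (if z = a then deriv g a else (g z - g a) / (z - a))" for z
  have q: "q holomorphic_on ball 0 1"
    unfolding q_def by (rule pole_lemma_open[OF g]) simp
  show thesis
  proof (rule that[of "\<lambda>z. - q z * (1 - cnj a * z) * a / of_real (cmod a)"])
    show "(\<lambda>z. - q z * (1 - cnj a * z) * a / of_real (cmod a)) holomorphic_on ball 0 1"
      using a by (intro holomorphic_intros q) auto
    fix z :: complex assume z: "cmod z < 1"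
    have "g z = (z - a) * q z"
      using a by (simp add: q_def)
    then show "g z = blaschke_factor a z * (- q z * (1 - cnj a * z) * a / of_real (cmod a))"
      using a z blaschke_denominator_nonzero[of a z] by (simp add: blaschke_factor_def) (simp add: field_simps)
  qed
qed

lemma minimal_zero:
  assumes g: "g holomorphic_on ball 0 1" "g 0 \<noteq> 0" and w: "cmod w < 1" "g w = 0"
  obtains a where "0 < cmod a" "cmod a < 1" "g a = 0" "\<And>z. cmod z < 1 \<Longrightarrow> g z = 0 \<Longrightarrow> cmod a \<le> cmod z"
proof -
  define S where "S = {z \<in> cball 0 (cmod w). g z = 0}"
  have "continuous_on (cball 0 (cmod w)) g"
    using w by (intro continuous_on_subset[OF holomorphic_on_imp_continuous_on[OF g(1)]]) auto
  then have "closedin (top_of_set (cball 0 (cmod w))) S"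
    unfolding S_def by (rule continuous_closedin_preimage_constant)
  then have S: "compact S"
    by (rule closedin_compact[OF compact_cball])
  moreover have "w \<in> S"
    using w by (simp add: S_def)
  ultimately obtain a where a: "a \<in> S" "\<And>z. z \<in> S \<Longrightarrow> cmod a \<le> cmod z"
    using continuous_attains_inf[of S cmod] by (auto intro!: continuous_intros)
  show thesis
  proof (rule that[of a])
    show "0 < cmod a"
      using a(1) g by (auto simp: S_def)
    show "cmod a < 1" "g a = 0"
      using a(1) w by (auto simp: S_def)
    show "cmod a \<le> cmod z" if "cmod z < 1" "g z = 0" for z
    proof (cases "cmod z \<le> cmod w")
      case True
      then show ?thesis
        using a(2)[of z] that by (simp add: S_def)
    next
      case False
      then show ?thesis
        using a(1) by (simp add: S_def)
    qed
  qed
qed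

lemma factor_zero_at_origin:
  assumes f: "f holomorphic_on ball 0 1" "\<exists>z\<in>ball 0 1. f z \<noteq> 0"
  obtains m :: nat and g where "g holomorphic_on ball 0 1" "g 0 \<noteq> 0" "\<And>z. cmod z < 1 \<Longrightarrow> f z = z ^ m * g z"
proof (cases "f 0 = 0")
  case True
  have nc: "\<not> f constant_on ball 0 1"
    using True f(2) unfolding constant_on_def by (metis centre_in_ball zero_less_one)
  have "0 \<in> ball (0::complex) 1" by simp
  then obtain g r n where n: "0 < n" "0 < r" "ball 0 r \<subseteq> ball (0::complex) 1" "g holomorphic_on ball 0 r"
    and g: "\<And>w. w \<in> ball 0 r \<Longrightarrow> f w = (w - 0) ^ n * g w" "\<And>w. w \<in> ball 0 r \<Longrightarrow> g w \<noteq> 0"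
    by (rule holomorphic_factor_zero_nonconstant[OF f(1) open_ball connected_ball _ True nc]) (rule that)
  \<comment> \<open>\<open>g\<close> is known on a small ball only; away from 0 the quotient
    continues it to the whole disc.\<close>
  define h where "h z = (if z = 0 then g 0 else f z / z ^ n)" for z
  have hg: "h z = g z" if "z \<in> ball 0 r" for z
    using g(1)[OF that] by (auto simp: h_def)
  have "h holomorphic_on ball 0 r"
    using n(4) by (rule holomorphic_transform) (simp add: hg)
  moreover have "(\<lambda>z. f z / z ^ n) holomorphic_on (ball 0 1 - {0})"
    by (intro holomorphic_intros holomorphic_on_subset[OF f(1)]) auto
  then have "h holomorphic_on (ball 0 1 - {0})"
    by (rule holomorphic_transform) (auto simp: h_def)
  ultimately have "h holomorphic_on (ball 0 r \<union> (ball 0 1 - {0}))"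
    by (rule holomorphic_on_Un) auto
  then have "h holomorphic_on ball 0 1"
    by (rule holomorphic_on_subset) (use n in auto)
  then show thesis
    using n g(2)[of 0] g(1)[of 0] True by (intro that[of h n]) (auto simp: h_def power_0_left)
next
  case False
  then show thesis
    using f by (intro that[of f 0]) auto
qed

text \<open>The zeros are divided out one at a time, always one of minimal modulus. Each quotient keeps
  the bound on the logarithmic means; hence the Blaschke condition holds, so the moduli tend to
  \<open>1\<close> and every zero is removed eventually.\<close>

lemma remove_zeros:
  assumes f: "log_means_le f M" "f 0 \<noteq> 0"
  obtains K a g where "blaschke_zeros K a" "log_means_le g M" "\<And>z. cmod z < 1 \<Longrightarrow> g z \<noteq> 0"
    "\<And>z. cmod z < 1 \<Longrightarrow> f z = (\<Prod>k. blaschke_zeros.factor K a k z) * g z"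
proof -
  \<comment> \<open>One removal step. When no zero is left it returns \<open>g\<close> itself, so
    the iteration never stops and the index stays outside \<open>K\<close>.\<close>
  define P where "P g a h \<longleftrightarrow>
      (if \<exists>w. cmod w < 1 \<and> g w = 0
       then 0 < cmod a \<and> cmod a < 1 \<and> (\<forall>z. cmod z < 1 \<longrightarrow> g z = 0 \<longrightarrow> cmod a \<le> cmod z)
          \<and> (\<forall>z. cmod z < 1 \<longrightarrow> g z = blaschke_factor a z * h z) \<and> log_means_le h M \<and> h 0 \<noteq> 0
       else h = g)" for g h :: "complex \<Rightarrow> complex" and a :: complex
  have "\<exists>a h. log_means_le g M \<and> g 0 \<noteq> 0 \<longrightarrow> P g a h" for g
  proof (cases "(log_means_le g M \<and> g 0 \<noteq> 0) \<and> (\<exists>w. cmod w < 1 \<and> g w = 0)")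
    case True
    note hol = log_means_leD(1)[of g M]
    obtain a where a: "0 < cmod a" "cmod a < 1" "g a = 0" "\<And>z. cmod z < 1 \<Longrightarrow> g z = 0 \<Longrightarrow> cmod a \<le> cmod z"
      using minimal_zero[OF hol] True by metis
    obtain h where h: "h holomorphic_on ball 0 1" "\<And>z. cmod z < 1 \<Longrightarrow> g z = blaschke_factor a z * h z"
      using blaschke_factor_divides[OF hol a(1-3)] True by metis
    have "log_means_le h M"
      using True a h by (intro log_means_le_divide[OF _ h(1) continuous_on_blaschke_factor cmod_blaschke_factor_circle h(2)]) auto
    moreover have "h 0 \<noteq> 0"
      using True h(2)[of 0] by auto
    ultimately show ?thesis
      using a h True by (auto simp: P_def)
  next
    case False
    then show ?thesis
      by (auto simp: P_def)
  qed
  then obtain A H where AH: "\<And>g. log_means_le g M \<and> g 0 \<noteq> 0 \<longrightarrow> P g (A g) (H g)"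
    by metis
  define G where "G n = (H ^^ n) f" for n
  have G0: "G 0 = f" and GS: "G (Suc n) = H (G n)" for n
    by (auto simp: G_def)
  have G: "log_means_le (G n) M \<and> G n 0 \<noteq> 0" for n
  proof (induction n)
    case (Suc n)
    then show ?case
      using AH[of "G n"] by (auto simp: GS P_def split: if_splits)
  qed (simp add: f G0)
  define K where "K = {n. \<exists>w. cmod w < 1 \<and> G n w = 0}"
  define a where "a n = A (G n)" for n
  define b where "b n z = (if n \<in> K then blaschke_factor (a n) z else 1)" for n z
  have PG: "P (G n) (a n) (G (Suc n))" for n
    using AH G unfolding a_def GS by blast
  have PK: "0 < cmod (a n) \<and> cmod (a n) < 1 \<and> (\<forall>z. cmod z < 1 \<longrightarrow> G n z = 0 \<longrightarrow> cmod (a n) \<le> cmod z)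
      \<and> (\<forall>z. cmod z < 1 \<longrightarrow> G n z = blaschke_factor (a n) z * G (Suc n) z)" if "n \<in> K" for n
  proof -
    have "(\<exists>w. cmod w < 1 \<and> G n w = 0) = True"
      using that by (simp add: K_def)
    then show ?thesis
      using PG[of n] unfolding P_def by (simp only: if_True) blast
  qed
  have PN: "G (Suc n) = G n" if "n \<notin> K" for n
  proof -
    have "(\<exists>w. cmod w < 1 \<and> G n w = 0) = False"
      using that by (simp add: K_def)
    then show ?thesis
      using PG[of n] unfolding P_def by (simp only: if_False)
  qed
  have a: "0 < cmod (a n)" "cmod (a n) < 1" "\<And>z. cmod z < 1 \<Longrightarrow> G n z = 0 \<Longrightarrow> cmod (a n) \<le> cmod z" if "n \<in> K" for n
    using PK[OF that] by blast+
  have step: "G n z = b n z * G (Suc n) z" if "cmod z < 1" for n z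
    using PK[of n] PN[of n] that by (cases "n \<in> K") (simp_all add: b_def)
  have prod: "f z = (\<Prod>k<n. b k z) * G n z" if "cmod z < 1" for n z
  proof (induction n)
    case (Suc n)
    then show ?case
      by (subst (asm) step[OF that, of n]) (simp add: mult.assoc)
  qed (simp add: G0)
  define x where "x k = (if k \<in> K then 1 - cmod (a k) else 0)" for k
  have b0: "cmod (b k 0) = 1 - x k" for k
    using a(1)[of k] by (auto simp: b_def x_def blaschke_factor_0)
  have M: "cmod (G n 0) \<le> exp M" for n
  proof -
    have "(LINT \<zeta>|circle_measure. log_plus (cmod (G n (of_real 0 * \<zeta>)))) \<le> M"
      using G[of n] by (intro log_means_leD(2)) auto
    then have "log_plus (cmod (G n 0)) \<le> M" by simp
    then show ?thesis by (simp add: log_plus_le_iff)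
  qed
  \<comment> \<open>\<open>|f 0|\<close> is the product of the moduli removed so far times
    \<open>|G n 0|\<close>, and the last factor is at most \<open>exp M\<close>. So \<open>c\<close>
    bounds all partial products from below, which forces the Blaschke condition.\<close>
  define c where "c = cmod (f 0) * exp (- M)"
  have c: "0 < c" using f(2) by (simp add: c_def)
  have cle: "c \<le> (\<Prod>k<n. 1 - x k)" for n
  proof -
    have "cmod (f 0) = (\<Prod>k<n. 1 - x k) * cmod (G n 0)"
      using prod[of 0 n] by (simp add: norm_mult b0 flip: prod_norm)
    also have "\<dots> \<le> (\<Prod>k<n. 1 - x k) * exp M"
      by (intro mult_left_mono M prod_nonneg) (use a(2) in \<open>auto simp: x_def\<close>)
    finally show ?thesis
      by (simp add: c_def exp_minus field_simps)
  qed
  have x: "0 \<le> x k" "x k < 1" for k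
    using a[of k] by (auto simp: x_def)
  have "summable x"
  proof (rule summableI_nonneg_bounded[where x = "- ln c"])
    show "(\<Sum>k<n. x k) \<le> - ln c" for n
    proof -
      have "ln c \<le> ln (\<Prod>k<n. 1 - x k)"
        using c cle[of n] by simp
      also have "\<dots> = (\<Sum>k<n. ln (1 - x k))"
      proof (rule ln_prod)
        show "1 - x k \<noteq> 0" for k using x(2)[of k] by simp
      qed simp
      also have "\<dots> \<le> (\<Sum>k<n. - x k)"
      proof (rule sum_mono)
        show "ln (1 - x k) \<le> - x k" for k
          using ln_le_minus_one[of "1 - x k"] x[of k] by simp
      qed
      finally show ?thesis by (simp add: sum_negf)
    qed
  qed (rule x)
  then interpret blaschke_zeros K a
    using a unfolding x_def by unfold_locales auto
  have bf: "b = factor"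
    by (intro ext) (simp add: b_def factor_def)
  have bnd: "\<exists>B. \<forall>h\<in>range G. \<forall>z\<in>C. norm (h z) \<le> B" if C: "compact C" "C \<subseteq> ball 0 1" for C
  proof (cases "C = {}")
    case False
    then obtain w where w: "w \<in> C" "\<And>z. z \<in> C \<Longrightarrow> cmod z \<le> cmod w"
      using continuous_attains_sup[OF C(1), of cmod] by (auto intro!: continuous_intros)
    then have "cmod w < 1" using C by auto
    then have "norm (G n z) \<le> exp (2 / (1 - cmod w / ((1 + cmod w) / 2)) * M)" if "z \<in> C" for n z
      using G w(2)[OF that] by (intro log_means_le_bound) auto
    then show ?thesis by blast
  qed auto
  obtain g r where g: "g holomorphic_on ball 0 1" and r: "strict_mono (r :: nat \<Rightarrow> nat)"
    and lim: "\<And>z. z \<in> ball 0 1 \<Longrightarrow> (\<lambda>n. G (r n) z) \<longlonglongrightarrow> g z"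
    and unif: "\<And>C. compact C \<Longrightarrow> C \<subseteq> ball 0 1 \<Longrightarrow> uniform_limit C (G \<circ> r) g sequentially"
  proof (rule Montel[OF open_ball, of "range G" 0 1 G])
    show "h holomorphic_on ball 0 1" if "h \<in> range G" for h
      using that G log_means_leD(1) by blast
  qed (use bnd in blast)+
  have fg: "f z = (\<Prod>k. factor k z) * g z" if z: "cmod z < 1" for z
  proof -
    have "(\<lambda>n. (\<Prod>k<r n. factor k z) * G (r n) z) \<longlonglongrightarrow> (\<Prod>k. factor k z) * g z"
      using z by (intro tendsto_mult lim LIMSEQ_subseq_LIMSEQ[OF factors_LIMSEQ[OF z] r, unfolded o_def]) auto
    then show ?thesis
      unfolding bf[symmetric] prod[OF z, symmetric] by (simp add: LIMSEQ_const_iff)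
  qed
  have gM: "log_means_le g M"
    unfolding log_means_le_def
  proof (intro conjI g allI impI)
    fix s :: real assume s: "0 \<le> s" "s < 1"
    have cs: "cmod (of_real s * \<zeta>) < 1" if "cmod \<zeta> = 1" for \<zeta>
      using s that by (simp add: norm_mult)
    have "(\<lambda>n. LINT \<zeta>|circle_measure. log_plus (cmod (G (r n) (of_real s * \<zeta>)))) \<longlonglongrightarrow> (LINT \<zeta>|circle_measure. log_plus (cmod (g (of_real s * \<zeta>))))"
    proof (rule integral_dominated_convergence[where w = "\<lambda>_. max 0 (2 / (1 - s / ((1 + s) / 2)) * M)"])
      show "(\<lambda>\<zeta>. log_plus (cmod (g (of_real s * \<zeta>)))) \<in> borel_measurable circle_measure"
        using integrable_log_plus_dilation[OF g s] by (rule borel_measurable_integrable)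
      show "(\<lambda>\<zeta>. log_plus (cmod (G (r n) (of_real s * \<zeta>)))) \<in> borel_measurable circle_measure" for n
        using integrable_log_plus_dilation[OF log_means_leD(1) s] G by (blast intro: borel_measurable_integrable)
      show "AE \<zeta> in circle_measure. (\<lambda>n. log_plus (cmod (G (r n) (of_real s * \<zeta>)))) \<longlonglongrightarrow> log_plus (cmod (g (of_real s * \<zeta>)))"
      proof (rule AE_I2)
        fix \<zeta> assume "\<zeta> \<in> space circle_measure"
        then have l: "(\<lambda>n. G (r n) (of_real s * \<zeta>)) \<longlonglongrightarrow> g (of_real s * \<zeta>)"
          using cs by (intro lim) auto
        have "continuous_on UNIV (\<lambda>w :: complex. log_plus (cmod w))"
          by (intro continuous_on_log_plus_norm continuous_intros)
        then have "isCont (\<lambda>w :: complex. log_plus (cmod w)) (g (of_real s * \<zeta>))"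
          by (simp add: continuous_on_eq_continuous_at)
        then show "(\<lambda>n. log_plus (cmod (G (r n) (of_real s * \<zeta>)))) \<longlonglongrightarrow> log_plus (cmod (g (of_real s * \<zeta>)))"
          using isCont_tendsto_compose l by blast
      qed
      show "AE \<zeta> in circle_measure. norm (log_plus (cmod (G (r n) (of_real s * \<zeta>)))) \<le> max 0 (2 / (1 - s / ((1 + s) / 2)) * M)" for n
      proof (rule AE_I2)
        fix \<zeta> assume "\<zeta> \<in> space circle_measure"
        then have "cmod (of_real s * \<zeta>) \<le> s"
          using s by (simp add: norm_mult)
        then have "cmod (G (r n) (of_real s * \<zeta>)) \<le> exp (2 / (1 - s / ((1 + s) / 2)) * M)"
          using G s by (intro log_means_le_bound) auto
        also have "\<dots> \<le> exp (max 0 (2 / (1 - s / ((1 + s) / 2)) * M))"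
          by simp
        finally show "norm (log_plus (cmod (G (r n) (of_real s * \<zeta>)))) \<le> max 0 (2 / (1 - s / ((1 + s) / 2)) * M)"
          by (simp add: log_plus_le_iff)
      qed
    qed simp
    then show "(LINT \<zeta>|circle_measure. log_plus (cmod (g (of_real s * \<zeta>)))) \<le> M"
      by (rule LIMSEQ_le_const2) (use G s in \<open>auto intro!: log_means_leD(2)\<close>)
  qed
  \<comment> \<open>Hurwitz's theorem. By minimality every zero of \<open>G k\<close> has modulus at
    least \<open>1 - x k\<close>, and \<open>x k\<close> tends to 0, so the late quotients have no
    zeros in a given smaller disc.\<close>
  have gnz: "g z \<noteq> 0" if z: "cmod z < 1" for z
  proof -
    define \<rho> where "\<rho> = (1 + cmod z) / 2"
    have \<rho>: "cmod z < \<rho>" "0 < \<rho>" "\<rho> < 1"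
      using z by (simp_all add: \<rho>_def add_pos_nonneg)
    have g0: "g 0 \<noteq> 0"
      using fg[of 0] f(2) by auto
    have "\<forall>\<^sub>F k in sequentially. x k < 1 - \<rho>"
      using \<rho> by (intro order_tendstoD(2)[OF summable_LIMSEQ_zero[OF \<open>summable x\<close>]]) auto
    then obtain N where N: "\<And>k. k \<ge> N \<Longrightarrow> x k < 1 - \<rho>"
      by (auto simp: eventually_sequentially)
    have nz: "G k w \<noteq> 0" if "k \<ge> N" "w \<in> ball 0 \<rho>" for k w
    proof
      assume w: "G k w = 0"
      have "cmod w < 1" using that \<rho> by auto
      then have k: "k \<in> K" using w by (auto simp: K_def)
      then show False
        using N[OF that(1)] a(3)[OF k \<open>cmod w < 1\<close> w] that by (simp add: x_def)
    qed
    have sub: "ball 0 \<rho> \<subseteq> ball 0 (1::real)"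
      using \<rho> by auto
    show ?thesis
    proof (cases "g constant_on ball 0 \<rho>")
      case True
      then have "g z = g 0"
        using \<rho> unfolding constant_on_def by (metis centre_in_ball mem_ball_0)
      then show ?thesis using g0 by simp
    next
      case False
      show ?thesis
      proof (rule Hurwitz_no_zeros[OF open_ball connected_ball _ holomorphic_on_subset[OF g sub] _ False])
        show "(\<lambda>n. G (r (n + N))) n holomorphic_on ball 0 \<rho>" for n
          using G log_means_leD(1) sub by (blast intro: holomorphic_on_subset)
        show "uniform_limit C (\<lambda>n. G (r (n + N))) g sequentially" if "compact C" "C \<subseteq> ball 0 \<rho>" for C
          using filterlim_compose[OF unif[OF that(1) order_trans[OF that(2) sub]] filterlim_add_const_nat_at_top[of N]]
          by (simp add: o_def)
        show "G (r (n + N)) w \<noteq> 0" if "w \<in> ball 0 \<rho>" for n w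
          using nz[OF _ that, of "r (n + N)"] seq_suble[OF r, of "n + N"] by simp
        show "z \<in> ball 0 \<rho>" using \<rho> by simp
      qed
    qed
  qed
  show thesis
    by (rule that[OF blaschke_zeros_axioms gM gnz fg])
qed

section \<open>The Herglotz representation\<close>

text \<open>Helly selection on the line: divided by \<open>C\<close>, the densities become
  probability measures carried by \<open>[0, 2 pi]\<close>, a tight sequence. A weak limit
  \<open>P\<close> is wrapped back onto the circle by \<open>cis\<close> and multiplied by
  \<open>C\<close>.\<close>

lemma circle_density_compactness:
  assumes d: "\<And>n. continuous_on (sphere 0 1) (d n)" "\<And>n \<zeta>. \<zeta> \<in> sphere 0 1 \<Longrightarrow> 0 \<le> d n \<zeta>"
    and C: "\<And>n. (LINT \<zeta>|circle_measure. d n \<zeta>) = C" "0 < C"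
  obtains r m where "strict_mono (r :: nat \<Rightarrow> nat)" "circle_borel_measure m"
    "\<And>\<psi> :: complex \<Rightarrow> complex. continuous_on (sphere 0 1) \<psi> \<Longrightarrow>
      (\<lambda>n. LINT \<zeta>|circle_measure. d (r n) \<zeta> *\<^sub>R \<psi> \<zeta>) \<longlonglongrightarrow> (LINT \<zeta>|m. \<psi> \<zeta>)"
proof -
  let ?U = "uniform_measure lborel {0..2 * pi}"
  have cc: "continuous_on UNIV (\<lambda>t. g (cis t))" if "continuous_on (sphere 0 1) g" for g :: "complex \<Rightarrow> 'b::topological_space"
    by (intro continuous_on_compose2[OF that] continuous_intros) auto
  have mc: "(\<lambda>t. g (cis t)) \<in> borel_measurable borel" if "continuous_on (sphere 0 1) g" for g :: "complex \<Rightarrow> 'b::topological_space"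
    by (rule borel_measurable_continuous_onI[OF cc[OF that]])
  note [measurable] = mc[OF d(1)]
  have gm: "g \<in> borel_measurable (restrict_space borel (sphere 0 1))" if "continuous_on (sphere 0 1) g" for g :: "complex \<Rightarrow> 'b::topological_space"
    by (rule borel_measurable_continuous_on_restrict[OF that])
  define N where "N n = density ?U (\<lambda>t. ennreal (d n (cis t) / C))" for n
  have int: "(LINT t|N n. \<psi> (cis t)) = (LINT \<zeta>|circle_measure. (d n \<zeta> / C) *\<^sub>R \<psi> \<zeta>)"
    if "continuous_on (sphere 0 1) \<psi>" for n and \<psi> :: "complex \<Rightarrow> complex"
  proof -
    note [measurable] = mc[OF that]
    have "(LINT t|N n. \<psi> (cis t)) = (LINT t|?U. (d n (cis t) / C) *\<^sub>R \<psi> (cis t))"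
      unfolding N_def using d(2) C(2) by (intro integral_density) auto
    also have "\<dots> = (LINT \<zeta>|circle_measure. (d n \<zeta> / C) *\<^sub>R \<psi> \<zeta>)"
      unfolding circle_measure_def
      by (rule integral_distr[symmetric]) (auto intro!: gm continuous_intros d that simp: C(2) less_imp_neq[symmetric])
    finally show ?thesis .
  qed
  have tot: "(\<integral>\<^sup>+t. ennreal (d n (cis t) / C) \<partial>?U) = 1" for n
  proof -
    have "(\<integral>\<^sup>+t. ennreal (d n (cis t) / C) \<partial>?U) = (\<integral>\<^sup>+\<zeta>. ennreal (d n \<zeta> / C) \<partial>circle_measure)"
      unfolding circle_measure_def
      by (rule nn_integral_distr[symmetric]) (auto intro!: measurable_compose[OF gm measurable_ennreal] continuous_intros d simp: C(2) less_imp_neq[symmetric])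
    also have "\<dots> = ennreal (LINT \<zeta>|circle_measure. d n \<zeta> / C)"
      using d C(2) by (intro nn_integral_eq_integral circle_continuous_integrable[OF circle_borel_circle_measure] continuous_intros AE_I2) auto
    finally show ?thesis
      using C by simp
  qed
  have N1: "emeasure (N n) {-1<..7} = 1" "emeasure (N n) (space (N n)) = 1" for n
  proof -
    have ae: "AE t in ?U. t \<in> {0..2 * pi}"
      by (rule AE_uniform_measureI) auto
    have "(\<integral>\<^sup>+t. ennreal (d n (cis t) / C) * indicator {-1<..7} t \<partial>?U) = (\<integral>\<^sup>+t. ennreal (d n (cis t) / C) \<partial>?U)"
    proof (rule nn_integral_cong_AE)
      have "2 * pi \<le> 7" using pi_approx by simp
      then show "AE t in ?U. ennreal (d n (cis t) / C) * indicator {-1<..7} t = ennreal (d n (cis t) / C)"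
        by (intro AE_mp[OF ae AE_I2]) (auto simp: indicator_def)
    qed
    then show "emeasure (N n) {-1<..7} = 1"
      unfolding N_def by (subst emeasure_density) (auto simp: tot)
    show "emeasure (N n) (space (N n)) = 1"
      unfolding N_def by (subst emeasure_density) (auto simp: tot)
  qed
  have prob: "prob_space (N n)" for n
    by (rule prob_spaceI) (rule N1)
  have rd: "real_distribution (N n)" for n
    using prob[of n] by (auto simp: real_distribution_def real_distribution_axioms_def N_def)
  have tight: "tight N"
    unfolding tight_def
  proof (intro conjI allI impI rd)
    fix e :: real assume e: "0 < e"
    have "measure (N n) {-1<..7} = 1" for n
      using N1(1)[of n] by (simp add: measure_def)
    then show "\<exists>a b. a < b \<and> (\<forall>n. 1 - e < measure (N n) {a<..b})"
      using e by (intro exI[of _ "-1"] exI[of _ 7]) auto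
  qed
  obtain r P where r: "strict_mono (r :: nat \<Rightarrow> nat)" and P: "real_distribution P" and wc: "weak_conv_m (N \<circ> id \<circ> r) P"
    using tight_imp_convergent_subsubsequence[OF tight strict_mono_id] by auto
  interpret P: real_distribution P by fact
  define m where "m = density (distr P (restrict_space borel (sphere 0 1)) cis) (\<lambda>_. ennreal C)"
  have pd: "prob_space (distr P (restrict_space borel (sphere 0 1)) cis)"
    by (rule P.prob_space_distr) simp
  show thesis
  proof (rule that[OF r])
    have "emeasure (density (distr P (restrict_space borel (sphere 0 1)) cis) (\<lambda>_. ennreal C)) (sphere 0 1)
        = ennreal C * emeasure (distr P (restrict_space borel (sphere 0 1)) cis) (sphere 0 1)"
      using sets.top[of circle_measure] by (intro emeasure_density_const) simp
    then have "emeasure m (space m) < \<infinity>"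
      unfolding m_def using prob_space.emeasure_space_1[OF pd]
      by (simp add: space_restrict_space)
    then show "circle_borel_measure m"
      unfolding circle_borel_measure_def by (auto simp: m_def intro!: finite_measureI)
    fix \<psi> :: "complex \<Rightarrow> complex" assume \<psi>: "continuous_on (sphere 0 1) \<psi>"
    obtain B where B: "\<And>x. x \<in> sphere 0 1 \<Longrightarrow> norm (\<psi> x) \<le> B"
      using continuous_on_compact_bound[OF compact_sphere \<psi>] by blast
    have "(\<lambda>n. LINT t|(N \<circ> id \<circ> r) n. \<psi> (cis t)) \<longlonglongrightarrow> (LINT t|P. \<psi> (cis t))"
    proof (rule weak_conv_imp_integral_bdd_continuous_conv[OF _ P wc])
      show "real_distribution ((N \<circ> id \<circ> r) n)" for n by (simp add: rd)
      show "isCont (\<lambda>t. \<psi> (cis t)) t" for t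
        using cc[OF \<psi>] by (simp add: continuous_on_eq_continuous_at)
      show "norm (\<psi> (cis t)) \<le> B" for t by (rule B) simp
    qed
    then have "(\<lambda>n. C *\<^sub>R (LINT \<zeta>|circle_measure. (d (r n) \<zeta> / C) *\<^sub>R \<psi> \<zeta>)) \<longlonglongrightarrow> C *\<^sub>R (LINT t|P. \<psi> (cis t))"
      by (intro tendsto_intros) (simp add: int[OF \<psi>])
    also have "(\<lambda>n. C *\<^sub>R (LINT \<zeta>|circle_measure. (d (r n) \<zeta> / C) *\<^sub>R \<psi> \<zeta>)) = (\<lambda>n. LINT \<zeta>|circle_measure. d (r n) \<zeta> *\<^sub>R \<psi> \<zeta>)"
      using C(2) by (simp flip: integral_scaleR_right)
    also have "C *\<^sub>R (LINT t|P. \<psi> (cis t)) = (LINT \<zeta>|m. \<psi> \<zeta>)"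
    proof -
      have "(LINT \<zeta>|m. \<psi> \<zeta>) = (LINT \<zeta>|distr P (restrict_space borel (sphere 0 1)) cis. C *\<^sub>R \<psi> \<zeta>)"
        unfolding m_def using C(2) gm[OF \<psi>] by (intro integral_density) auto
      also have "\<dots> = (LINT t|P. C *\<^sub>R \<psi> (cis t))"
        using gm[OF \<psi>] by (intro integral_distr) auto
      finally show ?thesis by simp
    qed
    finally show "(\<lambda>n. LINT \<zeta>|circle_measure. d (r n) \<zeta> *\<^sub>R \<psi> \<zeta>) \<longlonglongrightarrow> (LINT \<zeta>|m. \<psi> \<zeta>)" .
  qed
qed

text \<open>The Schwarz formula writes each dilation of \<open>G\<close> as a Herglotz integral of
  its boundary real part \<open>u n\<close>. The positive and negative parts of \<open>u n\<close>
  have bounded mass, and their weak limits represent \<open>G\<close>.\<close>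

lemma herglotz_representation:
  assumes G: "G holomorphic_on ball 0 1"
    and M: "\<And>r. 0 \<le> r \<Longrightarrow> r < 1 \<Longrightarrow> (LINT \<zeta>|circle_measure. max 0 (Re (G (of_real r * \<zeta>)))) \<le> M"
  obtains p q where "circle_borel_measure p" "circle_borel_measure q"
    "\<And>z. cmod z < 1 \<Longrightarrow> G z = \<i> * of_real (Im (G 0)) + herglotz p z - herglotz q z"
proof -
  define r where "r n = 1 - 1 / real (n + 1)" for n :: nat
  have r: "0 \<le> r n" "r n < 1" for n
    by (auto simp: r_def)
  have rlim: "r \<longlonglongrightarrow> 1"
    unfolding r_def by real_asymp
  define u where "u n \<zeta> = Re (G (of_real (r n) * \<zeta>))" for n \<zeta>
  note K = circle_continuous_integrable[OF circle_borel_circle_measure]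
  note hol = dilation_holomorphic[OF G r]
  have cu: "continuous_on (sphere 0 1) (u n)" for n
    unfolding u_def by (intro continuous_intros continuous_on_subset[OF hol(1)]) auto
  have mu: "(LINT \<zeta>|circle_measure. u n \<zeta>) = Re (G 0)" for n
    unfolding u_def using circle_mean_value_Re[OF hol] by simp
  define m where "m n = (LINT \<zeta>|circle_measure. max 0 (u n \<zeta>))" for n
  have m: "m n \<le> M" for n
    unfolding m_def u_def by (rule M[OF r])
  have m': "(LINT \<zeta>|circle_measure. max 0 (- u n \<zeta>)) = m n - Re (G 0)" for n
  proof -
    have "(LINT \<zeta>|circle_measure. max 0 (- u n \<zeta>)) = (LINT \<zeta>|circle_measure. max 0 (u n \<zeta>) - u n \<zeta>)"
      by (intro Bochner_Integration.integral_cong) auto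
    also have "\<dots> = m n - Re (G 0)"
      unfolding m_def mu[of n, symmetric]
      by (intro Bochner_Integration.integral_diff K continuous_intros cu)
    finally show ?thesis .
  qed
  \<comment> \<open>The constant added to both parts cancels in their difference; it fixes the
    masses at \<open>M + 1\<close> and \<open>M + 1 - Re (G 0)\<close>, as the compactness lemma
    requires, and keeps them positive.\<close>
  define dp where "dp n \<zeta> = max 0 (u n \<zeta>) + (M + 1 - m n)" for n \<zeta>
  define dq where "dq n \<zeta> = max 0 (- u n \<zeta>) + (M + 1 - m n)" for n \<zeta>
  have cd: "continuous_on (sphere 0 1) (dp n)" "continuous_on (sphere 0 1) (dq n)" for n
    unfolding dp_def dq_def by (intro continuous_intros cu)+
  have pos: "1 \<le> dp n \<zeta>" "1 \<le> dq n \<zeta>" for n \<zeta>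
    using m[of n] by (auto simp: dp_def dq_def)
  then have pos0: "0 \<le> dp n \<zeta>" "0 \<le> dq n \<zeta>" for n \<zeta>
    by (meson order_trans zero_le_one)+
  have Ip: "(LINT \<zeta>|circle_measure. dp n \<zeta>) = M + 1" for n
    unfolding dp_def by (subst Bochner_Integration.integral_add)
      (auto intro!: K continuous_intros cu simp: m_def)
  have Iq: "(LINT \<zeta>|circle_measure. dq n \<zeta>) = M + 1 - Re (G 0)" for n
    unfolding dq_def by (subst Bochner_Integration.integral_add)
      (auto intro!: K continuous_intros cu simp: m')
  have ge: "1 \<le> (LINT \<zeta>|circle_measure. g \<zeta>)" if "continuous_on (sphere 0 1) g" "\<And>\<zeta>. 1 \<le> g \<zeta>" for g :: "complex \<Rightarrow> real"
    using integral_mono[OF _ K[OF that(1)], of "\<lambda>_. 1"] that(2) by simp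
  have C: "0 < M + 1" "0 < M + 1 - Re (G 0)"
    using ge[OF cd(1) pos(1)[of 0]] ge[OF cd(2) pos(2)[of 0]] unfolding Ip Iq by auto
  obtain s p where s: "strict_mono (s :: nat \<Rightarrow> nat)" and p: "circle_borel_measure p"
    and plim: "\<And>\<psi> :: complex \<Rightarrow> complex. continuous_on (sphere 0 1) \<psi> \<Longrightarrow>
      (\<lambda>n. LINT \<zeta>|circle_measure. dp (s n) \<zeta> *\<^sub>R \<psi> \<zeta>) \<longlonglongrightarrow> (LINT \<zeta>|p. \<psi> \<zeta>)"
    by (rule circle_density_compactness[of dp, OF cd(1) pos0(1) Ip C(1)]) (rule that)
  obtain t q where t: "strict_mono (t :: nat \<Rightarrow> nat)" and q: "circle_borel_measure q"
    and qlim: "\<And>\<psi> :: complex \<Rightarrow> complex. continuous_on (sphere 0 1) \<psi> \<Longrightarrow>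
      (\<lambda>n. LINT \<zeta>|circle_measure. dq (s (t n)) \<zeta> *\<^sub>R \<psi> \<zeta>) \<longlonglongrightarrow> (LINT \<zeta>|q. \<psi> \<zeta>)"
    by (rule circle_density_compactness[of "\<lambda>n. dq (s n)", OF cd(2) pos0(2) Iq C(2)]) (rule that)
  show thesis
  proof (rule that[OF p q])
    fix z :: complex assume z: "cmod z < 1"
    have ck: "continuous_on (sphere 0 1) (herglotz_kernel z)"
      by (rule continuous_herglotz_kernel[OF z])
    have "(\<lambda>n. (LINT \<zeta>|circle_measure. dp (s (t n)) \<zeta> *\<^sub>R herglotz_kernel z \<zeta>) - (LINT \<zeta>|circle_measure. dq (s (t n)) \<zeta> *\<^sub>R herglotz_kernel z \<zeta>))
        \<longlonglongrightarrow> herglotz p z - herglotz q z"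
      unfolding herglotz_def
      by (intro tendsto_diff qlim ck LIMSEQ_subseq_LIMSEQ[OF plim[OF ck] t, unfolded o_def])
    moreover have "(LINT \<zeta>|circle_measure. dp n \<zeta> *\<^sub>R herglotz_kernel z \<zeta>) - (LINT \<zeta>|circle_measure. dq n \<zeta> *\<^sub>R herglotz_kernel z \<zeta>)
        = G (of_real (r n) * z) - \<i> * of_real (Im (G 0))" for n
    proof -
      have "(LINT \<zeta>|circle_measure. dp n \<zeta> *\<^sub>R herglotz_kernel z \<zeta>) - (LINT \<zeta>|circle_measure. dq n \<zeta> *\<^sub>R herglotz_kernel z \<zeta>)
          = (LINT \<zeta>|circle_measure. dp n \<zeta> *\<^sub>R herglotz_kernel z \<zeta> - dq n \<zeta> *\<^sub>R herglotz_kernel z \<zeta>)"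
        by (intro Bochner_Integration.integral_diff[symmetric] K continuous_intros cd ck)
      also have "\<dots> = (LINT \<zeta>|circle_measure. herglotz_kernel z \<zeta> * of_real (u n \<zeta>))"
      proof (intro Bochner_Integration.integral_cong refl)
        fix \<zeta>
        have "dp n \<zeta> - dq n \<zeta> = u n \<zeta>"
          by (simp add: dp_def dq_def max_def)
        then show "dp n \<zeta> *\<^sub>R herglotz_kernel z \<zeta> - dq n \<zeta> *\<^sub>R herglotz_kernel z \<zeta> = herglotz_kernel z \<zeta> * of_real (u n \<zeta>)"
          by (metis mult.commute scaleR_conv_of_real scaleR_left_diff_distrib)
      qed
      also have "\<dots> = G (of_real (r n) * z) - \<i> * of_real (Im (G 0))"
        unfolding u_def using schwarz_formula[OF hol z] by simp
      finally show ?thesis .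
    qed
    ultimately have "(\<lambda>n. G (of_real (r (s (t n))) * z) - \<i> * of_real (Im (G 0))) \<longlonglongrightarrow> herglotz p z - herglotz q z"
      by simp
    moreover have "(\<lambda>n. G (of_real (r (s (t n))) * z) - \<i> * of_real (Im (G 0))) \<longlonglongrightarrow> G (of_real 1 * z) - \<i> * of_real (Im (G 0))"
    proof (intro tendsto_intros isCont_tendsto_compose[of _ G])
      show "isCont G (of_real 1 * z)"
        using z continuous_on_interior[OF holomorphic_on_imp_continuous_on[OF G]] by simp
      have "(\<lambda>n. r (s (t n))) \<longlonglongrightarrow> 1"
        using LIMSEQ_subseq_LIMSEQ[OF LIMSEQ_subseq_LIMSEQ[OF rlim s] t] by (simp add: o_def)
      then show "(\<lambda>n. r (s (t n))) \<longlonglongrightarrow> 1" .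
    qed
    ultimately have "G z - \<i> * of_real (Im (G 0)) = herglotz p z - herglotz q z"
      using LIMSEQ_unique by fastforce
    then show "G z = \<i> * of_real (Im (G 0)) + herglotz p z - herglotz q z"
      by (simp add: algebra_simps)
  qed
qed

section \<open>Existence of the canonical factorization\<close>

lemma real_density_exists:
  assumes t: "circle_borel_measure t" and m: "circle_borel_measure m"
    and ac: "\<And>A. A \<in> sets circle_measure \<Longrightarrow> emeasure t A = 0 \<Longrightarrow> measure m A = 0"
  obtains s :: "complex \<Rightarrow> real" where "s \<in> borel_measurable circle_measure" "\<And>\<zeta>. 0 \<le> s \<zeta>"
    "m = density t (\<lambda>\<zeta>. ennreal (s \<zeta>))" "integrable t s"
proof -
  interpret t: finite_measure t by (rule circle_borelD(2)[OF t])
  interpret m: finite_measure m by (rule circle_borelD(2)[OF m])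
  have st: "sets t = sets circle_measure" "sets m = sets t"
    using circle_borelD(1)[OF t] circle_borelD(1)[OF m] by auto
  have mt: "measurable t N = measurable circle_measure N" for N :: "'c measure"
    by (rule circle_borel_measurable_cong[OF t])
  have "absolutely_continuous t m"
    unfolding absolutely_continuous_def
  proof
    fix A assume A: "A \<in> null_sets t"
    then have "emeasure m A = 0"
      using ac[of A] st by (auto simp: null_sets_def m.emeasure_eq_measure)
    then show "A \<in> null_sets m"
      using A st by (auto simp: null_sets_def)
  qed
  then obtain f where f: "f \<in> borel_measurable t" "density t f = m"
    using t.Radon_Nikodym st(2) by blast
  have "emeasure m (space t) = (\<integral>\<^sup>+x. f x * indicator (space t) x \<partial>t)"
    unfolding f(2)[symmetric] by (rule emeasure_density[OF f(1)]) simp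
  also have "\<dots> = (\<integral>\<^sup>+x. f x \<partial>t)"
    by (intro nn_integral_cong) simp
  finally have "(\<integral>\<^sup>+x. f x \<partial>t) = emeasure m (space t)"
    by simp
  then have fin: "(\<integral>\<^sup>+x. f x \<partial>t) < \<infinity>"
    using m.emeasure_finite[of "space t"] by (simp add: less_top[symmetric])
  then have ae: "AE x in t. f x \<noteq> \<infinity>"
    using nn_integral_noteq_infinite[OF f(1)] by simp
  have eq: "AE x in t. f x = ennreal (enn2real (f x))"
    using ae by eventually_elim (simp add: top.not_eq_extremum)
  show thesis
  proof (rule that[of "\<lambda>x. enn2real (f x)"])
    show m1: "(\<lambda>x. enn2real (f x)) \<in> borel_measurable circle_measure"
      using f(1) unfolding mt by measurable
    show "m = density t (\<lambda>x. ennreal (enn2real (f x)))"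
      unfolding f(2)[symmetric] using f(1) eq by (intro density_cong) auto
    show "integrable t (\<lambda>x. enn2real (f x))"
    proof (rule integrableI_bounded)
      show "(\<lambda>x. enn2real (f x)) \<in> borel_measurable t"
        using m1 unfolding mt .
      have "(\<integral>\<^sup>+x. ennreal (norm (enn2real (f x))) \<partial>t) = (\<integral>\<^sup>+x. f x \<partial>t)"
        using eq by (intro nn_integral_cong_AE) (auto elim!: eventually_mono)
      then show "(\<integral>\<^sup>+x. ennreal (norm (enn2real (f x))) \<partial>t) < \<infinity>"
        using fin by simp
    qed
  qed simp
qed

text \<open>All three measures have densities with respect to a common finite measure \<open>t\<close>; the absolutely
  continuous part lives where the density \<open>s\<close> of arc length is positive, the singular parts on \<open>{s = 0}\<close>.\<close>

lemma herglotz_difference_decomposition: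
  assumes p: "circle_borel_measure p" and q: "circle_borel_measure q"
  obtains a \<mu> \<nu> where "integrable circle_measure a" "singular_circle_measure \<mu>" "singular_circle_measure \<nu>"
    "mutually_singular \<mu> \<nu>"
    "\<And>z. cmod z < 1 \<Longrightarrow> herglotz p z - herglotz q z
      = (LINT \<zeta>|circle_measure. herglotz_kernel z \<zeta> * of_real (a \<zeta>)) + herglotz \<nu> z - herglotz \<mu> z"
proof -
  \<comment> \<open>A finite measure dominating all three is wanted; the supremum is finite because
    it is at most the sum.\<close>
  define t0 where "t0 = sup_measure' p q"
  define t where "t = sup_measure' circle_measure t0"
  have sp: "sets q = sets p" "sets p = sets circle_measure"
    using circle_borelD(1)[OF p] circle_borelD(1)[OF q] by auto
  have st0: "sets t0 = sets circle_measure" "space t0 = sphere 0 1"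
    using sp circle_borelD(3)[OF p] by (auto simp: t0_def)
  have st: "sets t = sets circle_measure" "space t = sphere 0 1"
    using st0 by (auto simp: t_def)
  have ge: "emeasure circle_measure A \<le> emeasure t A" "emeasure p A \<le> emeasure t A" "emeasure q A \<le> emeasure t A"
    if "A \<in> sets circle_measure" for A
  proof -
    show "emeasure circle_measure A \<le> emeasure t A"
      unfolding t_def using st0 that by (intro le_emeasure_sup_measure'1) auto
    have "emeasure t0 A \<le> emeasure t A"
      unfolding t_def using st0 that by (intro le_emeasure_sup_measure'2) auto
    moreover have "emeasure p A \<le> emeasure t0 A" "emeasure q A \<le> emeasure t0 A"
      unfolding t0_def using sp that by (intro le_emeasure_sup_measure'1 le_emeasure_sup_measure'2; simp)+
    ultimately show "emeasure p A \<le> emeasure t A" "emeasure q A \<le> emeasure t A"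
      by (auto intro: order_trans)
  qed
  have sum: "emeasure (sup_measure' A B) X \<le> emeasure A X + emeasure B X"
    if "sets B = sets A" "X \<in> sets A" for A B :: "complex measure" and X
    unfolding emeasure_sup_measure'[OF that]
  proof (rule SUP_least)
    fix Y assume Y: "Y \<in> sets A"
    have "X - Y \<in> sets B" using that Y by auto
    moreover have "X \<inter> - Y = X - Y" by auto
    ultimately show "emeasure A (X \<inter> Y) + emeasure B (X \<inter> - Y) \<le> emeasure A X + emeasure B X"
      using that Y by (intro add_mono emeasure_mono) auto
  qed
  have t: "circle_borel_measure t"
  proof -
    have S: "sphere 0 1 \<in> sets circle_measure"
      using sets.top[of circle_measure] by simp
    have "emeasure t (sphere 0 1) \<le> emeasure circle_measure (sphere 0 1) + emeasure t0 (sphere 0 1)"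
      unfolding t_def using st0 S by (intro sum) auto
    also have "emeasure t0 (sphere 0 1) \<le> emeasure p (sphere 0 1) + emeasure q (sphere 0 1)"
      unfolding t0_def using sp S by (intro sum) auto
    finally have "emeasure t (sphere 0 1) \<le> emeasure circle_measure (sphere 0 1) + (emeasure p (sphere 0 1) + emeasure q (sphere 0 1))"
      by (simp add: add_left_mono)
    also have "\<dots> < \<infinity>"
      using finite_measure.emeasure_finite[OF circle_borelD(2)[OF p]] finite_measure.emeasure_finite[OF circle_borelD(2)[OF q]]
        circle.emeasure_finite by (simp add: top.not_eq_extremum[symmetric])
    finally show ?thesis
      unfolding circle_borel_measure_def using st by (auto intro!: finite_measureI)
  qed
  interpret t: finite_measure t by (rule circle_borelD(2)[OF t])
  have mt: "measurable t N = measurable circle_measure N" for N :: "'c measure"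
    by (rule circle_borel_measurable_cong[OF t])
  have ac: "measure circle_measure A = 0" "measure p A = 0" "measure q A = 0"
    if "A \<in> sets circle_measure" "emeasure t A = 0" for A
    using ge[OF that(1)] that(2) by (simp_all add: measure_def)
  obtain s where s: "s \<in> borel_measurable circle_measure" "\<And>\<zeta>. 0 \<le> s \<zeta>" "circle_measure = density t (\<lambda>\<zeta>. ennreal (s \<zeta>))" "integrable t s"
    by (rule real_density_exists[OF t circle_borel_circle_measure ac(1)]) (assumption | rule that)+
  obtain b where b: "b \<in> borel_measurable circle_measure" "\<And>\<zeta>. 0 \<le> b \<zeta>" "p = density t (\<lambda>\<zeta>. ennreal (b \<zeta>))" "integrable t b"
    by (rule real_density_exists[OF t p ac(2)]) (assumption | rule that)+
  obtain c where c: "c \<in> borel_measurable circle_measure" "\<And>\<zeta>. 0 \<le> c \<zeta>" "q = density t (\<lambda>\<zeta>. ennreal (c \<zeta>))" "integrable t c"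
    by (rule real_density_exists[OF t q ac(3)]) (assumption | rule that)+
  have [measurable]: "s \<in> borel_measurable t" "b \<in> borel_measurable t" "c \<in> borel_measurable t"
    using s b c by (auto simp: mt)
  define a where "a \<zeta> = (if s \<zeta> = 0 then 0 else (b \<zeta> - c \<zeta>) / s \<zeta>)" for \<zeta>
  define u where "u \<zeta> = (if s \<zeta> = 0 then max 0 (b \<zeta> - c \<zeta>) else 0)" for \<zeta>
  define v where "v \<zeta> = (if s \<zeta> = 0 then max 0 (c \<zeta> - b \<zeta>) else 0)" for \<zeta>
  have [measurable]: "a \<in> borel_measurable t" "u \<in> borel_measurable t" "v \<in> borel_measurable t"
    unfolding a_def u_def v_def by measurable
  have eq: "b \<zeta> - c \<zeta> = s \<zeta> * a \<zeta> + u \<zeta> - v \<zeta>" for \<zeta>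
    by (auto simp: a_def u_def v_def)
  have bd: "\<bar>s \<zeta> * a \<zeta>\<bar> \<le> b \<zeta> + c \<zeta>" "\<bar>u \<zeta>\<bar> \<le> b \<zeta> + c \<zeta>" "\<bar>v \<zeta>\<bar> \<le> b \<zeta> + c \<zeta>" for \<zeta>
    using b(2)[of \<zeta>] c(2)[of \<zeta>] by (auto simp: a_def u_def v_def)
  have bc: "integrable t (\<lambda>\<zeta>. b \<zeta> + c \<zeta>)"
    by (intro Bochner_Integration.integrable_add b c)
  have I: "integrable t (\<lambda>\<zeta>. s \<zeta> * a \<zeta>)" "integrable t u" "integrable t v"
    using bd b(2) c(2) by (auto intro!: Bochner_Integration.integrable_bound[OF bc])
  have uv: "0 \<le> u \<zeta>" "0 \<le> v \<zeta>" for \<zeta>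
    by (auto simp: u_def v_def)
  have ia: "integrable circle_measure a"
    by (subst s(3), subst integrable_density) (use I s(2) in auto)
  define \<nu> \<mu> where "\<nu> = density t (\<lambda>\<zeta>. ennreal (u \<zeta>))" and "\<mu> = density t (\<lambda>\<zeta>. ennreal (v \<zeta>))"
  have dens: "circle_borel_measure (density t (\<lambda>\<zeta>. ennreal (w \<zeta>)))" if "integrable t w" "\<And>\<zeta>. 0 \<le> w \<zeta>" for w
  proof -
    have [measurable]: "w \<in> borel_measurable t"
      using that by auto
    have "emeasure (density t (\<lambda>\<zeta>. ennreal (w \<zeta>))) (space t) = (\<integral>\<^sup>+\<zeta>. ennreal (w \<zeta>) * indicator (space t) \<zeta> \<partial>t)"
      by (rule emeasure_density) auto
    also have "\<dots> = (\<integral>\<^sup>+\<zeta>. ennreal (w \<zeta>) \<partial>t)"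
      by (intro nn_integral_cong) auto
    also have "\<dots> = ennreal (LINT \<zeta>|t. w \<zeta>)"
      using that by (intro nn_integral_eq_integral) auto
    finally show ?thesis
      unfolding circle_borel_measure_def using st by (auto intro!: finite_measureI)
  qed
  have circ: "circle_borel_measure \<nu>" "circle_borel_measure \<mu>"
    unfolding \<nu>_def \<mu>_def by (intro dens I uv)+
  have null: "emeasure (density t (\<lambda>\<zeta>. ennreal (w \<zeta>))) A = 0"
    if [measurable]: "w \<in> borel_measurable t" and A: "A \<in> sets t" "\<And>\<zeta>. \<zeta> \<in> A \<Longrightarrow> w \<zeta> = 0" for w :: "complex \<Rightarrow> real" and A
  proof -
    have "emeasure (density t (\<lambda>\<zeta>. ennreal (w \<zeta>))) A = (\<integral>\<^sup>+\<zeta>. ennreal (w \<zeta>) * indicator A \<zeta> \<partial>t)"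
      using A by (intro emeasure_density) auto
    also have "\<dots> = (\<integral>\<^sup>+\<zeta>. 0 \<partial>t)"
      using A by (intro nn_integral_cong) (auto simp: indicator_def)
    finally show ?thesis by simp
  qed
  define A where "A = {\<zeta> \<in> space t. s \<zeta> \<noteq> 0}"
  have A: "A \<in> sets t" unfolding A_def by measurable
  have A': "space t - A \<in> sets t" using A by auto
  have "emeasure (density t (\<lambda>\<zeta>. ennreal (s \<zeta>))) (space t - A) = 0"
    by (rule null[OF _ A']) (auto simp: A_def)
  then have sA: "emeasure circle_measure (space circle_measure - A) = 0"
    unfolding s(3)[symmetric] by (simp add: st)
  have uA: "emeasure \<nu> A = 0" "emeasure \<mu> A = 0"
    unfolding \<nu>_def \<mu>_def by (rule null[OF _ A]; simp add: A_def u_def v_def)+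
  have sets_\<nu>\<mu>: "A \<in> sets \<nu>" "A \<in> sets \<mu>"
    using A by (simp_all add: \<nu>_def \<mu>_def)
  have sing: "singular_circle_measure \<nu>" "singular_circle_measure \<mu>"
    unfolding singular_circle_measure_def mutually_singular_def
    using circ sA uA sets_\<nu>\<mu> by blast+
  \<comment> \<open>The sign of \<open>b - c\<close> separates \<open>\<mu>\<close> from
    \<open>\<nu>\<close>.\<close>
  define D where "D = {\<zeta> \<in> space t. c \<zeta> \<le> b \<zeta>}"
  have D: "D \<in> sets t" unfolding D_def by measurable
  have "emeasure \<mu> D = 0"
    unfolding \<mu>_def by (rule null[OF _ D]) (auto simp: D_def v_def)
  moreover have "emeasure \<nu> (space t - D) = 0"
    unfolding \<nu>_def by (rule null) (use D in \<open>auto simp: D_def u_def\<close>)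
  moreover have "D \<in> sets \<mu>" "space \<nu> = space t"
    using D by (auto simp: \<mu>_def \<nu>_def)
  ultimately have "mutually_singular \<mu> \<nu>"
    unfolding mutually_singular_def by auto
  moreover have "herglotz p z - herglotz q z
      = (LINT \<zeta>|circle_measure. herglotz_kernel z \<zeta> * of_real (a \<zeta>)) + herglotz \<nu> z - herglotz \<mu> z" if z: "cmod z < 1" for z
  proof -
    let ?k = "herglotz_kernel z"
    have km [measurable]: "?k \<in> borel_measurable t"
      by (intro circle_continuous_measurable[OF t] continuous_herglotz_kernel z)
    have kb: "cmod (?k \<zeta>) \<le> 2 / (1 - cmod z)" if "\<zeta> \<in> space t" for \<zeta>
      using that z by (intro herglotz_kernel_bound) (auto simp: st)
    have ik: "integrable t (\<lambda>\<zeta>. w \<zeta> *\<^sub>R ?k \<zeta>)" if w: "integrable t w" for w :: "complex \<Rightarrow> real"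
    proof (rule Bochner_Integration.integrable_bound)
      show "integrable t (\<lambda>\<zeta>. 2 / (1 - cmod z) * w \<zeta>)"
        by (rule integrable_mult_right[OF w])
      show "AE \<zeta> in t. norm (w \<zeta> *\<^sub>R ?k \<zeta>) \<le> norm (2 / (1 - cmod z) * w \<zeta>)"
      proof (rule AE_I2)
        fix \<zeta> assume "\<zeta> \<in> space t"
        then have "\<bar>w \<zeta>\<bar> * cmod (?k \<zeta>) \<le> \<bar>w \<zeta>\<bar> * (2 / (1 - cmod z))"
          by (intro mult_left_mono kb) auto
        then show "norm (w \<zeta> *\<^sub>R ?k \<zeta>) \<le> norm (2 / (1 - cmod z) * w \<zeta>)"
          using z by (simp add: abs_mult mult.commute)
      qed
    qed (use w in measurable)
    have dint: "herglotz (density t (\<lambda>\<zeta>. ennreal (w \<zeta>))) z = (LINT \<zeta>|t. w \<zeta> *\<^sub>R ?k \<zeta>)"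
      if "integrable t w" "\<And>\<zeta>. 0 \<le> w \<zeta>" for w
      unfolding herglotz_def using that by (intro integral_density) auto
    have "herglotz p z - herglotz q z = (LINT \<zeta>|t. b \<zeta> *\<^sub>R ?k \<zeta>) - (LINT \<zeta>|t. c \<zeta> *\<^sub>R ?k \<zeta>)"
      unfolding b(3) c(3) by (simp only: dint b c)
    also have "\<dots> = (LINT \<zeta>|t. b \<zeta> *\<^sub>R ?k \<zeta> - c \<zeta> *\<^sub>R ?k \<zeta>)"
      by (intro Bochner_Integration.integral_diff[symmetric] ik b c)
    also have "\<dots> = (LINT \<zeta>|t. (s \<zeta> * a \<zeta>) *\<^sub>R ?k \<zeta> + u \<zeta> *\<^sub>R ?k \<zeta> - v \<zeta> *\<^sub>R ?k \<zeta>)"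
      by (simp only: scaleR_left_diff_distrib[symmetric] scaleR_left_distrib[symmetric] eq)
    also have "\<dots> = (LINT \<zeta>|t. (s \<zeta> * a \<zeta>) *\<^sub>R ?k \<zeta>) + (LINT \<zeta>|t. u \<zeta> *\<^sub>R ?k \<zeta>) - (LINT \<zeta>|t. v \<zeta> *\<^sub>R ?k \<zeta>)"
      by (simp add: Bochner_Integration.integral_diff Bochner_Integration.integral_add ik I)
    also have "(LINT \<zeta>|t. (s \<zeta> * a \<zeta>) *\<^sub>R ?k \<zeta>) = (LINT \<zeta>|t. s \<zeta> *\<^sub>R (?k \<zeta> * of_real (a \<zeta>)))"
      by (intro Bochner_Integration.integral_cong refl) (simp add: scaleR_conv_of_real)
    also have "\<dots> = (LINT \<zeta>|circle_measure. ?k \<zeta> * of_real (a \<zeta>))"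
      by (subst s(3), subst integral_density) (use s(2) in auto)
    also have "(LINT \<zeta>|t. u \<zeta> *\<^sub>R ?k \<zeta>) = herglotz \<nu> z"
      unfolding \<nu>_def by (rule dint[symmetric]) (auto intro: I uv)
    also have "(LINT \<zeta>|t. v \<zeta> *\<^sub>R ?k \<zeta>) = herglotz \<mu> z"
      unfolding \<mu>_def by (rule dint[symmetric]) (auto intro: I uv)
    finally show ?thesis .
  qed
  ultimately show thesis
    using that[OF ia sing(2,1)] by blast
qed

lemma outer_function_exp:
  assumes "integrable circle_measure a"
  shows "outer_function (\<lambda>z. exp (\<i> * of_real \<theta>) * exp (LINT \<zeta>|circle_measure. herglotz_kernel z \<zeta> * of_real (a \<zeta>)))"
  unfolding outer_function_def
proof (intro exI[of _ "exp (\<i> * of_real \<theta>)"] exI[of _ "\<lambda>\<zeta>. exp (a \<zeta>)"] conjI ballI)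
  show "integrable circle_measure (\<lambda>\<zeta>. ln (exp (a \<zeta>)))"
    using assms by simp
qed (auto simp: herglotz_kernel_def norm_exp_eq_Re)

lemma blaschke_product_factors:
  assumes "blaschke_zeros K a"
  shows "blaschke_product (\<lambda>z. z ^ m * (\<Prod>k. blaschke_zeros.factor K a k z))"
proof -
  interpret blaschke_zeros K a by fact
  have "(\<lambda>k. if k \<in> K then 1 - cmod (a k) else 0) summable_on UNIV"
    using summable_zeros zeros by (subst summable_on_UNIV_nonneg_real_iff) (auto intro: less_imp_le)
  then have "(\<lambda>k. 1 - cmod (a k)) summable_on K"
    by (subst (asm) summable_on_cong_neutral[of K UNIV "\<lambda>k. 1 - cmod (a k)"]) auto
  then show ?thesis
    unfolding blaschke_product_def using zeros
    by (intro exI[of _ m] exI[of _ K] exI[of _ a]) (auto simp: factor_def blaschke_factor_def cong: if_cong)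
qed

text \<open>Once the zeros are divided out, the quotient \<open>g\<close> is
  \<open>exp (G z)\<close>, and the positive part of \<open>Re G\<close> is
  \<open>log_plus |g|\<close>; the bound on the logarithmic means is thus the hypothesis of the
  Herglotz representation. The absolutely continuous part of the representing measures becomes the
  outer factor, the singular part the two singular functions.\<close>

theorem nevanlinna_factorization_exists:
  assumes f: "nevanlinna f" "\<exists>z\<in>ball 0 1. f z \<noteq> 0"
  obtains \<mu> \<nu> where "nevanlinna_factorization f \<mu> \<nu>"
proof -
  obtain M where M: "log_means_le f M"
    using f(1) nevanlinna_iff_log_means_le by blast
  obtain m f1 where f1: "f1 holomorphic_on ball 0 1" "f1 0 \<noteq> 0" "\<And>z. cmod z < 1 \<Longrightarrow> f z = z ^ m * f1 z"
    by (rule factor_zero_at_origin[OF log_means_leD(1)[OF M] f(2)]) (rule that)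
  have M1: "log_means_le f1 M"
    by (rule log_means_le_divide[OF M f1(1) _ _ f1(3)]) (auto intro!: continuous_intros simp: norm_power)
  obtain K a g where K: "blaschke_zeros K a" and g: "log_means_le g M" "\<And>z. cmod z < 1 \<Longrightarrow> g z \<noteq> 0"
    "\<And>z. cmod z < 1 \<Longrightarrow> f1 z = (\<Prod>k. blaschke_zeros.factor K a k z) * g z"
    by (rule remove_zeros[OF M1 f1(2)]) (rule that)
  obtain G where G: "G holomorphic_on ball 0 1" "\<And>z. z \<in> ball 0 1 \<Longrightarrow> exp (G z) = g z"
    by (rule holomorphic_logarithm_exists[OF convex_ball open_ball log_means_leD(1)[OF g(1)], of 0]) (use g(2) in auto)
  have "(LINT \<zeta>|circle_measure. max 0 (Re (G (of_real r * \<zeta>)))) \<le> M" if r: "0 \<le> r" "r < 1" for r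
  proof -
    have "(LINT \<zeta>|circle_measure. max 0 (Re (G (of_real r * \<zeta>)))) = (LINT \<zeta>|circle_measure. log_plus (cmod (g (of_real r * \<zeta>))))"
    proof (intro Bochner_Integration.integral_cong refl)
      fix \<zeta> assume "\<zeta> \<in> space circle_measure"
      then have "of_real r * \<zeta> \<in> ball 0 1"
        using r by (simp add: norm_mult)
      from G(2)[OF this, symmetric] show "max 0 (Re (G (of_real r * \<zeta>))) = log_plus (cmod (g (of_real r * \<zeta>)))"
        by (simp add: log_plus_def norm_exp_eq_Re)
    qed
    then show ?thesis
      using log_means_leD(2)[OF g(1) r] by simp
  qed
  then obtain p q where pq: "circle_borel_measure p" "circle_borel_measure q"
    and Gpq: "\<And>z. cmod z < 1 \<Longrightarrow> G z = \<i> * of_real (Im (G 0)) + herglotz p z - herglotz q z"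
    using herglotz_representation[OF G(1)] by metis
  obtain b \<mu> \<nu> where b: "integrable circle_measure b" and sing: "singular_circle_measure \<mu>" "singular_circle_measure \<nu>"
    "mutually_singular \<mu> \<nu>"
    and H: "\<And>z. cmod z < 1 \<Longrightarrow> herglotz p z - herglotz q z
      = (LINT \<zeta>|circle_measure. herglotz_kernel z \<zeta> * of_real (b \<zeta>)) + herglotz \<nu> z - herglotz \<mu> z"
    by (rule herglotz_difference_decomposition[OF pq]) (rule that)
  have "nevanlinna_factorization f \<mu> \<nu>"
    unfolding nevanlinna_factorization_def
  proof (intro conjI sing exI ballI)
    show "blaschke_product (\<lambda>z. z ^ m * (\<Prod>k. blaschke_zeros.factor K a k z))"
      by (rule blaschke_product_factors[OF K])
    show "outer_function (\<lambda>z. exp (\<i> * of_real (Im (G 0))) * exp (LINT \<zeta>|circle_measure. herglotz_kernel z \<zeta> * of_real (b \<zeta>)))"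
      by (rule outer_function_exp[OF b])
    fix z :: complex assume "z \<in> ball 0 1"
    then have z: "cmod z < 1" by simp
    have "g z = exp (\<i> * of_real (Im (G 0)) + ((LINT \<zeta>|circle_measure. herglotz_kernel z \<zeta> * of_real (b \<zeta>)) + herglotz \<nu> z - herglotz \<mu> z))"
      using G(2)[of z] Gpq[OF z] z unfolding H[OF z, symmetric] by (simp add: add_diff_eq)
    then show "f z = (z ^ m * (\<Prod>k. blaschke_zeros.factor K a k z)) *
        (exp (\<i> * of_real (Im (G 0))) * exp (LINT \<zeta>|circle_measure. herglotz_kernel z \<zeta> * of_real (b \<zeta>))) *
        singular_function \<mu> z / singular_function \<nu> z"
      unfolding f1(3)[OF z] g(3)[OF z]
      by (simp add: singular_function_eq exp_add exp_diff exp_minus field_simps)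
  qed
  then show thesis by (rule that)
qed

section \<open>Plurisubharmonic functions along analytic discs\<close>

text \<open>\<open>circle_mean\<close> is a difference of two nonnegative integrals, the second
  possibly infinite, so the positive and negative parts are compared separately.\<close>

lemma circle_mean_le:
  assumes h: "continuous_on (sphere 0 1) h" and le: "\<And>\<zeta>. \<zeta> \<in> sphere 0 1 \<Longrightarrow> g \<zeta> \<le> ereal (h \<zeta>)"
  shows "circle_mean g \<le> ereal (LINT \<zeta>|circle_measure. h \<zeta>)"
proof -
  note K = circle_continuous_integrable[OF circle_borel_circle_measure]
  have i: "integrable circle_measure (\<lambda>\<zeta>. max 0 (h \<zeta>))" "integrable circle_measure (\<lambda>\<zeta>. max 0 (- h \<zeta>))"
    by (intro K continuous_intros h)+
  have "(\<integral>\<^sup>+ \<zeta>. e2ennreal (g \<zeta>) \<partial>circle_measure) \<le> (\<integral>\<^sup>+ \<zeta>. ennreal (max 0 (h \<zeta>)) \<partial>circle_measure)"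
  proof (rule nn_integral_mono)
    fix \<zeta> assume "\<zeta> \<in> space circle_measure"
    then have "e2ennreal (g \<zeta>) \<le> e2ennreal (ereal (max 0 (h \<zeta>)))"
      by (intro e2ennreal_mono order_trans[OF le]) auto
    then show "e2ennreal (g \<zeta>) \<le> ennreal (max 0 (h \<zeta>))"
      by (simp add: ennreal.abs_eq e2ennreal_def)
  qed
  also have "\<dots> = ennreal (LINT \<zeta>|circle_measure. max 0 (h \<zeta>))"
    by (rule nn_integral_eq_integral[OF i(1)]) simp
  finally have "enn2ereal (\<integral>\<^sup>+ \<zeta>. e2ennreal (g \<zeta>) \<partial>circle_measure) \<le> enn2ereal (ennreal (LINT \<zeta>|circle_measure. max 0 (h \<zeta>)))"
    by (simp only: less_eq_ennreal.rep_eq)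
  also have "\<dots> = ereal (LINT \<zeta>|circle_measure. max 0 (h \<zeta>))"
    by (intro enn2ereal_ennreal integral_nonneg) simp
  finally have 1: "enn2ereal (\<integral>\<^sup>+ \<zeta>. e2ennreal (g \<zeta>) \<partial>circle_measure) \<le> ereal (LINT \<zeta>|circle_measure. max 0 (h \<zeta>))" .
  have "ennreal (LINT \<zeta>|circle_measure. max 0 (- h \<zeta>)) = (\<integral>\<^sup>+ \<zeta>. ennreal (max 0 (- h \<zeta>)) \<partial>circle_measure)"
    by (rule nn_integral_eq_integral[OF i(2), symmetric]) simp
  also have "\<dots> \<le> (\<integral>\<^sup>+ \<zeta>. e2ennreal (- g \<zeta>) \<partial>circle_measure)"
  proof (rule nn_integral_mono)
    fix \<zeta> assume "\<zeta> \<in> space circle_measure"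
    then have "ereal (- h \<zeta>) \<le> - g \<zeta>"
      using le[of \<zeta>] by (simp add: ereal_uminus_le_reorder flip: uminus_ereal.simps)
    then have "e2ennreal (ereal (- h \<zeta>)) \<le> e2ennreal (- g \<zeta>)"
      by (rule e2ennreal_mono)
    then show "ennreal (max 0 (- h \<zeta>)) \<le> e2ennreal (- g \<zeta>)"
      by (simp add: ennreal_max_0)
  qed
  finally have "enn2ereal (ennreal (LINT \<zeta>|circle_measure. max 0 (- h \<zeta>))) \<le> enn2ereal (\<integral>\<^sup>+ \<zeta>. e2ennreal (- g \<zeta>) \<partial>circle_measure)"
    by (simp only: less_eq_ennreal.rep_eq)
  moreover have "enn2ereal (ennreal (LINT \<zeta>|circle_measure. max 0 (- h \<zeta>))) = ereal (LINT \<zeta>|circle_measure. max 0 (- h \<zeta>))"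
    by (intro enn2ereal_ennreal integral_nonneg) simp
  ultimately have 2: "ereal (LINT \<zeta>|circle_measure. max 0 (- h \<zeta>)) \<le> enn2ereal (\<integral>\<^sup>+ \<zeta>. e2ennreal (- g \<zeta>) \<partial>circle_measure)"
    by simp
  have "circle_mean g \<le> ereal (LINT \<zeta>|circle_measure. max 0 (h \<zeta>)) - ereal (LINT \<zeta>|circle_measure. max 0 (- h \<zeta>))"
    unfolding circle_mean_def by (rule ereal_minus_mono[OF 1 2])
  also have "\<dots> = ereal (LINT \<zeta>|circle_measure. max 0 (h \<zeta>) - max 0 (- h \<zeta>))"
    by (simp add: Bochner_Integration.integral_diff[OF i])
  also have "(LINT \<zeta>|circle_measure. max 0 (h \<zeta>) - max 0 (- h \<zeta>)) = (LINT \<zeta>|circle_measure. h \<zeta>)"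
    by (intro Bochner_Integration.integral_cong) auto
  finally show ?thesis .
qed

text \<open>Otherwise each point has a strictly better one, and in a finite subcover the best of
  these chosen values would be beaten. Semicontinuity is relative to \<open>S\<close> because the
  discs are continuous on the closed unit disc only.\<close>

lemma compact_usc_attains_max:
  fixes g :: "'a::topological_space \<Rightarrow> ereal"
  assumes S: "compact S" "S \<noteq> {}"
    and g: "\<And>x c. x \<in> S \<Longrightarrow> g x < c \<Longrightarrow> \<exists>U. open U \<and> x \<in> U \<and> (\<forall>y\<in>U \<inter> S. g y < c)"
  obtains x where "x \<in> S" "\<And>y. y \<in> S \<Longrightarrow> g y \<le> g x"
proof (rule ccontr)
  assume "\<not> thesis"
  then have "\<forall>x\<in>S. \<exists>y\<in>S. g x < g y"
    using that by (meson not_le)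
  then obtain Y where Y: "\<And>x. x \<in> S \<Longrightarrow> Y x \<in> S \<and> g x < g (Y x)"
    by metis
  then have "\<forall>x\<in>S. \<exists>U. open U \<and> x \<in> U \<and> (\<forall>y\<in>U \<inter> S. g y < g (Y x))"
    using g by blast
  then obtain U where U: "\<And>x. x \<in> S \<Longrightarrow> open (U x) \<and> x \<in> U x \<and> (\<forall>y\<in>U x \<inter> S. g y < g (Y x))"
    by metis
  obtain F where F: "F \<subseteq> S" "finite F" "S \<subseteq> (\<Union>x\<in>F. U x)"
    by (rule compactE_image[OF S(1), of S U]) (use U in auto)
  then have "F \<noteq> {}" using S by auto
  have "Max ((\<lambda>x. g (Y x)) ` F) \<in> (\<lambda>x. g (Y x)) ` F"
    using F \<open>F \<noteq> {}\<close> by (intro Max_in) auto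
  then obtain x where x: "x \<in> F" "g (Y x) = Max ((\<lambda>x. g (Y x)) ` F)"
    by auto
  obtain x' where x': "x' \<in> F" "Y x \<in> U x'"
    using F Y x by blast
  then have "g (Y x) < g (Y x')"
    using U[of x'] F Y[of x] x by blast
  also have "\<dots> \<le> g (Y x)"
    unfolding x(2) using F x' by (intro Max_ge) auto
  finally show False by simp
qed

lemma usc_add_continuous:
  fixes u :: "'b::topological_space \<Rightarrow> ereal" and h :: "'a::topological_space \<Rightarrow> real"
  assumes u: "usc u" and v: "continuous_on UNIV v" and h: "continuous_on S h"
    and x: "x \<in> S" "u (v x) + ereal (h x) < c"
  shows "\<exists>U. open U \<and> x \<in> U \<and> (\<forall>y\<in>U \<inter> S. u (v y) + ereal (h y) < c)"
proof -
  have "u (v x) < c - ereal (h x)"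
    using x(2) by (simp add: ereal_less_minus_iff)
  then obtain d where d: "u (v x) < ereal d" "ereal d < c - ereal (h x)"
    using ereal_dense2 by blast
  then have "ereal (d + h x) < c"
    by (simp add: ereal_less_minus_iff)
  then obtain e where e: "d + h x < e" "ereal e < c \<or> ereal e = c"
  proof (cases c)
    case (real c')
    then show ?thesis using that[of c'] \<open>ereal (d + h x) < c\<close> by auto
  next
    case PInf
    then show ?thesis using that[of "d + h x + 1"] by auto
  qed auto
  have "open {y. u y < ereal d}"
    using u by (simp add: usc_def)
  then have "open (v -` {y. u y < ereal d})"
    using v by (rule open_vimage)
  moreover obtain W where W: "open W" "W \<inter> S = h -` {..<e - d} \<inter> S"
    using h by (auto simp: continuous_on_open_invariant elim!: allE[of _ "{..<e - d}"])
  have "u (v y) + ereal (h y) < c" if "u (v y) < ereal d" "h y < e - d" for y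
  proof -
    have "u (v y) + ereal (h y) \<le> ereal d + ereal (h y)"
      using that by (intro add_right_mono) auto
    also have "\<dots> < ereal e"
      using that by simp
    finally show ?thesis using e by auto
  qed
  ultimately show ?thesis
    using W d e x by (intro exI[of _ "v -` {y. u y < ereal d} \<inter> W"]) (auto simp: set_eq_iff)
qed

lemma norm_vec_power2: "(norm x)\<^sup>2 = (\<Sum>j\<in>UNIV. (cmod (x $ j))\<^sup>2)" for x :: "complex ^ 'n"
  by (simp add: norm_vec_def L2_set_def sum_nonneg)

lemma norm_scalar_mult_vec: "norm (c *s x) = cmod c * norm x" for x :: "complex ^ 'n"
  by (simp add: norm_vec_def norm_mult L2_set_right_distrib)

lemma cmod_add_power2: "(cmod (a + b))\<^sup>2 = (cmod a)\<^sup>2 + 2 * Re (cnj a * b) + (cmod b)\<^sup>2"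
  unfolding cmod_power2 by (simp add: power2_eq_square algebra_simps)

lemma cmod_diff_power2: "(cmod (a - b))\<^sup>2 = (cmod a)\<^sup>2 - 2 * Re (cnj a * b) + (cmod b)\<^sup>2"
  unfolding cmod_power2 by (simp add: power2_eq_square algebra_simps)

text \<open>The penalised function \<open>u(w) - \<phi>(\<zeta>) - k \<bar>w - f(\<zeta>)\<bar>\<^sup>2\<close> has no interior local maximum if
  \<open>\<phi> = Re p + \<epsilon> (1 - \<bar>\<zeta>\<bar>\<^sup>2)\<close>: move along \<open>(\<zeta> + \<lambda>, w + \<lambda> f'(\<zeta>))\<close>, a complex line, on which \<open>u\<close> is
  subharmonic, while the Taylor remainder of \<open>f\<close> enters the penalty only through its harmonic real
  part and a term of smaller order than \<open>\<epsilon> \<bar>\<lambda>\<bar>\<^sup>2\<close>.\<close>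

lemma penalised_no_interior_max:
  fixes f :: "complex \<Rightarrow> complex ^ 'n"
  assumes u: "plurisubharmonic u" and f: "\<And>j. (\<lambda>z. f z $ j) holomorphic_on ball 0 1"
    and \<zeta>: "cmod \<zeta> < 1" and w: "norm w < R" and \<epsilon>: "0 < \<epsilon>" and k: "0 \<le> k" and U: "u w = ereal U"
    and max: "\<And>\<zeta>' w'. cmod \<zeta>' \<le> 1 \<Longrightarrow> norm w' \<le> R \<Longrightarrow>
      u w' + ereal (- (Re (poly p \<zeta>') + \<epsilon> * (1 - (cmod \<zeta>')\<^sup>2)) - k * (norm (w' - f \<zeta>'))\<^sup>2)
      \<le> u w + ereal (- (Re (poly p \<zeta>) + \<epsilon> * (1 - (cmod \<zeta>)\<^sup>2)) - k * (norm (w - f \<zeta>))\<^sup>2)"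
  shows False
proof -
  define f' where "f' j = deriv (\<lambda>z. f z $ j) \<zeta>" for j
  define b :: "complex ^ 'n" where "b = (\<chi> j. f' j)"
  define d where "d = w - f \<zeta>"
  define rem where "rem j h = f (\<zeta> + h) $ j - f \<zeta> $ j - h * f' j" for j h
  define N where "N = real CARD('n)"
  have N: "1 \<le> N"
    unfolding N_def by (simp add: Suc_leI)
  \<comment> \<open>\<open>\<eta>\<close> bounds the Taylor remainders relative to the step; their
    quadratic cost \<open>k * N * \<eta>\<^sup>2\<close> per squared step must stay below the gain
    \<open>\<epsilon>\<close>.\<close>
  obtain \<eta> where \<eta>: "0 < \<eta>" "k * N * \<eta>\<^sup>2 < \<epsilon>"
  proof -
    have "((\<lambda>\<eta>. k * N * \<eta>\<^sup>2) \<longlongrightarrow> k * N * 0\<^sup>2) (at_right 0)"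
      by (intro tendsto_intros)
    then have "\<forall>\<^sub>F \<eta> in at_right 0. k * N * \<eta>\<^sup>2 < \<epsilon>"
      using \<epsilon> by (intro order_tendstoD(2)) auto
    moreover have "\<forall>\<^sub>F \<eta> in at_right (0::real). 0 < \<eta>"
      by (simp add: eventually_at_right_less)
    ultimately have "\<forall>\<^sub>F \<eta> in at_right 0. 0 < \<eta> \<and> k * N * \<eta>\<^sup>2 < \<epsilon>"
      by eventually_elim auto
    then show ?thesis
      using that eventually_happens[of _ "at_right (0::real)"] by auto
  qed
  have der: "((\<lambda>z. f z $ j) has_field_derivative f' j) (at \<zeta>)" for j
    unfolding f'_def using \<zeta> by (intro holomorphic_derivI[OF f]) auto
  have "\<forall>\<^sub>F h in at 0. cmod (rem j h) \<le> \<eta> * cmod h" for j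
  proof -
    have "((\<lambda>h. (f (\<zeta> + h) $ j - f \<zeta> $ j) / h) \<longlongrightarrow> f' j) (at 0)"
      using der[of j] unfolding DERIV_def .
    then have "\<forall>\<^sub>F h in at 0. dist ((f (\<zeta> + h) $ j - f \<zeta> $ j) / h) (f' j) < \<eta>"
      using \<eta> by (intro tendstoD)
    moreover have "\<forall>\<^sub>F h in at (0::complex). h \<noteq> 0"
      by (simp add: eventually_at_filter)
    ultimately show ?thesis
    proof eventually_elim
      case (elim h)
      have "rem j h = h * ((f (\<zeta> + h) $ j - f \<zeta> $ j) / h - f' j)"
        using elim by (simp add: rem_def field_simps)
      then have "cmod (rem j h) = cmod h * dist ((f (\<zeta> + h) $ j - f \<zeta> $ j) / h) (f' j)"
        by (simp only: norm_mult dist_norm)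
      then show ?case
        using elim mult_left_mono[of _ \<eta> "cmod h"] by (simp add: less_imp_le mult.commute)
    qed
  qed
  then have "\<forall>\<^sub>F h in at 0. \<forall>j. cmod (rem j h) \<le> \<eta> * cmod h"
    by (rule eventually_all_finite)
  then obtain \<delta> where \<delta>: "0 < \<delta>" "\<And>h j. h \<noteq> 0 \<Longrightarrow> cmod h < \<delta> \<Longrightarrow> cmod (rem j h) \<le> \<eta> * cmod h"
    unfolding eventually_at by (auto simp: dist_norm)
  \<comment> \<open>The three bounds keep the remainder estimate valid, the moved
    \<open>\<zeta>\<close> in the unit disc, and the moved \<open>w\<close> in the ball of radius
    \<open>R\<close>.\<close>
  define s where "s = min (min (\<delta> / 2) ((1 - cmod \<zeta>) / 2)) ((R - norm w) / (norm b + 1))"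
  have bpos: "0 < norm b + 1"
    by (simp add: add_nonneg_pos)
  then have "0 < (R - norm w) / (norm b + 1)"
    using w by (intro divide_pos_pos) auto
  then have "0 < s"
    using \<delta>(1) \<zeta> by (simp add: s_def)
  moreover have "s \<le> \<delta> / 2" "s \<le> (1 - cmod \<zeta>) / 2" "s \<le> (R - norm w) / (norm b + 1)"
    by (simp_all only: s_def min_le_iff_disj order_refl simp_thms)
  ultimately have s: "0 < s" "s < \<delta>" "cmod \<zeta> + s < 1" and sR: "s * (norm b + 1) \<le> R - norm w"
    using \<delta>(1) \<zeta> bpos by (auto simp: pos_le_divide_eq)
  have sb: "norm w + s * norm b \<le> R"
    using s sR by (simp add: algebra_simps)
  \<comment> \<open>\<open>Re Q\<close> collects the harmonic terms of the comparison. It vanishes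
    at 0, hence has mean 0, and only the loss
    \<open>(\<epsilon> - k * N * \<eta>\<^sup>2) * s\<^sup>2\<close> survives.\<close>
  define Q where "Q z = poly p (\<zeta> + of_real s * z) - poly p \<zeta> - 2 * of_real \<epsilon> * cnj \<zeta> * of_real s * z
      - 2 * of_real k * (\<Sum>j\<in>UNIV. cnj (d $ j) * rem j (of_real s * z))" for z
  have sz: "\<zeta> + of_real s * z \<in> ball 0 1" if "cmod z \<le> 1" for z
  proof -
    have "cmod (\<zeta> + of_real s * z) \<le> cmod \<zeta> + s * cmod z"
      using s by (intro order_trans[OF norm_triangle_ineq]) (simp add: norm_mult)
    also have "s * cmod z \<le> s * 1"
      using s that by (intro mult_left_mono) auto
    finally show ?thesis using s by simp
  qed
  have contf: "continuous_on (ball 0 1) (\<lambda>z. f z $ j)" for j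
    by (rule holomorphic_on_imp_continuous_on[OF f])
  have c1: "continuous_on (cball 0 1) (\<lambda>z. f (\<zeta> + of_real s * z) $ j)" for j
    by (rule continuous_on_compose2[OF contf]) (intro continuous_intros, use sz in auto)
  have h1: "(\<lambda>z. f (\<zeta> + of_real s * z) $ j) holomorphic_on ball 0 1" for j
  proof -
    have "(\<lambda>z. f z $ j) \<circ> (\<lambda>z. \<zeta> + of_real s * z) holomorphic_on ball 0 1"
      by (rule holomorphic_on_compose_gen[OF _ f]) (intro holomorphic_intros, use sz in auto)
    then show ?thesis by (simp add: o_def)
  qed
  have Q: "continuous_on (cball 0 1) Q" "Q holomorphic_on ball 0 1"
    unfolding Q_def rem_def by (intro continuous_intros c1) (intro holomorphic_intros h1)
  define H where "H z = U - (\<epsilon> - k * N * \<eta>\<^sup>2) * s\<^sup>2 + Re (Q z)" for z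
  have le: "u (w + (0 + of_real s * z) *s b) \<le> ereal (H z)" if "z \<in> sphere 0 1" for z
  proof -
    have z: "cmod z = 1" using that by simp
    let ?l = "of_real s * z"
    have l: "cmod ?l = s" "?l \<noteq> 0"
      using z s by (auto simp: norm_mult)
    have "norm (?l *s b) = s * norm b"
      using l by (simp add: norm_scalar_mult_vec norm_mult)
    then have "norm (w + ?l *s b) \<le> R"
      using sb norm_triangle_ineq[of w "?l *s b"] by simp
    moreover have "cmod (\<zeta> + ?l) \<le> 1"
      using sz[of z] z by simp
    ultimately have "u (w + ?l *s b) + ereal (- (Re (poly p (\<zeta> + ?l)) + \<epsilon> * (1 - (cmod (\<zeta> + ?l))\<^sup>2)) - k * (norm (w + ?l *s b - f (\<zeta> + ?l)))\<^sup>2)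
      \<le> ereal U + ereal (- (Re (poly p \<zeta>) + \<epsilon> * (1 - (cmod \<zeta>)\<^sup>2)) - k * (norm d)\<^sup>2)"
      using max U by (simp add: d_def)
    then have le1: "u (w + ?l *s b) \<le> ereal (U - (Re (poly p \<zeta>) + \<epsilon> * (1 - (cmod \<zeta>)\<^sup>2)) - k * (norm d)\<^sup>2
        + (Re (poly p (\<zeta> + ?l)) + \<epsilon> * (1 - (cmod (\<zeta> + ?l))\<^sup>2)) + k * (norm (w + ?l *s b - f (\<zeta> + ?l)))\<^sup>2)"
      by (cases "u (w + ?l *s b)") auto
    have n1: "(norm (w + ?l *s b - f (\<zeta> + ?l)))\<^sup>2 \<le> (norm d)\<^sup>2 - 2 * Re (\<Sum>j\<in>UNIV. cnj (d $ j) * rem j ?l) + N * (\<eta>\<^sup>2 * s\<^sup>2)"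
    proof -
      have "(norm (w + ?l *s b - f (\<zeta> + ?l)))\<^sup>2 = (\<Sum>j\<in>UNIV. (cmod (d $ j - rem j ?l))\<^sup>2)"
        unfolding norm_vec_power2 by (simp add: d_def rem_def b_def algebra_simps)
      also have "\<dots> = (\<Sum>j\<in>UNIV. (cmod (d $ j))\<^sup>2) - 2 * Re (\<Sum>j\<in>UNIV. cnj (d $ j) * rem j ?l) + (\<Sum>j\<in>UNIV. (cmod (rem j ?l))\<^sup>2)"
        by (simp only: cmod_diff_power2 sum.distrib sum_subtractf sum_distrib_left Re_sum)
      also have "(\<Sum>j\<in>UNIV. (cmod (rem j ?l))\<^sup>2) \<le> (\<Sum>j\<in>(UNIV :: 'n set). (\<eta> * s)\<^sup>2)"
        using \<delta>(2)[OF l(2)] l s by (intro sum_mono power_mono) auto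
      also have "\<dots> = N * (\<eta>\<^sup>2 * s\<^sup>2)"
        by (simp add: N_def power_mult_distrib)
      finally show ?thesis by (simp add: norm_vec_power2)
    qed
    have n2: "(cmod (\<zeta> + ?l))\<^sup>2 = (cmod \<zeta>)\<^sup>2 + 2 * Re (cnj \<zeta> * ?l) + s\<^sup>2"
      unfolding cmod_add_power2 using l by simp
    have "U - (Re (poly p \<zeta>) + \<epsilon> * (1 - (cmod \<zeta>)\<^sup>2)) - k * (norm d)\<^sup>2
        + (Re (poly p (\<zeta> + ?l)) + \<epsilon> * (1 - (cmod (\<zeta> + ?l))\<^sup>2)) + k * (norm (w + ?l *s b - f (\<zeta> + ?l)))\<^sup>2
      \<le> U - (Re (poly p \<zeta>) + \<epsilon> * (1 - (cmod \<zeta>)\<^sup>2)) - k * (norm d)\<^sup>2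
        + (Re (poly p (\<zeta> + ?l)) + \<epsilon> * (1 - (cmod (\<zeta> + ?l))\<^sup>2))
        + k * ((norm d)\<^sup>2 - 2 * Re (\<Sum>j\<in>UNIV. cnj (d $ j) * rem j ?l) + N * (\<eta>\<^sup>2 * s\<^sup>2))"
      using mult_left_mono[OF n1 k] by simp
    also have "\<dots> = H z"
      unfolding n2 H_def Q_def by (simp add: algebra_simps)
    finally show ?thesis
      using le1 by (simp add: order_trans[OF _ ereal_less_eq(3)[THEN iffD2]])
  qed
  have "u (w + 0 *s b) \<le> circle_mean (\<lambda>z. u (w + (0 + of_real s * z) *s b))"
    using u s(1) unfolding plurisubharmonic_def subharmonic_def by blast
  also have "\<dots> \<le> ereal (LINT z|circle_measure. H z)"
    by (rule circle_mean_le[OF _ le]) (auto simp: H_def intro!: continuous_intros continuous_on_subset[OF Q(1)])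
  also have "(LINT z|circle_measure. H z) = U - (\<epsilon> - k * N * \<eta>\<^sup>2) * s\<^sup>2 + (LINT z|circle_measure. Re (Q z))"
    unfolding H_def
    by (subst Bochner_Integration.integral_add) (auto intro!: circle_continuous_integrable[OF circle_borel_circle_measure]
        continuous_intros continuous_on_subset[OF Q(1)])
  also have "(LINT z|circle_measure. Re (Q z)) = 0"
    using circle_mean_value_Re[OF Q] by (simp add: Q_def rem_def)
  finally have "U \<le> U - (\<epsilon> - k * N * \<eta>\<^sup>2) * s\<^sup>2"
    using U by simp
  moreover have "0 < (\<epsilon> - k * N * \<eta>\<^sup>2) * s\<^sup>2"
    using s \<eta> by (intro mult_pos_pos) auto
  ultimately show False by linarith
qed

text \<open>\<open>u\<close> is merely semicontinuous, and subharmonic along complex lines, while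
  \<open>f\<close> is curved. So the variables are doubled: \<open>w\<close> ranges freely and its
  distance from \<open>f \<zeta>\<close> is penalised with weight \<open>k\<close>. As
  \<open>k\<close> grows, maximisers approach the graph of \<open>f\<close>. A limit over the circle
  contradicts the strict boundary inequality, a limit over the interior contradicts
  \<open>penalised_no_interior_max\<close>.\<close>

lemma plurisubharmonic_disc_le_Re_poly:
  fixes f :: "complex \<Rightarrow> complex ^ 'n"
  assumes u: "plurisubharmonic u" and f: "\<And>j. (\<lambda>z. f z $ j) holomorphic_on ball 0 1"
    and cf: "continuous_on (cball 0 1) f"
    and p: "\<And>\<zeta>. \<zeta> \<in> sphere 0 1 \<Longrightarrow> u (f \<zeta>) < ereal (Re (poly p \<zeta>))" and z0: "cmod z0 \<le> 1"
  shows "u (f z0) \<le> ereal (Re (poly p z0))"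
proof (rule ccontr)
  assume "\<not> u (f z0) \<le> ereal (Re (poly p z0))"
  then obtain t where t: "ereal (Re (poly p z0)) < ereal t" "ereal t < u (f z0)"
    using ereal_dense2 not_le by metis
  \<comment> \<open>Half of the gap, so that an excess of at least \<open>\<epsilon>\<close> remains
    at \<open>z0\<close> after the bump \<open>\<epsilon> * (1 - (cmod z0)\<^sup>2)\<close> is added
    to the majorant.\<close>
  define \<epsilon> where "\<epsilon> = (t - Re (poly p z0)) / 2"
  have \<epsilon>: "0 < \<epsilon>" using t by (simp add: \<epsilon>_def)
  define \<phi> where "\<phi> \<zeta> = Re (poly p \<zeta>) + \<epsilon> * (1 - (cmod \<zeta>)\<^sup>2)" for \<zeta>
  have uscu: "usc u" and fin: "u z < \<infinity>" for z
    using u by (auto simp: plurisubharmonic_def)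
  obtain R0 where R0: "0 \<le> R0" "\<And>x. x \<in> cball 0 1 \<Longrightarrow> norm (f x) \<le> R0"
    using continuous_on_compact_bound[OF compact_cball cf] by blast
  define R where "R = R0 + 1"
  define S where "S = cball (0::complex) 1 \<times> cball (0::complex ^ 'n) R"
  have S: "compact S" unfolding S_def by (intro compact_Times compact_cball)
  have zS: "(z0, f z0) \<in> S"
    using z0 R0(2)[of z0] by (auto simp: S_def R_def)
  define h where "h k x = - \<phi> (fst x) - real k * (norm (snd x - f (fst x)))\<^sup>2" for k :: nat and x
  have cont_h: "continuous_on S (h k)" for k
    unfolding h_def \<phi>_def by (intro continuous_intros continuous_on_compose2[OF cf]) (auto simp: S_def)
  have "\<exists>x\<in>S. \<forall>y\<in>S. u (snd y) + ereal (h k y) \<le> u (snd x) + ereal (h k x)" for k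
  proof -
    obtain x where "x \<in> S" "\<And>y. y \<in> S \<Longrightarrow> u (snd y) + ereal (h k y) \<le> u (snd x) + ereal (h k x)"
    proof (rule compact_usc_attains_max[OF S, of "\<lambda>x. u (snd x) + ereal (h k x)"])
      show "S \<noteq> {}" using zS by auto
      fix x c assume "x \<in> S" "u (snd x) + ereal (h k x) < c"
      then show "\<exists>U. open U \<and> x \<in> U \<and> (\<forall>y\<in>U \<inter> S. u (snd y) + ereal (h k y) < c)"
        by (intro usc_add_continuous[OF uscu _ cont_h]) (auto intro!: continuous_intros)
    qed blast
    then show ?thesis by blast
  qed
  then obtain X where X: "\<And>k. X k \<in> S" "\<And>k y. y \<in> S \<Longrightarrow> u (snd y) + ereal (h k y) \<le> u (snd (X k)) + ereal (h k (X k))"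
    by metis
  obtain A where A: "\<And>x. x \<in> S \<Longrightarrow> u (snd x) \<le> ereal A"
  proof -
    obtain x where x: "x \<in> S" "\<And>y. y \<in> S \<Longrightarrow> u (snd y) + ereal 0 \<le> u (snd x) + ereal 0"
    proof (rule compact_usc_attains_max[OF S, of "\<lambda>x. u (snd x) + ereal 0"])
      show "S \<noteq> {}" using zS by auto
      fix x c assume "x \<in> S" "u (snd x) + ereal 0 < c"
      then show "\<exists>U. open U \<and> x \<in> U \<and> (\<forall>y\<in>U \<inter> S. u (snd y) + ereal 0 < c)"
        by (intro usc_add_continuous[OF uscu]) (auto intro!: continuous_intros)
    qed blast
    obtain A where "u (snd x) \<le> ereal A"
      using fin[of "snd x"] by (cases "u (snd x)") auto
    then show ?thesis
      using that[of A] x by (auto intro: order_trans simp flip: zero_ereal_def)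
  qed
  have low: "ereal \<epsilon> < u (snd (X k)) + ereal (h k (X k))" for k
  proof -
    have "ereal \<epsilon> \<le> ereal t + ereal (h k (z0, f z0))"
    proof -
      have "\<epsilon> * (1 - (cmod z0)\<^sup>2) \<le> \<epsilon>"
        using \<epsilon> by (simp add: algebra_simps)
      moreover have "t = Re (poly p z0) + 2 * \<epsilon>"
        unfolding \<epsilon>_def by (simp add: field_simps)
      ultimately have "\<epsilon> \<le> t + h k (z0, f z0)"
        unfolding h_def \<phi>_def by simp
      then show ?thesis by simp
    qed
    also have "\<dots> < u (f z0) + ereal (h k (z0, f z0))"
      using t by (cases "u (f z0)") auto
    also have "\<dots> \<le> u (snd (X k)) + ereal (h k (X k))"
      using X(2)[OF zS, of k] by simp
    finally show ?thesis .
  qed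
  have real_u: "\<exists>U. u (snd (X k)) = ereal U" for k
    using low[of k] fin[of "snd (X k)"] by (cases "u (snd (X k))") auto
  then obtain V where V: "\<And>k. u (snd (X k)) = ereal (V k)"
    by metis
  have lowV: "\<epsilon> < V k + h k (X k)" for k
    using low[of k] by (simp add: V)
  have VA: "V k \<le> A" for k
    using A[OF X(1)[of k]] by (simp add: V)
  have c\<phi>: "continuous_on (cball 0 1) \<phi>"
    unfolding \<phi>_def by (intro continuous_intros)
  obtain B where B: "0 \<le> B" "\<And>x. x \<in> cball 0 1 \<Longrightarrow> norm (\<phi> x) \<le> B"
    using continuous_on_compact_bound[OF compact_cball c\<phi>] by blast
  \<comment> \<open>The penalty stays bounded in \<open>k\<close>; along a convergent subsequence
    this forces the limit onto the graph of \<open>f\<close>.\<close>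
  have pen: "real k * (norm (snd (X k) - f (fst (X k))))\<^sup>2 \<le> A + B" for k
    using lowV[of k] VA[of k] B(2)[of "fst (X k)"] X(1)[of k] \<epsilon> by (auto simp: h_def S_def)
  obtain l r where l: "l \<in> S" and r: "strict_mono (r :: nat \<Rightarrow> nat)" and lim: "(X \<circ> r) \<longlonglongrightarrow> l"
    using S X(1) unfolding compact_eq_seq_compact_metric seq_compact_def by metis
  have lim1: "(\<lambda>n. fst (X (r n))) \<longlonglongrightarrow> fst l" and lim2: "(\<lambda>n. snd (X (r n))) \<longlonglongrightarrow> snd l"
    using tendsto_fst[OF lim] tendsto_snd[OF lim] by (auto simp: o_def)
  have inS: "fst (X k) \<in> cball 0 1" "snd (X k) \<in> cball 0 R" for k
    using X(1)[of k] by (auto simp: S_def)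
  have lS: "fst l \<in> cball 0 1" using l by (auto simp: S_def)
  have limf: "(\<lambda>n. f (fst (X (r n)))) \<longlonglongrightarrow> f (fst l)"
    by (rule continuous_on_tendsto_compose[OF cf lim1 lS]) (use inS in auto)
  have lim\<phi>: "(\<lambda>n. \<phi> (fst (X (r n)))) \<longlonglongrightarrow> \<phi> (fst l)"
    by (rule continuous_on_tendsto_compose[OF c\<phi> lim1 lS]) (use inS in auto)
  have eq: "snd l = f (fst l)"
  proof -
    have "(\<lambda>n. (norm (snd (X (r n)) - f (fst (X (r n)))))\<^sup>2) \<longlonglongrightarrow> (norm (snd l - f (fst l)))\<^sup>2"
      by (intro tendsto_intros lim2 limf)
    moreover have "(\<lambda>n. (norm (snd (X (r n)) - f (fst (X (r n)))))\<^sup>2) \<longlonglongrightarrow> 0"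
    proof (rule tendsto_sandwich[of "\<lambda>_. 0" _ _ "\<lambda>n. (A + B) / real n"])
      show "(\<lambda>n. (A + B) / real n) \<longlonglongrightarrow> 0"
        by (rule lim_const_over_n)
      show "\<forall>\<^sub>F n in sequentially. (norm (snd (X (r n)) - f (fst (X (r n)))))\<^sup>2 \<le> (A + B) / real n"
        using eventually_gt_at_top[of 0]
      proof eventually_elim
        case (elim n)
        have "real n * (norm (snd (X (r n)) - f (fst (X (r n)))))\<^sup>2 \<le> real (r n) * (norm (snd (X (r n)) - f (fst (X (r n)))))\<^sup>2"
          using seq_suble[OF r, of n] by (intro mult_right_mono) auto
        then show ?case
          using pen[of "r n"] elim by (simp add: field_simps)
      qed
    qed auto
    ultimately have "(norm (snd l - f (fst l)))\<^sup>2 = 0"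
      using LIMSEQ_unique by blast
    then show ?thesis by simp
  qed
  have int: "cmod (fst l) < 1"
  proof (rule ccontr)
    assume "\<not> cmod (fst l) < 1"
    then have s: "fst l \<in> sphere 0 1" using lS by simp
    have "u (f (fst l)) < ereal (\<phi> (fst l))"
      using p[OF s] s by (simp add: \<phi>_def)
    then obtain e where e: "u (snd l) < ereal e" "ereal e < ereal (\<phi> (fst l))"
      using ereal_dense2 eq by metis
    have "\<forall>\<^sub>F n in sequentially. e < \<phi> (fst (X (r n)))"
      using e by (intro order_tendstoD(1)[OF lim\<phi>]) auto
    moreover have "\<forall>\<^sub>F n in sequentially. snd (X (r n)) \<in> {y. u y < ereal e}"
      using uscu e by (intro topological_tendstoD[OF lim2]) (auto simp: usc_def)
    ultimately have "\<forall>\<^sub>F n in sequentially. False"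
    proof eventually_elim
      case (elim n)
      then have "V (r n) < \<phi> (fst (X (r n)))"
        by (simp add: V)
      moreover have "0 \<le> real (r n) * (norm (snd (X (r n)) - f (fst (X (r n)))))\<^sup>2"
        by simp
      ultimately show False
        using lowV[of "r n"] \<epsilon> unfolding h_def by linarith
    qed
    then show False by simp
  qed
  have "norm (snd l) < R"
    using R0(2)[OF lS] by (simp add: eq R_def)
  then have "\<forall>\<^sub>F n in sequentially. norm (snd (X (r n))) < R"
    by (intro order_tendstoD(2)[OF tendsto_norm[OF lim2]])
  moreover have "\<forall>\<^sub>F n in sequentially. cmod (fst (X (r n))) < 1"
    using int by (intro order_tendstoD(2)[OF tendsto_norm[OF lim1]])
  ultimately have "\<forall>\<^sub>F n in sequentially. norm (snd (X (r n))) < R \<and> cmod (fst (X (r n))) < 1"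
    by eventually_elim auto
  then obtain n where n: "norm (snd (X (r n))) < R" "cmod (fst (X (r n))) < 1"
    by (auto simp: eventually_sequentially)
  show False
  proof (rule penalised_no_interior_max[OF u f n(2) n(1) \<epsilon> _ V, of "real (r n)" p])
    fix \<zeta>' :: complex and w' :: "complex ^ 'n" assume "cmod \<zeta>' \<le> 1" "norm w' \<le> R"
    then have "(\<zeta>', w') \<in> S" by (auto simp: S_def)
    from X(2)[OF this, of "r n"] show "u w' + ereal (- (Re (poly p \<zeta>') + \<epsilon> * (1 - (cmod \<zeta>')\<^sup>2)) - real (r n) * (norm (w' - f \<zeta>'))\<^sup>2)
      \<le> u (snd (X (r n))) + ereal (- (Re (poly p (fst (X (r n)))) + \<epsilon> * (1 - (cmod (fst (X (r n))))\<^sup>2)) - real (r n) * (norm (snd (X (r n)) - f (fst (X (r n)))))\<^sup>2)"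
      by (simp add: h_def \<phi>_def)
  qed simp
qed

lemma plurisubharmonic_disc_mean:
  fixes f :: "complex \<Rightarrow> complex ^ 'n"
  assumes u: "plurisubharmonic u" and f: "\<And>j. (\<lambda>z. f z $ j) holomorphic_on ball 0 1"
    and cf: "continuous_on (cball 0 1) f"
    and \<psi>: "continuous_on (sphere 0 1) \<psi>" "\<And>\<zeta>. \<zeta> \<in> sphere 0 1 \<Longrightarrow> u (f \<zeta>) \<le> ereal (\<psi> \<zeta>)"
  shows "u (f 0) \<le> ereal (LINT \<zeta>|circle_measure. \<psi> \<zeta>)"
proof (rule ereal_le_epsilon2)
  fix e :: real assume e: "0 < e"
  obtain p where p: "\<And>\<zeta>. \<zeta> \<in> sphere 0 1 \<Longrightarrow> \<psi> \<zeta> < Re (poly p \<zeta>) \<and> Re (poly p \<zeta>) < \<psi> \<zeta> + e"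
    using Re_poly_majorant[OF \<psi>(1) e] by blast
  have "u (f \<zeta>) < ereal (Re (poly p \<zeta>))" if "\<zeta> \<in> sphere 0 1" for \<zeta>
    using \<psi>(2)[OF that] p[OF that] by (auto intro: le_less_trans)
  then have "u (f 0) \<le> ereal (Re (poly p 0))"
    by (intro plurisubharmonic_disc_le_Re_poly[OF u f cf]) auto
  also have "Re (poly p 0) = (LINT \<zeta>|circle_measure. Re (poly p \<zeta>))"
    using poly_mean_value_Re[of p 1] by simp
  also have "\<dots> \<le> (LINT \<zeta>|circle_measure. \<psi> \<zeta> + e)"
  proof (rule integral_mono)
    show "Re (poly p \<zeta>) \<le> \<psi> \<zeta> + e" if "\<zeta> \<in> space circle_measure" for \<zeta>
      using p[of \<zeta>] that by simp
  qed (auto intro!: circle_continuous_integrable[OF circle_borel_circle_measure] continuous_intros \<psi>)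
  also have "\<dots> = (LINT \<zeta>|circle_measure. \<psi> \<zeta>) + e"
    by (subst Bochner_Integration.integral_add)
      (auto intro!: circle_continuous_integrable[OF circle_borel_circle_measure] \<psi>)
  finally show "u (f 0) \<le> ereal (LINT \<zeta>|circle_measure. \<psi> \<zeta>) + ereal e"
    by simp
qed

section \<open>The extremal function is at most the negative mass\<close>

lemma poisson_mono:
  assumes m: "circle_borel_measure m" and m': "circle_borel_measure m'"
    and le: "\<And>A. A \<in> sets circle_measure \<Longrightarrow> emeasure m A \<le> emeasure m' A" and z: "cmod z < 1"
  shows "poisson m z \<le> poisson m' z"
proof -
  have s: "sets m = sets m'" "sets m = sets circle_measure"
    using circle_borelD(1)[OF m] circle_borelD(1)[OF m'] by auto
  have "m \<le> m'"
    using le s by (subst le_measure) auto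
  have eq: "ennreal (poisson M z) = (\<integral>\<^sup>+\<zeta>. ennreal (poisson_kernel z \<zeta>) \<partial>M)" if "circle_borel_measure M" for M
    unfolding poisson_def using that z
    by (intro nn_integral_eq_integral[symmetric] integrable_poisson_kernel AE_I2)
      (auto intro!: less_imp_le poisson_kernel_pos simp: circle_borelD(3)[OF that])
  have "ennreal (poisson m z) \<le> ennreal (poisson m' z)"
    unfolding eq[OF m] eq[OF m'] by (rule nn_integral_mono_measure[OF s(1) \<open>m \<le> m'\<close>])
  then show ?thesis
    using poisson_nonneg[OF m' z] by (simp add: ennreal_le_iff)
qed

text \<open>The Blaschke product, the singular numerator and the negative part of the logarithm of
  the outer factor only lower the modulus. For the zero function the denominator is the null
  measure.\<close>

lemma nevanlinna_bound:
  assumes g: "nevanlinna g"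
  obtains a where "integrable circle_measure a" "\<And>\<zeta>. 0 \<le> a \<zeta>" "circle_borel_measure (denominator_measure g)"
    "\<And>z. cmod z < 1 \<Longrightarrow> cmod (g z) \<le> exp ((LINT \<zeta>|circle_measure. poisson_kernel z \<zeta> * a \<zeta>) + poisson (denominator_measure g) z)"
proof (cases "\<forall>z\<in>ball 0 1. g z = 0")
  case True
  then show thesis
    by (intro that[of "\<lambda>_. 0"]) (auto simp: denominator_measure_def circle_borel_null_measure)
next
  case False
  then obtain \<mu> \<nu> where fac: "nevanlinna_factorization g \<mu> \<nu>"
    using nevanlinna_factorization_exists[OF g] by metis
  have circ: "circle_borel_measure \<mu>" "circle_borel_measure \<nu>"
    using fac by (auto simp: nevanlinna_factorization_def singular_circle_measure_def)
  have den: "denominator_measure g = \<nu>"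
    by (rule denominator_measure_eq[OF fac])
  obtain B p q where B: "blaschke_product B" and p: "circle_borel_measure p" and q: "circle_borel_measure q"
    and p0: "\<And>A. A \<in> sets circle_measure \<Longrightarrow> emeasure circle_measure A = 0 \<Longrightarrow> measure p A = 0"
    and f: "\<And>z. cmod z < 1 \<Longrightarrow> cmod (g z) = cmod (B z) * exp (poisson p z - poisson q z + poisson \<nu> z - poisson \<mu> z)"
    by (rule nevanlinna_factorization_cmod[OF fac]) blast
  obtain a where a: "a \<in> borel_measurable circle_measure" "\<And>\<zeta>. 0 \<le> a \<zeta>" "p = density circle_measure (\<lambda>\<zeta>. ennreal (a \<zeta>))"
    "integrable circle_measure a"
    by (rule real_density_exists[OF circle_borel_circle_measure p p0]) (assumption | rule that)+
  show thesis
  proof (rule that[OF a(4) a(2)])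
    show "circle_borel_measure (denominator_measure g)"
      using circ den by simp
    fix z :: complex assume z: "cmod z < 1"
    have "cmod (g z) \<le> 1 * exp (poisson p z - poisson q z + poisson \<nu> z - poisson \<mu> z)"
      unfolding f[OF z] by (intro mult_right_mono blaschke_product_le_1 B z) auto
    also have "\<dots> \<le> exp (poisson p z + poisson \<nu> z)"
      using poisson_nonneg[OF q z] poisson_nonneg[OF circ(1) z] by simp
    also have "poisson p z = (LINT \<zeta>|circle_measure. poisson_kernel z \<zeta> * a \<zeta>)"
      unfolding poisson_def a(3) using z
      by (subst integral_circle_density[OF a(4)]) (auto simp: a(2) mult.commute
          intro!: circle_continuous_measurable[OF circle_borel_circle_measure] continuous_poisson_kernel)
    finally show "cmod (g z) \<le> exp ((LINT \<zeta>|circle_measure. poisson_kernel z \<zeta> * a \<zeta>) + poisson (denominator_measure g) z)"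
      by (simp add: den)
  qed
qed

lemma nontangential_imp_radial_limit:
  assumes lim: "has_nontangential_limit f \<zeta> w" and \<zeta>: "cmod \<zeta> = 1"
    and r: "\<And>n. 0 \<le> r n" "\<And>n. r n < 1" "r \<longlonglongrightarrow> 1"
  shows "(\<lambda>n. f (of_real (r n) * \<zeta>)) \<longlonglongrightarrow> w"
proof -
  have "(f \<longlongrightarrow> w) (at \<zeta> within {z. cmod (z - \<zeta>) < 2 * (1 - cmod z)})"
    using lim[unfolded has_nontangential_limit_def, rule_format, of 2] by simp
  moreover have "filterlim (\<lambda>n. of_real (r n) * \<zeta>) (at \<zeta> within {z. cmod (z - \<zeta>) < 2 * (1 - cmod z)}) sequentially"
    unfolding filterlim_at
  proof (intro conjI always_eventually allI)
    have "(\<lambda>n. of_real (r n) * \<zeta>) \<longlonglongrightarrow> of_real 1 * \<zeta>"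
      by (intro tendsto_intros r)
    then show "(\<lambda>n. of_real (r n) * \<zeta>) \<longlonglongrightarrow> \<zeta>" by simp
    fix n
    have "cmod (of_real (r n) * \<zeta> - \<zeta>) = cmod (of_real (r n - 1) * \<zeta>)"
      by (simp add: algebra_simps)
    also have "\<dots> = 1 - r n"
      using r(2)[of n] \<zeta> by (simp only: norm_mult norm_of_real) simp
    finally have "cmod (of_real (r n) * \<zeta> - \<zeta>) = 1 - r n" .
    then show "of_real (r n) * \<zeta> \<in> {z. cmod (z - \<zeta>) < 2 * (1 - cmod z)}" "of_real (r n) * \<zeta> \<noteq> \<zeta>"
      using r(1)[of n] r(2)[of n] \<zeta> by (auto simp: norm_mult)
  qed
  ultimately show ?thesis
    by (rule filterlim_compose)
qed

lemma continuous_on_vec_componentwise: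
  fixes f :: "'a::topological_space \<Rightarrow> 'b::topological_space ^ 'n"
  assumes "\<And>j. continuous_on S (\<lambda>x. f x $ j)"
  shows "continuous_on S f"
  using continuous_on_vec_lambda[of S "\<lambda>j x. f x $ j"] assms by simp

text \<open>Continuous majorants of a function that is \<open>\<le> 0\<close> on \<open>X\<close> and \<open>\<le> L\<close> elsewhere; they decrease to
  \<open>0\<close> on \<open>X\<close> as \<open>k\<close> grows. The case \<open>X = UNIV\<close> is separate because \<open>infdist w {} = 0\<close>.\<close>

definition cutoff_majorant :: "'a::metric_space set \<Rightarrow> ('a \<Rightarrow> real) \<Rightarrow> nat \<Rightarrow> 'a \<Rightarrow> real" where
  "cutoff_majorant X L k w = (if X = UNIV then 0 else L w * max 0 (1 - real k * infdist w (- X)))"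

lemma cutoff_majorant_bounds:
  assumes "0 \<le> L w"
  shows "0 \<le> cutoff_majorant X L k w" "cutoff_majorant X L k w \<le> L w"
proof -
  show "0 \<le> cutoff_majorant X L k w"
    using assms by (simp add: cutoff_majorant_def)
  have "max 0 (1 - real k * infdist w (- X)) \<le> 1"
    by (simp add: infdist_nonneg)
  from mult_left_mono[OF this assms] show "cutoff_majorant X L k w \<le> L w"
    using assms by (auto simp: cutoff_majorant_def)
qed

lemma cutoff_majorant_outside: "w \<notin> X \<Longrightarrow> cutoff_majorant X L k w = L w"
  by (auto simp: cutoff_majorant_def)

lemma cutoff_majorant_antimono:
  assumes "0 \<le> L w" "k \<le> l"
  shows "cutoff_majorant X L l w \<le> cutoff_majorant X L k w"
proof -
  have "real k * infdist w (- X) \<le> real l * infdist w (- X)"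
    using assms by (intro mult_right_mono infdist_nonneg) auto
  then show ?thesis
    unfolding cutoff_majorant_def using assms by (auto intro!: mult_left_mono)
qed

lemma continuous_on_cutoff_majorant:
  "continuous_on S L \<Longrightarrow> continuous_on S (cutoff_majorant X L k)"
  unfolding cutoff_majorant_def by (cases "X = UNIV") (auto intro!: continuous_intros)

lemma cutoff_majorant_eventually_0:
  assumes X: "open X" and w: "w \<in> X" and lim: "x \<longlonglongrightarrow> w"
  shows "\<forall>\<^sub>F n in sequentially. cutoff_majorant X L n (x n) = 0"
proof (cases "X = UNIV")
  case False
  define \<delta> where "\<delta> = infdist w (- X)"
  have \<delta>: "0 < \<delta>"
    unfolding \<delta>_def using X False w by (intro infdist_pos_not_in_closed) auto
  have "(\<lambda>n. infdist (x n) (- X)) \<longlonglongrightarrow> \<delta>"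
    unfolding \<delta>_def by (intro tendsto_intros lim)
  then have "\<forall>\<^sub>F n in sequentially. \<delta> / 2 < infdist (x n) (- X)"
    using \<delta> by (intro order_tendstoD(1)) auto
  moreover have "\<forall>\<^sub>F n in sequentially. 2 / \<delta> < real n"
    by (rule eventually_gt_at_top[THEN eventually_compose_filterlim[OF _ filterlim_real_sequentially]])
  ultimately show ?thesis
  proof eventually_elim
    case (elim n)
    have "1 < real n * (\<delta> / 2)"
      using elim(2) \<delta> by (simp add: field_simps)
    also have "\<dots> \<le> real n * infdist (x n) (- X)"
      using elim(1) by (intro mult_left_mono) auto
    finally show ?case by (simp add: cutoff_majorant_def)
  qed
qed (simp add: cutoff_majorant_def)

lemma extremal_competitor_le_negative_mass:
  fixes X :: "(complex ^ 'n) set"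
  assumes X: "open X" and f: "f \<in> nevanlinna_discs X" and u: "u \<in> lelong_class" and u0: "\<And>x. x \<in> X \<Longrightarrow> u x \<le> 0"
  shows "u (f 0) \<le> negative_mass f"
proof -
  define nu where "nu j = denominator_measure (\<lambda>z. f z $ j)" for j
  define N where "N = (SUP j. nu j)"
  have nev: "nevanlinna (\<lambda>z. f z $ j)" for j
    using f by (simp add: nevanlinna_discs_def nevanlinna_disc_def)
  have hol: "(\<lambda>z. f z $ j) holomorphic_on ball 0 1" for j
    using nev[of j] by (simp add: nevanlinna_def)
  have bdry: "AE \<zeta> in circle_measure. \<exists>w\<in>X. has_nontangential_limit f \<zeta> w"
    using f by (simp add: nevanlinna_discs_def)
  have "\<exists>a. integrable circle_measure a \<and> (\<forall>\<zeta>. 0 \<le> a \<zeta>) \<and> circle_borel_measure (nu j) \<and>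
    (\<forall>z. cmod z < 1 \<longrightarrow> cmod (f z $ j) \<le> exp ((LINT \<zeta>|circle_measure. poisson_kernel z \<zeta> * a \<zeta>) + poisson (nu j) z))" for j
    by (rule nevanlinna_bound[OF nev[of j]]) (auto simp: nu_def)
  then obtain a where a: "\<And>j. integrable circle_measure (a j)" "\<And>j \<zeta>. 0 \<le> a j \<zeta>" and nu: "\<And>j. circle_borel_measure (nu j)"
    and fb: "\<And>j z. cmod z < 1 \<Longrightarrow> cmod (f z $ j) \<le> exp ((LINT \<zeta>|circle_measure. poisson_kernel z \<zeta> * a j \<zeta>) + poisson (nu j) z)"
    by metis
  have setsN: "sets N = sets circle_measure"
    unfolding N_def by (rule sets_SUP) (auto simp: circle_borelD(1)[OF nu])
  have nuN: "emeasure (nu j) A \<le> emeasure N A" if "A \<in> sets circle_measure" for j A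
  proof -
    have "nu j \<le> N"
      unfolding N_def by (rule SUP_upper) simp
    then show ?thesis
      using that setsN circle_borelD(1)[OF nu[of j]] by (subst (asm) le_measure) auto
  qed
  show ?thesis
  proof (cases "emeasure N (sphere 0 1) = \<infinity>")
    case True
    then show ?thesis
      by (simp add: negative_mass_def N_def nu_def)
  next
    case False
    have N: "circle_borel_measure N"
      unfolding circle_borel_measure_def using setsN sets_eq_imp_space_eq[OF setsN] False
      by (auto intro!: finite_measureI)
    interpret N: finite_measure N by (rule circle_borelD(2)[OF N])
    have psh: "plurisubharmonic u"
      using u by (simp add: lelong_class_def)
    obtain C0 where C0: "\<And>z. u z \<le> ereal (log_plus (norm z) + C0)"
      using u by (auto simp: lelong_class_def)
    define C where "C = max 0 C0"
    define L where "L z = log_plus (norm z) + C" for z :: "complex ^ 'n"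
    have L0: "0 \<le> L z" for z
      by (simp add: L_def C_def)
    have uL: "u z \<le> ereal (L z)" for z
      using C0[of z] by (rule order_trans) (simp add: L_def C_def)
    have cL: "continuous_on S L" for S
      unfolding L_def by (intro continuous_intros continuous_on_log_plus_norm)
    have u\<Phi>: "u w \<le> ereal (cutoff_majorant X L k w)" for k w
    proof (cases "w \<in> X")
      case True
      then show ?thesis
        using u0[of w] cutoff_majorant_bounds(1)[where L = L and w = w, OF L0, of X k] by (auto intro: order_trans)
    qed (simp add: uL cutoff_majorant_outside)
    define r where "r n = 1 - 1 / real (n + 1)" for n :: nat
    have r: "0 \<le> r n" "r n < 1" for n
      by (auto simp: r_def)
    have rlim: "r \<longlonglongrightarrow> 1"
      unfolding r_def by real_asymp
    have cf: "continuous_on (cball 0 1) (\<lambda>z. f (of_real (r n) * z))" for n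
      by (intro continuous_on_vec_componentwise dilation_holomorphic(1)[OF hol r])
    have cfs: "continuous_on (sphere 0 1) (\<lambda>z. f (of_real (r n) * z))" for n
      by (rule continuous_on_subset[OF cf]) auto
    \<comment> \<open>The cutoff sharpens together with the radius, so \<open>F n\<close> tends to 0
      wherever the radial limit of \<open>f\<close> lies in \<open>X\<close>.\<close>
    define F where "F n \<zeta> = cutoff_majorant X L n (f (of_real (r n) * \<zeta>))" for n \<zeta>
    have cF: "continuous_on (sphere 0 1) (F n)" for n
      unfolding F_def by (rule continuous_on_compose2[OF continuous_on_cutoff_majorant[OF cL] cfs]) auto
    have F0: "0 \<le> F n \<zeta>" for n \<zeta>
      unfolding F_def by (rule cutoff_majorant_bounds(1)[where L = L, OF L0])
    note K = circle_continuous_integrable[OF circle_borel_circle_measure]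
    have uF: "u (f 0) \<le> ereal (LINT \<zeta>|circle_measure. F n \<zeta>)" for n
    proof -
      have "u (f (of_real (r n) * 0)) \<le> ereal (LINT \<zeta>|circle_measure. F n \<zeta>)"
        by (rule plurisubharmonic_disc_mean[OF psh dilation_holomorphic(2)[OF hol r] cf cF]) (simp add: F_def u\<Phi>)
      then show ?thesis by simp
    qed
    define \<gamma> where "\<gamma> \<zeta> = (\<Sum>j\<in>UNIV. a j \<zeta>)" for \<zeta>
    have \<gamma>: "integrable circle_measure \<gamma>" "0 \<le> \<gamma> \<zeta>" "a j \<zeta> \<le> \<gamma> \<zeta>" for \<zeta> j
      unfolding \<gamma>_def using a(2) by (auto intro!: Bochner_Integration.integrable_sum a sum_nonneg member_le_sum)
    define n0 where "n0 = real CARD('n)"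
    have n0: "1 \<le> n0"
      unfolding n0_def by (simp add: Suc_leI)
    \<comment> \<open>\<open>\<gamma>\<close> is cut at height \<open>M\<close>. The part below
      enters the constant \<open>c\<close>, which disappears as \<open>n\<close> grows; the mean of
      the part above tends to 0 with \<open>M\<close>.\<close>
    define tail where "tail M \<zeta> = max 0 (\<gamma> \<zeta> - real M)" for M :: nat and \<zeta>
    have it: "integrable circle_measure (tail M)" for M
      unfolding tail_def by (intro integrable_max Bochner_Integration.integrable_diff \<gamma>) auto
    have t0: "0 \<le> tail M \<zeta>" for M \<zeta>
      by (simp add: tail_def)
    have bound: "u (f 0) \<le> ereal (measure N (sphere 0 1) + (LINT \<zeta>|circle_measure. tail M \<zeta>))" for M
    proof -
      define D where "D = density circle_measure (\<lambda>\<zeta>. ennreal (tail M \<zeta>))"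
      have D: "circle_borel_measure D"
        unfolding D_def by (rule circle_borel_density[OF it t0])
      have PD: "poisson D z = (LINT \<zeta>|circle_measure. poisson_kernel z \<zeta> * tail M \<zeta>)" if "cmod z < 1" for z
        unfolding poisson_def D_def using that
        by (subst integral_circle_density[OF it t0]) (auto simp: mult.commute
          intro!: circle_continuous_measurable[OF circle_borel_circle_measure] continuous_poisson_kernel)
      have mD: "measure D (sphere 0 1) = (LINT \<zeta>|circle_measure. tail M \<zeta>)"
      proof -
        have "measure D (sphere 0 1) = (LINT \<zeta>|D. 1)"
          by (simp add: circle_borelD(3)[OF D])
        also have "\<dots> = (LINT \<zeta>|circle_measure. tail M \<zeta>)"
          unfolding D_def by (subst integral_circle_density[OF it t0]) auto
        finally show ?thesis .
      qed
      define c where "c = ln n0 + real M + C"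
      have c0: "0 \<le> c"
        using n0 by (simp add: c_def C_def)
      have Lb: "L (f z) \<le> c + poisson D z + poisson N z" if z: "cmod z < 1" for z
      proof -
        have P0: "0 \<le> poisson_kernel z \<zeta>" if "\<zeta> \<in> sphere 0 1" for \<zeta>
          using that z by (auto intro!: less_imp_le poisson_kernel_pos)
        have "(LINT \<zeta>|circle_measure. poisson_kernel z \<zeta> * \<gamma> \<zeta>) \<le> (LINT \<zeta>|circle_measure. real M * poisson_kernel z \<zeta> + poisson_kernel z \<zeta> * tail M \<zeta>)"
        proof (rule integral_mono)
          fix \<zeta> assume "\<zeta> \<in> space circle_measure"
          then have "poisson_kernel z \<zeta> * \<gamma> \<zeta> \<le> poisson_kernel z \<zeta> * (real M + tail M \<zeta>)"
            using P0 by (intro mult_left_mono) (auto simp: tail_def)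
          then show "poisson_kernel z \<zeta> * \<gamma> \<zeta> \<le> real M * poisson_kernel z \<zeta> + poisson_kernel z \<zeta> * tail M \<zeta>"
            by (simp add: algebra_simps)
        qed (auto intro!: Bochner_Integration.integrable_add integrable_mult_right integrable_kernel_mult(2)[OF _ z]
            integrable_poisson_kernel[OF circle_borel_circle_measure z] \<gamma> it)
        also have "\<dots> = real M + poisson D z"
          using z by (subst Bochner_Integration.integral_add) (auto intro!: integrable_mult_right integrable_kernel_mult(2)[OF _ z]
            integrable_poisson_kernel[OF circle_borel_circle_measure z] it simp: PD poisson_kernel_integral)
        finally have g: "(LINT \<zeta>|circle_measure. poisson_kernel z \<zeta> * \<gamma> \<zeta>) \<le> real M + poisson D z" .
        have "cmod (f z $ j) \<le> exp (real M + poisson D z + poisson N z)" for j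
        proof -
          have "(LINT \<zeta>|circle_measure. poisson_kernel z \<zeta> * a j \<zeta>) \<le> (LINT \<zeta>|circle_measure. poisson_kernel z \<zeta> * \<gamma> \<zeta>)"
            by (intro integral_mono integrable_kernel_mult(2)[OF _ z] mult_left_mono a \<gamma> P0) auto
          moreover have "poisson (nu j) z \<le> poisson N z"
            by (rule poisson_mono[OF nu N nuN z])
          ultimately show ?thesis
            using fb[OF z, of j] g by (smt (verit) exp_le_cancel_iff)
        qed
        then have "norm (f z) \<le> (\<Sum>j\<in>(UNIV :: 'n set). exp (real M + poisson D z + poisson N z))"
          unfolding norm_vec_def by (intro order_trans[OF L2_set_le_sum] sum_mono) auto
        also have "\<dots> = exp (ln n0) * exp (real M + poisson D z + poisson N z)"
          using n0 by (simp add: n0_def)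
        also have "\<dots> = exp (ln n0 + real M + poisson D z + poisson N z)"
          by (simp add: exp_add)
        finally have "log_plus (norm (f z)) \<le> ln n0 + real M + poisson D z + poisson N z"
          using n0 poisson_nonneg[OF D z] poisson_nonneg[OF N z] by (simp add: log_plus_le_iff)
        then show ?thesis by (simp add: L_def c_def)
      qed
      \<comment> \<open>Truncation at \<open>c\<close> makes dominated convergence applicable; the
        excess is at most two Poisson integrals, whose means are the masses of \<open>D\<close> and
        \<open>N\<close> at every radius.\<close>
      have Fb: "F n \<zeta> \<le> min (F n \<zeta>) c + (poisson D (of_real (r n) * \<zeta>) + poisson N (of_real (r n) * \<zeta>))"
        if "\<zeta> \<in> sphere 0 1" for n \<zeta>
      proof -
        have z: "cmod (of_real (r n) * \<zeta>) < 1"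
          using that r[of n] by (simp add: norm_mult)
        have "F n \<zeta> \<le> L (f (of_real (r n) * \<zeta>))"
          unfolding F_def by (rule cutoff_majorant_bounds(2)[where L = L, OF L0])
        then show ?thesis
          using Lb[OF z] poisson_nonneg[OF D z] poisson_nonneg[OF N z] by (simp add: min_def)
      qed
      have im: "integrable circle_measure (\<lambda>\<zeta>. min (F n \<zeta>) c)" for n
        by (intro K continuous_intros cF)
      have iP: "integrable circle_measure (\<lambda>\<zeta>. poisson m (of_real (r n) * \<zeta>))" if "circle_borel_measure m" for m n
        by (intro K continuous_on_poisson_circle that r)
      have "(LINT \<zeta>|circle_measure. F n \<zeta>) \<le> (LINT \<zeta>|circle_measure. min (F n \<zeta>) c) + ((LINT \<zeta>|circle_measure. tail M \<zeta>) + measure N (sphere 0 1))" for n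
      proof -
        have "(LINT \<zeta>|circle_measure. F n \<zeta>) \<le> (LINT \<zeta>|circle_measure. min (F n \<zeta>) c + (poisson D (of_real (r n) * \<zeta>) + poisson N (of_real (r n) * \<zeta>)))"
          by (intro integral_mono K cF Bochner_Integration.integrable_add im iP D N Fb) auto
        also have "\<dots> = (LINT \<zeta>|circle_measure. min (F n \<zeta>) c) + ((LINT \<zeta>|circle_measure. tail M \<zeta>) + measure N (sphere 0 1))"
          by (simp add: im iP D N poisson_mean[OF D r] poisson_mean[OF N r] mD)
        finally show ?thesis .
      qed
      then have le: "u (f 0) \<le> ereal ((LINT \<zeta>|circle_measure. min (F n \<zeta>) c) + ((LINT \<zeta>|circle_measure. tail M \<zeta>) + measure N (sphere 0 1)))" for n
        using uF[of n] by (meson ereal_less_eq(3) order_trans)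
      have "(\<lambda>n. LINT \<zeta>|circle_measure. min (F n \<zeta>) c) \<longlonglongrightarrow> (LINT \<zeta>|circle_measure. 0)"
      proof (rule integral_dominated_convergence[where w = "\<lambda>_. c"])
        show "AE \<zeta> in circle_measure. norm (min (F n \<zeta>) c) \<le> c" for n
          using F0 c0 by (intro AE_I2) auto
        show "AE \<zeta> in circle_measure. (\<lambda>n. min (F n \<zeta>) c) \<longlonglongrightarrow> 0"
          using bdry AE_space
        proof eventually_elim
          case (elim \<zeta>)
          then obtain w where w: "w \<in> X" "has_nontangential_limit f \<zeta> w" by blast
          have "(\<lambda>n. f (of_real (r n) * \<zeta>)) \<longlonglongrightarrow> w"
            using elim by (intro nontangential_imp_radial_limit[OF w(2)] r rlim) auto
          then have "\<forall>\<^sub>F n in sequentially. F n \<zeta> = 0"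
            unfolding F_def by (rule cutoff_majorant_eventually_0[OF X w(1)])
          then have "\<forall>\<^sub>F n in sequentially. min (F n \<zeta>) c = 0"
            by eventually_elim (use c0 in simp)
          then show ?case by (rule tendsto_eventually)
        qed
        show "(\<lambda>\<zeta>. min (F n \<zeta>) c) \<in> borel_measurable circle_measure" for n
          using im[of n] by (rule borel_measurable_integrable)
      qed auto
      then have "(\<lambda>n. ereal ((LINT \<zeta>|circle_measure. min (F n \<zeta>) c) + ((LINT \<zeta>|circle_measure. tail M \<zeta>) + measure N (sphere 0 1))))
          \<longlonglongrightarrow> ereal (0 + ((LINT \<zeta>|circle_measure. tail M \<zeta>) + measure N (sphere 0 1)))"
        by (intro tendsto_intros) simp
      then have "u (f 0) \<le> ereal (0 + ((LINT \<zeta>|circle_measure. tail M \<zeta>) + measure N (sphere 0 1)))"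
        by (rule LIMSEQ_le_const) (use le in auto)
      then show ?thesis by (simp add: add.commute)
    qed
    have "(\<lambda>M. LINT \<zeta>|circle_measure. tail M \<zeta>) \<longlonglongrightarrow> (LINT \<zeta>|circle_measure. 0)"
    proof (rule integral_dominated_convergence[where w = \<gamma>])
      show "AE \<zeta> in circle_measure. (\<lambda>M. tail M \<zeta>) \<longlonglongrightarrow> 0"
      proof (rule AE_I2)
        fix \<zeta>
        have "\<forall>\<^sub>F M in sequentially. \<gamma> \<zeta> < real M"
          by (rule eventually_gt_at_top[THEN eventually_compose_filterlim[OF _ filterlim_real_sequentially]])
        then have "\<forall>\<^sub>F M in sequentially. tail M \<zeta> = 0"
          by eventually_elim (simp add: tail_def)
        then show "(\<lambda>M. tail M \<zeta>) \<longlonglongrightarrow> 0"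
          by (rule tendsto_eventually)
      qed
      show "AE \<zeta> in circle_measure. norm (tail M \<zeta>) \<le> \<gamma> \<zeta>" for M
        using \<gamma>(2) by (intro AE_I2) (auto simp: tail_def)
      show "tail M \<in> borel_measurable circle_measure" for M
        using it[of M] by (rule borel_measurable_integrable)
    qed (auto intro: \<gamma>)
    then have "(\<lambda>M. ereal (measure N (sphere 0 1) + (LINT \<zeta>|circle_measure. tail M \<zeta>))) \<longlonglongrightarrow> ereal (measure N (sphere 0 1) + 0)"
      by (intro tendsto_intros) simp
    then have "u (f 0) \<le> ereal (measure N (sphere 0 1) + 0)"
      by (rule LIMSEQ_le_const) (use bound in auto)
    then show ?thesis
      by (simp add: negative_mass_def N.emeasure_eq_measure enn2ereal_ennreal flip: nu_def N_def)
  qed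
qed

lemma extremal_function_le_negative_mass:
  assumes "open X" "f \<in> nevanlinna_discs X"
  shows "extremal_function X (f 0) \<le> negative_mass f"
  unfolding extremal_function_def
  by (rule SUP_least) (use assms extremal_competitor_le_negative_mass in blast)

section \<open>Parameter integrals and cells\<close>

lemma continuous_on_circle_integral:
  fixes H :: "'a::metric_space \<Rightarrow> complex \<Rightarrow> real"
  assumes S: "compact S" and H: "continuous_on (S \<times> sphere 0 1) (\<lambda>(x, \<zeta>). H x \<zeta>)"
  shows "continuous_on S (\<lambda>x. LINT \<zeta>|circle_measure. H x \<zeta>)"
proof -
  have uc: "uniformly_continuous_on (S \<times> sphere 0 1) (\<lambda>(x, \<zeta>). H x \<zeta>)"
    by (rule compact_uniformly_continuous[OF H]) (intro compact_Times S compact_sphere)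
  have cH: "continuous_on (sphere 0 1) (H x)" if "x \<in> S" for x
  proof -
    have "continuous_on (sphere 0 1) (\<lambda>\<zeta>. (\<lambda>(x, \<zeta>). H x \<zeta>) (x, \<zeta>))"
      by (intro continuous_on_compose2[OF H] continuous_intros) (use that in auto)
    then show ?thesis by simp
  qed
  have iH: "integrable circle_measure (H x)" if "x \<in> S" for x
    by (rule circle_continuous_integrable[OF circle_borel_circle_measure cH[OF that]])
  show ?thesis
    unfolding continuous_on_iff
  proof (intro ballI allI impI)
    fix x and e :: real assume x: "x \<in> S" and e: "0 < e"
    obtain d where d: "0 < d" "\<And>p q. p \<in> S \<times> sphere 0 1 \<Longrightarrow> q \<in> S \<times> sphere 0 1 \<Longrightarrow> dist q p < d \<Longrightarrow>
        dist (case q of (x, \<zeta>) \<Rightarrow> H x \<zeta>) (case p of (x, \<zeta>) \<Rightarrow> H x \<zeta>) < e / 2"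
      using uc half_gt_zero[OF e] unfolding uniformly_continuous_on_def by metis
    have "dist (LINT \<zeta>|circle_measure. H x' \<zeta>) (LINT \<zeta>|circle_measure. H x \<zeta>) < e" if x': "x' \<in> S" "dist x' x < d" for x'
    proof -
      have "\<bar>(LINT \<zeta>|circle_measure. H x' \<zeta>) - (LINT \<zeta>|circle_measure. H x \<zeta>)\<bar> = \<bar>LINT \<zeta>|circle_measure. H x' \<zeta> - H x \<zeta>\<bar>"
        by (simp add: Bochner_Integration.integral_diff iH x x')
      also have "\<dots> \<le> (LINT \<zeta>|circle_measure. \<bar>H x' \<zeta> - H x \<zeta>\<bar>)"
        by (rule integral_abs_bound)
      also have "\<dots> \<le> (LINT \<zeta>|circle_measure. e / 2)"
      proof (rule integral_mono)
        fix \<zeta> assume "\<zeta> \<in> space circle_measure"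
        then show "\<bar>H x' \<zeta> - H x \<zeta>\<bar> \<le> e / 2"
          using d(2)[of "(x, \<zeta>)" "(x', \<zeta>)"] x x' by (simp add: dist_Pair_Pair dist_real_def)
      qed (auto intro!: integrable_abs Bochner_Integration.integrable_diff iH x x')
      finally show ?thesis
        using e by (simp add: dist_real_def)
    qed
    then show "\<exists>d>0. \<forall>x'\<in>S. dist x' x < d \<longrightarrow> dist (LINT \<zeta>|circle_measure. H x' \<zeta>) (LINT \<zeta>|circle_measure. H x \<zeta>) < e"
      using d(1) by blast
  qed
qed

text \<open>For \<open>Re (poly p)\<close> both sides equal the value at 0; the rest is uniform
  approximation.\<close>

lemma circle_integral_rotate:
  fixes g :: "complex \<Rightarrow> real"
  assumes g: "continuous_on (sphere 0 1) g" and c: "cmod c = 1"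
  shows "(LINT w|circle_measure. g (c * w)) = (LINT w|circle_measure. g w)"
proof -
  note K = circle_continuous_integrable[OF circle_borel_circle_measure]
  have gc: "continuous_on (sphere 0 1) (\<lambda>w. g (c * w))"
    by (intro continuous_on_compose2[OF g] continuous_intros) (auto simp: norm_mult c)
  have "\<bar>(LINT w|circle_measure. g (c * w)) - (LINT w|circle_measure. g w)\<bar> \<le> 0 + e" if e: "e > 0" for e
  proof -
    obtain p where p: "\<And>\<zeta>. \<zeta> \<in> sphere 0 1 \<Longrightarrow> \<bar>g \<zeta> - Re (poly p \<zeta>)\<bar> < e / 2"
      using Re_poly_approx[OF g half_gt_zero[OF e]] by blast
    have *: "\<bar>(LINT w|circle_measure. g (b * w)) - Re (poly p 0)\<bar> \<le> e / 2"
      if b: "cmod b = 1" and gb: "continuous_on (sphere 0 1) (\<lambda>w. g (b * w))" for b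
    proof -
      have "(LINT w|circle_measure. Re (poly p (b * w))) = Re (poly p 0)"
        using circle_mean_value_Re[of "\<lambda>w. poly p (b * w)"] by (simp add: continuous_intros holomorphic_intros)
      then have "\<bar>(LINT w|circle_measure. g (b * w)) - Re (poly p 0)\<bar>
          = \<bar>LINT w|circle_measure. g (b * w) - Re (poly p (b * w))\<bar>"
        by (subst Bochner_Integration.integral_diff) (auto intro!: K gb continuous_intros)
      also have "\<dots> \<le> (LINT w|circle_measure. \<bar>g (b * w) - Re (poly p (b * w))\<bar>)"
        by (rule integral_abs_bound)
      also have "\<dots> \<le> (LINT w|circle_measure. e / 2)"
        by (intro integral_mono K continuous_intros gb less_imp_le[OF p]) (auto simp: norm_mult b)
      finally show ?thesis by simp
    qed
    have "\<bar>(LINT w|circle_measure. g w) - Re (poly p 0)\<bar> \<le> e / 2"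
      using *[of 1] g by simp
    then show ?thesis
      using *[OF c gc] by linarith
  qed
  then have "\<bar>(LINT w|circle_measure. g (c * w)) - (LINT w|circle_measure. g w)\<bar> \<le> 0"
    by (rule field_le_epsilon)
  then show ?thesis by simp
qed

text \<open>For fixed \<open>\<zeta>\<close> the rotation by \<open>\<zeta> ^ K\<close> preserves
  the mean in \<open>w\<close>, so the average of the left side over \<open>w0\<close> is the right
  side, and some \<open>w0\<close> does no worse than the average. This turns a family of discs into
  a single one.\<close>

lemma circle_double_integral_rotate:
  fixes H :: "complex \<Rightarrow> complex \<Rightarrow> real"
  assumes H: "continuous_on (sphere 0 1 \<times> sphere 0 1) (\<lambda>(x, y). H x y)"
  shows "\<exists>w0\<in>sphere 0 1. (LINT \<zeta>|circle_measure. H \<zeta> (\<zeta> ^ K * w0))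
      \<le> (LINT \<zeta>|circle_measure. (LINT w|circle_measure. H \<zeta> w))"
proof -
  have cH: "continuous_on (sphere 0 1) (H \<zeta>)" if "\<zeta> \<in> sphere 0 1" for \<zeta>
  proof -
    have "continuous_on (sphere 0 1) (\<lambda>w. (\<lambda>(x, y). H x y) (\<zeta>, w))"
      by (intro continuous_on_compose2[OF H] continuous_intros) (use that in auto)
    then show ?thesis by simp
  qed
  define G where "G w \<zeta> = H \<zeta> (\<zeta> ^ K * w)" for w \<zeta>
  have cG: "continuous_on (sphere 0 1 \<times> sphere 0 1) (\<lambda>(w, \<zeta>). G w \<zeta>)"
  proof -
    have "continuous_on (sphere 0 1 \<times> sphere 0 1) (\<lambda>q. (\<lambda>(x, y). H x y) (snd q, snd q ^ K * fst q))"
      by (intro continuous_on_compose2[OF H] continuous_intros) (auto simp: norm_mult norm_power)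
    then show ?thesis by (simp add: G_def case_prod_beta')
  qed
  have cI: "continuous_on (sphere 0 1) (\<lambda>w. LINT \<zeta>|circle_measure. G w \<zeta>)"
    by (rule continuous_on_circle_integral[OF compact_sphere cG])
  interpret pair_sigma_finite circle_measure circle_measure ..
  interpret P: prob_space "circle_measure \<Otimes>\<^sub>M circle_measure"
    by (rule prob_space_pair) unfold_locales
  have "integrable (circle_measure \<Otimes>\<^sub>M circle_measure) (case_prod G)"
  proof -
    obtain B where B: "\<And>q. q \<in> sphere 0 1 \<times> sphere 0 1 \<Longrightarrow> norm ((\<lambda>(w, \<zeta>). G w \<zeta>) q) \<le> B"
      using continuous_on_compact_bound[OF compact_Times[OF compact_sphere compact_sphere] cG] by blast
    have Gm: "case_prod G \<in> borel_measurable (restrict_space borel (sphere 0 1 \<times> sphere 0 1))"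
      by (rule borel_measurable_continuous_on_restrict) (use cG in simp)
    have idm: "(\<lambda>x. x) \<in> circle_measure \<Otimes>\<^sub>M circle_measure \<rightarrow>\<^sub>M restrict_space borel (sphere 0 1 \<times> sphere 0 1)"
    proof -
      have [measurable]: "(\<lambda>x. x) \<in> circle_measure \<rightarrow>\<^sub>M borel"
        by (rule circle_ident_measurable[OF circle_borel_circle_measure])
      have "(\<lambda>x. (fst x, snd x)) \<in> circle_measure \<Otimes>\<^sub>M circle_measure \<rightarrow>\<^sub>M borel"
        by measurable
      then have "(\<lambda>x. x) \<in> circle_measure \<Otimes>\<^sub>M circle_measure \<rightarrow>\<^sub>M borel" by simp
      then show ?thesis
        by (intro measurable_restrict_space2) (auto simp: space_pair_measure)
    qed
    from measurable_compose[OF idm Gm] have "case_prod G \<in> borel_measurable (circle_measure \<Otimes>\<^sub>M circle_measure)" .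
    then show ?thesis
      using B by (intro P.integrable_const_bound[where B = B] AE_I2) (auto simp: space_pair_measure)
  qed
  from Fubini_integral[OF this]
  have fub: "(LINT w|circle_measure. (LINT \<zeta>|circle_measure. G w \<zeta>)) = (LINT \<zeta>|circle_measure. (LINT w|circle_measure. G w \<zeta>))"
    by simp
  also have "\<dots> = (LINT \<zeta>|circle_measure. (LINT w|circle_measure. H \<zeta> w))"
  proof (rule Bochner_Integration.integral_cong[OF refl])
    fix \<zeta> assume "\<zeta> \<in> space circle_measure"
    then show "(LINT w|circle_measure. G w \<zeta>) = (LINT w|circle_measure. H \<zeta> w)"
      unfolding G_def by (intro circle_integral_rotate cH) (auto simp: norm_power)
  qed
  finally have eq: "(LINT w|circle_measure. (LINT \<zeta>|circle_measure. G w \<zeta>)) = (LINT \<zeta>|circle_measure. (LINT w|circle_measure. H \<zeta> w))" .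
  have "(1::complex) \<in> sphere 0 1" by simp
  then have ne: "sphere 0 1 \<noteq> ({} :: complex set)" by blast
  obtain w0 where w0: "w0 \<in> sphere 0 1"
    "\<forall>w\<in>sphere 0 1. (LINT \<zeta>|circle_measure. G w0 \<zeta>) \<le> (LINT \<zeta>|circle_measure. G w \<zeta>)"
    using continuous_attains_inf[OF compact_sphere ne cI] by (elim bexE)
  have "(LINT w|circle_measure. (LINT \<zeta>|circle_measure. G w0 \<zeta>)) \<le> (LINT w|circle_measure. (LINT \<zeta>|circle_measure. G w \<zeta>))"
    by (rule integral_mono[OF _ circle_continuous_integrable[OF circle_borel_circle_measure cI]]) (use w0 in auto)
  then show ?thesis
    using w0(1) unfolding eq by (auto simp: G_def)
qed

section \<open>A grid that cuts the circle into small cells\<close>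

lemma finite_sphere_Re: "finite {\<zeta> \<in> sphere 0 1. Re \<zeta> = c}" and finite_sphere_Im: "finite {\<zeta> \<in> sphere 0 1. Im \<zeta> = c}"
proof -
  have eq: "(Re \<zeta>)\<^sup>2 + (Im \<zeta>)\<^sup>2 = 1" if "\<zeta> \<in> sphere 0 1" for \<zeta>
    using that by (simp add: cmod_def)
  have sq: "y = sqrt (1 - x\<^sup>2) \<or> y = - sqrt (1 - x\<^sup>2)" if "x\<^sup>2 + y\<^sup>2 = 1" for x y :: real
  proof -
    have "1 - x\<^sup>2 = y\<^sup>2" using that by simp
    then show ?thesis by (auto simp: abs_if)
  qed
  show "finite {\<zeta> \<in> sphere 0 1. Re \<zeta> = c}"
  proof (rule finite_subset)
    show "{\<zeta> \<in> sphere 0 1. Re \<zeta> = c} \<subseteq> {Complex c (sqrt (1 - c\<^sup>2)), Complex c (- sqrt (1 - c\<^sup>2))}"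
    proof
      fix \<zeta> assume "\<zeta> \<in> {\<zeta> \<in> sphere 0 1. Re \<zeta> = c}"
      then show "\<zeta> \<in> {Complex c (sqrt (1 - c\<^sup>2)), Complex c (- sqrt (1 - c\<^sup>2))}"
        using eq[of \<zeta>] sq[of c "Im \<zeta>"] by (simp add: complex_eq_iff)
    qed
  qed simp
  show "finite {\<zeta> \<in> sphere 0 1. Im \<zeta> = c}"
  proof (rule finite_subset)
    show "{\<zeta> \<in> sphere 0 1. Im \<zeta> = c} \<subseteq> {Complex (sqrt (1 - c\<^sup>2)) c, Complex (- sqrt (1 - c\<^sup>2)) c}"
    proof
      fix \<zeta> assume "\<zeta> \<in> {\<zeta> \<in> sphere 0 1. Im \<zeta> = c}"
      then show "\<zeta> \<in> {Complex (sqrt (1 - c\<^sup>2)) c, Complex (- sqrt (1 - c\<^sup>2)) c}"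
        using eq[of \<zeta>] sq[of c "Re \<zeta>"] by (simp add: complex_eq_iff add.commute)
    qed
  qed simp
qed

text \<open>Open squares of side \<open>s\<close> divide the circle into small pieces without a
  choice of argument; the grid lines meet it in finitely many points.\<close>

definition grid_cell :: "real \<Rightarrow> int \<times> int \<Rightarrow> complex set" where
  "grid_cell s ij = {z. s * of_int (fst ij) < Re z \<and> Re z < s * of_int (fst ij + 1) \<and>
      s * of_int (snd ij) < Im z \<and> Im z < s * of_int (snd ij + 1)}"

lemma open_grid_cell: "open (grid_cell s ij)"
  unfolding grid_cell_def by (intro open_Collect_conj open_Collect_less continuous_intros)

lemma grid_cell_disjoint:
  assumes "0 < s" "z \<in> grid_cell s ij" "z \<in> grid_cell s kl"
  shows "ij = kl"
proof -
  have *: "i = k" if "s * of_int i < x" "x < s * of_int (i + 1)" "s * of_int k < x" "x < s * of_int (k + 1)" for i k :: int and x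
  proof -
    have "s * of_int i < s * of_int (k + 1)" "s * of_int k < s * of_int (i + 1)"
      using that by linarith+
    then have "i < k + 1" "k < i + 1"
      using assms(1) by (simp_all only: mult_less_cancel_left_pos of_int_less_iff)
    then show ?thesis by simp
  qed
  show ?thesis
    using assms(2,3) * by (auto simp: grid_cell_def prod_eq_iff)
qed

lemma dist_grid_cell:
  assumes "x \<in> closure (grid_cell s ij)" "y \<in> closure (grid_cell s ij)"
  shows "dist x y \<le> 2 * s"
proof -
  define C where "C = {z. s * of_int (fst ij) \<le> Re z \<and> Re z \<le> s * of_int (fst ij + 1) \<and>
      s * of_int (snd ij) \<le> Im z \<and> Im z \<le> s * of_int (snd ij + 1)}"
  have "closed C"
    unfolding C_def by (intro closed_Collect_conj closed_Collect_le continuous_intros)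
  moreover have "grid_cell s ij \<subseteq> C"
    by (auto simp: grid_cell_def C_def)
  ultimately have "closure (grid_cell s ij) \<subseteq> C"
    by (simp add: closure_minimal)
  then have "x \<in> C" "y \<in> C" using assms by auto
  then have "\<bar>Re (x - y)\<bar> \<le> s" "\<bar>Im (x - y)\<bar> \<le> s"
    by (auto simp: C_def abs_le_iff algebra_simps)
  then show ?thesis
    using cmod_le[of "x - y"] unfolding dist_norm by linarith
qed

lemma grid_cells_cover:
  assumes s: "0 < s"
  obtains I where "finite I" "finite (sphere 0 1 - (\<Union>i\<in>I. grid_cell s i))"
proof -
  define m where "m = \<lceil>1 / s\<rceil> + 1"
  define I where "I = {-m..m} \<times> {-m..m}"
  define F where "F = (\<Union>i\<in>{-m..m}. {\<zeta> \<in> sphere 0 1. Re \<zeta> = s * of_int i} \<union> {\<zeta> \<in> sphere 0 1. Im \<zeta> = s * of_int i})"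
  have coord: "\<exists>i\<in>{-m..m}. s * of_int i \<le> x \<and> x < s * of_int (i + 1)" if "\<bar>x\<bar> \<le> 1" for x
  proof (intro bexI[of _ "\<lfloor>x / s\<rfloor>"] conjI)
    show "s * of_int \<lfloor>x / s\<rfloor> \<le> x" "x < s * of_int (\<lfloor>x / s\<rfloor> + 1)"
    proof -
      have "of_int \<lfloor>x / s\<rfloor> \<le> x / s" "x / s < of_int (\<lfloor>x / s\<rfloor> + 1)"
        by linarith+
      then show "s * of_int \<lfloor>x / s\<rfloor> \<le> x" "x < s * of_int (\<lfloor>x / s\<rfloor> + 1)"
        by (simp_all only: pos_le_divide_eq[OF s] pos_divide_less_eq[OF s] mult.commute)
    qed
    define y where "y = x / s"
    have "\<bar>y\<bar> \<le> 1 / s"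
      unfolding y_def using that s by (simp add: divide_right_mono)
    then have "y \<le> of_int \<lceil>1 / s\<rceil>" "- of_int \<lceil>1 / s\<rceil> \<le> y"
      by linarith+
    then have "\<lfloor>y\<rfloor> \<le> m" "- m \<le> \<lfloor>y\<rfloor>"
      unfolding m_def by linarith+
    then show "\<lfloor>x / s\<rfloor> \<in> {-m..m}"
      by (simp add: y_def)
  qed
  have inF: "\<zeta> \<in> F" if z: "\<zeta> \<in> sphere 0 1" and nz: "\<zeta> \<notin> (\<Union>i\<in>I. grid_cell s i)" for \<zeta>
  proof -
    have ab: "\<bar>Re \<zeta>\<bar> \<le> 1" "\<bar>Im \<zeta>\<bar> \<le> 1"
      using z abs_Re_le_cmod[of \<zeta>] abs_Im_le_cmod[of \<zeta>] by auto
    obtain i where i: "i \<in> {-m..m}" "s * of_int i \<le> Re \<zeta>" "Re \<zeta> < s * of_int (i + 1)"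
      using coord[OF ab(1)] by blast
    obtain j where j: "j \<in> {-m..m}" "s * of_int j \<le> Im \<zeta>" "Im \<zeta> < s * of_int (j + 1)"
      using coord[OF ab(2)] by blast
    have "\<zeta> \<notin> grid_cell s (i, j)"
      using nz i(1) j(1) by (auto simp: I_def)
    then have "Re \<zeta> = s * of_int i \<or> Im \<zeta> = s * of_int j"
      using i j by (auto simp: grid_cell_def)
    then show ?thesis
      using z i(1) j(1) by (auto simp: F_def)
  qed
  have "finite F"
    unfolding F_def by (intro finite_UN_I finite_UnI finite_sphere_Re finite_sphere_Im) simp
  then have "finite (sphere 0 1 - (\<Union>i\<in>I. grid_cell s i))"
    by (rule finite_subset[rotated]) (intro subsetI inF; elim DiffE)
  moreover have "finite I" by (simp add: I_def)
  ultimately show thesis using that by blast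
qed

lemma null_sets_circle_countable:
  assumes "countable A" "A \<subseteq> sphere 0 1"
  shows "A \<in> null_sets circle_measure"
proof -
  have "(\<Union>x\<in>A. {x}) \<in> null_sets circle_measure"
  proof (rule null_sets_UN'[OF assms(1)])
    fix x assume "x \<in> A"
    then have "cmod x = 1" using assms by auto
    then show "{x} \<in> null_sets circle_measure"
      using measure_circle_singleton[of x]
      by (auto simp: null_sets_def measure_circle_null sets_restrict_space intro!: image_eqI[of _ _ "{x}"])
  qed
  then show ?thesis by simp
qed

lemma AE_circle_notin_countable:
  assumes "countable A" "A \<subseteq> sphere 0 1"
  shows "AE \<zeta> in circle_measure. \<zeta> \<notin> A"
  using AE_not_in[OF null_sets_circle_countable[OF assms]] .

section \<open>The Poisson envelope\<close>

definition poly_disc :: "('n \<Rightarrow> complex poly) \<Rightarrow> complex \<Rightarrow> complex ^ 'n" where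
  "poly_disc P \<zeta> = (\<chi> j. poly (P j) \<zeta>)"

lemma continuous_on_poly_disc [continuous_intros]:
  fixes f :: "'a::topological_space \<Rightarrow> complex"
  assumes "continuous_on S f"
  shows "continuous_on S (\<lambda>x. poly_disc P (f x))"
  unfolding poly_disc_def by (intro continuous_on_vec_lambda continuous_intros assms)

lemma continuous_on_scalar_mult_vec [continuous_intros]:
  fixes f :: "'a::topological_space \<Rightarrow> complex" and g :: "'a \<Rightarrow> complex ^ 'n"
  assumes "continuous_on S f" "continuous_on S g"
  shows "continuous_on S (\<lambda>x. f x *s g x)"
  unfolding vector_scalar_mult_def
  by (intro continuous_on_vec_lambda continuous_intros assms bounded_linear.continuous_on[OF bounded_linear_vec_nth])

text \<open>Continuous and decreasing in \<open>n\<close>, in contrast to the infimum of the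
  sequence, which it approximates.\<close>

primrec run_min :: "(nat \<Rightarrow> 'a \<Rightarrow> real) \<Rightarrow> nat \<Rightarrow> 'a \<Rightarrow> real" where
  "run_min q 0 x = q 0 x"
| "run_min q (Suc n) x = min (run_min q n x) (q (Suc n) x)"

lemma run_min_le: "i \<le> n \<Longrightarrow> run_min q n x \<le> q i x"
  by (induction n) (auto simp: le_Suc_eq min_le_iff_disj)

lemma run_min_attained: "\<exists>i\<le>n. run_min q n x = q i x"
proof (induction n)
  case (Suc n)
  then show ?case
    by (auto simp: min_def intro: le_SucI)
qed auto

lemma continuous_on_run_min: "(\<And>i. continuous_on S (q i)) \<Longrightarrow> continuous_on S (run_min q n)"
proof (induction n)
  case 0
  then show ?case by simp
next
  case (Suc n)
  have "continuous_on S (\<lambda>x. min (run_min q n x) (q (Suc n) x))"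
    by (intro continuous_intros Suc)
  then show ?case by simp
qed

lemma uniformly_continuous_finite:
  fixes q :: "nat \<Rightarrow> 'a::metric_space \<Rightarrow> real"
  assumes S: "compact S" and q: "\<And>i. continuous_on S (q i)" and e: "0 < e"
  shows "\<exists>d>0. \<forall>i\<le>n. \<forall>x\<in>S. \<forall>y\<in>S. dist x y < d \<longrightarrow> \<bar>q i x - q i y\<bar> < e"
proof (induction n)
  case 0
  then show ?case
    using compact_uniformly_continuous[OF q S, of 0] e
    unfolding uniformly_continuous_on_def dist_real_def by (metis dist_commute le_zero_eq)
next
  case (Suc n)
  then obtain d where d: "0 < d" "\<And>i x y. i \<le> n \<Longrightarrow> x \<in> S \<Longrightarrow> y \<in> S \<Longrightarrow> dist x y < d \<Longrightarrow> \<bar>q i x - q i y\<bar> < e"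
    by blast
  obtain d' where d': "0 < d'" "\<And>x y. x \<in> S \<Longrightarrow> y \<in> S \<Longrightarrow> dist x y < d' \<Longrightarrow> \<bar>q (Suc n) x - q (Suc n) y\<bar> < e"
    using compact_uniformly_continuous[OF q S, of "Suc n"] e
    unfolding uniformly_continuous_on_def dist_real_def by (metis dist_commute)
  show ?case
    using d d' by (intro exI[of _ "min d d'"]) (auto simp: le_Suc_eq)
qed

text \<open>The cutoff majorants are the intended weights. Their limit is in general only upper
  semicontinuous, so the index \<open>k\<close> is optimised together with the disc.\<close>

locale disc_weights =
  fixes \<Phi> :: "nat \<Rightarrow> complex ^ 'n \<Rightarrow> real"
  assumes continuous: "\<And>k S. continuous_on S (\<Phi> k)"
    and nonneg: "\<And>k w. 0 \<le> \<Phi> k w"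
    and antimono: "\<And>k l w. k \<le> l \<Longrightarrow> \<Phi> l w \<le> \<Phi> k w"
begin

definition disc_mean :: "nat \<Rightarrow> ('n \<Rightarrow> complex poly) \<Rightarrow> complex ^ 'n \<Rightarrow> real" where
  "disc_mean k P z = (LINT \<zeta>|circle_measure. \<Phi> k (z + poly_disc P \<zeta>))"

text \<open>A disc is stored by its deviation from the centre. One pair then serves all centres, and
  \<open>disc_mean\<close> is continuous in the centre.\<close>

definition discs :: "(nat \<times> ('n \<Rightarrow> complex poly)) set" where
  "discs = {q. \<forall>j. poly (snd q j) 0 = 0}"

definition envelope :: "complex ^ 'n \<Rightarrow> real" where
  "envelope z = (INF q\<in>discs. disc_mean (fst q) (snd q) z)"

lemma weight_compose:
  "continuous_on S g \<Longrightarrow> continuous_on S (\<lambda>x. \<Phi> k (g x))"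
  by (rule continuous_on_compose2[OF continuous]) auto

lemma disc_mean_nonneg: "0 \<le> disc_mean k P z"
  unfolding disc_mean_def by (intro Bochner_Integration.integral_nonneg nonneg)

lemma disc_mean_antimono: "k \<le> l \<Longrightarrow> disc_mean l P z \<le> disc_mean k P z"
  unfolding disc_mean_def
  by (intro integral_mono circle_continuous_integrable[OF circle_borel_circle_measure] weight_compose
      continuous_intros antimono)

lemma continuous_on_disc_mean: "continuous_on S (disc_mean k P)"
proof -
  have "isCont (disc_mean k P) z" for z
  proof -
    have "continuous_on (cball z 1) (\<lambda>x. LINT \<zeta>|circle_measure. \<Phi> k (x + poly_disc P \<zeta>))"
    proof (rule continuous_on_circle_integral)
      have "continuous_on (cball z 1 \<times> sphere 0 1) (\<lambda>q. \<Phi> k (fst q + poly_disc P (snd q)))"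
        by (intro weight_compose continuous_intros)
      then show "continuous_on (cball z 1 \<times> sphere 0 1) (\<lambda>(x, \<zeta>). \<Phi> k (x + poly_disc P \<zeta>))"
        by (simp add: case_prod_beta')
    qed simp
    then show ?thesis
      using continuous_on_interior[of "cball z 1" "disc_mean k P" z] by (simp add: disc_mean_def[abs_def])
  qed
  then show ?thesis
    by (simp add: continuous_at_imp_continuous_on)
qed

lemma disc_mean_compose:
  "continuous_on S g \<Longrightarrow> continuous_on S (\<lambda>x. disc_mean k P (g x))"
  by (rule continuous_on_compose2[OF continuous_on_disc_mean]) auto

lemma discs_nonempty: "(k, \<lambda>_. 0) \<in> discs"
  by (simp add: discs_def)

lemma bdd_below_discs: "bdd_below ((\<lambda>q. disc_mean (fst q) (snd q) z) ` discs)"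
  by (rule bdd_belowI[of _ 0]) (auto simp: disc_mean_nonneg)

lemma envelope_le: "q \<in> discs \<Longrightarrow> envelope z \<le> disc_mean (fst q) (snd q) z"
  unfolding envelope_def by (rule cINF_lower[OF bdd_below_discs])

lemma envelope_nonneg: "0 \<le> envelope z"
  unfolding envelope_def using discs_nonempty by (intro cINF_greatest disc_mean_nonneg) auto

lemma envelope_lessE:
  assumes "envelope z < c"
  obtains q where "q \<in> discs" "disc_mean (fst q) (snd q) z < c"
  using assms discs_nonempty unfolding envelope_def by (subst (asm) cINF_less_iff[OF _ bdd_below_discs]) auto

lemma envelope_le_weight: "envelope z \<le> \<Phi> k z"
  using envelope_le[OF discs_nonempty, of z k]
  by (simp add: disc_mean_def poly_disc_def zero_vec_def[symmetric] vec_lambda_eta)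

lemma open_envelope_less: "open {z. envelope z < c}"
proof -
  have "{z. envelope z < c} = (\<Union>q\<in>discs. {z. disc_mean (fst q) (snd q) z < c})"
    by (auto elim: envelope_lessE intro: le_less_trans[OF envelope_le])
  moreover have "open {z. disc_mean k P z < c}" for k P
    by (intro open_Collect_less continuous_on_disc_mean continuous_intros)
  ultimately show ?thesis by (simp add: open_UN)
qed

text \<open>Over small cells of the circle the minimum of finitely many means is nearly attained by a fixed
  disc. These are glued by cutoffs \<open>\<eta>\<close> in \<open>\<zeta>\<close>, made polynomial up to a power of \<open>\<zeta>\<close>; substituting
  \<open>w = \<zeta>\<^sup>K w\<^sub>0\<close> with \<open>K\<close> large clears these poles, as each disc vanishes at \<open>w = 0\<close>.\<close>

lemma envelope_le_mean_run_min:
  fixes e :: "nat \<Rightarrow> nat \<times> ('n \<Rightarrow> complex poly)"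
  assumes e: "\<And>i. e i \<in> discs"
  shows "envelope a \<le> (LINT \<zeta>|circle_measure. run_min (\<lambda>i \<zeta>. disc_mean (fst (e i)) (snd (e i)) (a + \<zeta> *s b)) n \<zeta>)"
proof (rule field_le_epsilon)
  fix \<epsilon>' :: real assume "0 < \<epsilon>'"
  \<comment> \<open>Four shares: two for freezing one disc on each cell, one for the cutoffs, one
    for making them polynomial.\<close>
  define \<epsilon> where "\<epsilon> = \<epsilon>' / 4"
  have \<epsilon>: "0 < \<epsilon>" using \<open>0 < \<epsilon>'\<close> by (simp add: \<epsilon>_def)
  note K = circle_continuous_integrable[OF circle_borel_circle_measure]
  define q where "q i \<zeta> = disc_mean (fst (e i)) (snd (e i)) (a + \<zeta> *s b)" for i \<zeta>
  have cq: "continuous_on S (q i)" for S i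
    unfolding q_def by (intro disc_mean_compose continuous_intros)
  have crm: "continuous_on S (run_min q n)" for S
    by (rule continuous_on_run_min[OF cq])
  obtain \<delta> where \<delta>: "0 < \<delta>" "\<And>i x y. i \<le> n \<Longrightarrow> x \<in> sphere 0 1 \<Longrightarrow> y \<in> sphere 0 1 \<Longrightarrow> dist x y < \<delta> \<Longrightarrow> \<bar>q i x - q i y\<bar> < \<epsilon>"
    using uniformly_continuous_finite[of "sphere 0 1" q \<epsilon> n, OF compact_sphere cq \<epsilon>]
    by (elim exE conjE) (rule that, auto)
  define s where "s = \<delta> / 3"
  have s: "0 < s" using \<delta> by (simp add: s_def)
  have dist_cell: "dist x y < \<delta>" if "x \<in> grid_cell s c" "y \<in> grid_cell s c" for x y c
    using dist_grid_cell[of x s c y] that \<delta>(1) closure_subset[of "grid_cell s c"] by (force simp: s_def)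
  obtain I where I: "finite I" "finite (sphere 0 1 - (\<Union>c\<in>I. grid_cell s c))"
    using grid_cells_cover[OF s] by blast
  have "\<exists>i\<le>n. \<forall>\<zeta>\<in>grid_cell s c \<inter> sphere 0 1. q i \<zeta> \<le> run_min q n \<zeta> + 2 * \<epsilon>" for c
  proof (cases "grid_cell s c \<inter> sphere 0 1 = {}")
    case False
    then obtain x where x: "x \<in> grid_cell s c" "x \<in> sphere 0 1" by blast
    obtain i where i: "i \<le> n" "run_min q n x = q i x"
      using run_min_attained[of n q x] by (elim exE conjE)
    have "q i \<zeta> \<le> run_min q n \<zeta> + 2 * \<epsilon>" if z: "\<zeta> \<in> grid_cell s c" "\<zeta> \<in> sphere 0 1" for \<zeta>
    proof -
      obtain i' where i': "i' \<le> n" "run_min q n \<zeta> = q i' \<zeta>"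
        using run_min_attained[of n q \<zeta>] by (elim exE conjE)
      have "\<bar>q i \<zeta> - q i x\<bar> < \<epsilon>" "\<bar>q i' \<zeta> - q i' x\<bar> < \<epsilon>"
        using \<delta>(2)[OF i(1) z(2) x(2)] \<delta>(2)[OF i'(1) z(2) x(2)] dist_cell[OF z(1) x(1)] by auto
      then show ?thesis
        using run_min_le[OF i'(1), of q x] i i' by linarith
    qed
    then show ?thesis using i by blast
  qed auto
  then obtain \<iota> where \<iota>: "\<And>c. \<iota> c \<le> n" "\<And>c \<zeta>. \<zeta> \<in> grid_cell s c \<Longrightarrow> \<zeta> \<in> sphere 0 1 \<Longrightarrow> q (\<iota> c) \<zeta> \<le> run_min q n \<zeta> + 2 * \<epsilon>"
    by (metis IntI)
  \<comment> \<open>One weight index for all cells; it is at least every index in use, so passing to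
    it only lowers the means.\<close>
  define k where "k = (\<Sum>i\<le>n. fst (e i))"
  have k: "fst (e (\<iota> c)) \<le> k" for c
    unfolding k_def using \<iota>(1)[of c] by (intro member_le_sum) auto
  define P where "P c = snd (e (\<iota> c))" for c
  have P0: "poly (P c j) 0 = 0" for c j
    using e[of "\<iota> c"] by (simp add: P_def discs_def)
  have "\<exists>B\<ge>0. \<forall>w\<in>sphere 0 1. norm (poly_disc (P c) w) \<le> B" for c
  proof -
    have "continuous_on (sphere 0 1) (\<lambda>w. poly_disc (P c) w)"
      by (intro continuous_intros)
    from continuous_on_compact_bound[OF compact_sphere this] show ?thesis by metis
  qed
  then obtain B where B: "\<And>c. 0 \<le> B c" "\<And>c w. w \<in> sphere 0 1 \<Longrightarrow> norm (poly_disc (P c) w) \<le> B c"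
    by metis
  define R where "R = norm a + norm b + (\<Sum>c\<in>I. B c)"
  have cell_ne: "- grid_cell s c \<noteq> {}" for c
  proof -
    have "Complex (s * of_int (fst c)) 0 \<notin> grid_cell s c"
      by (simp add: grid_cell_def)
    then show ?thesis by blast
  qed
  define \<eta> where "\<eta> M c \<zeta> = min 1 (real M * infdist \<zeta> (- grid_cell s c))" for M :: nat and c \<zeta>
  have \<eta>: "0 \<le> \<eta> M c \<zeta>" "\<eta> M c \<zeta> \<le> 1" for M c \<zeta>
    by (auto simp: \<eta>_def infdist_nonneg)
  have \<eta>0: "\<eta> M c \<zeta> = 0" if "\<zeta> \<notin> grid_cell s c" for M c \<zeta>
    using that by (simp add: \<eta>_def)
  have \<eta>1: "\<forall>\<^sub>F M in sequentially. \<eta> M c \<zeta> = 1" if "\<zeta> \<in> grid_cell s c" for c \<zeta>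
  proof -
    have d: "0 < infdist \<zeta> (- grid_cell s c)"
      using that cell_ne by (intro infdist_pos_not_in_closed) (auto simp: open_grid_cell)
    have "\<forall>\<^sub>F M in sequentially. 1 / infdist \<zeta> (- grid_cell s c) < real M"
      by (rule eventually_gt_at_top[THEN eventually_compose_filterlim[OF _ filterlim_real_sequentially]])
    then show ?thesis
      by eventually_elim (use d in \<open>simp add: \<eta>_def field_simps\<close>)
  qed
  \<comment> \<open>For \<open>\<zeta>\<close> in a cell and \<open>M\<close> large this is, in
    \<open>w\<close>, the disc chosen for that cell with centre
    \<open>a + \<zeta> *s b\<close>.\<close>
  define F where "F M \<zeta> w = a + \<zeta> *s b + (\<Sum>c\<in>I. of_real (\<eta> M c \<zeta>) *s poly_disc (P c) w)" for M \<zeta> w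
  have cF: "continuous_on S (\<lambda>x. F M (fst x) (snd x))" for S M
    unfolding F_def \<eta>_def by (intro continuous_intros)
  have FR: "norm (F M \<zeta> w) \<le> R" if "\<zeta> \<in> sphere 0 1" "w \<in> sphere 0 1" for M \<zeta> w
  proof -
    have "norm (\<Sum>c\<in>I. of_real (\<eta> M c \<zeta>) *s poly_disc (P c) w) \<le> (\<Sum>c\<in>I. B c)"
    proof (rule sum_norm_le)
      fix c
      have "\<bar>\<eta> M c \<zeta>\<bar> * norm (poly_disc (P c) w) \<le> 1 * B c"
        using \<eta>[of M c \<zeta>] B that by (intro mult_mono) auto
      then show "norm (of_real (\<eta> M c \<zeta>) *s poly_disc (P c) w) \<le> B c"
        by (simp add: norm_scalar_mult_vec)
    qed
    moreover have "norm (a + \<zeta> *s b) \<le> norm a + norm b"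
      using norm_triangle_ineq[of a "\<zeta> *s b"] that by (simp add: norm_scalar_mult_vec)
    ultimately show ?thesis
      unfolding F_def R_def by (intro order_trans[OF norm_triangle_ineq]) linarith
  qed
  define G where "G M \<zeta> = (LINT w|circle_measure. \<Phi> k (F M \<zeta> w))" for M \<zeta>
  have cG: "continuous_on (sphere 0 1) (G M)" for M
    unfolding G_def
    by (rule continuous_on_circle_integral[OF compact_sphere])
      (simp add: case_prod_beta' weight_compose[OF cF])
  obtain C where C: "0 \<le> C" "\<And>x. x \<in> cball 0 R \<Longrightarrow> norm (\<Phi> k x) \<le> C"
    using continuous_on_compact_bound[OF compact_cball continuous] by blast
  have cFw: "continuous_on S (\<lambda>w. F M \<zeta> w)" for S M \<zeta>
    unfolding F_def by (intro continuous_intros)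
  have GC: "0 \<le> G M \<zeta>" "G M \<zeta> \<le> C" if "\<zeta> \<in> sphere 0 1" for M \<zeta>
  proof -
    show "0 \<le> G M \<zeta>"
      unfolding G_def by (intro Bochner_Integration.integral_nonneg nonneg)
    have "G M \<zeta> \<le> (LINT w|circle_measure. C)"
      unfolding G_def
    proof (rule integral_mono[OF K[OF weight_compose[OF cFw]]])
      fix w assume "w \<in> space circle_measure"
      then show "\<Phi> k (F M \<zeta> w) \<le> C"
        using C(2)[of "F M \<zeta> w"] FR[OF that, of w M] by auto
    qed simp
    then show "G M \<zeta> \<le> C" by simp
  qed
  define mm where "mm \<zeta> = run_min q n \<zeta> + 2 * \<epsilon>" for \<zeta>
  have cmm: "continuous_on S mm" for S
    unfolding mm_def by (intro continuous_intros crm)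
  obtain Bm where Bm: "0 \<le> Bm" "\<And>x. x \<in> sphere 0 1 \<Longrightarrow> norm (mm x) \<le> Bm"
    using continuous_on_compact_bound[OF compact_sphere cmm] by blast
  have "(\<lambda>M. LINT \<zeta>|circle_measure. max (G M \<zeta>) (mm \<zeta>)) \<longlonglongrightarrow> (LINT \<zeta>|circle_measure. mm \<zeta>)"
  proof (rule integral_dominated_convergence[where w = "\<lambda>_. C + Bm"])
    show "AE \<zeta> in circle_measure. norm (max (G M \<zeta>) (mm \<zeta>)) \<le> C + Bm" for M
    proof (rule AE_I2)
      fix \<zeta> assume "\<zeta> \<in> space circle_measure"
      then have z: "\<zeta> \<in> sphere 0 1" by simp
      show "norm (max (G M \<zeta>) (mm \<zeta>)) \<le> C + Bm"
        using GC[OF z, of M] Bm(2)[OF z] Bm(1) C(1) by (auto simp: max_def abs_le_iff)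
    qed
    have F0: "countable (sphere 0 1 - (\<Union>c\<in>I. grid_cell s c))"
      using I(2) by (rule countable_finite)
    show "AE \<zeta> in circle_measure. (\<lambda>M. max (G M \<zeta>) (mm \<zeta>)) \<longlonglongrightarrow> mm \<zeta>"
      using AE_circle_notin_countable[OF F0 Diff_subset] AE_space
    proof eventually_elim
      case (elim \<zeta>)
      then obtain c where c: "c \<in> I" "\<zeta> \<in> grid_cell s c" by auto
      have "\<forall>\<^sub>F M in sequentially. max (G M \<zeta>) (mm \<zeta>) = mm \<zeta>"
        using \<eta>1[OF c(2)]
      proof eventually_elim
        case (elim M)
        have "(\<Sum>c'\<in>I. of_real (\<eta> M c' \<zeta>) *s poly_disc (P c') w) = poly_disc (P c) w" for w
        proof -
          have "(\<Sum>c'\<in>I. of_real (\<eta> M c' \<zeta>) *s poly_disc (P c') w) = (\<Sum>c'\<in>I. if c' = c then poly_disc (P c) w else 0)"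
          proof (rule sum.cong[OF refl])
            fix c'
            show "of_real (\<eta> M c' \<zeta>) *s poly_disc (P c') w = (if c' = c then poly_disc (P c) w else 0)"
              using grid_cell_disjoint[OF s c(2), of c'] \<eta>0[of \<zeta> c' M] elim by auto
          qed
          then show ?thesis using I(1) c(1) by simp
        qed
        then have "G M \<zeta> = disc_mean k (P c) (a + \<zeta> *s b)"
          by (simp add: G_def F_def disc_mean_def)
        also have "\<dots> \<le> q (\<iota> c) \<zeta>"
          unfolding q_def P_def by (rule disc_mean_antimono[OF k])
        also have "\<dots> \<le> mm \<zeta>"
          unfolding mm_def using \<iota>(2)[OF c(2)] \<open>\<zeta> \<in> space circle_measure\<close> by simp
        finally show ?case by simp
      qed
      then show ?case by (rule tendsto_eventually)
    qed
  qed (auto intro!: circle_continuous_measurable[OF circle_borel_circle_measure] continuous_intros cG cmm)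
  then have "\<forall>\<^sub>F M in sequentially. (LINT \<zeta>|circle_measure. max (G M \<zeta>) (mm \<zeta>)) < (LINT \<zeta>|circle_measure. mm \<zeta>) + \<epsilon>"
    using \<epsilon> by (intro order_tendstoD(2)) auto
  then obtain M where M: "(LINT \<zeta>|circle_measure. max (G M \<zeta>) (mm \<zeta>)) < (LINT \<zeta>|circle_measure. mm \<zeta>) + \<epsilon>"
    by (auto simp: eventually_sequentially)
  have "(LINT \<zeta>|circle_measure. G M \<zeta>) \<le> (LINT \<zeta>|circle_measure. max (G M \<zeta>) (mm \<zeta>))"
    by (rule integral_mono[OF K[OF cG] K]) (auto intro!: continuous_intros cG cmm)
  moreover have "(LINT \<zeta>|circle_measure. mm \<zeta>) = (LINT \<zeta>|circle_measure. run_min q n \<zeta>) + 2 * \<epsilon>"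
    unfolding mm_def by (simp add: K[OF crm])
  ultimately have GM: "(LINT \<zeta>|circle_measure. G M \<zeta>) \<le> (LINT \<zeta>|circle_measure. run_min q n \<zeta>) + 3 * \<epsilon>"
    using M by linarith
  have "uniformly_continuous_on (cball 0 (R + 1)) (\<Phi> k)"
    by (rule compact_uniformly_continuous[OF continuous compact_cball])
  then obtain t0 where t0: "0 < t0" "\<And>x y. x \<in> cball 0 (R + 1) \<Longrightarrow> y \<in> cball 0 (R + 1) \<Longrightarrow> dist y x < t0 \<Longrightarrow> dist (\<Phi> k y) (\<Phi> k x) < \<epsilon>"
    using \<epsilon> unfolding uniformly_continuous_on_def by metis
  define t where "t = min t0 1"
  define BB where "BB = (\<Sum>c\<in>I. B c)"
  have BB: "0 \<le> BB" unfolding BB_def by (intro sum_nonneg B)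
  define r where "r = t / (BB + 1)"
  have t: "0 < t" "t \<le> t0" "t \<le> 1" using t0 by (auto simp: t_def)
  have r: "0 < r" using t BB by (simp add: r_def add_nonneg_pos)
  have rBB: "r * BB < t"
    using t BB by (simp add: r_def field_simps)
  have "\<exists>N p. \<forall>\<zeta>\<in>sphere 0 1. cmod (of_real (\<eta> M c \<zeta>) - poly p \<zeta> / \<zeta> ^ N) < r" for c
    by (rule trigonometric_approx[OF _ r]) (auto simp: \<eta>_def intro!: continuous_intros)
  then obtain N p where p: "\<And>c \<zeta>. \<zeta> \<in> sphere 0 1 \<Longrightarrow> cmod (of_real (\<eta> M c \<zeta>) - poly (p c) \<zeta> / \<zeta> ^ N c) < r"
    by metis
  define H where "H \<zeta> w = a + \<zeta> *s b + (\<Sum>c\<in>I. (poly (p c) \<zeta> / \<zeta> ^ N c) *s poly_disc (P c) w)" for \<zeta> w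
  have cH: "continuous_on (sphere 0 1 \<times> sphere 0 1) (\<lambda>x. H (fst x) (snd x))"
    unfolding H_def by (intro continuous_intros) auto
  have HF: "\<Phi> k (H \<zeta> w) \<le> \<Phi> k (F M \<zeta> w) + \<epsilon>" if z: "\<zeta> \<in> sphere 0 1" "w \<in> sphere 0 1" for \<zeta> w
  proof -
    have "H \<zeta> w - F M \<zeta> w = (\<Sum>c\<in>I. (poly (p c) \<zeta> / \<zeta> ^ N c - of_real (\<eta> M c \<zeta>)) *s poly_disc (P c) w)"
      by (simp add: H_def F_def vector_sub_rdistrib sum_subtractf)
    also have "norm \<dots> \<le> (\<Sum>c\<in>I. r * B c)"
    proof (rule sum_norm_le)
      fix c
      show "norm ((poly (p c) \<zeta> / \<zeta> ^ N c - of_real (\<eta> M c \<zeta>)) *s poly_disc (P c) w) \<le> r * B c"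
        unfolding norm_scalar_mult_vec using p[OF z(1), of c] B z r
        by (intro mult_mono) (auto simp: norm_minus_commute)
    qed
    also have "\<dots> = r * BB"
      by (simp add: BB_def sum_distrib_left)
    finally have d: "norm (H \<zeta> w - F M \<zeta> w) < t"
      using rBB by linarith
    have "norm (H \<zeta> w) \<le> norm (F M \<zeta> w) + norm (H \<zeta> w - F M \<zeta> w)"
      using norm_triangle_ineq[of "F M \<zeta> w" "H \<zeta> w - F M \<zeta> w"] by simp
    then have "H \<zeta> w \<in> cball 0 (R + 1)" "F M \<zeta> w \<in> cball 0 (R + 1)"
      using FR[OF z, of M] d t by auto
    then have "dist (\<Phi> k (H \<zeta> w)) (\<Phi> k (F M \<zeta> w)) < \<epsilon>"
      using d t by (intro t0) (auto simp: dist_norm)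
    then show ?thesis by (simp add: dist_real_def abs_less_iff)
  qed
  have cHw: "continuous_on (sphere 0 1) (\<lambda>w. H \<zeta> w)" for \<zeta>
    unfolding H_def by (intro continuous_intros)
  \<comment> \<open>\<open>K\<close> exceeds the order of every pole left by the trigonometric
    approximation, so after the substitution the map is polynomial with value \<open>a\<close> at
    0.\<close>
  define K where "K = Suc (\<Sum>c\<in>I. N c)"
  have KN: "N c < K" if "c \<in> I" for c
    unfolding K_def using member_le_sum[of c I N] that I(1) by simp
  have c\<Phi>H: "continuous_on (sphere 0 1 \<times> sphere 0 1) (\<lambda>(\<zeta>, w). \<Phi> k (H \<zeta> w))"
    using weight_compose[OF cH] by (simp add: case_prod_beta')
  obtain w0 where w0: "w0 \<in> sphere 0 1"
    "(LINT \<zeta>|circle_measure. \<Phi> k (H \<zeta> (\<zeta> ^ K * w0))) \<le> (LINT \<zeta>|circle_measure. (LINT w|circle_measure. \<Phi> k (H \<zeta> w)))"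
    using circle_double_integral_rotate[OF c\<Phi>H, of K] by blast
  have cHH: "continuous_on (sphere 0 1) (\<lambda>\<zeta>. LINT w|circle_measure. \<Phi> k (H \<zeta> w))"
    by (rule continuous_on_circle_integral[OF compact_sphere c\<Phi>H])
  have inner: "(LINT w|circle_measure. \<Phi> k (H \<zeta> w)) \<le> G M \<zeta> + \<epsilon>" if "\<zeta> \<in> sphere 0 1" for \<zeta>
  proof -
    have "(LINT w|circle_measure. \<Phi> k (H \<zeta> w)) \<le> (LINT w|circle_measure. \<Phi> k (F M \<zeta> w) + \<epsilon>)"
      by (rule integral_mono[OF K K]) (auto intro!: continuous_intros weight_compose cHw cFw HF that)
    also have "\<dots> = G M \<zeta> + \<epsilon>"
      unfolding G_def by (simp add: K[OF weight_compose[OF cFw]])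
    finally show ?thesis .
  qed
  have "(LINT \<zeta>|circle_measure. (LINT w|circle_measure. \<Phi> k (H \<zeta> w))) \<le> (LINT \<zeta>|circle_measure. G M \<zeta> + \<epsilon>)"
    by (rule integral_mono[OF K[OF cHH] K]) (use inner in \<open>auto intro!: continuous_intros cG\<close>)
  also have "\<dots> = (LINT \<zeta>|circle_measure. G M \<zeta>) + \<epsilon>"
    by (simp add: K[OF cG])
  finally have HG: "(LINT \<zeta>|circle_measure. \<Phi> k (H \<zeta> (\<zeta> ^ K * w0))) \<le> (LINT \<zeta>|circle_measure. G M \<zeta>) + \<epsilon>"
    using w0(2) by linarith
  have "\<exists>T. P c j = [:0, 1:] * T" for c j
    using P0[of c j] by (simp add: poly_eq_0_iff_dvd dvd_def)
  then obtain T where T: "\<And>c j. P c j = [:0, 1:] * T c j"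
    by metis
  \<comment> \<open>The factor \<open>[:0, 1:]\<close> split off from \<open>P c j\<close>
    contributes \<open>w0 * \<zeta> ^ K\<close>, of which \<open>\<zeta> ^ N c\<close> pays for the
    denominator.\<close>
  define P' where "P' j = monom (b $ j) 1 + (\<Sum>c\<in>I. p c * monom w0 (K - N c) * pcompose (T c j) (monom w0 K))" for j
  have "poly (p c) 0 * (w0 * 0 ^ (K - N c)) * y = 0" if "c \<in> I" for c y
    using KN[OF that] by simp
  then have "(k, P') \<in> discs"
    by (auto simp: discs_def P'_def poly_sum poly_monom intro!: sum.neutral)
  then have "envelope a \<le> disc_mean k P' a"
    using envelope_le by fastforce
  also have "\<dots> = (LINT \<zeta>|circle_measure. \<Phi> k (H \<zeta> (\<zeta> ^ K * w0)))"
    unfolding disc_mean_def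
  proof (rule Bochner_Integration.integral_cong[OF refl])
    fix \<zeta> assume "\<zeta> \<in> space circle_measure"
    then have nz: "\<zeta> \<noteq> 0" by auto
    have "poly (p c) \<zeta> * (w0 * \<zeta> ^ (K - N c)) * poly (T c j) (w0 * \<zeta> ^ K)
        = poly (p c) \<zeta> / \<zeta> ^ N c * (\<zeta> ^ K * w0 * poly (T c j) (\<zeta> ^ K * w0))" if "c \<in> I" for c j
      using nz KN[OF that] by (simp add: power_diff mult_ac)
    then have "a + poly_disc P' \<zeta> = H \<zeta> (\<zeta> ^ K * w0)"
      by (simp add: vec_eq_iff poly_disc_def P'_def H_def T poly_sum poly_monom poly_pcompose mult_ac cong: sum.cong)
    then show "\<Phi> k (a + poly_disc P' \<zeta>) = \<Phi> k (H \<zeta> (\<zeta> ^ K * w0))" by simp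
  qed
  also have "\<dots> \<le> (LINT \<zeta>|circle_measure. run_min q n \<zeta>) + \<epsilon>'"
    using HG GM by (simp add: \<epsilon>_def)
  finally show "envelope a \<le> (LINT \<zeta>|circle_measure. run_min (\<lambda>i \<zeta>. disc_mean (fst (e i)) (snd (e i)) (a + \<zeta> *s b)) n \<zeta>) + \<epsilon>'"
    unfolding q_def .
qed

text \<open>Lindelof at every rational level selects countably many discs whose infimum along the
  line is the envelope. Their running minima decrease to it boundedly, so measurability,
  integrability and the inequality pass to the limit.\<close>

lemma envelope_submean:
  "integrable circle_measure (\<lambda>\<zeta>. envelope (a + \<zeta> *s b))"
  "envelope a \<le> (LINT \<zeta>|circle_measure. envelope (a + \<zeta> *s b))"
proof -
  define q where "q x \<zeta> = disc_mean (fst x) (snd x) (a + \<zeta> *s b)" for x \<zeta>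
  have cq: "continuous_on S (q x)" for S x
    unfolding q_def by (intro disc_mean_compose continuous_intros)
  have "\<exists>D. D \<subseteq> discs \<and> countable D \<and> (\<Union>x\<in>D. {\<zeta>. q x \<zeta> < of_rat c}) = (\<Union>x\<in>discs. {\<zeta>. q x \<zeta> < of_rat c})" for c :: rat
  proof -
    let ?U = "\<lambda>x. {\<zeta>. q x \<zeta> < of_rat c}"
    have o: "open (?U x)" for x
      by (intro open_Collect_less cq continuous_intros)
    obtain \<F> where \<F>: "\<F> \<subseteq> ?U ` discs" "countable \<F>" "\<Union>\<F> = \<Union>(?U ` discs)"
      by (rule Lindelof[of "?U ` discs"]) (use o in auto)
    then obtain D where "D \<subseteq> discs" "countable D" "\<F> = ?U ` D"
      by (metis (no_types, lifting) countable_subset_image)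
    then show ?thesis using \<F>(3) by blast
  qed
  then obtain D where D: "\<And>c. D c \<subseteq> discs" "\<And>c. countable (D c)"
    "\<And>c. (\<Union>x\<in>D c. {\<zeta>. q x \<zeta> < of_rat c}) = (\<Union>x\<in>discs. {\<zeta>. q x \<zeta> < of_rat c})"
    by metis
  define E where "E = insert (0, \<lambda>_. 0) (\<Union>c. D c)"
  have E: "countable E" "E \<noteq> {}" "E \<subseteq> discs"
    using D(1,2) discs_nonempty by (auto simp: E_def)
  define e where "e = from_nat_into E"
  have range_e: "range e = E"
    unfolding e_def using E by (intro range_from_nat_into)
  have e: "e i \<in> discs" for i
    using range_e E(3) by auto
  define m where "m n \<zeta> = run_min (\<lambda>i \<zeta>. disc_mean (fst (e i)) (snd (e i)) (a + \<zeta> *s b)) n \<zeta>" for n \<zeta>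
  have mq: "m n \<zeta> \<le> q (e i) \<zeta>" if "i \<le> n" for i n \<zeta>
    unfolding m_def q_def by (rule run_min_le[OF that, of "\<lambda>i \<zeta>. disc_mean (fst (e i)) (snd (e i)) (a + \<zeta> *s b)"])
  have cm: "continuous_on S (m n)" for S n
    unfolding m_def by (intro continuous_on_run_min disc_mean_compose continuous_intros)
  have env_m: "envelope (a + \<zeta> *s b) \<le> m n \<zeta>" for n \<zeta>
    using run_min_attained[of n "\<lambda>i \<zeta>. disc_mean (fst (e i)) (snd (e i)) (a + \<zeta> *s b)" \<zeta>] envelope_le[OF e]
    unfolding m_def by metis
  have lim: "(\<lambda>n. m n \<zeta>) \<longlonglongrightarrow> envelope (a + \<zeta> *s b)" for \<zeta>
  proof (rule order_tendstoI)
    fix t assume "t < envelope (a + \<zeta> *s b)"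
    then show "\<forall>\<^sub>F n in sequentially. t < m n \<zeta>"
      using env_m[of \<zeta>] by (intro always_eventually allI) (rule less_le_trans)
  next
    fix t assume "envelope (a + \<zeta> *s b) < t"
    then obtain c where c: "envelope (a + \<zeta> *s b) < of_rat c" "of_rat c < t"
      using of_rat_dense by blast
    obtain x where "x \<in> discs" "q x \<zeta> < of_rat c"
      using envelope_lessE[OF c(1)] unfolding q_def by blast
    then have "\<zeta> \<in> (\<Union>x\<in>D c. {\<zeta>. q x \<zeta> < of_rat c})"
      unfolding D(3) by blast
    then obtain x' where x': "x' \<in> D c" "q x' \<zeta> < of_rat c" by blast
    then have "x' \<in> range e"
      unfolding range_e E_def by blast
    then obtain i where "x' = e i" by blast
    then have "m n \<zeta> < t" if "n \<ge> i" for n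
      using mq[OF that, of \<zeta>] x'(2) c(2) by simp
    then show "\<forall>\<^sub>F n in sequentially. m n \<zeta> < t"
      by (auto simp: eventually_sequentially)
  qed
  obtain B where B: "0 \<le> B" "\<And>x. x \<in> sphere 0 1 \<Longrightarrow> norm (q (e 0) x) \<le> B"
    using continuous_on_compact_bound[OF compact_sphere cq] by blast
  have mB: "norm (m n \<zeta>) \<le> B" if "\<zeta> \<in> sphere 0 1" for n \<zeta>
    using mq[of 0 n \<zeta>] env_m[of \<zeta> n] envelope_nonneg[of "a + \<zeta> *s b"] B(2)[OF that] by auto
  have mm: "m n \<in> borel_measurable circle_measure" for n
    by (rule circle_continuous_measurable[OF circle_borel_circle_measure cm])
  have lm: "(\<lambda>\<zeta>. envelope (a + \<zeta> *s b)) \<in> borel_measurable circle_measure"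
    by (rule borel_measurable_LIMSEQ_real[OF _ mm]) (rule lim)
  have dom: "AE \<zeta> in circle_measure. norm (m n \<zeta>) \<le> B" for n
    using mB by (intro AE_I2) auto
  have aelim: "AE \<zeta> in circle_measure. (\<lambda>n. m n \<zeta>) \<longlonglongrightarrow> envelope (a + \<zeta> *s b)"
    using lim by (intro AE_I2) auto
  show "integrable circle_measure (\<lambda>\<zeta>. envelope (a + \<zeta> *s b))"
    by (rule integrable_dominated_convergence[OF lm mm _ aelim dom]) simp
  have "(\<lambda>n. LINT \<zeta>|circle_measure. m n \<zeta>) \<longlonglongrightarrow> (LINT \<zeta>|circle_measure. envelope (a + \<zeta> *s b))"
    by (rule integral_dominated_convergence[OF lm mm _ aelim dom]) simp
  then show "envelope a \<le> (LINT \<zeta>|circle_measure. envelope (a + \<zeta> *s b))"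
    by (rule LIMSEQ_le_const) (use envelope_le_mean_run_min[OF e] in \<open>auto simp: m_def\<close>)
qed

lemma plurisubharmonic_envelope: "plurisubharmonic (\<lambda>z. ereal (envelope z))"
proof -
  have usc: "open {z. ereal (envelope z) < c}" for c
    by (cases c) (auto simp: open_envelope_less)
  have mean: "circle_mean (\<lambda>\<zeta>. ereal (envelope (a + \<zeta> *s b))) = ereal (LINT \<zeta>|circle_measure. envelope (a + \<zeta> *s b))" for a b
  proof -
    have "(\<integral>\<^sup>+ \<zeta>. ennreal (envelope (a + \<zeta> *s b)) \<partial>circle_measure) = ennreal (LINT \<zeta>|circle_measure. envelope (a + \<zeta> *s b))"
      by (rule nn_integral_eq_integral[OF envelope_submean(1)]) (simp add: envelope_nonneg)
    then show ?thesis
      unfolding circle_mean_def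
      by (simp add: enn2ereal_ennreal Bochner_Integration.integral_nonneg envelope_nonneg e2ennreal_neg ennreal_neg zero_ereal_def zero_ennreal.rep_eq)
  qed
  have "subharmonic (\<lambda>\<zeta>. ereal (envelope (a + \<zeta> *s b)))" for a b
    unfolding subharmonic_def usc_def
  proof (intro conjI allI impI)
    fix c
    have "open ((\<lambda>\<zeta>. a + \<zeta> *s b) -` {z. ereal (envelope z) < c})"
      by (intro open_vimage usc continuous_intros)
    then show "open {\<zeta>. ereal (envelope (a + \<zeta> *s b)) < c}" by (simp add: vimage_def)
  next
    fix c :: complex and r :: real
    have eq: "a + (c + of_real r * \<zeta>) *s b = (a + c *s b) + \<zeta> *s (of_real r *s b)" for \<zeta>
      by (simp add: vec_eq_iff algebra_simps)
    show "ereal (envelope (a + c *s b)) \<le> circle_mean (\<lambda>\<zeta>. ereal (envelope (a + (c + of_real r * \<zeta>) *s b)))"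
      unfolding eq mean using envelope_submean(2) by (simp only: ereal_less_eq)
  qed simp
  then show ?thesis
    unfolding plurisubharmonic_def usc_def using usc by simp
qed

end

section \<open>Shifting a boundary density to atoms\<close>

lemma herglotz_kernel_diff_point:
  assumes "x \<noteq> z" "x \<noteq> w"
  shows "herglotz_kernel z x - herglotz_kernel w x = 2 * x * (z - w) / ((x - z) * (x - w))"
  using assms unfolding herglotz_kernel_def by (simp add: field_simps)

lemma herglotz_kernel_diff_pole:
  assumes "x \<noteq> z" "y \<noteq> z"
  shows "herglotz_kernel z x - herglotz_kernel z y = 2 * z * (y - x) / ((x - z) * (y - z))"
  using assms unfolding herglotz_kernel_def by (simp add: field_simps)

lemma borel_measurable_herglotz_kernel [measurable (raw)]:
  assumes "\<tau> \<in> borel_measurable M"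
  shows "(\<lambda>x. herglotz_kernel z (\<tau> x)) \<in> borel_measurable M"
  unfolding herglotz_kernel_def by (intro borel_measurable_divide borel_measurable_add borel_measurable_diff assms borel_measurable_const)

text \<open>Almost everywhere that \<open>h\<close> is nonzero, \<open>\<tau> x\<close> keeps
  distance \<open>d\<close> from \<open>\<eta>\<close>; so the kernel is bounded and Lipschitz in
  \<open>z\<close> up to \<open>\<eta>\<close>. The limit is imaginary because the kernel of two
  distinct points of the circle is. The map \<open>\<tau>\<close> makes the lemma serve the original
  and the moved mass alike.\<close>

lemma herglotz_kernel_integral_boundary:
  fixes h :: "'a \<Rightarrow> real"
  assumes M: "finite_measure M" and \<tau>: "\<tau> \<in> borel_measurable M" "\<And>x. x \<in> space M \<Longrightarrow> \<tau> x \<in> sphere 0 1"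
    and h: "h \<in> borel_measurable M" "\<And>x. x \<in> space M \<Longrightarrow> \<bar>h x\<bar> \<le> C"
    and \<eta>: "cmod \<eta> = 1" and d: "0 < d" and van: "AE x in M. dist (\<tau> x) \<eta> < d \<longrightarrow> h x = 0"
  obtains l where "((\<lambda>z. LINT x|M. herglotz_kernel z (\<tau> x) * of_real (h x)) \<longlongrightarrow> l) (at \<eta> within ball 0 1)" "Re l = 0"
proof -
  interpret finite_measure M by (rule M)
  define l where "l z = (LINT x|M. herglotz_kernel z (\<tau> x) * of_real (h x))" for z
  define W where "W z = insert \<eta> {z. cmod z < 1 \<and> dist z \<eta> < d / 2}" for z :: complex
  have bound: "cmod (herglotz_kernel z (\<tau> x) * of_real (h x)) \<le> 4 / d * C"
    if z: "cmod z \<le> 1" "dist z \<eta> < d / 2" and x: "x \<in> space M" "dist (\<tau> x) \<eta> < d \<longrightarrow> h x = 0" for z x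
  proof (cases "h x = 0")
    case True
    then show ?thesis using h(2)[OF x(1)] d by simp
  next
    case False
    then have "d \<le> dist (\<tau> x) \<eta>" using x by auto
    then have t: "d / 2 \<le> cmod (\<tau> x - z)"
      using dist_triangle[of "\<tau> x" \<eta> z] z(2) by (simp add: dist_norm)
    have "cmod (herglotz_kernel z (\<tau> x)) = cmod (\<tau> x + z) / cmod (\<tau> x - z)"
      by (simp add: herglotz_kernel_def norm_divide)
    also have "\<dots> \<le> 2 / (d / 2)"
      using t d z(1) \<tau>(2)[OF x(1)] norm_triangle_ineq[of "\<tau> x" z] by (intro frac_le) auto
    finally show ?thesis
      using h(2)[OF x(1)] d unfolding norm_mult by (intro mult_mono) auto
  qed
  have meas: "(\<lambda>x. herglotz_kernel z (\<tau> x) * of_real (h x)) \<in> borel_measurable M" for z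
    by (intro borel_measurable_times borel_measurable_herglotz_kernel \<tau>(1) measurable_compose[OF h(1)]) simp
  have int: "integrable M (\<lambda>x. herglotz_kernel z (\<tau> x) * of_real (h x))"
    if z: "cmod z \<le> 1" "dist z \<eta> < d / 2" for z
  proof (rule integrable_const_bound[OF _ meas])
    show "AE x in M. cmod (herglotz_kernel z (\<tau> x) * of_real (h x)) \<le> 4 / d * C"
      using van AE_space by eventually_elim (use bound[OF z] in blast)
  qed
  have lip: "dist (l z) (l \<eta>) \<le> (4 / d\<^sup>2 * C * measure M (space M)) * dist z \<eta>" if z: "cmod z < 1" "dist z \<eta> < d / 2" for z
  proof -
    have i: "integrable M (\<lambda>x. herglotz_kernel z (\<tau> x) * of_real (h x))" "integrable M (\<lambda>x. herglotz_kernel \<eta> (\<tau> x) * of_real (h x))"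
      using z d \<eta> by (auto intro!: int)
    have "l z - l \<eta> = (LINT x|M. herglotz_kernel z (\<tau> x) * of_real (h x) - herglotz_kernel \<eta> (\<tau> x) * of_real (h x))"
      unfolding l_def by (rule Bochner_Integration.integral_diff[OF i, symmetric])
    also have "cmod \<dots> \<le> (LINT x|M. 4 / d\<^sup>2 * C * dist z \<eta>)"
    proof (rule order_trans[OF integral_norm_bound integral_mono_AE])
      show "integrable M (\<lambda>x. cmod (herglotz_kernel z (\<tau> x) * of_real (h x) - herglotz_kernel \<eta> (\<tau> x) * of_real (h x)))"
        by (intro integrable_norm Bochner_Integration.integrable_diff i)
      show "AE x in M. cmod (herglotz_kernel z (\<tau> x) * of_real (h x) - herglotz_kernel \<eta> (\<tau> x) * of_real (h x)) \<le> 4 / d\<^sup>2 * C * dist z \<eta>"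
        using van AE_space
      proof eventually_elim
        case (elim x)
        show ?case
        proof (cases "h x = 0")
          case True
          then show ?thesis using h(2)[OF elim(2)] d by simp
        next
          case False
          then have f: "d \<le> cmod (\<tau> x - \<eta>)" using elim by (auto simp: dist_norm)
          then have t: "d / 2 \<le> cmod (\<tau> x - z)"
            using dist_triangle[of "\<tau> x" \<eta> z] z(2) by (simp add: dist_norm)
          have "cmod (herglotz_kernel z (\<tau> x) - herglotz_kernel \<eta> (\<tau> x)) = 2 * cmod (z - \<eta>) / (cmod (\<tau> x - z) * cmod (\<tau> x - \<eta>))"
            using f t d \<tau>(2)[OF elim(2)] by (subst herglotz_kernel_diff_point) (auto simp: norm_mult norm_divide)
          also have "\<dots> \<le> 2 * cmod (z - \<eta>) / (d / 2 * d)"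
            using f t d by (intro divide_left_mono mult_mono mult_pos_pos) auto
          also have "\<dots> = 4 / d\<^sup>2 * dist z \<eta>"
            by (simp add: dist_norm power2_eq_square)
          finally have "cmod (herglotz_kernel z (\<tau> x) - herglotz_kernel \<eta> (\<tau> x)) * \<bar>h x\<bar> \<le> 4 / d\<^sup>2 * dist z \<eta> * C"
            using h(2)[OF elim(2)] by (intro mult_mono) auto
          moreover have "herglotz_kernel z (\<tau> x) * of_real (h x) - herglotz_kernel \<eta> (\<tau> x) * of_real (h x)
              = (herglotz_kernel z (\<tau> x) - herglotz_kernel \<eta> (\<tau> x)) * of_real (h x)"
            by (simp add: left_diff_distrib)
          ultimately show ?thesis
            by (simp add: norm_mult mult_ac)
        qed
      qed
    qed simp
    finally show ?thesis by (simp add: dist_norm mult_ac)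
  qed
  have "(l \<longlongrightarrow> l \<eta>) (at \<eta> within ball 0 1)"
  proof (rule tendstoI)
    fix e :: real assume e: "0 < e"
    define A where "A = 4 / d\<^sup>2 * C * measure M (space M)"
    have "((\<lambda>z. A * dist z \<eta>) \<longlongrightarrow> A * dist \<eta> \<eta>) (at \<eta> within ball 0 1)"
      by (intro tendsto_intros)
    then have "\<forall>\<^sub>F z in at \<eta> within ball 0 1. A * dist z \<eta> < e"
      using e by (intro order_tendstoD(2)) auto
    moreover have "\<forall>\<^sub>F z in at \<eta> within ball 0 1. z \<in> ball 0 1 \<and> dist z \<eta> < d / 2"
      using d by (auto simp: eventually_at intro!: exI[of _ "d / 2"])
    ultimately show "\<forall>\<^sub>F z in at \<eta> within ball 0 1. dist (l z) (l \<eta>) < e"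
    proof eventually_elim
      case (elim z)
      then show ?case using lip[of z] by (simp add: A_def)
    qed
  qed
  moreover have "Re (l \<eta>) = 0"
  proof -
    have "Re (l \<eta>) = (LINT x|M. Re (herglotz_kernel \<eta> (\<tau> x) * of_real (h x)))"
      unfolding l_def using d \<eta> by (intro integral_Re[symmetric] int) auto
    also have "\<dots> = (LINT x|M. 0)"
    proof (rule Bochner_Integration.integral_cong[OF refl])
      fix x assume x: "x \<in> space M"
      have "Re (herglotz_kernel \<eta> (\<tau> x)) = 0"
        using poisson_kernel_eq[of "\<tau> x" \<eta>] \<tau>(2)[OF x] \<eta> by (simp add: poisson_kernel_def)
      then show "Re (herglotz_kernel \<eta> (\<tau> x) * of_real (h x)) = 0" by simp
    qed
    finally show ?thesis by simp
  qed
  ultimately show thesis using that[of "l \<eta>"] by (simp add: l_def[abs_def])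
qed

text \<open>The cells on which the representative is constant have diameter \<open>O(\<epsilon> d\<^sup>2)\<close> at distance \<open>d\<close> from
  the complement of \<open>U\<close>.\<close>

lemma boundary_representatives:
  fixes U :: "complex set"
  assumes U: "open U" "- U \<noteq> {}" and \<epsilon>: "0 < \<epsilon>"
  obtains \<rho> R where "\<rho> \<in> borel_measurable circle_measure" "\<And>x. x \<in> sphere 0 1 \<Longrightarrow> \<rho> x \<in> sphere 0 1"
    "\<And>x y. x \<in> sphere 0 1 \<inter> U \<Longrightarrow> y \<notin> U \<Longrightarrow> dist x (\<rho> x) \<le> \<epsilon> * dist x y * dist (\<rho> x) y"
    "countable R" "R \<subseteq> sphere 0 1 \<inter> U" "\<And>\<eta>. \<eta> \<in> U \<Longrightarrow> \<exists>d>0. finite (R \<inter> ball \<eta> d)"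
    "AE x in circle_measure. x \<in> U \<longrightarrow> \<rho> x \<in> R"
    "\<And>y. y \<in> R \<Longrightarrow> 0 < measure circle_measure {x \<in> sphere 0 1. x \<in> U \<and> \<rho> x = y}"
proof -
  define d where "d x = infdist x (- U)" for x
  have d_pos: "0 < d x" if "x \<in> U" for x
    unfolding d_def using that U by (intro infdist_pos_not_in_closed) auto
  have cd: "continuous_on S d" for S
    unfolding d_def by (intro continuous_intros)
  \<comment> \<open>An integer grade of the distance to the complement. A point and its
    representative share the grade, hence also the lower bound \<open>1 / m x\<close> for their
    distances.\<close>
  define m where "m x = nat \<lceil>1 / d x\<rceil>" for x
  have md: "1 / real (m x) \<le> d x" "0 < m x" if "x \<in> U" for x
  proof -
    have "0 < 1 / d x" using d_pos[OF that] by simp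
    then have r: "1 / d x \<le> real (m x)" unfolding m_def by linarith
    then show "0 < m x" using \<open>0 < 1 / d x\<close> by (simp add: m_def)
    then show "1 / real (m x) \<le> d x"
      using r d_pos[OF that] by (simp add: field_simps)
  qed
  \<comment> \<open>Cells of grade \<open>m\<close> have side
    \<open>1 / (\<kappa> * m\<^sup>2)\<close>, so the two coordinates of a displacement add up to at
    most \<open>\<epsilon> / m\<^sup>2\<close>.\<close>
  define \<kappa> where "\<kappa> = 2 / \<epsilon>"
  have \<kappa>: "0 < \<kappa>" using \<epsilon> by (simp add: \<kappa>_def)
  define a where "a x = \<lfloor>\<kappa> * (real (m x))\<^sup>2 * Re x\<rfloor>" for x
  define b where "b x = \<lfloor>\<kappa> * (real (m x))\<^sup>2 * Im x\<rfloor>" for x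
  define rep where "rep k = (SOME y. y \<in> sphere 0 1 \<inter> U \<and> (m y, a y, b y) = k)" for k
  define \<rho> where "\<rho> x = (if x \<in> U then rep (m x, a x, b x) else 1)" for x
  have rep: "rep (m x, a x, b x) \<in> sphere 0 1 \<inter> U \<and>
      (m (rep (m x, a x, b x)), a (rep (m x, a x, b x)), b (rep (m x, a x, b x))) = (m x, a x, b x)"
    if "x \<in> sphere 0 1 \<inter> U" for x
    unfolding rep_def by (rule someI[of _ x]) (use that in simp)
  have \<rho>U: "\<rho> x \<in> sphere 0 1 \<inter> U" "m (\<rho> x) = m x" "a (\<rho> x) = a x" "b (\<rho> x) = b x" if "x \<in> sphere 0 1 \<inter> U" for x
    using rep[OF that] that by (auto simp: \<rho>_def)
  have \<rho>1: "\<rho> x \<in> sphere 0 1" if "x \<in> sphere 0 1" for x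
    using \<rho>U(1)[of x] that by (cases "x \<in> U") (auto simp: \<rho>_def)
  have meas_d [measurable]: "d \<in> borel_measurable circle_measure"
    by (rule circle_continuous_measurable[OF circle_borel_circle_measure cd])
  have meas_Re [measurable]: "Re \<in> borel_measurable circle_measure" and meas_Im [measurable]: "Im \<in> borel_measurable circle_measure"
    by (intro circle_continuous_measurable[OF circle_borel_circle_measure] continuous_intros)+
  have meas_U [measurable]: "Measurable.pred circle_measure (\<lambda>x. x \<in> U)"
  proof -
    have "sphere 0 1 \<inter> U \<in> sets circle_measure"
      using U(1) by (auto simp: sets_restrict_space)
    then show ?thesis
      by (simp add: Measurable.pred_def Int_def)
  qed
  have meas_m [measurable]: "m \<in> measurable circle_measure (count_space UNIV)"
    unfolding m_def by measurable
  have meas_a [measurable]: "a \<in> measurable circle_measure (count_space UNIV)"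
    unfolding a_def by measurable
  have meas_b [measurable]: "b \<in> measurable circle_measure (count_space UNIV)"
    unfolding b_def by measurable
  have "(\<lambda>x. rep (m x, a x, b x)) \<in> borel_measurable circle_measure"
    by (rule measurable_compose_countable[OF _ meas_m], rule measurable_compose_countable[OF _ meas_a],
        rule measurable_compose_countable[OF _ meas_b]) simp
  then have meas_\<rho> [measurable]: "\<rho> \<in> borel_measurable circle_measure"
    unfolding \<rho>_def by measurable
  define R' where "R' = \<rho> ` (sphere 0 1 \<inter> U)"
  \<comment> \<open>Representatives with a fibre of length zero are dropped, which is invisible
    almost everywhere; each remaining one will carry an atom.\<close>
  define R where "R = {y \<in> R'. 0 < measure circle_measure {x \<in> sphere 0 1. x \<in> U \<and> \<rho> x = y}}"
  have "R' \<subseteq> range rep"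
    by (auto simp: R'_def \<rho>_def)
  then have cR': "countable R'"
    by (rule countable_subset) simp
  have RU: "R' \<subseteq> sphere 0 1 \<inter> U"
    unfolding R'_def using \<rho>U(1) by blast
  have fib: "{x \<in> sphere 0 1. x \<in> U \<and> \<rho> x = y} \<in> sets circle_measure" for y
  proof -
    have "{x \<in> space circle_measure. x \<in> U \<and> \<rho> x = y} \<in> sets circle_measure"
      by measurable
    then show ?thesis by simp
  qed
  show thesis
  proof (rule that[OF meas_\<rho> \<rho>1])
    show "dist x (\<rho> x) \<le> \<epsilon> * dist x y * dist (\<rho> x) y" if x: "x \<in> sphere 0 1 \<inter> U" and y: "y \<notin> U" for x y
    proof -
      define M where "M = \<kappa> * (real (m x))\<^sup>2"
      have m0: "0 < real (m x)" using md(2)[of x] x by simp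
      have M: "0 < M" using m0 \<kappa> by (simp add: M_def)
      have fl: "\<bar>s - t\<bar> < 1" if "\<lfloor>s\<rfloor> = \<lfloor>t\<rfloor>" for s t :: real
        using that by linarith
      have sc: "\<bar>s - t\<bar> < 1 / M" if "\<lfloor>M * s\<rfloor> = \<lfloor>M * t\<rfloor>" for s t
      proof -
        have "M * s - M * t = M * (s - t)" by (simp add: algebra_simps)
        then have "M * \<bar>s - t\<bar> < 1"
          using fl[OF that] M by (simp add: abs_mult)
        then show ?thesis using M by (simp add: field_simps)
      qed
      have re: "\<bar>Re x - Re (\<rho> x)\<bar> < 1 / M"
        using \<rho>U(2,3)[OF x] by (intro sc) (simp add: a_def M_def)
      have im: "\<bar>Im x - Im (\<rho> x)\<bar> < 1 / M"
        using \<rho>U(2,4)[OF x] by (intro sc) (simp add: b_def M_def)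
      have "dist x (\<rho> x) \<le> 2 / M"
        using cmod_le[of "x - \<rho> x"] re im by (simp add: dist_norm)
      also have "2 / M = \<epsilon> * (1 / real (m x)) * (1 / real (m x))"
        using \<epsilon> m0 by (simp add: M_def \<kappa>_def power2_eq_square)
      also have "\<dots> \<le> \<epsilon> * dist x y * dist (\<rho> x) y"
      proof -
        have "1 / real (m x) \<le> dist x y"
          using md(1)[of x] infdist_le[of y "- U" x] x y by (simp add: d_def)
        moreover have "1 / real (m x) \<le> dist (\<rho> x) y"
          using md(1)[of "\<rho> x"] infdist_le[of y "- U" "\<rho> x"] \<rho>U(1,2)[OF x] y by (simp add: d_def)
        ultimately show ?thesis
          using \<epsilon> m0 by (intro mult_mono) auto
      qed
      finally show ?thesis .
    qed
    show "countable R" "R \<subseteq> sphere 0 1 \<inter> U"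
      using cR' RU by (auto simp: R_def intro: countable_subset)
    show "0 < measure circle_measure {x \<in> sphere 0 1. x \<in> U \<and> \<rho> x = y}" if "y \<in> R" for y
      using that by (simp add: R_def)
    show "AE x in circle_measure. x \<in> U \<longrightarrow> \<rho> x \<in> R"
    proof -
      have "AE x in circle_measure. \<not> (x \<in> U \<and> \<rho> x = y)" if "y \<in> R' - R" for y
      proof -
        have "measure circle_measure {x \<in> sphere 0 1. x \<in> U \<and> \<rho> x = y} = 0"
          using that by (simp add: R_def zero_less_measure_iff)
        then have "{x \<in> sphere 0 1. x \<in> U \<and> \<rho> x = y} \<in> null_sets circle_measure"
          using fib by (auto simp: circle.emeasure_eq_measure)
        from AE_not_in[OF this] AE_space show ?thesis
          by eventually_elim auto
      qed
      then have "AE x in circle_measure. \<forall>y\<in>R' - R. \<not> (x \<in> U \<and> \<rho> x = y)"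
        using cR' by (intro AE_ball_countable') auto
      then show ?thesis
        using AE_space by eventually_elim (auto simp: R'_def)
    qed
    show "\<exists>e>0. finite (R \<inter> ball \<eta> e)" if \<eta>: "\<eta> \<in> U" for \<eta>
    proof (intro exI[of _ "d \<eta> / 2"] conjI)
      show "0 < d \<eta> / 2" using d_pos[OF \<eta>] by simp
      define m0 where "m0 = nat \<lceil>2 / d \<eta>\<rceil>"
      define N where "N = \<lceil>\<kappa> * (real m0)\<^sup>2\<rceil>"
      \<comment> \<open>Near \<open>\<eta>\<close> the distance to the complement is bounded below,
        so the grade and both cell indices range over finite sets.\<close>
      have "R \<inter> ball \<eta> (d \<eta> / 2) \<subseteq> rep ` ({..m0} \<times> {-N..N} \<times> {-N..N})"
      proof
        fix y assume y: "y \<in> R \<inter> ball \<eta> (d \<eta> / 2)"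
        then obtain x where x: "x \<in> sphere 0 1 \<inter> U" "y = rep (m x, a x, b x)"
          by (auto simp: R_def R'_def \<rho>_def)
        have yU: "y \<in> sphere 0 1 \<inter> U" "m y = m x" "a y = a x" "b y = b x"
          using rep[OF x(1)] x(2) by auto
        have "d \<eta> \<le> d y + dist \<eta> y"
          unfolding d_def by (rule infdist_triangle)
        then have dy: "d \<eta> / 2 \<le> d y" using y by simp
        have "1 / d y \<le> 2 / d \<eta>"
          using dy d_pos[OF \<eta>] d_pos[of y] yU by (simp add: field_simps)
        then have my: "m y \<le> m0"
          unfolding m_def m0_def by (intro nat_mono ceiling_mono)
        have coord: "\<lfloor>\<kappa> * (real (m y))\<^sup>2 * t\<rfloor> \<in> {-N..N}" if "\<bar>t\<bar> \<le> 1" for t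
        proof -
          have "\<bar>\<kappa> * (real (m y))\<^sup>2 * t\<bar> \<le> \<kappa> * (real m0)\<^sup>2 * 1"
            unfolding abs_mult using \<kappa> my that by (intro mult_mono power_mono) auto
          also have "\<dots> \<le> of_int N" unfolding N_def by linarith
          finally have "- of_int N \<le> \<kappa> * (real (m y))\<^sup>2 * t" "\<kappa> * (real (m y))\<^sup>2 * t \<le> of_int N"
            by linarith+
          then show ?thesis by (auto simp: le_floor_iff floor_le_iff)
        qed
        have "a y \<in> {-N..N}" "b y \<in> {-N..N}"
          unfolding a_def b_def using abs_Re_le_cmod[of y] abs_Im_le_cmod[of y] yU(1) by (intro coord; simp)+
        then show "y \<in> rep ` ({..m0} \<times> {-N..N} \<times> {-N..N})"
          using my yU x(2) by (intro image_eqI[of _ _ "(m x, a x, b x)"]) auto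
      qed
      then show "finite (R \<inter> ball \<eta> (d \<eta> / 2))"
        by (rule finite_subset) simp
    qed
  qed
qed


text \<open>\<open>U\<close> cuts the arcs out of the circle, \<open>c\<close> is the step density
  on them and \<open>R\<close> the set of atoms. The product form of \<open>\<rho>_close\<close>
  matches the denominator in \<open>herglotz_kernel_diff_pole\<close> as the pole approaches a point
  \<open>y\<close> outside \<open>U\<close>.\<close>

locale mass_shift =
  fixes U :: "complex set" and c :: "complex \<Rightarrow> real" and C :: real and \<rho> :: "complex \<Rightarrow> complex"
    and R :: "complex set" and \<epsilon> :: real
  assumes c_measurable: "c \<in> borel_measurable circle_measure"
    and c_bounds: "\<And>x. 0 \<le> c x" "\<And>x. c x \<le> C"
    and c_outside: "\<And>x. x \<notin> U \<Longrightarrow> c x = 0"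
    and c_inside: "\<And>x. x \<in> U \<Longrightarrow> 0 < c x"
    and c_locally_constant: "\<And>x. x \<in> U \<Longrightarrow> \<exists>d>0. \<forall>y\<in>ball x d. c y = c x"
    and \<rho>_measurable: "\<rho> \<in> borel_measurable circle_measure"
    and \<rho>_circle: "\<And>x. x \<in> sphere 0 1 \<Longrightarrow> \<rho> x \<in> sphere 0 1"
    and \<rho>_close: "\<And>x y. x \<in> sphere 0 1 \<inter> U \<Longrightarrow> y \<notin> U \<Longrightarrow> dist x (\<rho> x) \<le> \<epsilon> * dist x y * dist (\<rho> x) y"
    and R: "countable R" "R \<subseteq> sphere 0 1 \<inter> U"
    and R_discrete: "\<And>\<eta>. \<eta> \<in> U \<Longrightarrow> \<exists>d>0. finite (R \<inter> ball \<eta> d)"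
    and \<rho>_R: "AE x in circle_measure. x \<in> U \<longrightarrow> \<rho> x \<in> R"
    and R_fibre: "\<And>y. y \<in> R \<Longrightarrow> 0 < measure circle_measure {x \<in> sphere 0 1. x \<in> U \<and> \<rho> x = y}"
    and \<epsilon>: "0 \<le> \<epsilon>"
begin

definition lam :: "complex measure" where "lam = density circle_measure (\<lambda>x. ennreal (c x))"
definition nu :: "complex measure" where "nu = distr lam (restrict_space borel (sphere 0 1)) \<rho>"
definition G :: "complex \<Rightarrow> complex" where "G z = herglotz lam z - herglotz nu z"

lemma C_nonneg: "0 \<le> C"
  using c_bounds[of 0] by linarith

lemma integrable_c: "integrable circle_measure c"
  by (rule circle_bounded_integrable[OF circle_borel_circle_measure c_measurable, of C])
    (use c_bounds in \<open>auto simp: abs_le_iff intro: order_trans[of _ 0]\<close>)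

lemma lam_circle_borel: "circle_borel_measure lam"
  unfolding lam_def by (rule circle_borel_density[OF integrable_c c_bounds(1)])

lemma \<rho>_measurable_lam: "\<rho> \<in> measurable lam (restrict_space borel (sphere 0 1))"
proof -
  have "\<rho> \<in> measurable circle_measure (restrict_space borel (sphere 0 1))"
    using \<rho>_circle \<rho>_measurable by (intro measurable_restrict_space2) auto
  then show ?thesis
    using circle_borel_measurable_cong[OF lam_circle_borel] by blast
qed

lemma nu_circle_borel: "circle_borel_measure nu"
proof -
  interpret finite_measure lam by (rule circle_borelD(2)[OF lam_circle_borel])
  show ?thesis
    unfolding nu_def circle_borel_measure_def using finite_measure_distr[OF \<rho>_measurable_lam] by simp
qed

lemma herglotz_lam: "herglotz lam z = (LINT x|circle_measure. herglotz_kernel z x * of_real (c x))"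
  unfolding herglotz_def lam_def
  by (subst integral_circle_density[OF integrable_c c_bounds(1)])
    (auto simp: scaleR_conv_of_real mult_ac intro!: borel_measurable_herglotz_kernel circle_ident_measurable circle_borel_circle_measure)

lemma herglotz_nu: "herglotz nu z = (LINT x|circle_measure. herglotz_kernel z (\<rho> x) * of_real (c x))"
proof -
  have "herglotz nu z = (LINT x|lam. herglotz_kernel z (\<rho> x))"
    unfolding herglotz_def nu_def
    by (rule integral_distr[OF \<rho>_measurable_lam])
      (simp add: borel_measurable_herglotz_kernel measurable_restrict_space1)
  also have "\<dots> = (LINT x|circle_measure. herglotz_kernel z (\<rho> x) * of_real (c x))"
    unfolding lam_def
    by (subst integral_circle_density[OF integrable_c c_bounds(1)])
      (auto simp: scaleR_conv_of_real mult_ac intro!: borel_measurable_herglotz_kernel \<rho>_measurable)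
  finally show ?thesis .
qed

lemma measure_lam: "measure lam (sphere 0 1) = (LINT x|circle_measure. c x)"
proof -
  have "(LINT x|circle_measure. herglotz_kernel 0 x * complex_of_real (c x)) = (LINT x|circle_measure. complex_of_real (c x))"
    by (rule Bochner_Integration.integral_cong[OF refl]) (auto simp: herglotz_kernel_def)
  then show ?thesis
    using herglotz_lam[of 0] herglotz_at_0[OF lam_circle_borel] by simp
qed

lemma measure_nu: "measure nu (sphere 0 1) = (LINT x|circle_measure. c x)"
proof -
  have "(LINT x|circle_measure. herglotz_kernel 0 (\<rho> x) * complex_of_real (c x)) = (LINT x|circle_measure. complex_of_real (c x))"
  proof (rule Bochner_Integration.integral_cong[OF refl])
    fix x assume "x \<in> space circle_measure"
    then have "\<rho> x \<noteq> 0" using \<rho>_circle[of x] by auto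
    then show "herglotz_kernel 0 (\<rho> x) * complex_of_real (c x) = complex_of_real (c x)"
      by (simp add: herglotz_kernel_def)
  qed
  then show ?thesis
    using herglotz_nu[of 0] herglotz_at_0[OF nu_circle_borel] by simp
qed

lemma G_0: "G 0 = 0"
  by (simp add: G_def herglotz_at_0 lam_circle_borel nu_circle_borel measure_lam measure_nu)

lemma G_holomorphic: "G holomorphic_on ball 0 1"
  unfolding G_def[abs_def] by (intro holomorphic_on_diff herglotz_holomorphic lam_circle_borel nu_circle_borel)

lemma Re_G: "cmod z < 1 \<Longrightarrow> Re (G z) = poisson lam z - poisson nu z"
  by (simp add: G_def Re_herglotz lam_circle_borel nu_circle_borel)

lemma cmod_exp_G: "cmod z < 1 \<Longrightarrow> cmod (exp (- G z)) \<le> exp (poisson nu z)"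
  using poisson_nonneg[OF lam_circle_borel] by (simp add: Re_G)

lemma poisson_lam_le:
  assumes z: "cmod z < 1"
  shows "poisson lam z \<le> C"
proof -
  note K = circle_continuous_integrable[OF circle_borel_circle_measure continuous_poisson_kernel[OF z]]
  have [measurable]: "c \<in> borel_measurable circle_measure" by (rule c_measurable)
  have "poisson lam z = (LINT x|circle_measure. c x *\<^sub>R poisson_kernel z x)"
    unfolding poisson_def lam_def
    by (rule integral_circle_density[OF integrable_c c_bounds(1)]) (rule borel_measurable_integrable[OF K])
  also have "\<dots> \<le> (LINT x|circle_measure. C * poisson_kernel z x)"
  proof (rule integral_mono)
    have "\<bar>c x * poisson_kernel z x\<bar> \<le> C * (2 / (1 - cmod z))" if "cmod x = 1" for x
      unfolding abs_mult using c_bounds[of x] poisson_kernel_bounds(2)[OF that z] by (intro mult_mono) auto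
    then show "integrable circle_measure (\<lambda>x. c x *\<^sub>R poisson_kernel z x)"
      using borel_measurable_integrable[OF K]
      by (intro circle_bounded_integrable[OF circle_borel_circle_measure, of _ "C * (2 / (1 - cmod z))"]) auto
    show "integrable circle_measure (\<lambda>x. C * poisson_kernel z x)"
      using K by simp
    show "c x *\<^sub>R poisson_kernel z x \<le> C * poisson_kernel z x" if "x \<in> space circle_measure" for x
      using c_bounds[of x] poisson_kernel_pos[of x z] that z by (auto intro!: mult_right_mono less_imp_le)
  qed
  also have "\<dots> = C"
    using poisson_kernel_integral[OF z] by simp
  finally show ?thesis .
qed

lemma integrable_shifted_kernel:
  assumes z: "cmod z < 1" and \<tau>: "\<tau> \<in> borel_measurable circle_measure" "\<And>x. x \<in> sphere 0 1 \<Longrightarrow> \<tau> x \<in> sphere 0 1"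
  shows "integrable circle_measure (\<lambda>x. herglotz_kernel z (\<tau> x) * of_real (c x))"
proof (rule circle_bounded_integrable[OF circle_borel_circle_measure])
  show "(\<lambda>x. herglotz_kernel z (\<tau> x) * of_real (c x)) \<in> borel_measurable circle_measure"
    by (intro borel_measurable_times borel_measurable_herglotz_kernel \<tau>(1) measurable_compose[OF c_measurable]) simp
  show "norm (herglotz_kernel z (\<tau> x) * of_real (c x)) \<le> 2 / (1 - cmod z) * C" if "x \<in> sphere 0 1" for x
    unfolding norm_mult using herglotz_kernel_bound[of "\<tau> x" z] \<tau>(2)[OF that] z c_bounds[of x] by (intro mult_mono) auto
qed

text \<open>For \<open>z\<close> on the radius to \<open>\<eta>\<close>, every \<open>x\<close> on
  the circle satisfies \<open>|x - \<eta>| \<le> 2 * |x - z|\<close>. So \<open>\<rho>_close\<close>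
  cancels both factors in the denominator of the kernel difference, and the constant is
  \<open>2 * 2 * 2\<close>.\<close>

lemma G_radial_bound:
  assumes \<eta>: "\<eta> \<in> sphere 0 1" "\<eta> \<notin> U" and t: "0 \<le> t" "t < 1"
  shows "cmod (G (of_real t * \<eta>)) \<le> 8 * \<epsilon> * C"
proof -
  define z where "z = of_real t * \<eta>"
  have z: "cmod z = t" using \<eta> t by (simp add: z_def norm_mult)
  then have z1: "cmod z < 1" using t by simp
  have far: "cmod (x - \<eta>) \<le> 2 * cmod (x - z)" "x \<noteq> z" if "cmod x = 1" for x
  proof -
    have "cmod (z - \<eta>) = 1 - t"
    proof -
      have "z - \<eta> = of_real (t - 1) * \<eta>" by (simp add: z_def algebra_simps)
      then show ?thesis using \<eta> t by (simp only: norm_mult norm_of_real) simp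
    qed
    also have "\<dots> \<le> cmod (x - z)"
      using norm_triangle_ineq2[of x z] that z by simp
    finally show "cmod (x - \<eta>) \<le> 2 * cmod (x - z)"
      using norm_triangle_ineq[of "x - z" "z - \<eta>"] by simp
    show "x \<noteq> z" using that z1 by auto
  qed
  have i: "integrable circle_measure (\<lambda>x. herglotz_kernel z x * of_real (c x))"
    "integrable circle_measure (\<lambda>x. herglotz_kernel z (\<rho> x) * of_real (c x))"
    by (intro integrable_shifted_kernel[OF z1] circle_ident_measurable circle_borel_circle_measure \<rho>_measurable \<rho>_circle; simp)+
  have "G z = (LINT x|circle_measure. herglotz_kernel z x * of_real (c x) - herglotz_kernel z (\<rho> x) * of_real (c x))"
    unfolding G_def herglotz_lam herglotz_nu by (rule Bochner_Integration.integral_diff[OF i, symmetric])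
  also have "cmod \<dots> \<le> (LINT x|circle_measure. 8 * \<epsilon> * C)"
  proof (rule order_trans[OF integral_norm_bound integral_mono])
    show "integrable circle_measure (\<lambda>x. cmod (herglotz_kernel z x * of_real (c x) - herglotz_kernel z (\<rho> x) * of_real (c x)))"
      by (intro integrable_norm Bochner_Integration.integrable_diff i)
    fix x assume "x \<in> space circle_measure"
    then have x: "x \<in> sphere 0 1" "\<rho> x \<in> sphere 0 1" using \<rho>_circle by auto
    show "cmod (herglotz_kernel z x * of_real (c x) - herglotz_kernel z (\<rho> x) * of_real (c x)) \<le> 8 * \<epsilon> * C"
    proof (cases "x \<in> U")
      case False
      then show ?thesis using \<epsilon> C_nonneg by (simp add: c_outside)
    next
      case True
      have p: "0 < cmod (x - z)" "0 < cmod (\<rho> x - z)"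
        using far(2) x by auto
      have "cmod (herglotz_kernel z x - herglotz_kernel z (\<rho> x)) = 2 * t * cmod (\<rho> x - x) / (cmod (x - z) * cmod (\<rho> x - z))"
        using p by (subst herglotz_kernel_diff_pole) (auto simp: norm_mult norm_divide z t)
      also have "\<dots> \<le> 2 * t * (\<epsilon> * (2 * cmod (x - z)) * (2 * cmod (\<rho> x - z))) / (cmod (x - z) * cmod (\<rho> x - z))"
      proof (intro divide_right_mono mult_left_mono)
        have "cmod (\<rho> x - x) \<le> \<epsilon> * cmod (x - \<eta>) * cmod (\<rho> x - \<eta>)"
          using \<rho>_close[of x \<eta>] x True \<eta> by (simp add: dist_norm norm_minus_commute)
        also have "\<dots> \<le> \<epsilon> * (2 * cmod (x - z)) * (2 * cmod (\<rho> x - z))"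
          using far(1) x \<epsilon> by (intro mult_mono) auto
        finally show "cmod (\<rho> x - x) \<le> \<epsilon> * (2 * cmod (x - z)) * (2 * cmod (\<rho> x - z))" .
      qed (use t in auto)
      also have "\<dots> = 8 * \<epsilon> * t"
        using p by (simp add: field_simps)
      also have "\<dots> \<le> 8 * \<epsilon> * 1"
        using \<epsilon> t by (intro mult_left_mono) auto
      finally have "cmod (herglotz_kernel z x - herglotz_kernel z (\<rho> x)) * \<bar>c x\<bar> \<le> 8 * \<epsilon> * C"
        using c_bounds[of x] \<epsilon> by (intro mult_mono) auto
      moreover have "herglotz_kernel z x * of_real (c x) - herglotz_kernel z (\<rho> x) * of_real (c x)
          = (herglotz_kernel z x - herglotz_kernel z (\<rho> x)) * of_real (c x)"
        by (simp add: left_diff_distrib)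
      ultimately show ?thesis
        by (simp add: norm_mult)
    qed
  qed simp
  finally show ?thesis by (simp add: z_def)
qed

text \<open>The Herglotz integral of the constant \<open>c \<eta>\<close> is
  \<open>c \<eta>\<close>. What remains of \<open>c\<close> vanishes near \<open>\<eta>\<close>, and
  the moved mass stays away because atoms do not accumulate in \<open>U\<close>; both remainders
  have imaginary limits.\<close>

lemma G_limit_inside:
  assumes \<eta>: "\<eta> \<in> sphere 0 1" "\<eta> \<in> U" "\<eta> \<notin> R"
  obtains l where "(G \<longlongrightarrow> l) (at \<eta> within ball 0 1)" "Re l = c \<eta>"
proof -
  have h1: "cmod \<eta> = 1" using \<eta> by simp
  obtain d where d: "0 < d" "\<And>y. dist \<eta> y < d \<Longrightarrow> c y = c \<eta>"
    using c_locally_constant[OF \<eta>(2)] unfolding Ball_def mem_ball by blast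
  obtain d' where d': "0 < d'" "finite (R \<inter> ball \<eta> d')"
    using R_discrete[OF \<eta>(2)] by blast
  have "y \<noteq> \<eta>" if "y \<in> R \<inter> ball \<eta> d'" for y
    using that \<eta>(3) by blast
  then obtain e where e: "0 < e" "\<And>y. y \<in> R \<inter> ball \<eta> d' \<Longrightarrow> e \<le> dist \<eta> y"
    using finite_set_avoid[OF d'(2), of \<eta>] by metis
  obtain l1 where l1: "((\<lambda>z. LINT x|circle_measure. herglotz_kernel z x * of_real (c x - c \<eta>)) \<longlongrightarrow> l1) (at \<eta> within ball 0 1)" "Re l1 = 0"
  proof (rule herglotz_kernel_integral_boundary[OF circle.finite_measure_axioms, where \<tau> = "\<lambda>x. x" and h = "\<lambda>x. c x - c \<eta>" and C = C and \<eta> = \<eta> and d = d])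
    have "c x - c \<eta> = 0" if "dist x \<eta> < d" for x
      using d(2)[of x] that by (simp add: dist_commute)
    then show "AE x in circle_measure. dist x \<eta> < d \<longrightarrow> c x - c \<eta> = 0"
      by simp
    show "\<bar>c x - c \<eta>\<bar> \<le> C" for x
      using c_bounds[of x] c_bounds[of \<eta>] by linarith
  qed (use d(1) h1 c_measurable in \<open>auto intro: circle_ident_measurable circle_borel_circle_measure\<close>)
  obtain l2 where l2: "((\<lambda>z. LINT x|circle_measure. herglotz_kernel z (\<rho> x) * of_real (c x)) \<longlongrightarrow> l2) (at \<eta> within ball 0 1)" "Re l2 = 0"
  proof (rule herglotz_kernel_integral_boundary[OF circle.finite_measure_axioms \<rho>_measurable _ c_measurable, where C = C and \<eta> = \<eta> and d = "min d' e"])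
    show "AE x in circle_measure. dist (\<rho> x) \<eta> < min d' e \<longrightarrow> c x = 0"
      using \<rho>_R
    proof eventually_elim
      case (elim x)
      show ?case
        using elim e(2)[of "\<rho> x"] c_outside[of x] by (auto simp: dist_commute)
    qed
  qed (use d' e h1 \<rho>_circle c_bounds in \<open>auto simp: abs_le_iff intro: order_trans[of _ 0]\<close>)
  have G: "G z = (LINT x|circle_measure. herglotz_kernel z x * of_real (c x - c \<eta>)) + of_real (c \<eta>) - (LINT x|circle_measure. herglotz_kernel z (\<rho> x) * of_real (c x))"
    if "z \<in> ball 0 1" for z
  proof -
    have z: "cmod z < 1" using that by simp
    have K: "integrable circle_measure (\<lambda>x. herglotz_kernel z x)"
      by (rule circle_continuous_integrable[OF circle_borel_circle_measure continuous_herglotz_kernel[OF z]])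
    have i: "integrable circle_measure (\<lambda>x. herglotz_kernel z x * of_real (c x))"
      by (intro integrable_shifted_kernel[OF z] circle_ident_measurable circle_borel_circle_measure)
    have "(LINT x|circle_measure. herglotz_kernel z x) = 1"
      using schwarz_formula[of "\<lambda>_. 1" z] z by simp
    then have "(LINT x|circle_measure. herglotz_kernel z x * of_real (c x) - herglotz_kernel z x * of_real (c \<eta>)) = herglotz lam z - of_real (c \<eta>)"
      unfolding herglotz_lam using i K by (subst Bochner_Integration.integral_diff) auto
    then show ?thesis
      by (simp add: G_def herglotz_nu right_diff_distrib)
  qed
  have "((\<lambda>z. (LINT x|circle_measure. herglotz_kernel z x * of_real (c x - c \<eta>)) + of_real (c \<eta>) - (LINT x|circle_measure. herglotz_kernel z (\<rho> x) * of_real (c x)))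
      \<longlongrightarrow> l1 + of_real (c \<eta>) - l2) (at \<eta> within ball 0 1)"
    by (intro tendsto_intros l1 l2)
  then have "(G \<longlongrightarrow> l1 + of_real (c \<eta>) - l2) (at \<eta> within ball 0 1)"
    by (rule Lim_transform_within[OF _ zero_less_one]) (use G in auto)
  then show thesis
    by (rule that) (simp add: l1 l2)
qed

lemma radial_filterlim: "cmod \<eta> = 1 \<Longrightarrow> filterlim (\<lambda>t. of_real t * \<eta>) (at \<eta> within ball 0 1) (at_left 1)"
proof -
  assume \<eta>: "cmod \<eta> = 1"
  have "((\<lambda>t. of_real t * \<eta>) \<longlongrightarrow> of_real 1 * \<eta>) (at_left (1::real))"
    by (intro tendsto_intros)
  moreover have "\<forall>\<^sub>F t in at_left (1::real). of_real t * \<eta> \<in> ball 0 1 \<and> of_real t * \<eta> \<noteq> \<eta>"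
    using eventually_at_left_real[of 0 1] \<eta>
    by (auto simp: norm_mult elim!: eventually_mono)
  ultimately show ?thesis
    by (simp add: filterlim_at eventually_conj_iff)
qed

text \<open>Neither \<open>c\<close> nor the atoms come near \<open>\<eta>\<close>, so the limit
  exists; its size is read off along the radius.\<close>

lemma G_limit_outside:
  assumes \<eta>: "\<eta> \<in> sphere 0 1" and d: "0 < d" "ball \<eta> d \<inter> U = {}"
  obtains l where "(G \<longlongrightarrow> l) (at \<eta> within ball 0 1)" "cmod l \<le> 8 * \<epsilon> * C"
proof -
  have h1: "cmod \<eta> = 1" using \<eta> by simp
  have near: "dist x \<eta> < d \<Longrightarrow> x \<notin> U" for x
    using d by (auto simp: dist_commute)
  obtain l1 where l1: "((\<lambda>z. LINT x|circle_measure. herglotz_kernel z x * of_real (c x)) \<longlongrightarrow> l1) (at \<eta> within ball 0 1)"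
  proof (rule herglotz_kernel_integral_boundary[OF circle.finite_measure_axioms _ _ c_measurable, where \<tau> = "\<lambda>x. x" and C = C and \<eta> = \<eta> and d = d])
    show "AE x in circle_measure. dist x \<eta> < d \<longrightarrow> c x = 0"
      by (intro AE_I2) (simp add: near c_outside)
  qed (use d h1 c_bounds in \<open>auto simp: abs_le_iff intro: order_trans[of _ 0] circle_ident_measurable circle_borel_circle_measure\<close>)
  obtain l2 where l2: "((\<lambda>z. LINT x|circle_measure. herglotz_kernel z (\<rho> x) * of_real (c x)) \<longlongrightarrow> l2) (at \<eta> within ball 0 1)"
  proof (rule herglotz_kernel_integral_boundary[OF circle.finite_measure_axioms \<rho>_measurable _ c_measurable, where C = C and \<eta> = \<eta> and d = d])
    show "AE x in circle_measure. dist (\<rho> x) \<eta> < d \<longrightarrow> c x = 0"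
      using \<rho>_R
    proof eventually_elim
      case (elim x)
      then show ?case using near[of "\<rho> x"] R(2) c_outside[of x] by auto
    qed
  qed (use d h1 \<rho>_circle c_bounds in \<open>auto simp: abs_le_iff intro: order_trans[of _ 0]\<close>)
  have lim: "(G \<longlongrightarrow> l1 - l2) (at \<eta> within ball 0 1)"
    unfolding G_def[abs_def] herglotz_lam herglotz_nu by (intro tendsto_intros l1 l2)
  have "((\<lambda>t. G (of_real t * \<eta>)) \<longlongrightarrow> l1 - l2) (at_left (1::real))"
    by (rule filterlim_compose[OF lim radial_filterlim[OF h1]])
  then have "((\<lambda>t. cmod (G (of_real t * \<eta>))) \<longlongrightarrow> cmod (l1 - l2)) (at_left (1::real))"
    by (rule tendsto_norm)
  then have "cmod (l1 - l2) \<le> 8 * \<epsilon> * C"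
  proof (rule tendsto_upperbound)
    show "\<forall>\<^sub>F t in at_left (1::real). cmod (G (of_real t * \<eta>)) \<le> 8 * \<epsilon> * C"
      using eventually_at_left_real[of 0 1]
      by (rule eventually_mono) (use near[of \<eta>] d \<eta> in \<open>auto intro!: G_radial_bound\<close>)
  qed simp
  then show thesis using lim that by blast
qed

text \<open>The fibre over \<open>\<eta>\<close> has positive length, and \<open>c\<close> is
  positive on it.\<close>

lemma measure_nu_atom:
  assumes \<eta>: "\<eta> \<in> R"
  shows "0 < measure nu {\<eta>}"
proof -
  interpret lam: finite_measure lam by (rule circle_borelD(2)[OF lam_circle_borel])
  define A where "A = {x \<in> sphere 0 1. x \<in> U \<and> \<rho> x = \<eta>}"
  have A0: "0 < measure circle_measure A"
    unfolding A_def by (rule R_fibre[OF \<eta>])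
  then have sA: "A \<in> sets circle_measure"
    using measure_notin_sets by fastforce
  have s\<eta>: "{\<eta>} \<in> sets (restrict_space borel (sphere 0 1))"
    using \<eta> R(2) by (auto simp: sets_restrict_space intro!: image_eqI[of _ _ "{\<eta>}"])
  have "emeasure lam A \<noteq> 0"
  proof
    assume "emeasure lam A = 0"
    then have "A \<in> null_sets lam"
      using sA by (auto simp: lam_def)
    then have "AE x in circle_measure. x \<in> A \<longrightarrow> ennreal (c x) = 0"
      unfolding lam_def using c_measurable by (subst (asm) null_sets_density_iff) auto
    then have "AE x in circle_measure. x \<notin> A"
      by eventually_elim (auto simp: A_def ennreal_eq_0_iff dest: c_inside)
    then have "A \<in> null_sets circle_measure"
      using sA AE_iff_null_sets by blast
    then show False using A0 by (simp add: measure_def null_setsD1)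
  qed
  then have "0 < measure lam A"
    by (simp add: lam.emeasure_eq_measure zero_less_measure_iff)
  also have "\<dots> \<le> measure lam (\<rho> -` {\<eta>} \<inter> space lam)"
  proof (rule lam.finite_measure_mono)
    show "A \<subseteq> \<rho> -` {\<eta>} \<inter> space lam"
      unfolding A_def circle_borelD(3)[OF lam_circle_borel] by blast
    show "\<rho> -` {\<eta>} \<inter> space lam \<in> sets lam"
      by (rule measurable_sets[OF \<rho>_measurable_lam s\<eta>])
  qed
  also have "\<dots> = measure nu {\<eta>}"
    unfolding nu_def by (rule measure_distr[OF \<rho>_measurable_lam s\<eta>, symmetric])
  finally show ?thesis .
qed

text \<open>On the radius the kernel at the atom is \<open>(1 + t) / (1 - t)\<close>, while
  \<open>lam\<close> contributes at most \<open>C\<close>. The blow-up bounds the components of the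
  final disc from below on the radii to the atoms.\<close>

lemma Re_G_atom:
  assumes \<eta>: "\<eta> \<in> R"
  shows "filterlim (\<lambda>t. Re (- G (of_real t * \<eta>))) at_top (at_left 1)"
proof -
  have h1: "cmod \<eta> = 1" using \<eta> R by auto
  interpret nu: finite_measure nu by (rule circle_borelD(2)[OF nu_circle_borel])
  define a where "a = measure nu {\<eta>}"
  have a: "0 < a" unfolding a_def by (rule measure_nu_atom[OF \<eta>])
  have s: "{\<eta>} \<in> sets nu"
    using a measure_notin_sets unfolding a_def by fastforce
  have le: "a / (1 - t) - C \<le> Re (- G (of_real t * \<eta>))" if t: "0 < t" "t < 1" for t
  proof -
    define z where "z = of_real t * \<eta>"
    have z: "cmod z < 1" "cmod z = t" using t h1 by (simp_all add: z_def norm_mult)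
    have "cmod (\<eta> - z) = 1 - t"
    proof -
      have "\<eta> - z = of_real (1 - t) * \<eta>" by (simp add: z_def algebra_simps)
      then show ?thesis using h1 t by (simp only: norm_mult norm_of_real) simp
    qed
    moreover have "1 - t\<^sup>2 = (1 + t) * (1 - t)"
      by (simp add: power2_eq_square algebra_simps)
    ultimately have "poisson_kernel z \<eta> = (1 + t) * (1 - t) / ((1 - t) * (1 - t))"
      by (simp only: poisson_kernel_eq[OF h1] z(2)) (simp add: power2_eq_square)
    then have "poisson_kernel z \<eta> = (1 + t) / (1 - t)"
      using t by simp
    then have P: "1 / (1 - t) \<le> poisson_kernel z \<eta>"
      using t by (simp add: divide_right_mono)
    have "a / (1 - t) = (LINT x|nu. indicator {\<eta>} x * (1 / (1 - t)))"
      using s by (simp add: a_def)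
    also have "\<dots> \<le> poisson nu z"
      unfolding poisson_def
    proof (rule integral_mono)
      show "integrable nu (poisson_kernel z)"
        by (rule integrable_poisson_kernel[OF nu_circle_borel z(1)])
      show "integrable nu (\<lambda>x. indicator {\<eta>} x * (1 / (1 - t)))"
        using s by (intro integrable_mult_left integrable_real_indicator) (auto simp: nu.emeasure_eq_measure)
      show "indicator {\<eta>} x * (1 / (1 - t)) \<le> poisson_kernel z x" if "x \<in> space nu" for x
        using P poisson_kernel_pos[of x z] z(1) that circle_borelD(3)[OF nu_circle_borel]
        by (auto simp: indicator_def less_imp_le)
    qed
    finally show ?thesis
      using Re_G[OF z(1)] poisson_lam_le[OF z(1)] by (simp add: z_def)
  qed
  have "filterlim (\<lambda>t. a / (1 - t) - C) at_top (at_left 1)"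
    using a by real_asymp
  then show ?thesis
    by (rule filterlim_at_top_mono) (use eventually_at_left_real[of 0 1] le in \<open>auto elim!: eventually_mono\<close>)
qed

end

section \<open>Construction of discs\<close>

lemma nevanlinna_if_le_poisson:
  assumes g: "g holomorphic_on ball 0 1" and m: "circle_borel_measure m" and B: "0 \<le> B"
    and le: "\<And>z. cmod z < 1 \<Longrightarrow> cmod (g z) \<le> exp (poisson m z + B)"
  shows "nevanlinna g"
  unfolding nevanlinna_def
proof (intro conjI g bdd_aboveI[of _ "measure m (sphere 0 1) + B"])
  fix y assume "y \<in> (\<lambda>r. LINT \<zeta>|circle_measure. log_plus (cmod (g (of_real r * \<zeta>)))) ` {0..<1}"
  then obtain r where r: "0 \<le> r" "r < 1" and y: "y = (LINT \<zeta>|circle_measure. log_plus (cmod (g (of_real r * \<zeta>))))"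
    by auto
  have i: "integrable circle_measure (\<lambda>\<zeta>. poisson m (of_real r * \<zeta>))"
    by (rule circle_continuous_integrable[OF circle_borel_circle_measure continuous_on_poisson_circle[OF m r]])
  have "y \<le> (LINT \<zeta>|circle_measure. poisson m (of_real r * \<zeta>) + B)"
    unfolding y
  proof (rule integral_mono[OF integrable_log_plus_dilation[OF g r]])
    show "integrable circle_measure (\<lambda>\<zeta>. poisson m (of_real r * \<zeta>) + B)"
      using i by simp
    fix \<zeta> assume "\<zeta> \<in> space circle_measure"
    then have z: "cmod (of_real r * \<zeta>) < 1" using r by (simp add: norm_mult)
    show "log_plus (cmod (g (of_real r * \<zeta>))) \<le> poisson m (of_real r * \<zeta>) + B"
      using le[OF z] poisson_nonneg[OF m z] B by (simp add: log_plus_le_iff)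
  qed
  also have "\<dots> = measure m (sphere 0 1) + B"
    using i by (simp add: poisson_mean[OF m r])
  finally show "y \<le> measure m (sphere 0 1) + B" .
qed

text \<open>The constant \<open>B\<close> is the Poisson integral of a multiple of arc length, which
  \<open>denominator_le\<close> disregards.\<close>

lemma denominator_measure_le:
  assumes g: "nevanlinna g" and m: "circle_borel_measure m" and B: "0 \<le> B"
    and le: "\<And>z. cmod z < 1 \<Longrightarrow> cmod (g z) \<le> exp (poisson m z + B)"
  shows "circle_borel_measure (denominator_measure g)" "denominator_measure g \<le> m"
proof -
  have "circle_borel_measure (denominator_measure g) \<and> denominator_measure g \<le> m"
  proof (cases "\<forall>z\<in>ball 0 1. g z = 0")
    case True
    then show ?thesis
      using circle_borel_null_measure circle_borelD(1)[OF m] by (simp add: denominator_measure_def le_measure)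
  next
    case False
    then obtain \<mu> \<nu> where fac: "nevanlinna_factorization g \<mu> \<nu>"
      using nevanlinna_factorization_exists[OF g] by metis
    have \<nu>: "circle_borel_measure \<nu>"
      using fac by (auto simp: nevanlinna_factorization_def singular_circle_measure_def)
    interpret \<nu>: finite_measure \<nu> by (rule circle_borelD(2)[OF \<nu>])
    interpret m: finite_measure m by (rule circle_borelD(2)[OF m])
    have iB: "integrable circle_measure (\<lambda>_. B)" by simp
    define d where "d = density circle_measure (\<lambda>_. ennreal B)"
    have d: "circle_borel_measure d"
      unfolding d_def by (rule circle_borel_density[OF iB B])
    have pd: "poisson d z = B" if z: "cmod z < 1" for z
    proof -
      have "poisson d z = (LINT \<zeta>|circle_measure. B *\<^sub>R poisson_kernel z \<zeta>)"
        unfolding poisson_def d_def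
        by (rule integral_circle_density[OF iB B])
          (rule circle_continuous_measurable[OF circle_borel_circle_measure continuous_poisson_kernel[OF z]])
      then show ?thesis using poisson_kernel_integral[OF z] by simp
    qed
    have "measure \<nu> A \<le> measure m A" if "A \<in> sets circle_measure" for A
    proof (rule denominator_le[OF fac m d _ _ that])
      show "measure d A = 0" if "A \<in> sets circle_measure" "emeasure circle_measure A = 0" for A
        unfolding d_def by (rule measure_density_null[OF iB that])
      show "cmod (g z) \<le> exp (poisson m z + poisson d z)" if "cmod z < 1" for z
        using le[OF that] pd[OF that] by simp
    qed
    then have "\<nu> \<le> m"
      using circle_borelD(1)[OF m] circle_borelD(1)[OF \<nu>]
      by (subst le_measure) (auto simp: \<nu>.emeasure_eq_measure m.emeasure_eq_measure ennreal_leI)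
    then show ?thesis
      using denominator_measure_eq[OF fac] \<nu> by simp
  qed
  then show "circle_borel_measure (denominator_measure g)" "denominator_measure g \<le> m"
    by auto
qed

lemma negative_mass_le:
  fixes g :: "complex \<Rightarrow> complex ^ 'n"
  assumes g: "nevanlinna_disc g" and m: "circle_borel_measure m" and B: "0 \<le> B"
    and le: "\<And>z j. cmod z < 1 \<Longrightarrow> cmod (g z $ j) \<le> exp (poisson m z + B)"
  shows "negative_mass g \<le> ereal (measure m (sphere 0 1))"
proof -
  interpret m: finite_measure m by (rule circle_borelD(2)[OF m])
  note d = denominator_measure_le[OF _ m B le]
  have n: "nevanlinna (\<lambda>z. g z $ j)" for j
    using g by (simp add: nevanlinna_disc_def)
  have s: "sets (SUP j. denominator_measure (\<lambda>z. g z $ j)) = sets circle_measure"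
    by (rule sets_SUP) (auto simp: circle_borelD(1)[OF d(1)[OF n]])
  have "(SUP j. denominator_measure (\<lambda>z. g z $ j)) \<le> m"
    by (rule SUP_least) (rule d(2)[OF n])
  moreover have "sphere 0 1 \<in> sets circle_measure"
    using sets.top[of circle_measure] by simp
  ultimately have "emeasure (SUP j. denominator_measure (\<lambda>z. g z $ j)) (sphere 0 1) \<le> emeasure m (sphere 0 1)"
    using s circle_borelD(1)[OF m] by (subst (asm) le_measure) auto
  then show ?thesis
    by (simp add: negative_mass_def m.emeasure_eq_measure less_eq_ennreal.rep_eq enn2ereal_ennreal)
qed

text \<open>Dilation by \<open>s < 1\<close> moves the zeros of \<open>P j\<close> and of
  \<open>P j - p $ j\<close> off the circle; if one of these vanishes identically, a small linear
  term is added instead. Only finitely many \<open>s\<close> fail, and the mean is continuous at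
  \<open>s = 1\<close>. Components different from 0 serve the class N^-, components different from
  those of \<open>p\<close> the blow-up at the atoms.\<close>

lemma polynomial_disc_perturbation:
  fixes P :: "'n::finite \<Rightarrow> complex poly" and p :: "complex ^ 'n"
  assumes \<Phi>: "\<And>S. continuous_on S \<Phi>" and e: "0 < (e::real)"
  obtains F :: "complex \<Rightarrow> complex ^ 'n" where "\<And>j. (\<lambda>z. F z $ j) holomorphic_on UNIV" "F 0 = poly_disc P 0"
    "\<And>\<zeta> j. \<zeta> \<in> sphere 0 1 \<Longrightarrow> F \<zeta> $ j \<noteq> 0 \<and> F \<zeta> $ j \<noteq> p $ j"
    "(LINT \<zeta>|circle_measure. \<Phi> (F \<zeta>)) < (LINT \<zeta>|circle_measure. \<Phi> (poly_disc P \<zeta>)) + e"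
proof -
  define a :: "'n \<Rightarrow> complex" where "a j = (if P j = 0 \<or> P j = [:p $ j:] then 1 else 0)" for j
  define F :: "real \<Rightarrow> complex \<Rightarrow> complex ^ 'n" where "F s z = (\<chi> j. poly (P j) (of_real s * z) + a j * of_real (1 - s) * z)" for s z
  define A where "A s = (LINT \<zeta>|circle_measure. \<Phi> (F s \<zeta>))" for s
  have "continuous_on ({0..1} \<times> sphere 0 1) (\<lambda>x. F (fst x) (snd x))"
    unfolding F_def by (intro continuous_on_vec_lambda continuous_intros)
  from continuous_on_compose2[OF \<Phi> this subset_UNIV]
  have "continuous_on ({0..1} \<times> sphere 0 1) (\<lambda>(s, \<zeta>). \<Phi> (F s \<zeta>))"
    by (simp add: case_prod_beta')
  then have "continuous_on {0..1} A"
    unfolding A_def by (rule continuous_on_circle_integral[OF compact_Icc])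
  then obtain d where d: "0 < d" "\<And>s. s \<in> {0..1} \<Longrightarrow> dist s 1 < d \<Longrightarrow> dist (A s) (A 1) < e"
    using e unfolding continuous_on_iff by (metis atLeastAtMost_iff order_refl zero_le_one)
  \<comment> \<open>In the degenerate cases the value is \<open>w\<close> or
    \<open>p $ j + w\<close> with \<open>|w| = 1 - s\<close>, so \<open>1 - s\<close> must differ
    from \<open>|p $ j|\<close>; otherwise \<open>s\<close> must not be the modulus of a
    root.\<close>
  define bad where "bad j = (if P j = 0 \<or> P j = [:p $ j:] then {1 - cmod (p $ j)}
      else cmod ` ({x. poly (P j) x = 0} \<union> {x. poly (P j - [:p $ j:]) x = 0}))" for j
  have "finite (bad j)" for j
    using poly_roots_finite[of "P j"] poly_roots_finite[of "P j - [:p $ j:]"] by (simp add: bad_def del: poly_diff)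
  then have "finite (\<Union>j. bad j)" by simp
  moreover have "infinite {max 0 (1 - d)<..<1}"
    using d by (intro infinite_Ioo) auto
  ultimately have "{max 0 (1 - d)<..<1} - (\<Union>j. bad j) \<noteq> {}"
    by (intro infinite_imp_nonempty Diff_infinite_finite)
  then obtain s where s: "s \<in> {max 0 (1 - d)<..<1}" "\<And>j. s \<notin> bad j"
    by blast
  have s01: "0 < s" "s < 1" using s by auto
  show thesis
  proof (rule that[of "F s"])
    show "(\<lambda>z. F s z $ j) holomorphic_on UNIV" for j
      unfolding F_def by (simp add: holomorphic_on_add holomorphic_on_mult) (intro holomorphic_intros)
    show "F s 0 = poly_disc P 0"
      by (simp add: F_def poly_disc_def)
    show "F s \<zeta> $ j \<noteq> 0 \<and> F s \<zeta> $ j \<noteq> p $ j" if \<zeta>: "\<zeta> \<in> sphere 0 1" for \<zeta> j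
    proof (cases "P j = 0 \<or> P j = [:p $ j:]")
      case True
      define w where "w = of_real (1 - s) * \<zeta>"
      have w: "cmod w = 1 - s" using \<zeta> s01 by (simp add: w_def norm_mult del: of_real_diff)
      have "1 - s \<noteq> cmod (p $ j)" using s(2)[of j] True by (auto simp: bad_def)
      then have "w \<noteq> p $ j" "w \<noteq> - (p $ j)" "w \<noteq> 0" using w s01 by auto
      moreover have "F s \<zeta> $ j = poly (P j) (of_real s * \<zeta>) + w"
        using True by (simp add: F_def a_def w_def)
      ultimately show ?thesis
        using True by (auto simp: add_eq_0_iff2 add_eq_0_iff)
    next
      case False
      have "s = cmod (of_real s * \<zeta>)" using \<zeta> s01 by (simp add: norm_mult)
      then have "poly (P j) (of_real s * \<zeta>) \<noteq> 0" "poly (P j - [:p $ j:]) (of_real s * \<zeta>) \<noteq> 0"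
        using s(2)[of j] False unfolding bad_def by (auto simp del: poly_diff)
      then show ?thesis
        using False by (simp add: F_def a_def)
    qed
    have "F 1 \<zeta> = poly_disc P \<zeta>" for \<zeta>
      by (simp add: F_def poly_disc_def)
    then have "A 1 = (LINT \<zeta>|circle_measure. \<Phi> (poly_disc P \<zeta>))"
      by (simp add: A_def)
    moreover have "dist (A s) (A 1) < e"
      using s s01 by (intro d) (auto simp: dist_real_def)
    ultimately show "(LINT \<zeta>|circle_measure. \<Phi> (F s \<zeta>)) < (LINT \<zeta>|circle_measure. \<Phi> (poly_disc P \<zeta>)) + e"
      by (simp add: A_def dist_real_def abs_less_iff)
  qed
qed

text \<open>On a cell whose closure meets \<open>E\<close>, \<open>c\<close> is
  \<open>l (y i) + e\<close> for a point \<open>y i\<close> of \<open>E\<close>, where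
  \<open>l\<close> and \<open>\<phi>\<close> agree. So \<open>c\<close> lies above \<open>l\<close>
  on \<open>U\<close> and below \<open>\<phi> + 2 * e\<close> on the circle, although
  \<open>\<phi>\<close> may fall below \<open>l\<close> off \<open>E\<close>. The closures of the
  other cells make up \<open>K\<close>.\<close>

lemma boundary_cells:
  fixes l \<phi> :: "complex \<Rightarrow> real"
  assumes l: "continuous_on (sphere 0 1) l" and \<phi>: "continuous_on (sphere 0 1) \<phi>"
    and E: "E \<subseteq> sphere 0 1" "\<And>\<zeta>. \<zeta> \<in> E \<Longrightarrow> \<phi> \<zeta> = l \<zeta>"
    and nonneg: "\<And>\<zeta>. 0 \<le> l \<zeta>" "\<And>\<zeta>. 0 \<le> \<phi> \<zeta>" and e: "0 < e"
  obtains U c C K F where "open U" "- U \<noteq> {}" "c \<in> borel_measurable circle_measure"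
    "\<And>x. 0 \<le> c x" "\<And>x. c x \<le> C" "\<And>x. x \<notin> U \<Longrightarrow> c x = 0" "\<And>x. x \<in> U \<Longrightarrow> 0 < c x"
    "\<And>x. x \<in> U \<Longrightarrow> \<exists>d>0. \<forall>y\<in>ball x d. c y = c x"
    "\<And>\<zeta>. \<zeta> \<in> sphere 0 1 \<Longrightarrow> \<zeta> \<in> U \<Longrightarrow> l \<zeta> \<le> c \<zeta>" "\<And>\<zeta>. \<zeta> \<in> sphere 0 1 \<Longrightarrow> c \<zeta> \<le> \<phi> \<zeta> + 2 * e"
    "compact K" "K \<subseteq> sphere 0 1 - E" "finite F" "F \<subseteq> sphere 0 1 - U"
    "\<And>\<zeta>. \<zeta> \<in> sphere 0 1 - U - F \<Longrightarrow> \<zeta> \<in> K \<and> (\<exists>d>0. ball \<zeta> d \<inter> U = {})"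
proof -
  obtain d1 where d1: "0 < d1" "\<And>x y. x \<in> sphere 0 1 \<Longrightarrow> y \<in> sphere 0 1 \<Longrightarrow> dist y x < d1 \<Longrightarrow> dist (l y) (l x) < e"
    using compact_uniformly_continuous[OF l compact_sphere] e unfolding uniformly_continuous_on_def by metis
  obtain d2 where d2: "0 < d2" "\<And>x y. x \<in> sphere 0 1 \<Longrightarrow> y \<in> sphere 0 1 \<Longrightarrow> dist y x < d2 \<Longrightarrow> dist (\<phi> y) (\<phi> x) < e"
    using compact_uniformly_continuous[OF \<phi> compact_sphere] e unfolding uniformly_continuous_on_def by metis
  define s where "s = min d1 d2 / 3"
  have s: "0 < s" "2 * s < d1" "2 * s < d2" using d1(1) d2(1) by (auto simp: s_def min_def)
  obtain I where I: "finite I" "finite (sphere 0 1 - (\<Union>i\<in>I. grid_cell s i))"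
    using grid_cells_cover[OF s(1)] by blast
  define J where "J = {i \<in> I. closure (grid_cell s i) \<inter> E \<noteq> {}}"
  have J: "finite J" using I by (simp add: J_def)
  have "\<exists>y. i \<in> J \<longrightarrow> y \<in> closure (grid_cell s i) \<inter> E" for i
    by (auto simp: J_def)
  then obtain y where y: "\<And>i. i \<in> J \<Longrightarrow> y i \<in> closure (grid_cell s i)" "\<And>i. i \<in> J \<Longrightarrow> y i \<in> E"
    by (metis IntD1 IntD2)
  define U where "U = (\<Union>i\<in>J. grid_cell s i)"
  define b where "b i = l (y i) + e" for i
  define c where "c x = (\<Sum>i\<in>J. if x \<in> grid_cell s i then b i else 0)" for x
  have b: "0 < b i" for i
    using nonneg(1)[of "y i"] e by (simp add: b_def)
  have c_cell: "c x = b i" if "i \<in> J" "x \<in> grid_cell s i" for x i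
  proof -
    have "c x = (\<Sum>k\<in>J. if k = i then b i else 0)"
      unfolding c_def
    proof (rule sum.cong[OF refl])
      fix k
      show "(if x \<in> grid_cell s k then b k else 0) = (if k = i then b i else 0)"
      proof (cases "k = i")
        case False
        then have "x \<notin> grid_cell s k"
          using grid_cell_disjoint[OF s(1) that(2)] by blast
        then show ?thesis using False by simp
      qed (simp add: that(2))
    qed
    then show ?thesis using J that(1) by simp
  qed
  have c_out: "c x = 0" if "x \<notin> U" for x
    using that by (auto simp: c_def U_def)
  have close: "\<bar>l x - l (y i)\<bar> < e" "\<bar>\<phi> x - \<phi> (y i)\<bar> < e" if "i \<in> J" "x \<in> grid_cell s i" "x \<in> sphere 0 1" for x i
  proof -
    have "dist x (y i) \<le> 2 * s"
      by (rule dist_grid_cell[OF subsetD[OF closure_subset that(2)] y(1)[OF that(1)]])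
    moreover have "y i \<in> sphere 0 1" using y(2)[OF that(1)] E by auto
    ultimately show "\<bar>l x - l (y i)\<bar> < e" "\<bar>\<phi> x - \<phi> (y i)\<bar> < e"
      using d1(2)[OF _ that(3)] d2(2)[OF _ that(3)] s by (auto simp: dist_real_def)
  qed
  define K where "K = (\<Union>i\<in>I - J. closure (grid_cell s i) \<inter> sphere 0 1)"
  show thesis
  proof (rule that[of U c "\<Sum>i\<in>J. b i" K "sphere 0 1 - (\<Union>i\<in>I. grid_cell s i)"])
    show "open U" unfolding U_def by (intro open_UN ballI open_grid_cell)
    have "0 \<notin> grid_cell s i" for i
      using s(1) by (auto simp: grid_cell_def mult_less_0_iff zero_less_mult_iff)
    then show "- U \<noteq> {}" unfolding U_def by blast
    show "c \<in> borel_measurable circle_measure"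
    proof -
      have "grid_cell s i \<inter> sphere 0 1 \<in> sets circle_measure" for i
        using open_grid_cell[of s i] by (auto simp: sets_restrict_space)
      then have [measurable]: "Measurable.pred circle_measure (\<lambda>x. x \<in> grid_cell s i)" for i
        by (simp add: Measurable.pred_def Int_def conj_commute)
      show ?thesis unfolding c_def by measurable
    qed
    show "0 \<le> c x" "c x \<le> (\<Sum>i\<in>J. b i)" for x
      unfolding c_def using b by (auto intro!: sum_nonneg sum_mono simp: less_imp_le)
    show "c x = 0" if "x \<notin> U" for x by (rule c_out[OF that])
    show "0 < c x" if "x \<in> U" for x
    proof -
      obtain i where i: "i \<in> J" "x \<in> grid_cell s i" using \<open>x \<in> U\<close> unfolding U_def by blast
      show ?thesis using b[of i] by (simp add: c_cell[OF i])
    qed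
    show "\<exists>d>0. \<forall>y\<in>ball x d. c y = c x" if "x \<in> U" for x
    proof -
      obtain i where i: "i \<in> J" "x \<in> grid_cell s i" using \<open>x \<in> U\<close> unfolding U_def by blast
      obtain d where "0 < d" "ball x d \<subseteq> grid_cell s i"
        using open_grid_cell[of s i] i(2) unfolding open_contains_ball by blast
      then show ?thesis using c_cell[OF i] c_cell[OF i(1)] by (metis subsetD)
    qed
    show "l \<zeta> \<le> c \<zeta>" if z: "\<zeta> \<in> sphere 0 1" "\<zeta> \<in> U" for \<zeta>
    proof -
      obtain i where i: "i \<in> J" "\<zeta> \<in> grid_cell s i" using z unfolding U_def by blast
      show ?thesis using close(1)[OF i z(1)] by (simp add: c_cell[OF i] b_def)
    qed
    show "c \<zeta> \<le> \<phi> \<zeta> + 2 * e" if z: "\<zeta> \<in> sphere 0 1" for \<zeta>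
    proof (cases "\<zeta> \<in> U")
      case True
      then obtain i where i: "i \<in> J" "\<zeta> \<in> grid_cell s i" unfolding U_def by blast
      show ?thesis using close(2)[OF i z(1)] E(2)[OF y(2)[OF i(1)]] by (simp add: c_cell[OF i] b_def)
    qed (use nonneg e in \<open>simp add: c_out\<close>)
    show "compact K"
      unfolding K_def using I by (intro compact_UN closed_Int_compact) auto
    show "K \<subseteq> sphere 0 1 - E"
      by (auto simp: K_def J_def)
    show "finite (sphere 0 1 - (\<Union>i\<in>I. grid_cell s i))" by (rule I(2))
    show "sphere 0 1 - (\<Union>i\<in>I. grid_cell s i) \<subseteq> sphere 0 1 - U"
      by (auto simp: U_def J_def)
    show "\<zeta> \<in> K \<and> (\<exists>d>0. ball \<zeta> d \<inter> U = {})" if z: "\<zeta> \<in> sphere 0 1 - U - (sphere 0 1 - (\<Union>i\<in>I. grid_cell s i))" for \<zeta>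
    proof -
      obtain i where i: "i \<in> I - J" "\<zeta> \<in> grid_cell s i" using z unfolding U_def by blast
      obtain d where d: "0 < d" "ball \<zeta> d \<subseteq> grid_cell s i"
        using open_grid_cell[of s i] i(2) unfolding open_contains_ball by blast
      have "ball \<zeta> d \<inter> U = {}"
      proof (rule ccontr)
        assume "ball \<zeta> d \<inter> U \<noteq> {}"
        then obtain x k where x: "x \<in> ball \<zeta> d" "k \<in> J" "x \<in> grid_cell s k" unfolding U_def by blast
        then have "x \<in> grid_cell s i" using d(2) by blast
        then have "i = k" using grid_cell_disjoint[OF s(1) _ x(3)] by blast
        then show False using i(1) x(2) by blast
      qed
      moreover have "\<zeta> \<in> K"
        using i z closure_subset[of "grid_cell s i"] by (auto simp: K_def)
      ultimately show ?thesis using d(1) by blast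
    qed
  qed
qed

lemma nontangential_limit_if_ball_limit:
  assumes "(f \<longlongrightarrow> w) (at \<zeta> within ball 0 1)"
  shows "has_nontangential_limit f \<zeta> w"
  unfolding has_nontangential_limit_def
proof (intro allI impI)
  fix \<alpha> :: real assume "1 < \<alpha>"
  have "{z. cmod (z - \<zeta>) < \<alpha> * (1 - cmod z)} \<subseteq> ball 0 1"
  proof
    fix z assume "z \<in> {z. cmod (z - \<zeta>) < \<alpha> * (1 - cmod z)}"
    then have "0 < \<alpha> * (1 - cmod z)"
      by (intro le_less_trans[OF norm_ge_zero[of "z - \<zeta>"]]) simp
    then show "z \<in> ball 0 1"
      using \<open>1 < \<alpha>\<close> by (simp add: zero_less_mult_iff)
  qed
  then show "(f \<longlongrightarrow> w) (at \<zeta> within {z. cmod (z - \<zeta>) < \<alpha> * (1 - cmod z)})"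
    using assms by (rule tendsto_within_subset[rotated])
qed

lemma lower_bound_near_limit:
  assumes lim: "(f \<longlongrightarrow> w) (at \<eta> within ball 0 1)" and w: "w \<noteq> (0::complex)" and \<eta>: "\<eta> \<in> sphere 0 1"
  shows "\<exists>d>0. \<exists>\<delta>>0. \<forall>z. cmod z < 1 \<longrightarrow> cmod (z - \<eta>) < d \<longrightarrow> \<delta> \<le> cmod (f z)"
proof -
  have "\<forall>\<^sub>F z in at \<eta> within ball 0 1. cmod w / 2 < cmod (f z)"
    using w by (intro order_tendstoD(1)[OF tendsto_norm[OF lim]]) auto
  then obtain d where d: "0 < d" "\<And>z. z \<in> ball 0 1 \<Longrightarrow> z \<noteq> \<eta> \<Longrightarrow> dist z \<eta> < d \<Longrightarrow> cmod w / 2 < cmod (f z)"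
    unfolding eventually_at by blast
  have "cmod w / 2 \<le> cmod (f z)" if "cmod z < 1" "cmod (z - \<eta>) < d" for z
    using d(2)[of z] that \<eta> by (cases "z = \<eta>") (auto simp: dist_norm)
  then show ?thesis
    using w d(1) by (intro exI[of _ d] conjI exI[of _ "cmod w / 2"]) auto
qed

text \<open>Because \<open>r < |p $ j|\<close>, the closed ball misses the coordinate hyperplanes,
  and \<open>F\<close> does so on the circle by the perturbation; hence the boundary values of the
  disc have no vanishing component, as \<open>nevanlinna_numerator_trivial\<close> wants.\<close>

lemma nevanlinna_minus_disc_exists:
  fixes X :: "(complex ^ 'n) set" and p :: "complex ^ 'n" and P :: "'n \<Rightarrow> complex poly"
  assumes X: "open X" and r: "0 < r" "\<And>j. r < cmod (p $ j)" "cball p r \<subseteq> X" and e: "0 < e"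
  defines "L \<equiv> \<lambda>w. log_plus (norm (w - p) / r)"
  obtains g where "g \<in> nevanlinna_minus_discs X" "g 0 = poly_disc P 0"
    "negative_mass g \<le> ereal ((LINT \<zeta>|circle_measure. cutoff_majorant X L k (poly_disc P \<zeta>)) + e)"
proof -
  define \<Phi> where "\<Phi> = cutoff_majorant X L k"
  have L0: "0 \<le> L w" for w by (simp add: L_def)
  have cL: "continuous_on S L" for S
    unfolding L_def using r(1) by (intro continuous_on_log_plus continuous_intros) auto
  have c\<Phi>: "continuous_on S \<Phi>" for S
    unfolding \<Phi>_def by (rule continuous_on_cutoff_majorant[OF cL])
  have \<Phi>0: "0 \<le> \<Phi> w" for w
    unfolding \<Phi>_def by (rule cutoff_majorant_bounds(1)[where L = L, OF L0])
  obtain F :: "complex \<Rightarrow> complex ^ 'n" where F: "\<And>j. (\<lambda>z. F z $ j) holomorphic_on UNIV" "F 0 = poly_disc P 0"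
    "\<And>\<zeta> j. \<zeta> \<in> sphere 0 1 \<Longrightarrow> F \<zeta> $ j \<noteq> 0 \<and> F \<zeta> $ j \<noteq> p $ j"
    "(LINT \<zeta>|circle_measure. \<Phi> (F \<zeta>)) < (LINT \<zeta>|circle_measure. \<Phi> (poly_disc P \<zeta>)) + e / 2"
    by (rule polynomial_disc_perturbation[OF c\<Phi> half_gt_zero[OF e], of P p]) (rule that, (assumption | blast)+)
  have cFj: "continuous_on S (\<lambda>z. F z $ j)" for S j
    using holomorphic_on_imp_continuous_on[OF F(1)[of j]] by (rule continuous_on_subset) simp
  have cF: "continuous_on S F" for S
    by (rule continuous_on_vec_componentwise[OF cFj])
  define E where "E = {\<zeta> \<in> sphere 0 1. F \<zeta> \<notin> X}"
  have cLF: "continuous_on (sphere 0 1) (\<lambda>\<zeta>. L (F \<zeta>))" and c\<Phi>F: "continuous_on (sphere 0 1) (\<lambda>\<zeta>. \<Phi> (F \<zeta>))"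
    using continuous_on_compose2[OF cL cF subset_UNIV] continuous_on_compose2[OF c\<Phi> cF subset_UNIV] by auto
  have e4: "0 < e / 4" using e by simp
  have E: "E \<subseteq> sphere 0 1" "\<Phi> (F \<zeta>) = L (F \<zeta>)" if "\<zeta> \<in> E" for \<zeta>
    using that by (auto simp: E_def \<Phi>_def cutoff_majorant_outside)
  have E1: "E \<subseteq> sphere 0 1" by (auto simp: E_def)
  obtain U c C K F0 where U: "open U" "- U \<noteq> {}" and c: "c \<in> borel_measurable circle_measure"
    "\<And>x. 0 \<le> c x" "\<And>x. c x \<le> C" "\<And>x. x \<notin> U \<Longrightarrow> c x = 0" "\<And>x. x \<in> U \<Longrightarrow> 0 < c x"
    "\<And>x. x \<in> U \<Longrightarrow> \<exists>d>0. \<forall>y\<in>ball x d. c y = c x"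
    and cl: "\<And>\<zeta>. \<zeta> \<in> sphere 0 1 \<Longrightarrow> \<zeta> \<in> U \<Longrightarrow> L (F \<zeta>) \<le> c \<zeta>" "\<And>\<zeta>. \<zeta> \<in> sphere 0 1 \<Longrightarrow> c \<zeta> \<le> \<Phi> (F \<zeta>) + 2 * (e / 4)"
    and K: "compact K" "K \<subseteq> sphere 0 1 - E" and F0: "finite F0" "F0 \<subseteq> sphere 0 1 - U"
    and rest: "\<And>\<zeta>. \<zeta> \<in> sphere 0 1 - U - F0 \<Longrightarrow> \<zeta> \<in> K \<and> (\<exists>d>0. ball \<zeta> d \<inter> U = {})"
    by (rule boundary_cells[OF cLF c\<Phi>F E1 E(2) L0 \<Phi>0 e4], assumption) (rule that, (assumption | blast)+)
  have C0: "0 \<le> C" using c(2,3)[of 0] by linarith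
  have "compact (F ` K)" by (rule compact_continuous_image[OF cF K(1)])
  moreover have "F ` K \<subseteq> X" using K(2) by (auto simp: E_def)
  ultimately obtain \<delta>0 where \<delta>0: "0 < \<delta>0" "(\<Union>w\<in>F ` K. ball w \<delta>0) \<subseteq> X"
    using compact_subset_open_imp_ball_epsilon_subset[OF _ X] by metis
  have cinv: "continuous_on (sphere 0 1) (\<lambda>\<zeta>. \<Sum>j\<in>UNIV. inverse (cmod (F \<zeta> $ j)))"
    using F(3) by (intro continuous_intros cFj) auto
  obtain b where b: "0 \<le> b" "\<And>\<zeta>. \<zeta> \<in> sphere 0 1 \<Longrightarrow> norm (\<Sum>j\<in>UNIV. inverse (cmod (F \<zeta> $ j))) \<le> b"
    using continuous_on_compact_bound[OF compact_sphere cinv] by blast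
  define \<mu> where "\<mu> = 1 / (b + 1)"
  have \<mu>: "0 < \<mu>" using b by (simp add: \<mu>_def)
  have F\<mu>: "\<mu> \<le> cmod (F \<zeta> $ j)" if "\<zeta> \<in> sphere 0 1" for \<zeta> j
  proof -
    have "inverse (cmod (F \<zeta> $ j)) \<le> (\<Sum>j\<in>UNIV. inverse (cmod (F \<zeta> $ j)))"
      by (rule member_le_sum) auto
    also have "\<dots> \<le> b" using b(2)[OF that] by simp
    finally have "inverse (cmod (F \<zeta> $ j)) \<le> inverse \<mu>" by (simp add: \<mu>_def)
    then show ?thesis
      using F(3)[OF that, of j] \<mu> by (simp add: inverse_le_iff_le)
  qed
  have cFp: "continuous_on (cball 0 1) (\<lambda>z. F z - p)"
    by (intro continuous_intros cF)
  obtain B where B: "0 \<le> B" "\<And>z. z \<in> cball 0 1 \<Longrightarrow> norm (F z - p) \<le> B"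
    using continuous_on_compact_bound[OF compact_cball cFp] by blast
  have Bj: "cmod (F z $ j - p $ j) \<le> B" if "z \<in> cball 0 1" for z j
    using B(2)[OF that] Finite_Cartesian_Product.norm_nth_le[of "F z - p" j] by simp
  \<comment> \<open>How close \<open>exp (- G)\<close> must be to 1 off the arcs: the first bound
    keeps the values in \<open>X\<close>, the second keeps the components at modulus at least
    \<open>\<mu> / 2\<close>.\<close>
  define \<kappa> where "\<kappa> = min (\<delta>0 / (B + 1)) (\<mu> / (2 * (B + 1)))"
  have \<kappa>: "0 < \<kappa>" "\<kappa> * B < \<delta>0" "\<kappa> * B \<le> \<mu> / 2"
  proof -
    show "0 < \<kappa>" using \<delta>0 \<mu> B by (simp add: \<kappa>_def)
    have "\<kappa> * B \<le> \<delta>0 / (B + 1) * B" "\<kappa> * B \<le> \<mu> / (2 * (B + 1)) * B"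
      unfolding \<kappa>_def by (intro mult_right_mono min.cobounded1 min.cobounded2 B(1))+
    moreover have "\<delta>0 / (B + 1) * B < \<delta>0" "\<mu> / (2 * (B + 1)) * B \<le> \<mu> / 2"
      using \<delta>0 \<mu> B by (auto simp: field_simps)
    ultimately show "\<kappa> * B < \<delta>0" "\<kappa> * B \<le> \<mu> / 2" by linarith+
  qed
  have "((\<lambda>w. exp (- w) - 1) \<longlongrightarrow> exp (- 0) - 1) (at (0::complex))"
    by (intro tendsto_intros)
  then obtain \<delta>1 where \<delta>1: "0 < \<delta>1" "\<And>w::complex. w \<noteq> 0 \<Longrightarrow> dist w 0 < \<delta>1 \<Longrightarrow> dist (exp (- w) - 1) (exp (- 0) - 1) < \<kappa>"
    using \<kappa>(1) unfolding tendsto_iff eventually_at by (metis UNIV_I)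
  define \<delta> where "\<delta> = \<delta>1 / 2"
  have \<delta>: "0 < \<delta>" "cmod (exp (- w) - 1) \<le> \<kappa>" if "cmod w \<le> \<delta>" for w
    using \<delta>1 \<delta>1(2)[of w] that \<kappa> by (cases "w = 0"; auto simp: \<delta>_def dist_norm intro: less_imp_le)+
  have \<delta>p: "0 < \<delta>" using \<delta>1 by (simp add: \<delta>_def)
  \<comment> \<open>The bound \<open>8 * \<epsilon> * C\<close> for \<open>G\<close> off the arcs is
    to be at most \<open>\<delta>\<close>; \<open>C + 1\<close> avoids a division by 0.\<close>
  define \<epsilon> where "\<epsilon> = \<delta> / (C + 1) / 8"
  have \<epsilon>b: "0 < \<epsilon>" "8 * \<epsilon> * C \<le> \<delta>"
  proof -
    show "0 < \<epsilon>" using \<delta>p C0 by (simp add: \<epsilon>_def)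
    have "8 * \<epsilon> = \<delta> / (C + 1)" using C0 by (simp add: \<epsilon>_def field_simps)
    then have "8 * \<epsilon> * C = \<delta> * (C / (C + 1))" by simp
    also have "\<dots> \<le> \<delta> * 1" using \<delta>p C0 by (intro mult_left_mono) auto
    finally show "8 * \<epsilon> * C \<le> \<delta>" by simp
  qed
  obtain \<rho> R where \<rho>: "\<rho> \<in> borel_measurable circle_measure" "\<And>x. x \<in> sphere 0 1 \<Longrightarrow> \<rho> x \<in> sphere 0 1"
    "\<And>x y. x \<in> sphere 0 1 \<inter> U \<Longrightarrow> y \<notin> U \<Longrightarrow> dist x (\<rho> x) \<le> \<epsilon> * dist x y * dist (\<rho> x) y"
    and R: "countable R" "R \<subseteq> sphere 0 1 \<inter> U" "\<And>\<eta>. \<eta> \<in> U \<Longrightarrow> \<exists>d>0. finite (R \<inter> ball \<eta> d)"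
    "AE x in circle_measure. x \<in> U \<longrightarrow> \<rho> x \<in> R"
    "\<And>y. y \<in> R \<Longrightarrow> 0 < measure circle_measure {x \<in> sphere 0 1. x \<in> U \<and> \<rho> x = y}"
    by (rule boundary_representatives[OF U \<epsilon>b(1)]) (rule that, (assumption | blast)+)
  interpret mass_shift U c C \<rho> R \<epsilon>
    using c \<rho> R \<epsilon>b(1) by unfold_locales (assumption | simp)+
  define g where "g z = p + exp (- G z) *s (F z - p)" for z
  have gj: "g z $ j = p $ j + exp (- G z) * (F z $ j - p $ j)" for z j
    by (simp only: g_def vector_add_component vector_smult_component vector_minus_component)
  have g_F: "g z $ j - F z $ j = (exp (- G z) - 1) * (F z $ j - p $ j)" for z j
    by (simp add: gj algebra_simps)
  have g0: "g 0 = poly_disc P 0"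
    by (simp add: vec_eq_iff gj G_0 F(2))
  have hol: "(\<lambda>z. g z $ j) holomorphic_on ball 0 1" for j
    unfolding gj by (intro holomorphic_intros G_holomorphic holomorphic_on_subset[OF F(1)]) auto
  define M where "M = ln (1 + norm p + B)"
  have M: "0 \<le> M" "exp M = 1 + norm p + B"
    using B norm_ge_zero[of p] by (auto simp: M_def intro!: ln_ge_zero simp del: norm_ge_zero)
  have bound: "cmod (g z $ j) \<le> exp (poisson nu z + M)" if z: "cmod z < 1" for z j
  proof -
    have ge1: "1 \<le> exp (poisson nu z)" using poisson_nonneg[OF nu_circle_borel z] by simp
    have "cmod (g z $ j) \<le> norm p + exp (poisson nu z) * B"
      unfolding gj using cmod_exp_G[OF z] Bj[of z j] z Finite_Cartesian_Product.norm_nth_le[of p j]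
      by (intro order_trans[OF norm_triangle_ineq] add_mono) (auto simp: norm_mult intro!: mult_mono)
    also have "\<dots> \<le> exp (poisson nu z) * (1 + norm p) + exp (poisson nu z) * B"
      using ge1 mult_mono[of 1 "exp (poisson nu z)" "norm p" "1 + norm p"] by auto
    finally show ?thesis by (simp add: exp_add M(2) algebra_simps)
  qed
  have nev: "nevanlinna (\<lambda>z. g z $ j)" for j
    by (rule nevanlinna_if_le_poisson[OF hol nu_circle_borel M(1) bound])
  then have nevd: "nevanlinna_disc g" by (simp add: nevanlinna_disc_def)
  have "negative_mass g \<le> ereal (measure nu (sphere 0 1))"
    by (rule negative_mass_le[OF nevd nu_circle_borel M(1) bound])
  also have "measure nu (sphere 0 1) \<le> (LINT \<zeta>|circle_measure. \<Phi> (poly_disc P \<zeta>)) + e"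
  proof -
    have i: "integrable circle_measure (\<lambda>\<zeta>. \<Phi> (F \<zeta>))"
      by (rule circle_continuous_integrable[OF circle_borel_circle_measure c\<Phi>F])
    have "(LINT x|circle_measure. c x) \<le> (LINT \<zeta>|circle_measure. \<Phi> (F \<zeta>) + e / 2)"
    proof (rule integral_mono[OF integrable_c])
      show "integrable circle_measure (\<lambda>\<zeta>. \<Phi> (F \<zeta>) + e / 2)" using i by simp
      show "c x \<le> \<Phi> (F x) + e / 2" if "x \<in> space circle_measure" for x
        using cl(2)[of x] that by simp
    qed
    also have "\<dots> = (LINT \<zeta>|circle_measure. \<Phi> (F \<zeta>)) + e / 2"
      using i by simp
    finally show ?thesis using F(4) by (simp add: measure_nu)
  qed
  finally have mass: "negative_mass g \<le> ereal ((LINT \<zeta>|circle_measure. \<Phi> (poly_disc P \<zeta>)) + e)"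
    by simp
  have Flim: "(F \<longlongrightarrow> F \<eta>) (at \<eta> within ball 0 1)" for \<eta>
    using cF[of UNIV] continuous_on_eq_continuous_at[of UNIV F] by (auto simp: isCont_def intro: tendsto_within_subset)
  have limit: "\<exists>w\<in>X. (\<forall>j. w $ j \<noteq> 0) \<and> (g \<longlongrightarrow> w) (at \<eta> within ball 0 1)"
    if \<eta>: "\<eta> \<in> sphere 0 1" "\<eta> \<notin> R" "\<eta> \<notin> F0" for \<eta>
  proof -
    have lim: "(g \<longlongrightarrow> p + exp (- l) *s (F \<eta> - p)) (at \<eta> within ball 0 1)" if "(G \<longlongrightarrow> l) (at \<eta> within ball 0 1)" for l
    proof (rule vec_tendstoI)
      fix j
      have "((\<lambda>z. p $ j + exp (- G z) * (F z $ j - p $ j)) \<longlongrightarrow> p $ j + exp (- l) * (F \<eta> $ j - p $ j)) (at \<eta> within ball 0 1)"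
        by (intro tendsto_intros that Flim)
      then show "((\<lambda>z. g z $ j) \<longlongrightarrow> (p + exp (- l) *s (F \<eta> - p)) $ j) (at \<eta> within ball 0 1)"
        by (simp only: gj vector_add_component vector_smult_component vector_minus_component)
    qed
    show ?thesis
    proof (cases "\<eta> \<in> U")
      case True
      obtain l where l: "(G \<longlongrightarrow> l) (at \<eta> within ball 0 1)" "Re l = c \<eta>"
        using G_limit_inside[OF \<eta>(1) True \<eta>(2)] by blast
      define w where "w = p + exp (- l) *s (F \<eta> - p)"
      have "norm (F \<eta> - p) / r \<le> exp (c \<eta>)"
        using cl(1)[OF \<eta>(1) True] r(1) c(2) unfolding L_def by (subst (asm) log_plus_le_iff) auto
      then have "exp (- c \<eta>) * norm (F \<eta> - p) \<le> exp (- c \<eta>) * (exp (c \<eta>) * r)"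
        using r(1) by (intro mult_left_mono) (auto simp: field_simps)
      moreover have "norm (w - p) = exp (- c \<eta>) * norm (F \<eta> - p)"
        by (simp only: w_def add_diff_cancel_left' norm_scalar_mult_vec norm_exp_eq_Re uminus_complex.sel l(2))
      moreover have "exp (- c \<eta>) * (exp (c \<eta>) * r) = r" by (simp add: exp_minus)
      ultimately have wr: "norm (w - p) \<le> r" by (simp only:)
      then have "w \<in> X" using r(3) by (auto simp: dist_norm norm_minus_commute)
      moreover have "w $ j \<noteq> 0" for j
        using Finite_Cartesian_Product.norm_nth_le[of "w - p" j] wr r(2)[of j] by auto
      ultimately show ?thesis
        using lim[OF l(1)] unfolding w_def by blast
    next
      case False
      obtain d where d: "\<eta> \<in> K" "0 < d" "ball \<eta> d \<inter> U = {}"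
        using rest[of \<eta>] \<eta> False by auto
      obtain l where l: "(G \<longlongrightarrow> l) (at \<eta> within ball 0 1)" "cmod l \<le> 8 * \<epsilon> * C"
        using G_limit_outside[OF \<eta>(1) d(2,3)] by blast
      define w where "w = p + exp (- l) *s (F \<eta> - p)"
      have "w - F \<eta> = (exp (- l) - 1) *s (F \<eta> - p)"
        by (simp only: w_def vec_eq_iff vector_add_component vector_smult_component vector_minus_component)
          (simp add: algebra_simps)
      then have "norm (w - F \<eta>) = cmod (exp (- l) - 1) * norm (F \<eta> - p)"
        by (simp only: norm_scalar_mult_vec)
      also have "\<dots> \<le> \<kappa> * B"
        using \<delta>(2)[of l] l(2) \<epsilon>b(2) B \<eta> \<kappa> by (intro mult_mono) auto
      finally have wF: "norm (w - F \<eta>) \<le> \<kappa> * B" .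
      then have "w \<in> ball (F \<eta>) \<delta>0" using \<kappa>(2) by (simp add: dist_norm norm_minus_commute)
      then have "w \<in> X" using \<delta>0(2) d(1) by blast
      moreover have "w $ j \<noteq> 0" for j
        using Finite_Cartesian_Product.norm_nth_le[of "w - F \<eta>" j] wF \<kappa>(3) F\<mu>[OF \<eta>(1), of j] \<mu> by auto
      ultimately show ?thesis
        using lim[OF l(1)] unfolding w_def by blast
    qed
  qed
  \<comment> \<open>The exceptional set of the criterion: the atoms, where the disc blows up, and
    the grid points, where only radial control of \<open>G\<close> is at hand.\<close>
  have cRF: "countable (R \<union> F0)" "R \<union> F0 \<subseteq> sphere 0 1"
    using R(1,2) F0 by (auto intro: countable_finite)
  have "AE \<zeta> in circle_measure. \<exists>w\<in>X. has_nontangential_limit g \<zeta> w"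
    using AE_circle_notin_countable[OF cRF] AE_space
  proof eventually_elim
    case (elim \<zeta>)
    then obtain w where "w \<in> X" "(g \<longlongrightarrow> w) (at \<zeta> within ball 0 1)"
      using limit[of \<zeta>] by auto
    then show ?case using nontangential_limit_if_ball_limit by blast
  qed
  then have gX: "g \<in> nevanlinna_discs X"
    using nevd by (simp add: nevanlinna_discs_def)
  have "nevanlinna_minus (\<lambda>z. g z $ j)" for j
  proof (cases "\<forall>z\<in>ball 0 1. g z $ j = 0")
    case False
    then obtain \<mu>' \<nu> where fac: "nevanlinna_factorization (\<lambda>z. g z $ j) \<mu>' \<nu>"
      using nevanlinna_factorization_exists[OF nev[of j]] by metis
    have "\<mu>' = null_measure circle_measure"
    proof (rule nevanlinna_numerator_trivial[OF fac cRF])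
      fix \<eta> assume \<eta>: "\<eta> \<in> sphere 0 1 - (R \<union> F0)"
      then obtain w where "w $ j \<noteq> 0" "(g \<longlongrightarrow> w) (at \<eta> within ball 0 1)"
        using limit[of \<eta>] by auto
      then show "\<exists>d>0. \<exists>\<delta>>0. \<forall>z. cmod z < 1 \<longrightarrow> cmod (z - \<eta>) < d \<longrightarrow> \<delta> \<le> cmod (g z $ j)"
        using \<eta> by (intro lower_bound_near_limit[OF tendsto_vec_nth]) auto
    next
      fix \<eta> assume "\<eta> \<in> R \<union> F0"
      then have \<eta>: "\<eta> \<in> sphere 0 1" using cRF by auto
      then have h1: "cmod \<eta> = 1" by simp
      have Fr: "((\<lambda>t. F (of_real t * \<eta>) $ j) \<longlongrightarrow> F \<eta> $ j) (at_left (1::real))"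
        by (rule filterlim_compose[OF tendsto_vec_nth[OF Flim] radial_filterlim[OF h1]])
      have t01: "\<forall>\<^sub>F t in at_left (1::real). t \<in> {0<..<1}"
        by (rule eventually_at_left_real) simp
      show "\<exists>\<delta>>0. \<forall>\<^sub>F t in at_left 1. \<delta> \<le> cmod (g (of_real t * \<eta>) $ j)"
      proof (cases "\<eta> \<in> R")
        case True
        define \<beta> where "\<beta> = cmod (F \<eta> $ j - p $ j)"
        have \<beta>: "0 < \<beta>" using F(3)[OF \<eta>, of j] by (simp add: \<beta>_def)
        \<comment> \<open>Chosen so that \<open>N * (\<beta> / 2)\<close> is
          \<open>|p $ j| + 1\<close>, which leaves modulus at least 1 for the component.\<close>
        define N where "N = 2 * (cmod (p $ j) + 1) / \<beta>"
        have N: "0 \<le> N" using \<beta> by (simp add: N_def)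
        have "((\<lambda>t. cmod (F (of_real t * \<eta>) $ j - p $ j)) \<longlongrightarrow> \<beta>) (at_left (1::real))"
          unfolding \<beta>_def by (intro tendsto_intros Fr)
        then have "\<forall>\<^sub>F t in at_left (1::real). \<beta> / 2 < cmod (F (of_real t * \<eta>) $ j - p $ j)"
          using \<beta> by (intro order_tendstoD(1)) auto
        moreover have "\<forall>\<^sub>F t in at_left (1::real). N \<le> Re (- G (of_real t * \<eta>))"
          using Re_G_atom[OF True] by (simp add: filterlim_at_top)
        ultimately have "\<forall>\<^sub>F t in at_left 1. 1 \<le> cmod (g (of_real t * \<eta>) $ j)"
        proof eventually_elim
          case (elim t)
          define z where "z = of_real t * \<eta>"
          have "N \<le> exp (Re (- G z))"
            using exp_ge_add_one_self[of "Re (- G z)"] elim(2) by (simp add: z_def)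
          then have "N * (\<beta> / 2) \<le> cmod (exp (- G z)) * cmod (F z $ j - p $ j)"
            using elim(1) N \<beta> by (intro mult_mono) (auto simp: z_def)
          then have "cmod (p $ j) + 1 \<le> cmod (exp (- G z) * (F z $ j - p $ j))"
            using \<beta> by (simp add: N_def norm_mult)
          also have "exp (- G z) * (F z $ j - p $ j) = g z $ j - p $ j" by (simp add: gj)
          finally show "1 \<le> cmod (g z $ j)"
            using norm_triangle_ineq4[of "g z $ j" "p $ j"] by linarith
        qed
        then show ?thesis by (intro exI[of _ 1]) auto
      next
        case False
        then have "\<eta> \<notin> U" using \<open>\<eta> \<in> R \<union> F0\<close> F0(2) by auto
        \<comment> \<open>Eventually \<open>|F $ j|\<close> exceeds \<open>3 / 4 * \<mu>\<close>,
          and \<open>g $ j\<close> differs from it by at most \<open>\<mu> / 2\<close>; hence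
          \<open>\<mu> / 4\<close>.\<close>
        have "((\<lambda>t. cmod (F (of_real t * \<eta>) $ j)) \<longlongrightarrow> cmod (F \<eta> $ j)) (at_left (1::real))"
          by (rule tendsto_norm[OF Fr])
        then have "\<forall>\<^sub>F t in at_left (1::real). 3 / 4 * \<mu> < cmod (F (of_real t * \<eta>) $ j)"
          using F\<mu>[OF \<eta>, of j] \<mu> by (intro order_tendstoD(1)) auto
        then have "\<forall>\<^sub>F t in at_left 1. \<mu> / 4 \<le> cmod (g (of_real t * \<eta>) $ j)"
          using t01
        proof eventually_elim
          case (elim t)
          define z where "z = of_real t * \<eta>"
          have z: "cmod z < 1" using elim h1 by (simp add: z_def norm_mult)
          have "cmod (G z) \<le> \<delta>"
            using G_radial_bound[OF \<eta> \<open>\<eta> \<notin> U\<close>, of t] elim \<epsilon>b(2) by (simp add: z_def)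
          then have "cmod (g z $ j - F z $ j) \<le> \<kappa> * B"
            unfolding g_F norm_mult using \<delta>(2) Bj z \<kappa> by (intro mult_mono) auto
          then show "\<mu> / 4 \<le> cmod (g z $ j)"
            using \<kappa>(3) elim(1) norm_triangle_ineq3[of "g z $ j" "F z $ j"] unfolding z_def by linarith
        qed
        then show ?thesis using \<mu> by (intro exI[of _ "\<mu> / 4"]) auto
      qed
    qed
    then show ?thesis
      using nev[of j] fac unfolding nevanlinna_minus_def by blast
  qed (use nev in \<open>simp add: nevanlinna_minus_def\<close>)
  then have "g \<in> nevanlinna_minus_discs X"
    using gX by (simp add: nevanlinna_minus_discs_def)
  then show thesis
    using that[of g] g0 mass by (simp add: \<Phi>_def)
qed

section \<open>The envelope as a competitor, and the conclusion\<close>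

lemma circle_mean_const: "circle_mean (\<lambda>_. ereal c) = ereal c"
proof (cases "0 \<le> c")
  case True
  then show ?thesis
    by (simp add: circle_mean_def circle.emeasure_space_1[simplified] ennreal_neg enn2ereal_ennreal zero_ennreal.rep_eq)
next
  case False
  then show ?thesis
    by (simp add: circle_mean_def circle.emeasure_space_1[simplified] ennreal_neg enn2ereal_ennreal zero_ennreal.rep_eq)
qed

lemma const_in_lelong_class: "(\<lambda>_. ereal c) \<in> lelong_class"
proof -
  have "c \<le> log_plus (norm z) + \<bar>c\<bar>" for z :: "complex ^ 'n"
    using log_plus_nonneg[of "norm z"] by linarith
  then show ?thesis
    by (auto simp: lelong_class_def plurisubharmonic_def subharmonic_def usc_def circle_mean_const)
qed

text \<open>All constants compete. The empty set contains no ball to start the construction from and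
  is settled this way.\<close>

lemma extremal_function_empty: "extremal_function {} z = \<infinity>"
proof (rule ereal_top)
  fix B :: real
  show "ereal B \<le> extremal_function {} z"
    unfolding extremal_function_def
    by (rule SUP_upper2[of "\<lambda>_. ereal B"]) (simp_all add: const_in_lelong_class)
qed

text \<open>Vanishing coordinates of a point of \<open>X\<close> are moved by \<open>t\<close>, so
  small that the total shift is at most \<open>s / 2\<close>; the radius is at most half the least
  modulus of a coordinate. The ball then misses the coordinate hyperplanes.\<close>

lemma polydisc_free_ball:
  fixes X :: "(complex ^ 'n) set"
  assumes "open X" "X \<noteq> {}"
  obtains p :: "complex ^ 'n" and r where "0 < r" "\<And>j. r < cmod (p $ j)" "cball p r \<subseteq> X"
proof -
  obtain q s where s: "0 < s" "cball q s \<subseteq> X"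
    using assms open_contains_cball by blast
  define t where "t = s / (2 * CARD('n))"
  have t: "0 < t" using s by (simp add: t_def)
  define p :: "complex ^ 'n" where "p = (\<chi> j. if q $ j = 0 then of_real t else q $ j)"
  have pj: "p $ j \<noteq> 0" for j
    using t by (simp add: p_def)
  have "norm (p - q) \<le> (\<Sum>j\<in>UNIV. norm ((p - q) $ j))"
    unfolding norm_vec_def by (rule L2_set_le_sum) simp
  also have "\<dots> \<le> (\<Sum>j\<in>(UNIV::'n set). t)"
    using t by (intro sum_mono) (simp add: p_def)
  also have "\<dots> = s / 2" by (simp add: t_def)
  finally have pq: "norm (p - q) \<le> s / 2" .
  define r where "r = min (s / 2) (Min (range (\<lambda>j. cmod (p $ j))) / 2)"
  have m: "0 < Min (range (\<lambda>j. cmod (p $ j)))"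
    using pj by (subst Min_gr_iff) auto
  show thesis
  proof (rule that[of r p])
    show "0 < r" using s m by (simp add: r_def)
    show "r < cmod (p $ j)" for j
    proof -
      have "Min (range (\<lambda>j. cmod (p $ j))) \<le> cmod (p $ j)" by simp
      moreover have "r \<le> Min (range (\<lambda>j. cmod (p $ j))) / 2" unfolding r_def by (rule min.cobounded2)
      ultimately show ?thesis using m by linarith
    qed
    show "cball p r \<subseteq> X"
    proof
      fix w assume "w \<in> cball p r"
      then have "dist p w \<le> s / 2" by (simp add: r_def)
      then have "dist q w \<le> s"
        using dist_triangle[of q w p] pq by (simp add: dist_norm norm_minus_commute)
      then show "w \<in> X" using s(2) by auto
    qed
  qed
qed

lemma log_plus_norm_diff_le:
  fixes p z :: "'a::real_normed_vector"
  assumes r: "0 < r"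
  shows "log_plus (norm (z - p) / r) \<le> log_plus (norm z) + log_plus ((1 + norm p) / r)"
proof -
  have "norm (z - p) \<le> norm z + norm p" by (rule norm_triangle_ineq4)
  also have "\<dots> \<le> exp (log_plus (norm z)) * (1 + norm p)"
  proof -
    have "norm p * 1 \<le> norm p * exp (log_plus (norm z))" by (intro mult_left_mono) auto
    then show ?thesis using le_exp_log_plus[of "norm z"] by (simp add: algebra_simps)
  qed
  finally have "norm (z - p) / r \<le> exp (log_plus (norm z)) * ((1 + norm p) / r)"
    using r by (simp add: divide_right_mono)
  also have "\<dots> \<le> exp (log_plus (norm z)) * exp (log_plus ((1 + norm p) / r))"
    using r by (intro mult_left_mono le_exp_log_plus) auto
  finally show ?thesis
    using r by (subst log_plus_le_iff) (auto simp: exp_add)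
qed

text \<open>Constant discs bound the envelope by the weights: this gives logarithmic growth and, as
  the weights vanish eventually at each point of \<open>X\<close>, nonpositivity on
  \<open>X\<close>. So the envelope competes, and each of its discs yields one in the class N^-
  whose negative mass exceeds the disc mean by at most \<open>e / 2\<close>.\<close>

lemma minus_envelope_le_extremal_function:
  fixes X :: "(complex ^ 'n) set"
  assumes X: "open X" "X \<noteq> {}"
  shows "disc_envelope (nevanlinna_minus_discs X) negative_mass z \<le> extremal_function X z"
proof -
  obtain p :: "complex ^ 'n" and r where r: "0 < r" "\<And>j. r < cmod (p $ j)" "cball p r \<subseteq> X"
    by (rule polydisc_free_ball[OF X]) blast
  define L where "L w = log_plus (norm (w - p) / r)" for w
  have L0: "0 \<le> L w" for w by (simp add: L_def)
  have cL: "continuous_on S L" for S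
    unfolding L_def using r(1) by (intro continuous_on_log_plus continuous_intros) auto
  interpret disc_weights "cutoff_majorant X L"
    by unfold_locales
      (rule continuous_on_cutoff_majorant[OF cL] cutoff_majorant_bounds(1)[where L = L, OF L0]
        cutoff_majorant_antimono[where L = L, OF L0]; assumption?)+
  have "(\<lambda>z. ereal (envelope z)) \<in> lelong_class"
  proof -
    have "envelope w \<le> log_plus (norm w) + log_plus ((1 + norm p) / r)" for w
      using envelope_le_weight[of w 0] cutoff_majorant_bounds(2)[where L = L, OF L0, of X 0 w]
        log_plus_norm_diff_le[OF r(1), of w p] unfolding L_def by linarith
    then show ?thesis
      using plurisubharmonic_envelope by (auto simp: lelong_class_def)
  qed
  moreover have "envelope x \<le> 0" if "x \<in> X" for x
  proof -
    have "\<forall>\<^sub>F n in sequentially. cutoff_majorant X L n x = 0"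
      by (rule cutoff_majorant_eventually_0[OF X(1) that tendsto_const])
    then obtain n where "cutoff_majorant X L n x = 0"
      by (auto simp: eventually_sequentially)
    then show ?thesis using envelope_le_weight[of x n] by simp
  qed
  ultimately have "ereal (envelope z) \<le> extremal_function X z"
    unfolding extremal_function_def by (intro SUP_upper2[of "\<lambda>z. ereal (envelope z)"]) auto
  moreover have "disc_envelope (nevanlinna_minus_discs X) negative_mass z \<le> ereal (envelope z)"
  proof (rule ereal_le_epsilon2)
    fix e :: real assume e: "0 < e"
    then have "envelope z < envelope z + e / 2" by simp
    then obtain q where q: "q \<in> discs" "disc_mean (fst q) (snd q) z < envelope z + e / 2"
      by (rule envelope_lessE)
    define P where "P j = [:z $ j:] + snd q j" for j
    have P: "poly_disc P \<zeta> = z + poly_disc (snd q) \<zeta>" for \<zeta>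
      by (simp add: vec_eq_iff poly_disc_def P_def)
    have P0: "poly_disc P 0 = z"
      using q(1) by (simp add: vec_eq_iff poly_disc_def P_def discs_def)
    obtain g where g: "g \<in> nevanlinna_minus_discs X" "g 0 = poly_disc P 0"
      "negative_mass g \<le> ereal ((LINT \<zeta>|circle_measure. cutoff_majorant X L (fst q) (poly_disc P \<zeta>)) + e / 2)"
      using nevanlinna_minus_disc_exists[OF X(1) r half_gt_zero[OF e], of P "fst q"] unfolding L_def by metis
    have "disc_envelope (nevanlinna_minus_discs X) negative_mass z \<le> negative_mass g"
      unfolding disc_envelope_def by (rule INF_lower) (simp add: g P0)
    also have "\<dots> \<le> ereal (envelope z + e)"
      by (rule order_trans[OF g(3)]) (use q(2) in \<open>simp add: P disc_mean_def\<close>)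
    finally show "disc_envelope (nevanlinna_minus_discs X) negative_mass z \<le> ereal (envelope z) + ereal e"
      by simp
  qed
  ultimately show ?thesis by (rule order_trans[rotated])
qed

theorem theorem2:
  fixes X :: "(complex ^ 'n) set"
  assumes "open X"
  shows "\<forall>z. extremal_function X z = disc_envelope (nevanlinna_discs X) negative_mass z \<and>
             extremal_function X z = disc_envelope (nevanlinna_minus_discs X) negative_mass z"
proof
  fix z
  have sub: "nevanlinna_minus_discs X \<subseteq> nevanlinna_discs X"
    by (auto simp: nevanlinna_minus_discs_def)
  have "extremal_function X z \<le> disc_envelope (nevanlinna_discs X) negative_mass z"
    unfolding disc_envelope_def
  proof (rule INF_greatest)
    fix f assume "f \<in> {f \<in> nevanlinna_discs X. f 0 = z}"
    then show "extremal_function X z \<le> negative_mass f"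
      using extremal_function_le_negative_mass[OF assms, of f] by auto
  qed
  moreover have "disc_envelope (nevanlinna_discs X) negative_mass z \<le> disc_envelope (nevanlinna_minus_discs X) negative_mass z"
    unfolding disc_envelope_def using sub by (intro INF_superset_mono) auto
  moreover have "disc_envelope (nevanlinna_minus_discs X) negative_mass z \<le> extremal_function X z"
    using minus_envelope_le_extremal_function[OF assms, of z] by (cases "X = {}") (auto simp: extremal_function_empty)
  ultimately show "extremal_function X z = disc_envelope (nevanlinna_discs X) negative_mass z \<and>
      extremal_function X z = disc_envelope (nevanlinna_minus_discs X) negative_mass z"
    by (intro conjI; order)
qed

end
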